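(* Let $n\in\mathbb{N}$, let $\alpha,\beta>0$, and let $\mathbf{L}^n$ be the self-adjoint operator defined by left-definite theory on $L^2[(-1,1),w]$, $w(x)=(1-x)^\alpha(1+x)^\beta$, with left-definite domain $\mathcal{D}_{\mathbf{L}}^n$, acting via $\ell^n$, the classical Jacobi differential expression with parameters $\alpha,\beta$ composed with itself $n$ times (order $2n$). Furthermore, let $\mathbf{L}^n$ be an extension of the minimal operator $\mathbf{L}^n_{\min}$, which has deficiency indices $(2n,2n)$. Then $$\mathcal{D}_{\mathbf{L}}^n=\mathcal{A}_n=\mathcal{B}_n=\widetilde{\mathcal{C}}_n=\mathcal{F}_n\qquad\forall n\in\mathbb{N}.$$
   Context: $\mathbb{N}=\{1,2,\dots\}$, $\mathbb{N}_0=\mathbb{N}\cup\{0\}$. The Jacobi differential expression is $\ell[f]=-\frac1w\left[(1-x)^{\alpha+1}(1+x)^{\beta+1}f'\right]'$, and $\ell^n$ is its $n$-fold composition, with Lagrangian symmetric form $\ell^n[f]=\frac1w\sum_{k=1}^n(-1)^k\left[a_kf^{(k)}\right]^{(k)}$, $a_k(x)=C(n,k,\alpha,\beta)(1-x)^{\alpha+k}(1+x)^{\beta+k}$ for certain constants $C(n,k,\alpha,\beta)$ determined by this identity. The maximal domain is $\mathcal{D}_{\max}^n=\{f\in L^2[(-1,1),w]:f,\dots,f^{(2n-1)}\in AC_{\mathrm{loc}}(-1,1),\ \ell^n[f]\in L^2[(-1,1),w]\}$. For $f,g\in\mathcal{D}_{\max}^n$ the sesquilinear form is $$[f,g]_n(x)=\sum_{k=1}^n\sum_{j=1}^k(-1)^{k+j}\Big\{\big[a_k\overline{g}^{(k)}\big]^{(k-j)}f^{(j-1)}-\big[a_kf^{(k)}\big]^{(k-j)}\overline{g}^{(j-1)}\Big\}(x),$$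 with $[f,g]_n(\pm1)$ the (finite) limits at the endpoints. $\mathbf{L}^n_{\min}$ is $\ell^n$ acting on $\mathcal{D}_{\min}^n=\{f\in\mathcal{D}_{\max}^n:[f,g]_n(1)-[f,g]_n(-1)=0\ \forall g\in\mathcal{D}_{\max}^n\}$. Left-definite domain: let $\mathbf{A}$ be the self-adjoint operator in $L^2[(-1,1),w]$ generated by $\ell$ that has the Jacobi polynomials $P_m=P_m^{(\alpha,\beta)}$, $m\in\mathbb{N}_0$, as a complete orthogonal set of eigenfunctions. Left-definite theory (for self-adjoint operators bounded below by a positive constant, arranged if necessary by adding a constant shift, which does not change the domains of integer powers) defines the $r$th left-definite space as having underlying vector space $\mathcal{V}_r=\mathcal{D}(\mathbf{A}^{r/2})$; the left-definite domain associated with the $n$th composition is $\mathcal{D}_{\mathbf{L}}^n=\mathcal{D}(\mathbf{A}^n)=\mathcal{V}_{2n}$, and $\mathbf{L}^n=\{\ell^n,\mathcal{D}_{\mathbf{L}}^n\}$. The other domains are - $\mathcal{A}_n=\{f\in\mathcal{D}_{\max}^n: f,f',\dots,f^{(2n-1)}\in AC_{\mathrm{loc}}(-1,1),\ (1-x^2)^nf^{(2n)}\in L^2[(-1,1),w]\}$; - $\mathcal{B}_n=\{f\in\mathcal{D}_{\max}^n:[f,P_j]_n(\pm1)=0\text{ for }j=0,1,\dots,n-1\}$; - $\widetilde{\mathcal{C}}_n=\bigcup_{\mathcal{M}}\widetilde{\mathcal{C}}_n(\mathcal{M})$, the union over all sets $\mathcal{M}=\{m_1,\dots,m_n\}\subset\mathbb{N}_0$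 of $n$ distinct indices, where $\widetilde{\mathcal{C}}_n(\mathcal{M})=\{f\in\mathcal{D}_{\max}^n:[f,P_{m_j}]_n(\pm1)=0\text{ for all }m_j\in\mathcal{M}\}$; - $\mathcal{F}_n=\{f\in\mathcal{D}_{\max}^n:\lim_{x\to\pm1^{\mp}}\left[a_j(x)f^{(j)}(x)\right]^{(j-1)}=0\text{ for }j=1,2,\dots,n\}$. Conditions written with $\pm1$ are imposed at both endpoints. *)

theory Defs
  imports "HOL-Analysis.Analysis"
begin

section \<open>Derivatives and absolute continuity\<close>

definition nth_deriv :: "nat \<Rightarrow> (real \<Rightarrow> complex) \<Rightarrow> real \<Rightarrow> complex" where
  "nth_deriv k f = ((\<lambda>g x. vector_derivative g (at x)) ^^ k) f"

definition abs_cont_on_interval :: "real \<Rightarrow> real \<Rightarrow> (real \<Rightarrow> complex) \<Rightarrow> bool" where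
  "abs_cont_on_interval a b f \<longleftrightarrow>
    (\<forall>e>0. \<exists>d>0. \<forall>(m::nat) u v.
       (\<forall>i<m. a \<le> u i \<and> u i \<le> v i \<and> v i \<le> b) \<and>
       (\<forall>i<m. \<forall>j<m. i \<noteq> j \<longrightarrow> {u i<..<v i} \<inter> {u j<..<v j} = {}) \<and>
       (\<Sum>i<m. v i - u i) < d \<longrightarrow>
       (\<Sum>i<m. norm (f (v i) - f (u i))) < e)"

definition AC_loc :: "(real \<Rightarrow> complex) set" where
  "AC_loc = {f. \<forall>a b. -1 < a \<and> a \<le> b \<and> b < 1 \<longrightarrow> abs_cont_on_interval a b f}"

section \<open>Unbounded operators in \<open>L\<^sup>2\<close>\<close>

text \<open>
  Elements of \<open>L\<^sup>2(M)\<close> are represented by functions, and two functions that agree almost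
  everywhere represent the same element. An operator is given by its graph, a set of pairs of
  representatives; the graphs built below with \<open>adjoint\<close> or \<open>ell_operator\<close> are closed under
  almost everywhere modification in both components. Composition and integer powers of
  operators are then relation composition and relation powers, and domains are \<open>Domain\<close>.
\<close>

type_synonym graph = "((real \<Rightarrow> complex) \<times> (real \<Rightarrow> complex)) set"

definition L2 :: "real measure \<Rightarrow> (real \<Rightarrow> complex) set" where
  "L2 M = {f \<in> borel_measurable M. integrable M (\<lambda>x. (norm (f x))\<^sup>2)}"

definition L2_inner :: "real measure \<Rightarrow> (real \<Rightarrow> complex) \<Rightarrow> (real \<Rightarrow> complex) \<Rightarrow> complex" where
  "L2_inner M f g = (LINT x|M. f x * cnj (g x))"

definition L2_norm :: "real measure \<Rightarrow> (real \<Rightarrow> complex) \<Rightarrow> real" where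
  "L2_norm M f = sqrt (LINT x|M. (norm (f x))\<^sup>2)"

text \<open>The subset of \<open>L\<^sup>2(M)\<close> whose elements have a representative in \<open>S\<close>.\<close>

definition L2_classes :: "real measure \<Rightarrow> (real \<Rightarrow> complex) set \<Rightarrow> (real \<Rightarrow> complex) set" where
  "L2_classes M S = {f \<in> L2 M. \<exists>h\<in>S. AE x in M. f x = h x}"

definition densely_defined :: "real measure \<Rightarrow> graph \<Rightarrow> bool" where
  "densely_defined M T \<longleftrightarrow>
    (\<forall>f\<in>L2 M. \<forall>e>0. \<exists>h\<in>Domain T. L2_norm M (\<lambda>x. f x - h x) < e)"

definition adjoint :: "real measure \<Rightarrow> graph \<Rightarrow> graph" where
  "adjoint M T = {(f, g). f \<in> L2 M \<and> g \<in> L2 M \<and>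
     (\<forall>(h, k)\<in>T. L2_inner M k f = L2_inner M h g)}"

definition self_adjoint :: "real measure \<Rightarrow> graph \<Rightarrow> bool" where
  "self_adjoint M T \<longleftrightarrow> T \<subseteq> L2 M \<times> L2 M \<and> densely_defined M T \<and> adjoint M T = T"

text \<open>Dimension \<open>d\<close> of the linear space represented by \<open>S\<close>, modulo functions that vanish
  almost everywhere: \<open>b\<close> enumerates a basis.\<close>

definition has_dim_ae :: "real measure \<Rightarrow> (real \<Rightarrow> complex) set \<Rightarrow> nat \<Rightarrow> bool" where
  "has_dim_ae M S d \<longleftrightarrow>
    (\<exists>b :: nat \<Rightarrow> real \<Rightarrow> complex.
       (\<forall>i<d. b i \<in> S) \<and>
       (\<forall>c :: nat \<Rightarrow> complex. (AE x in M. (\<Sum>i<d. c i * b i x) = 0) \<longrightarrow> (\<forall>i<d. c i = 0)) \<and>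
       (\<forall>f\<in>S. \<exists>c :: nat \<Rightarrow> complex. AE x in M. f x = (\<Sum>i<d. c i * b i x)))"

text \<open>The eigenspace of the adjoint of \<open>T\<close> for the eigenvalue \<open>z\<close>.\<close>

definition defect_space :: "real measure \<Rightarrow> graph \<Rightarrow> complex \<Rightarrow> (real \<Rightarrow> complex) set" where
  "defect_space M T z = {f. (f, \<lambda>x. z * f x) \<in> adjoint M T}"

definition has_deficiency_indices :: "real measure \<Rightarrow> graph \<Rightarrow> nat \<Rightarrow> nat \<Rightarrow> bool" where
  "has_deficiency_indices M T p q \<longleftrightarrow>
     has_dim_ae M (defect_space M T \<i>) p \<and> has_dim_ae M (defect_space M T (- \<i>)) q"

definition complete_orthogonal :: "real measure \<Rightarrow> (nat \<Rightarrow> real \<Rightarrow> complex) \<Rightarrow> bool" where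
  "complete_orthogonal M e \<longleftrightarrow>
     (\<forall>m. e m \<in> L2 M \<and> \<not> (AE x in M. e m x = 0)) \<and>
     (\<forall>i j. i \<noteq> j \<longrightarrow> L2_inner M (e i) (e j) = 0) \<and>
     (\<forall>f\<in>L2 M. (\<forall>m. L2_inner M f (e m) = 0) \<longrightarrow> (AE x in M. f x = 0))"

section \<open>The Jacobi expression and its powers\<close>

definition jacobi_weight :: "real \<Rightarrow> real \<Rightarrow> real \<Rightarrow> real" where
  "jacobi_weight \<alpha> \<beta> x = (1 - x) powr \<alpha> * (1 + x) powr \<beta>"

text \<open>The measure with density \<open>w\<close> on \<open>(-1,1)\<close>, on the Lebesgue measurable sets.\<close>

definition jacobi_measure :: "real \<Rightarrow> real \<Rightarrow> real measure" where
  "jacobi_measure \<alpha> \<beta> =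
     density (lebesgue_on {-1<..<1}) (\<lambda>x. ennreal (jacobi_weight \<alpha> \<beta> x))"

text \<open>All expressions below are only meaningful at points of \<open>(-1,1)\<close>; the values elsewhere are
  never used. If the last derivative in the composition exists only almost everywhere, then the
  values on the exceptional null set are irrelevant.\<close>

definition jacobi_ell :: "real \<Rightarrow> real \<Rightarrow> (real \<Rightarrow> complex) \<Rightarrow> real \<Rightarrow> complex" where
  "jacobi_ell \<alpha> \<beta> f x =
     - (1 / of_real (jacobi_weight \<alpha> \<beta> x)) *
       nth_deriv 1 (\<lambda>t. of_real ((1 - t) powr (\<alpha> + 1) * (1 + t) powr (\<beta> + 1)) * nth_deriv 1 f t) x"

definition jacobi_ell_pow ::
    "nat \<Rightarrow> real \<Rightarrow> real \<Rightarrow> (real \<Rightarrow> complex) \<Rightarrow> real \<Rightarrow> complex" where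
  "jacobi_ell_pow n \<alpha> \<beta> f = (jacobi_ell \<alpha> \<beta> ^^ n) f"

text \<open>The coefficients with constants \<open>c k\<close> in place of \<open>C(n,k,\<alpha>,\<beta>)\<close>, and the requirement that
  they represent the \<open>n\<close>th composition in Lagrangian symmetric form.\<close>

definition sym_coeff :: "(nat \<Rightarrow> real) \<Rightarrow> real \<Rightarrow> real \<Rightarrow> nat \<Rightarrow> real \<Rightarrow> complex" where
  "sym_coeff c \<alpha> \<beta> k x =
     of_real (c k * (1 - x) powr (\<alpha> + real k) * (1 + x) powr (\<beta> + real k))"

definition lagrange_symmetric :: "nat \<Rightarrow> real \<Rightarrow> real \<Rightarrow> (nat \<Rightarrow> real) \<Rightarrow> bool" where
  "lagrange_symmetric n \<alpha> \<beta> c \<longleftrightarrow>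
     (\<forall>f. (\<forall>k<2*n. \<forall>x\<in>{-1<..<1}. nth_deriv k f differentiable (at x)) \<longrightarrow>
       (\<forall>x\<in>{-1<..<1}.
          jacobi_ell_pow n \<alpha> \<beta> f x =
          1 / of_real (jacobi_weight \<alpha> \<beta> x) *
            (\<Sum>k=1..n. (-1) ^ k *
               nth_deriv k (\<lambda>t. sym_coeff c \<alpha> \<beta> k t * nth_deriv k f t) x)))"

text \<open>The identity determines the constants for \<open>1 \<le> k \<le> n\<close>; other values are not used.\<close>

definition jacobi_const :: "nat \<Rightarrow> real \<Rightarrow> real \<Rightarrow> nat \<Rightarrow> real" where
  "jacobi_const n \<alpha> \<beta> = (SOME c. lagrange_symmetric n \<alpha> \<beta> c)"

definition jacobi_coeff :: "nat \<Rightarrow> real \<Rightarrow> real \<Rightarrow> nat \<Rightarrow> real \<Rightarrow> complex" where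
  "jacobi_coeff n \<alpha> \<beta> = sym_coeff (jacobi_const n \<alpha> \<beta>) \<alpha> \<beta>"

definition jacobi_P :: "real \<Rightarrow> real \<Rightarrow> nat \<Rightarrow> real \<Rightarrow> complex" where
  "jacobi_P \<alpha> \<beta> m x = of_real
     (\<Sum>s\<le>m. ((real m + \<alpha>) gchoose (m - s)) * ((real m + \<beta>) gchoose s) *
             ((x - 1) / 2) ^ s * ((x + 1) / 2) ^ (m - s))"

section \<open>Maximal and minimal domains\<close>

definition D_max :: "nat \<Rightarrow> real \<Rightarrow> real \<Rightarrow> (real \<Rightarrow> complex) set" where
  "D_max n \<alpha> \<beta> = {f \<in> L2 (jacobi_measure \<alpha> \<beta>).
     (\<forall>k<2*n. nth_deriv k f \<in> AC_loc) \<and>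
     jacobi_ell_pow n \<alpha> \<beta> f \<in> L2 (jacobi_measure \<alpha> \<beta>)}"

definition jacobi_form ::
    "nat \<Rightarrow> real \<Rightarrow> real \<Rightarrow> (real \<Rightarrow> complex) \<Rightarrow> (real \<Rightarrow> complex) \<Rightarrow> real \<Rightarrow> complex" where
  "jacobi_form n \<alpha> \<beta> f g x =
     (\<Sum>k=1..n. \<Sum>j=1..k. (-1) ^ (k + j) *
        (nth_deriv (k - j) (\<lambda>t. jacobi_coeff n \<alpha> \<beta> k t * nth_deriv k (\<lambda>s. cnj (g s)) t) x
           * nth_deriv (j - 1) f x
         - nth_deriv (k - j) (\<lambda>t. jacobi_coeff n \<alpha> \<beta> k t * nth_deriv k f t) x
           * nth_deriv (j - 1) (\<lambda>s. cnj (g s)) x))"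

definition form_vanishes ::
    "nat \<Rightarrow> real \<Rightarrow> real \<Rightarrow> (real \<Rightarrow> complex) \<Rightarrow> (real \<Rightarrow> complex) \<Rightarrow> bool" where
  "form_vanishes n \<alpha> \<beta> f g \<longleftrightarrow>
     (jacobi_form n \<alpha> \<beta> f g \<longlongrightarrow> 0) (at_left 1) \<and>
     (jacobi_form n \<alpha> \<beta> f g \<longlongrightarrow> 0) (at_right (-1))"

definition D_min :: "nat \<Rightarrow> real \<Rightarrow> real \<Rightarrow> (real \<Rightarrow> complex) set" where
  "D_min n \<alpha> \<beta> = {f \<in> D_max n \<alpha> \<beta>. \<forall>g\<in>D_max n \<alpha> \<beta>. \<exists>p q.
     (jacobi_form n \<alpha> \<beta> f g \<longlongrightarrow> p) (at_left 1) \<and>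
     (jacobi_form n \<alpha> \<beta> f g \<longlongrightarrow> q) (at_right (-1)) \<and> p - q = 0}"

text \<open>The operator acting as the \<open>n\<close>th composition on the functions in \<open>D\<close>.\<close>

definition ell_operator :: "nat \<Rightarrow> real \<Rightarrow> real \<Rightarrow> (real \<Rightarrow> complex) set \<Rightarrow> graph" where
  "ell_operator n \<alpha> \<beta> D =
     {(f, g). f \<in> L2 (jacobi_measure \<alpha> \<beta>) \<and> g \<in> L2 (jacobi_measure \<alpha> \<beta>) \<and>
        (\<exists>h\<in>D. (AE x in jacobi_measure \<alpha> \<beta>. f x = h x) \<and>
               (AE x in jacobi_measure \<alpha> \<beta>. g x = jacobi_ell_pow n \<alpha> \<beta> h x))}"

definition L_min :: "nat \<Rightarrow> real \<Rightarrow> real \<Rightarrow> graph" where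
  "L_min n \<alpha> \<beta> = ell_operator n \<alpha> \<beta> (D_min n \<alpha> \<beta>)"

section \<open>The left-definite operator\<close>

text \<open>\<open>A\<close> is the self-adjoint operator generated by the Jacobi expression (a restriction of its
  maximal operator) that has the Jacobi polynomials as a complete orthogonal set of
  eigenfunctions.\<close>

definition jacobi_operator :: "real \<Rightarrow> real \<Rightarrow> graph \<Rightarrow> bool" where
  "jacobi_operator \<alpha> \<beta> A \<longleftrightarrow>
     self_adjoint (jacobi_measure \<alpha> \<beta>) A \<and>
     A \<subseteq> ell_operator 1 \<alpha> \<beta> (D_max 1 \<alpha> \<beta>) \<and>
     (\<forall>m. \<exists>z::complex. (jacobi_P \<alpha> \<beta> m, \<lambda>x. z * jacobi_P \<alpha> \<beta> m x) \<in> A) \<and>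
     complete_orthogonal (jacobi_measure \<alpha> \<beta>) (jacobi_P \<alpha> \<beta>)"

text \<open>The left-definite space \<open>V\<^sub>r\<close> is the domain of \<open>A\<^sup>r\<^sup>/\<^sup>2\<close>; the one belonging to the \<open>n\<close>th
  composition has \<open>r = 2 n\<close>, so only integer powers of \<open>A\<close> occur. A constant shift of \<open>A\<close> does not
  change the domains of these powers.\<close>

definition left_definite_domain :: "graph \<Rightarrow> nat \<Rightarrow> (real \<Rightarrow> complex) set" where
  "left_definite_domain A n = Domain (A ^^ n)"

text \<open>The restriction of the maximal operator of the \<open>n\<close>th composition to the left-definite
  domain.\<close>

definition left_definite_operator :: "nat \<Rightarrow> real \<Rightarrow> real \<Rightarrow> graph \<Rightarrow> graph" where
  "left_definite_operator n \<alpha> \<beta> A =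
     {(f, g) \<in> ell_operator n \<alpha> \<beta> (D_max n \<alpha> \<beta>). f \<in> left_definite_domain A n}"

section \<open>The other domains\<close>

definition dom_A :: "nat \<Rightarrow> real \<Rightarrow> real \<Rightarrow> (real \<Rightarrow> complex) set" where
  "dom_A n \<alpha> \<beta> = {f \<in> D_max n \<alpha> \<beta>. (\<forall>k<2*n. nth_deriv k f \<in> AC_loc) \<and>
     (\<lambda>x. of_real ((1 - x\<^sup>2) ^ n) * nth_deriv (2*n) f x) \<in> L2 (jacobi_measure \<alpha> \<beta>)}"

definition dom_B :: "nat \<Rightarrow> real \<Rightarrow> real \<Rightarrow> (real \<Rightarrow> complex) set" where
  "dom_B n \<alpha> \<beta> = {f \<in> D_max n \<alpha> \<beta>. \<forall>j<n. form_vanishes n \<alpha> \<beta> f (jacobi_P \<alpha> \<beta> j)}"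

definition dom_C_of :: "nat \<Rightarrow> real \<Rightarrow> real \<Rightarrow> nat set \<Rightarrow> (real \<Rightarrow> complex) set" where
  "dom_C_of n \<alpha> \<beta> I = {f \<in> D_max n \<alpha> \<beta>. \<forall>m\<in>I. form_vanishes n \<alpha> \<beta> f (jacobi_P \<alpha> \<beta> m)}"

definition dom_C :: "nat \<Rightarrow> real \<Rightarrow> real \<Rightarrow> (real \<Rightarrow> complex) set" where
  "dom_C n \<alpha> \<beta> = (\<Union>I\<in>{I. finite I \<and> card I = n}. dom_C_of n \<alpha> \<beta> I)"

definition dom_F :: "nat \<Rightarrow> real \<Rightarrow> real \<Rightarrow> (real \<Rightarrow> complex) set" where
  "dom_F n \<alpha> \<beta> = {f \<in> D_max n \<alpha> \<beta>. \<forall>j\<in>{1..n}.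
     (nth_deriv (j - 1) (\<lambda>t. jacobi_coeff n \<alpha> \<beta> j t * nth_deriv j f t) \<longlongrightarrow> 0) (at_left 1) \<and>
     (nth_deriv (j - 1) (\<lambda>t. jacobi_coeff n \<alpha> \<beta> j t * nth_deriv j f t) \<longlongrightarrow> 0) (at_right (-1))}"

end

theory Submission
  imports Defs "HOL-Computational_Algebra.Polynomial"
begin

text \<open>All domains are compared with the set \<open>good n\<close> of those \<open>f\<close> in the maximal domain whose
  quasi-derivatives \<open>p (\<ell>\<^sup>i f)'\<close>, \<open>i < n\<close>, where \<open>p = (1-x)\<^bsup>\<alpha>+1\<^esup>(1+x)\<^bsup>\<beta>+1\<^esup>\<close>, vanish at both endpoints.
  If \<open>\<lambda>\<^sub>i\<close> are the eigenvalues and \<open>w\<^sub>k = (1-x)\<^bsup>\<alpha>+k\<^esup>(1+x)\<^bsup>\<beta>+k\<^esup>\<close>, then \<open>[w\<^sub>k f\<^bsup>(k)\<^esup>]\<^bsup>(k-1)\<^esup>\<close> equals, up to sign,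
  \<open>p g'\<close> with \<open>g\<close> the image of \<open>f\<close> under \<open>\<Prod>\<^bsub>1\<le>i<k\<^esub> (\<ell> - \<lambda>\<^sub>i)\<close>. So the conditions of \<open>F\<^sub>n\<close> are a triangular system in the
  quasi-derivatives. Against an eigenfunction \<open>P\<close> with eigenvalue \<open>\<lambda>\<close> the form \<open>[f,P]\<^sub>n\<close> collapses to
  \<open>\<Sum>\<^bsub>i<n\<^esub> \<lambda>\<^bsup>n-1-i\<^esup> [\<ell>\<^sup>i f,P]\<^sub>1\<close>, and a Vandermonde argument over \<open>n\<close> distinct eigenvalues separates the terms.
  Integrability of \<open>(1-x\<^sup>2)\<^sup>n f\<^bsup>(2n)\<^esup>\<close> gives growth bounds on all lower derivatives that make the quasi-derivatives
  vanish; conversely a weighted Hardy inequality, applied to the quasi-derivatives, gives it back.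
  The operator \<open>A\<close> is \<open>\<ell>\<close> on \<open>good 1\<close>: Green's formula shows that \<open>\<ell>\<close> is symmetric there, and testing against \<open>P\<^sub>0\<close> and
  \<open>P\<^sub>1\<close> shows that \<open>A\<close> acts inside it. Since \<open>\<ell> f = g\<close> passes regularity from \<open>g\<close> to \<open>f\<close>, the domain
  of \<open>A\<^sup>n\<close> is \<open>good n\<close>.\<close>

section \<open>Absolutely continuous functions\<close>

text \<open>The algebra rests on the intertwining relation D \<ell>(a,b) = (\<ell>(a+1,b+1) + a + b
  + 2) D: a derivative raises both parameters and shifts the spectrum. So statements about k-th
  derivatives become statements about polynomials in \<ell>, handled with Newton bases and divided
  differences at the eigenvalues. The constants C(n,k,\<alpha>,\<beta>) enter through a choice and
  are pinned down by testing on eigenfunctions. Two obstacles shape the analysis. On the maximal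
  domain the derivative of order 2n exists only almost everywhere, so identities at top order carry
  a null set, and absolute continuity, given by finite families of intervals, has to be turned into
  integration of the derivative. Moreover f and \<ell>^n f are square integrable by definition, but
  the powers in between are not known to be. The weaker fact that w \<ell>^i f is integrable is
  propagated downwards from i = n, where the positivity of \<alpha> and \<beta> enters; vanishing
  boundary values then improve it to square integrability.\<close>

definition interval_family :: "'i set \<Rightarrow> ('i \<Rightarrow> real) \<Rightarrow> ('i \<Rightarrow> real) \<Rightarrow> real \<Rightarrow> real \<Rightarrow> bool" where
  "interval_family I u v a b \<longleftrightarrow> finite I \<and> (\<forall>i\<in>I. a \<le> u i \<and> u i \<le> v i \<and> v i \<le> b) \<and>
     (\<forall>i\<in>I. \<forall>j\<in>I. i \<noteq> j \<longrightarrow> {u i<..<v i} \<inter> {u j<..<v j} = {})"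

text \<open>Absolute continuity is given for families indexed by an initial segment of the naturals;
  a bijection frees the index type. The argument on total variation needs families indexed by
  pairs.\<close>

lemma abs_cont_on_intervalE:
  assumes "abs_cont_on_interval a b f" "e > 0"
  obtains d where "d > 0"
    "\<And>(I::'i set) u v. interval_family I u v a b \<Longrightarrow> (\<Sum>i\<in>I. v i - u i) < d \<Longrightarrow>
       (\<Sum>i\<in>I. norm (f (v i) - f (u i))) < e"
proof -
  obtain d where d': "d > 0 \<and> (\<forall>(m::nat) u v.
       (\<forall>i<m. a \<le> u i \<and> u i \<le> v i \<and> v i \<le> b) \<and>
       (\<forall>i<m. \<forall>j<m. i \<noteq> j \<longrightarrow> {u i<..<v i} \<inter> {u j<..<v j} = {}) \<and>
       (\<Sum>i<m. v i - u i) < d \<longrightarrow>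
       (\<Sum>i<m. norm (f (v i) - f (u i))) < e)"
    using assms(1)[unfolded abs_cont_on_interval_def, THEN spec, THEN mp, OF assms(2)] by (rule exE)
  note d = d'[THEN conjunct1] and * = d'[THEN conjunct2, THEN spec, THEN spec, THEN spec, THEN mp]
  show thesis
  proof (rule that[OF d])
    fix I :: "'i set" and u v
    assume fam: "interval_family I u v a b" and len: "(\<Sum>i\<in>I. v i - u i) < d"
    have "finite I" using fam by (simp add: interval_family_def)
    then obtain h where h: "bij_betw h {..<card I} I"
      by (metis ex_bij_betw_nat_finite lessThan_atLeast0)
    have hI: "h i \<in> I" if "i < card I" for i
      using h that by (auto simp: bij_betw_def)
    have hinj: "h i \<noteq> h j" if "i < card I" "j < card I" "i \<noteq> j" for i j
      using h that by (auto simp: bij_betw_def inj_on_def)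
    have "(\<Sum>i<card I. norm (f ((v \<circ> h) i) - f ((u \<circ> h) i))) < e"
    proof (rule *, intro conjI allI impI)
      show "(\<Sum>i<card I. (v \<circ> h) i - (u \<circ> h) i) < d"
        using len sum.reindex_bij_betw[OF h, of "\<lambda>i. v i - u i"] by simp
    qed (use fam hI hinj in \<open>auto simp: interval_family_def\<close>)
    then show "(\<Sum>i\<in>I. norm (f (v i) - f (u i))) < e"
      using sum.reindex_bij_betw[OF h, of "\<lambda>i. norm (f (v i) - f (u i))"] by simp
  qed
qed

text \<open>The open intervals are disjoint, so their lengths add up to the Lebesgue measure of a
  subset of [a,b].\<close>

lemma interval_family_length:
  assumes "interval_family I u v a b" "a \<le> b"
  shows "(\<Sum>i\<in>I. v i - u i) \<le> b - a"
proof -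
  have fin: "finite I" using assms by (simp add: interval_family_def)
  have "ennreal (\<Sum>i\<in>I. v i - u i) = (\<Sum>i\<in>I. ennreal (v i - u i))"
    using assms by (intro sum_ennreal[symmetric]) (auto simp: interval_family_def)
  also have "\<dots> = (\<Sum>i\<in>I. emeasure lborel {u i<..<v i})"
    using assms by (intro sum.cong) (auto simp: interval_family_def)
  also have "\<dots> = emeasure lborel (\<Union>i\<in>I. {u i<..<v i})"
    using assms fin by (intro sum_emeasure) (auto simp: interval_family_def disjoint_family_on_def)
  also have "\<dots> \<le> emeasure lborel {a..b}"
  proof (rule emeasure_mono)
    show "(\<Union>i\<in>I. {u i<..<v i}) \<subseteq> {a..b}"
      using assms by (fastforce simp: interval_family_def)
  qed simp
  also have "\<dots> = ennreal (b - a)"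
    using assms by simp
  finally show ?thesis using assms by simp
qed

section \<open>Total variation of an absolutely continuous function\<close>

definition var_sums :: "(real \<Rightarrow> complex) \<Rightarrow> real \<Rightarrow> real \<Rightarrow> real set" where
  "var_sums f a b = {(\<Sum>i<m. norm (f (v i) - f (u i))) | (m::nat) u v. interval_family {..<m} u v a b}"

definition total_variation :: "(real \<Rightarrow> complex) \<Rightarrow> real \<Rightarrow> real \<Rightarrow> real" where
  "total_variation f a b = Sup (var_sums f a b)"

text \<open>Clamping is monotone and can only shrink the open intervals; those outside [c,d]
  degenerate to empty ones.\<close>

lemma interval_family_clamp:
  assumes "interval_family I u v a b" "a \<le> c" "c \<le> d" "d \<le> b"
  shows "interval_family I (\<lambda>i. max c (min d (u i))) (\<lambda>i. max c (min d (v i))) c d"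
  unfolding interval_family_def
proof (intro conjI ballI impI)
  fix i j assume ij: "i \<in> I" "j \<in> I" "i \<noteq> j"
  have "{u i<..<v i} \<inter> {u j<..<v j} = {}"
    using assms ij by (auto simp: interval_family_def)
  moreover have "{max c (min d (u k))<..<max c (min d (v k))} \<subseteq> {u k<..<v k}" for k
    by auto
  ultimately show "{max c (min d (u i))<..<max c (min d (v i))} \<inter> {max c (min d (u j))<..<max c (min d (v j))} = {}"
    by blast
qed (use assms in \<open>auto simp: interval_family_def\<close>)

text \<open>Chopping a family at the points of a sufficiently fine grid bounds its variation sum by the
  number of grid cells.\<close>

lemma var_sums_bdd_above:
  assumes ac: "abs_cont_on_interval a b f" and "a \<le> b"
  shows "bdd_above (var_sums f a b)"
proof -
  obtain d where d: "d > 0" and D: "\<And>(I::nat set) u v. interval_family I u v a b \<Longrightarrow> (\<Sum>i\<in>I. v i - u i) < d \<Longrightarrow>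
       (\<Sum>i\<in>I. norm (f (v i) - f (u i))) < 1"
    by (rule abs_cont_on_intervalE[OF ac zero_less_one], rule that; blast)
  obtain N :: nat where N: "(b - a) / d < N" using reals_Archimedean2 by blast
  have "0 \<le> (b - a) / d" using assms d by simp
  then have N0: "N > 0" using N by (cases N) auto
  define t where "t k = a + real k * (b - a) / N" for k :: nat
  have tN: "t N = b" "t 0 = a" using N0 by (auto simp: t_def)
  have tmono: "t k \<le> t l" if "k \<le> l" for k l
    using that assms by (auto simp: t_def intro!: divide_right_mono mult_right_mono)
  have tstep: "t (Suc k) - t k < d" for k
  proof -
    have "t (Suc k) - t k = (b - a) / N" by (simp add: t_def algebra_simps add_divide_distrib diff_divide_distrib)
    also have "\<dots> < d" using N N0 d by (simp add: divide_less_eq mult.commute)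
    finally show ?thesis .
  qed
  \<comment> \<open>\<open>cl k\<close> clamps a point to the k-th grid cell. The increments of f
    from the left end of each cell to the clamped point telescope.\<close>
  define cl where "cl k x = max (t k) (min (t (Suc k)) x)" for k x
  have tele: "f (min (t K) x) - f a = (\<Sum>k<K. f (cl k x) - f (t k))" if "x \<ge> a" for K x
  proof (induction K)
    case 0 then show ?case using that by (simp add: tN min_absorb1)
  next
    case (Suc K)
    have "f (min (t (Suc K)) x) - f (min (t K) x) = f (cl K x) - f (t K)"
      using tmono[of K "Suc K"] by (auto simp: cl_def min_def max_def)
    with Suc show ?case by (simp add: algebra_simps)
  qed
  have diff: "norm (f v - f u) \<le> (\<Sum>k<N. norm (f (cl k v) - f (cl k u)))" if "a \<le> u" "u \<le> v" "v \<le> b" for u v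
  proof -
    have "f v - f u = (\<Sum>k<N. f (cl k v) - f (cl k u))"
    proof -
      have "f v - f u = (f (min (t N) v) - f a) - (f (min (t N) u) - f a)"
        using that by (simp add: tN min_absorb2)
      also have "\<dots> = (\<Sum>k<N. (f (cl k v) - f (t k)) - (f (cl k u) - f (t k)))"
        using that by (subst (1 2) tele) (auto simp: sum_subtractf)
      finally show ?thesis by simp
    qed
    then show ?thesis by (simp add: norm_sum)
  qed
  have "(\<Sum>i<m. norm (f (v i) - f (u i))) \<le> N" if fam: "interval_family {..<m} u v a b" for m::nat and u v
  proof -
    have "(\<Sum>i<m. norm (f (v i) - f (u i))) \<le> (\<Sum>i<m. \<Sum>k<N. norm (f (cl k (v i)) - f (cl k (u i))))"
      using fam by (intro sum_mono diff) (auto simp: interval_family_def)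
    also have "\<dots> = (\<Sum>k<N. \<Sum>i<m. norm (f (cl k (v i)) - f (cl k (u i))))"
      by (rule sum.swap)
    also have "\<dots> \<le> (\<Sum>k<N. 1)"
    proof (rule sum_mono)
      fix k assume k: "k \<in> {..<N}"
      have fam': "interval_family {..<m} (\<lambda>i. cl k (u i)) (\<lambda>i. cl k (v i)) (t k) (t (Suc k))"
        unfolding cl_def using tmono[of 0 k] tmono[of "Suc k" N] k tmono[of k "Suc k"]
        by (intro interval_family_clamp[OF fam]) (auto simp: tN)
      have "interval_family {..<m} (\<lambda>i. cl k (u i)) (\<lambda>i. cl k (v i)) a b"
        using fam' tmono[of 0 k] tmono[of "Suc k" N] k unfolding interval_family_def tN
        by (auto intro: order_trans)
      moreover have "(\<Sum>i<m. cl k (v i) - cl k (u i)) < d"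
        using interval_family_length[OF fam' tmono] tstep[of k] by simp
      ultimately show "(\<Sum>i<m. norm (f (cl k (v i)) - f (cl k (u i)))) \<le> 1"
        using D by fastforce
    qed
    finally show ?thesis by simp
  qed
  then show ?thesis by (intro bdd_aboveI[of _ "real N"]) (auto simp: var_sums_def)
qed

lemma abs_cont_on_subinterval:
  assumes "abs_cont_on_interval a b f" "a \<le> c" "d \<le> b"
  shows "abs_cont_on_interval c d f"
  unfolding abs_cont_on_interval_def
proof (intro allI impI)
  fix e :: real assume e: "e > 0"
  obtain \<delta> where "\<delta> > 0" and *: "\<And>(I::nat set) u v. interval_family I u v a b \<Longrightarrow> (\<Sum>i\<in>I. v i - u i) < \<delta> \<Longrightarrow>
       (\<Sum>i\<in>I. norm (f (v i) - f (u i))) < e"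
    by (rule abs_cont_on_intervalE[OF assms(1) e], rule that; blast)
  show "\<exists>da>0. \<forall>(m::nat) u v.
            (\<forall>i<m. c \<le> u i \<and> u i \<le> v i \<and> v i \<le> d) \<and>
            (\<forall>i<m. \<forall>j<m. i \<noteq> j \<longrightarrow> {u i<..<v i} \<inter> {u j<..<v j} = {}) \<and> (\<Sum>i<m. v i - u i) < da \<longrightarrow>
            (\<Sum>i<m. norm (f (v i) - f (u i))) < e"
  proof (intro exI[of _ \<delta>] conjI allI impI)
    fix m :: nat and u v
    assume H: "(\<forall>i<m. c \<le> u i \<and> u i \<le> v i \<and> v i \<le> d) \<and>
            (\<forall>i<m. \<forall>j<m. i \<noteq> j \<longrightarrow> {u i<..<v i} \<inter> {u j<..<v j} = {}) \<and> (\<Sum>i<m. v i - u i) < \<delta>"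
    have "interval_family {..<m} u v a b"
      unfolding interval_family_def using H assms by (auto intro: order_trans)
    with H show "(\<Sum>i<m. norm (f (v i) - f (u i))) < e" by (intro *) auto
  qed fact
qed

lemma total_variation_upper:
  assumes "abs_cont_on_interval a b f" "a \<le> b" "interval_family {..<m::nat} u v a b"
  shows "(\<Sum>i<m. norm (f (v i) - f (u i))) \<le> total_variation f a b"
  unfolding total_variation_def
  using assms by (intro cSup_upper var_sums_bdd_above) (auto simp: var_sums_def)

lemma var_sums_nonempty: "var_sums f a b \<noteq> {}"
proof -
  have "interval_family {..<0::nat} (\<lambda>_. 0) (\<lambda>_. 0) a b" by (simp add: interval_family_def)
  then show ?thesis unfolding var_sums_def by blast
qed

lemma norm_diff_le_total_variation:
  assumes "abs_cont_on_interval a b f" "a \<le> b"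
  shows "norm (f b - f a) \<le> total_variation f a b"
  using total_variation_upper[OF assms, of 1 "\<lambda>_. a" "\<lambda>_. b"] assms by (simp add: interval_family_def)

text \<open>Clamping to [a,c] and to [c,b] cuts an interval that straddles c, and the triangle
  inequality bounds its increment by those of the two pieces.\<close>

lemma total_variation_split:
  assumes ac: "abs_cont_on_interval a b f" and c: "a \<le> c" "c \<le> b"
  shows "total_variation f a b \<le> total_variation f a c + total_variation f c b"
  unfolding total_variation_def[of f a b]
proof (rule cSup_least[OF var_sums_nonempty])
  fix x assume "x \<in> var_sums f a b"
  then obtain m :: nat and u v where fam: "interval_family {..<m} u v a b"
    and x: "x = (\<Sum>i<m. norm (f (v i) - f (u i)))" by (auto simp: var_sums_def)
  define L where "L y = max a (min c y)" for y
  define R where "R y = max c (min b y)" for y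
  have "norm (f (v i) - f (u i)) \<le> norm (f (L (v i)) - f (L (u i))) + norm (f (R (v i)) - f (R (u i)))" if "i < m" for i
  proof -
    have uv: "a \<le> u i" "u i \<le> v i" "v i \<le> b" using fam that by (auto simp: interval_family_def)
    have "f (v i) - f (u i) = (f (L (v i)) - f (L (u i))) + (f (R (v i)) - f (R (u i)))"
      using uv c by (cases "u i \<le> c"; cases "v i \<le> c") (auto simp: L_def R_def)
    then show ?thesis by (metis norm_triangle_ineq)
  qed
  then have "x \<le> (\<Sum>i<m. norm (f (L (v i)) - f (L (u i)))) + (\<Sum>i<m. norm (f (R (v i)) - f (R (u i))))"
    unfolding x by (subst sum.distrib[symmetric]) (auto intro: sum_mono)
  also have "\<dots> \<le> total_variation f a c + total_variation f c b"
    unfolding L_def R_def using c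
    by (intro add_mono total_variation_upper abs_cont_on_subinterval[OF ac] interval_family_clamp[OF fam]) auto
  finally show "x \<le> total_variation f a c + total_variation f c b" .
qed

text \<open>Concatenating a family in [a,c] with one in [c,b] gives a family in [a,b]. The two
  suprema are then taken one after the other.\<close>

lemma total_variation_superadd:
  assumes ac: "abs_cont_on_interval a b f" and c: "a \<le> c" "c \<le> b"
  shows "total_variation f a c + total_variation f c b \<le> total_variation f a b"
proof -
  have "x + y \<le> total_variation f a b" if xy: "x \<in> var_sums f a c" "y \<in> var_sums f c b" for x y
  proof -
    obtain m :: nat and u v where fam: "interval_family {..<m} u v a c"
      and x: "x = (\<Sum>i<m. norm (f (v i) - f (u i)))" using xy by (auto simp: var_sums_def)
    obtain k :: nat and u' v' where fam': "interval_family {..<k} u' v' c b"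
      and y: "y = (\<Sum>i<k. norm (f (v' i) - f (u' i)))" using xy by (auto simp: var_sums_def)
    define U where "U i = (if i < m then u i else u' (i - m))" for i
    define V where "V i = (if i < m then v i else v' (i - m))" for i
    have "interval_family {..<m + k} U V a b"
      unfolding interval_family_def
    proof (intro conjI ballI impI)
      fix i j assume ij: "i \<in> {..<m + k}" "j \<in> {..<m + k}" "i \<noteq> j"
      have l: "V i \<le> c" if "i < m" for i using fam that by (auto simp: interval_family_def V_def)
      have r: "U i \<ge> c" if "i \<ge> m" "i < m + k" for i using fam' that by (auto simp: interval_family_def U_def)
      consider "i < m" "j < m" | "i < m" "j \<ge> m" | "i \<ge> m" "j < m" | "i \<ge> m" "j \<ge> m" by linarith
      then show "{U i<..<V i} \<inter> {U j<..<V j} = {}"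
      proof cases
        case 1 then show ?thesis using fam ij by (auto simp: interval_family_def U_def V_def)
      next
        case 2 then show ?thesis using l[of i] r[of j] ij by auto
      next
        case 3 then show ?thesis using l[of j] r[of i] ij by auto
      next
        case 4
        then have "i - m \<in> {..<k}" "j - m \<in> {..<k}" "i - m \<noteq> j - m" using ij by auto
        then have "{u' (i-m)<..<v' (i-m)} \<inter> {u' (j-m)<..<v' (j-m)} = {}" 
          using fam' unfolding interval_family_def by blast
        then show ?thesis using 4 by (auto simp: U_def V_def)
      qed
    next
      fix i assume i: "i \<in> {..<m + k}"
      have "a \<le> U i \<and> U i \<le> V i \<and> V i \<le> b"
      proof (cases "i < m")
        case True
        then have "a \<le> u i \<and> u i \<le> v i \<and> v i \<le> c" using fam by (auto simp: interval_family_def)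
        then show ?thesis using True c by (auto simp: U_def V_def)
      next
        case False
        then have "i - m \<in> {..<k}" using i by auto
        then have "c \<le> u' (i - m) \<and> u' (i - m) \<le> v' (i - m) \<and> v' (i - m) \<le> b"
          using fam' by (auto simp: interval_family_def)
        then show ?thesis using False c by (auto simp: U_def V_def)
      qed
      then show "a \<le> U i" "U i \<le> V i" "V i \<le> b" by auto
    qed simp
    then have "(\<Sum>i<m + k. norm (f (V i) - f (U i))) \<le> total_variation f a b"
      using c by (intro total_variation_upper[OF ac]) auto
    moreover have "(\<Sum>i<m + k'. norm (f (V i) - f (U i))) = x + (\<Sum>i<k'. norm (f (v' i) - f (u' i)))" for k'
    proof (induction k')
      case 0 show ?case unfolding x by (simp add: U_def V_def)
    next
      case (Suc k') then show ?case by (simp add: U_def V_def)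
    qed
    ultimately show ?thesis by (simp add: y)
  qed
  then have *: "x \<le> total_variation f a b - y" if "x \<in> var_sums f a c" "y \<in> var_sums f c b" for x y
    using that by (simp add: le_diff_eq)
  have "total_variation f a c \<le> total_variation f a b - y" if "y \<in> var_sums f c b" for y
    unfolding total_variation_def[of f a c] by (rule cSup_least[OF var_sums_nonempty *[OF _ that]])
  then have **: "y \<le> total_variation f a b - total_variation f a c" if "y \<in> var_sums f c b" for y
    using that by (simp add: le_diff_eq add.commute)
  have "total_variation f c b \<le> total_variation f a b - total_variation f a c"
    unfolding total_variation_def[of f c b] by (rule cSup_least[OF var_sums_nonempty **])
  then show ?thesis by simp
qed

text \<open>In every interval of the family choose a subfamily that is optimal up to \<eta>.
  Together, indexed by pairs, they form one family of total length below d, to which absolute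
  continuity of f applies; the accumulated errors stay within e/2.\<close>

lemma total_variation_abs_cont:
  assumes ac: "abs_cont_on_interval a b f" and "e > 0"
  obtains d where "d > 0"
    "\<And>(I::nat set) u v. interval_family I u v a b \<Longrightarrow> (\<Sum>i\<in>I. v i - u i) < d \<Longrightarrow>
       (\<Sum>i\<in>I. total_variation f (u i) (v i)) \<le> e"
proof -
  obtain d where d: "d > 0" and D: 
    "\<And>(I::(nat\<times>nat) set) u v. interval_family I u v a b \<Longrightarrow> (\<Sum>i\<in>I. v i - u i) < d \<Longrightarrow>
       (\<Sum>i\<in>I. norm (f (v i) - f (u i))) < e/2"
    by (rule abs_cont_on_intervalE[OF ac half_gt_zero[OF assms(2)]], rule that; blast)
  show thesis
  proof (rule that[OF d])
    fix I :: "nat set" and u v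
    assume fam: "interval_family I u v a b" and len: "(\<Sum>i\<in>I. v i - u i) < d"
    have fin: "finite I" using fam by (simp add: interval_family_def)
    define \<eta> where "\<eta> = e / 2 / (real (card I) + 1)"
    have eta: "\<eta> > 0" using assms by (simp add: \<eta>_def)
    have "\<exists>m U V. interval_family {..<m::nat} U V (u i) (v i) \<and> 
        total_variation f (u i) (v i) - \<eta> < (\<Sum>k<m. norm (f (V k) - f (U k)))" for i
    proof -
      have "total_variation f (u i) (v i) - \<eta> < Sup (var_sums f (u i) (v i))"
        using eta by (simp add: total_variation_def)
      then obtain x where "x \<in> var_sums f (u i) (v i)" "total_variation f (u i) (v i) - \<eta> < x"
        using less_cSupD[OF var_sums_nonempty] by blast
      then show ?thesis unfolding var_sums_def by blast
    qed
    then obtain m U V where F: "\<And>i. interval_family {..<m i::nat} (U i) (V i) (u i) (v i)"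
      and S: "\<And>i. total_variation f (u i) (v i) - \<eta> < (\<Sum>k<m i. norm (f (V i k) - f (U i k)))"
      by metis
    let ?S = "Sigma I (\<lambda>i. {..<m i})"
    have "(\<Sum>p\<in>?S. norm (f (V (fst p) (snd p)) - f (U (fst p) (snd p)))) < e/2"
    proof (rule D)
      show "interval_family ?S (\<lambda>p. U (fst p) (snd p)) (\<lambda>p. V (fst p) (snd p)) a b"
        unfolding interval_family_def
      proof (intro conjI ballI impI)
        fix p assume p: "p \<in> ?S"
        have "u (fst p) \<le> U (fst p) (snd p)" "U (fst p) (snd p) \<le> V (fst p) (snd p)" "V (fst p) (snd p) \<le> v (fst p)"
          using p F[of "fst p"] by (auto simp: interval_family_def)
        moreover have "a \<le> u (fst p)" "v (fst p) \<le> b" using fam p by (auto simp: interval_family_def)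
        ultimately show "a \<le> U (fst p) (snd p)" "U (fst p) (snd p) \<le> V (fst p) (snd p)" "V (fst p) (snd p) \<le> b" by auto
      next
        fix p q assume p: "p \<in> ?S" and q: "q \<in> ?S" and ne: "p \<noteq> q"
        have sub: "{U (fst p) (snd p)<..<V (fst p) (snd p)} \<subseteq> {u (fst p)<..<v (fst p)}" if "p \<in> ?S" for p
        proof -
          have "u (fst p) \<le> U (fst p) (snd p)" "V (fst p) (snd p) \<le> v (fst p)"
            using that F[of "fst p"] by (auto simp: interval_family_def)
          then show ?thesis by auto
        qed
        show "{U (fst p) (snd p)<..<V (fst p) (snd p)} \<inter> {U (fst q) (snd q)<..<V (fst q) (snd q)} = {}"
        proof (cases "fst p = fst q")
          case True
          then have "snd p \<noteq> snd q" using ne by (auto simp: prod_eq_iff)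
          moreover have "snd p \<in> {..<m (fst p)}" "snd q \<in> {..<m (fst p)}" using p q True by auto
          ultimately show ?thesis using F[of "fst p"] True unfolding interval_family_def by metis
        next
          case False
          then have "{u (fst p)<..<v (fst p)} \<inter> {u (fst q)<..<v (fst q)} = {}"
            using fam p q unfolding interval_family_def by auto
          then show ?thesis using sub[OF p] sub[OF q] by blast
        qed
      qed (use fin in auto)
      have "(\<Sum>p\<in>?S. V (fst p) (snd p) - U (fst p) (snd p)) = (\<Sum>i\<in>I. \<Sum>k<m i. V i k - U i k)"
        using fin by (subst sum.Sigma) (auto simp: split_def)
      also have "\<dots> \<le> (\<Sum>i\<in>I. v i - u i)"
        using fam by (intro sum_mono interval_family_length[OF F]) (auto simp: interval_family_def)
      also have "\<dots> < d" by fact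
      finally show "(\<Sum>p\<in>?S. V (fst p) (snd p) - U (fst p) (snd p)) < d" .
    qed
    then have "(\<Sum>i\<in>I. \<Sum>k<m i. norm (f (V i k) - f (U i k))) < e/2"
      using fin by (subst sum.Sigma) (auto simp: split_def)
    moreover have "(\<Sum>i\<in>I. total_variation f (u i) (v i) - \<eta>) \<le> (\<Sum>i\<in>I. \<Sum>k<m i. norm (f (V i k) - f (U i k)))"
      by (intro sum_mono less_imp_le S)
    moreover have "real (card I) * \<eta> \<le> e / 2"
      unfolding \<eta>_def using assms by (simp add: field_simps)
    ultimately show "(\<Sum>i\<in>I. total_variation f (u i) (v i)) \<le> e"
      by (simp add: sum_subtractf)
  qed
qed

lemma interval_familyD:
  assumes "interval_family I u v a b" "i \<in> I"
  shows "a \<le> u i" "u i \<le> v i" "v i \<le> b"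
  using assms by (auto simp: interval_family_def)

lemma abs_cont_on_intervalI:
  assumes "\<And>e. e > 0 \<Longrightarrow> \<exists>d>0. \<forall>(I::nat set) u v. interval_family I u v a b \<longrightarrow> (\<Sum>i\<in>I. v i - u i) < d \<longrightarrow>
       (\<Sum>i\<in>I. norm (f (v i) - f (u i))) < e"
  shows "abs_cont_on_interval a b f"
  unfolding abs_cont_on_interval_def
proof (intro allI impI)
  fix e :: real assume e: "e > 0"
  obtain d where "d > 0" and *: "\<And>(I::nat set) u v. interval_family I u v a b \<Longrightarrow> (\<Sum>i\<in>I. v i - u i) < d \<Longrightarrow>
       (\<Sum>i\<in>I. norm (f (v i) - f (u i))) < e" using assms[OF e] by blast
  then show "\<exists>d>0. \<forall>(m::nat) u v.
            (\<forall>i<m. a \<le> u i \<and> u i \<le> v i \<and> v i \<le> b) \<and>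
            (\<forall>i<m. \<forall>j<m. i \<noteq> j \<longrightarrow> {u i<..<v i} \<inter> {u j<..<v j} = {}) \<and> (\<Sum>i<m. v i - u i) < d \<longrightarrow>
            (\<Sum>i<m. norm (f (v i) - f (u i))) < e"
    by (intro exI[of _ d] conjI allI impI *) (auto simp: interval_family_def)
qed

text \<open>The variation function absorbs any g whose increments are dominated by those of f. The
  cases g = 0, Re f and Im f, which are also monotone by the next lemma, give a Jordan
  decomposition.\<close>

lemma total_variation_plus_abs_cont:
  assumes ac: "abs_cont_on_interval a b f"
    and g: "\<And>x y. a \<le> x \<Longrightarrow> x \<le> y \<Longrightarrow> y \<le> b \<Longrightarrow> \<bar>g y - g x\<bar> \<le> norm (f y - f x)"
  shows "abs_cont_on_interval a b (\<lambda>x. complex_of_real (total_variation f a x + g x))"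
proof (rule abs_cont_on_intervalI)
  fix e :: real assume e: "e > 0"
  then have e3: "e / 3 > 0" by simp
  obtain d where d: "d > 0" and D: 
    "\<And>(I::nat set) u v. interval_family I u v a b \<Longrightarrow> (\<Sum>i\<in>I. v i - u i) < d \<Longrightarrow>
       (\<Sum>i\<in>I. total_variation f (u i) (v i)) \<le> e/3"
    by (rule total_variation_abs_cont[OF ac e3], rule that; blast)
  show "\<exists>d>0. \<forall>(I::nat set) u v. interval_family I u v a b \<longrightarrow> (\<Sum>i\<in>I. v i - u i) < d \<longrightarrow>
       (\<Sum>i\<in>I. norm (complex_of_real (total_variation f a (v i) + g (v i)) - complex_of_real (total_variation f a (u i) + g (u i)))) < e"
  proof (intro exI[of _ d] conjI allI impI)
    fix I :: "nat set" and u v assume fam: "interval_family I u v a b" and len: "(\<Sum>i\<in>I. v i - u i) < d"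
    have "norm (complex_of_real (total_variation f a (v i) + g (v i)) - complex_of_real (total_variation f a (u i) + g (u i)))
       \<le> 2 * total_variation f (u i) (v i)" if i: "i \<in> I" for i
    proof -
      note uv = interval_familyD[OF fam i]
      have 1: "abs_cont_on_interval a (v i) f" "abs_cont_on_interval (u i) (v i) f"
        using uv by (auto intro: abs_cont_on_subinterval[OF ac])
      have "total_variation f a (v i) - total_variation f a (u i) = total_variation f (u i) (v i)"
        using total_variation_split[OF 1(1), of "u i"] total_variation_superadd[OF 1(1), of "u i"] uv by simp
      moreover have "\<bar>g (v i) - g (u i)\<bar> \<le> total_variation f (u i) (v i)"
        using g[of "u i" "v i"] norm_diff_le_total_variation[OF 1(2)] uv by simp
      moreover have "norm (complex_of_real (total_variation f a (v i) + g (v i)) - complex_of_real (total_variation f a (u i) + g (u i)))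
         = \<bar>(total_variation f a (v i) - total_variation f a (u i)) + (g (v i) - g (u i))\<bar>"
        by (subst of_real_diff[symmetric], subst norm_of_real) (simp add: algebra_simps)
      ultimately show ?thesis by linarith
    qed
    then have "(\<Sum>i\<in>I. norm (complex_of_real (total_variation f a (v i) + g (v i)) - complex_of_real (total_variation f a (u i) + g (u i))))
      \<le> 2 * (\<Sum>i\<in>I. total_variation f (u i) (v i))"
      unfolding sum_distrib_left by (rule sum_mono)
    also have "\<dots> < e" using D[OF fam len] e by simp
    finally show "(\<Sum>i\<in>I. norm (complex_of_real (total_variation f a (v i) + g (v i)) - complex_of_real (total_variation f a (u i) + g (u i)))) < e" .
  qed fact
qed

lemma total_variation_plus_mono:
  assumes ac: "abs_cont_on_interval a b f"
    and g: "\<And>x y. a \<le> x \<Longrightarrow> x \<le> y \<Longrightarrow> y \<le> b \<Longrightarrow> \<bar>g y - g x\<bar> \<le> norm (f y - f x)"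
    and xy: "a \<le> x" "x \<le> y" "y \<le> b"
  shows "total_variation f a x + g x \<le> total_variation f a y + g y"
proof -
  have 1: "abs_cont_on_interval a y f" "abs_cont_on_interval x y f"
    using xy by (auto intro: abs_cont_on_subinterval[OF ac])
  have "total_variation f a x + total_variation f x y \<le> total_variation f a y"
    using total_variation_superadd[OF 1(1), of x] xy by simp
  moreover have "\<bar>g y - g x\<bar> \<le> total_variation f x y"
    using g[OF xy] norm_diff_le_total_variation[OF 1(2)] xy by simp
  ultimately show ?thesis by linarith
qed

section \<open>Densities of absolutely continuous functions\<close>

lemma abs_cont_on_interval_continuous:
  assumes "abs_cont_on_interval a b f"
  shows "continuous_on {a..b} f"
  unfolding continuous_on_iff
proof (intro ballI allI impI)
  fix x e :: real assume x: "x \<in> {a..b}" and e: "e > 0"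
  obtain d where d: "d > 0" and D: "\<And>(I::nat set) u v. interval_family I u v a b \<Longrightarrow> (\<Sum>i\<in>I. v i - u i) < d \<Longrightarrow>
       (\<Sum>i\<in>I. norm (f (v i) - f (u i))) < e"
    by (rule abs_cont_on_intervalE[OF assms e], rule that; blast)
  have "dist (f y) (f x) < e" if y: "y \<in> {a..b}" "dist y x < d" for y
  proof -
    have "interval_family {0::nat} (\<lambda>_. min x y) (\<lambda>_. max x y) a b"
      using x y by (auto simp: interval_family_def)
    moreover have "(\<Sum>i\<in>{0::nat}. max x y - min x y) < d"
      using y by (auto simp: dist_real_def)
    ultimately have "norm (f (max x y) - f (min x y)) < e"
      using D by fastforce
    then show ?thesis by (auto simp: dist_norm norm_minus_commute max_def min_def split: if_splits)
  qed
  with d show "\<exists>d>0. \<forall>x'\<in>{a..b}. dist x' x < d \<longrightarrow> dist (f x') (f x) < e" by blast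
qed

text \<open>Every stage has finitely many cells, so absolute continuity, a statement on finite
  families, applies to it. Cells are half-open so that the halves of a cell are exactly cells of the
  next stage.\<close>

lemma open_dyadic_exhaustion:
  fixes a b :: real
  assumes U: "open U" and ab: "a < b"
  defines "cell k j \<equiv> {a + real j * (b - a) / 2 ^ k <.. a + real (Suc j) * (b - a) / 2 ^ k}"
  defines "J k \<equiv> {j. j < 2 ^ k \<and> cell k j \<subseteq> U}"
  shows "incseq (\<lambda>k. \<Union>j\<in>J k. cell k j)" "U \<inter> {a<..b} \<subseteq> (\<Union>k. \<Union>j\<in>J k. cell k j)"
proof -
  have split: "cell k j = cell (Suc k) (2 * j) \<union> cell (Suc k) (2 * j + 1)" for k j
  proof -
    define r where "r = (b - a) / 2 ^ Suc k"
    have r: "r \<ge> 0" using ab by (simp add: r_def)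
    have r2: "2 * r = (b - a) / 2 ^ k" by (simp add: r_def field_simps)
    have c: "cell k j = {a + real j * (2 * r) <.. a + real (Suc j) * (2 * r)}"
      "cell (Suc k) i = {a + real i * r <.. a + real (Suc i) * r}" for i
      unfolding r2 by (simp_all add: cell_def r_def)
    show ?thesis
      unfolding c using r by (auto simp: algebra_simps)
  qed
  show "incseq (\<lambda>k. \<Union>j\<in>J k. cell k j)"
  proof (rule incseq_SucI, rule subsetI)
    fix k x assume "x \<in> (\<Union>j\<in>J k. cell k j)"
    then obtain j where j: "j < 2 ^ k" "cell k j \<subseteq> U" "x \<in> cell k j" by (auto simp: J_def)
    then have "2 * j \<in> J (Suc k)" "2 * j + 1 \<in> J (Suc k)"
      unfolding J_def split[of k j] by auto
    moreover have "x \<in> cell (Suc k) (2 * j) \<or> x \<in> cell (Suc k) (2 * j + 1)" using j(3) unfolding split[of k j] by blast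
    ultimately show "x \<in> (\<Union>j\<in>J (Suc k). cell (Suc k) j)" by blast
  qed
  show "U \<inter> {a<..b} \<subseteq> (\<Union>k. \<Union>j\<in>J k. cell k j)"
  proof
    fix x assume x: "x \<in> U \<inter> {a<..b}"
    then obtain e where e: "e > 0" "ball x e \<subseteq> U" using U openE by blast
    obtain k where k: "(b - a) / 2 ^ k < e"
    proof -
      obtain k where "(1/2::real) ^ k < e / (b - a)"
        using real_arch_pow_inv[of "e / (b - a)" "1/2"] e ab by auto
      then have "(b - a) / 2 ^ k < e" using ab by (simp add: field_simps power_divide)
      then show ?thesis by (rule that)
    qed
    define z where "z = (x - a) * 2 ^ k / (b - a)"
    \<comment> \<open>One is subtracted from the ceiling because the cells are open on the left and
      closed on the right.\<close>
    define j where "j = nat (\<lceil>z\<rceil> - 1)"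
    have z: "0 < z" "z \<le> 2 ^ k" using x ab by (auto simp: z_def field_simps)
    then have c: "1 \<le> \<lceil>z\<rceil>" by (simp add: one_le_ceiling)
    have rj: "real j = of_int \<lceil>z\<rceil> - 1" "real (Suc j) = of_int \<lceil>z\<rceil>" using c by (simp_all add: j_def)
    have jz: "real j < z" "z \<le> real (Suc j)" unfolding rj by linarith+
    have "real j < 2 ^ k" using jz z by linarith
    then have jk: "j < 2 ^ k" by (metis of_nat_less_iff of_nat_numeral of_nat_power)
    have "x = a + z * (b - a) / 2 ^ k" using ab by (simp add: z_def)
    then have xc: "x \<in> cell k j" using jz ab 
      by (auto simp: cell_def intro!: divide_strict_right_mono divide_right_mono mult_right_mono)
    have "cell k j \<subseteq> ball x e"
    proof
      fix y assume y: "y \<in> cell k j"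
      have "a + real (Suc j) * (b - a) / 2 ^ k = a + real j * (b - a) / 2 ^ k + (b - a) / 2 ^ k"
        by (simp add: field_simps)
      then have "\<bar>x - y\<bar> < e" using y xc k by (auto simp: cell_def)
      then show "y \<in> ball x e" by (simp add: dist_real_def)
    qed
    then show "x \<in> (\<Union>k. \<Union>j\<in>J k. cell k j)" using e jk xc by (auto simp: J_def)
  qed
qed

text \<open>The Stieltjes measure of G is absolutely continuous with respect to Lebesgue measure,
  and its Radon-Nikodym derivative is the density.\<close>

lemma mono_abs_cont_density:
  fixes G :: "real \<Rightarrow> real"
  assumes ab: "a < b" and mono: "\<And>x y. a \<le> x \<Longrightarrow> x \<le> y \<Longrightarrow> y \<le> b \<Longrightarrow> G x \<le> G y"
    and ac: "abs_cont_on_interval a b (\<lambda>x. complex_of_real (G x))"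
  obtains h :: "real \<Rightarrow> real" where "\<And>x. h x \<ge> 0"
    "\<And>x y. a \<le> x \<Longrightarrow> x \<le> y \<Longrightarrow> y \<le> b \<Longrightarrow> (h has_integral (G y - G x)) {x..y}"
proof -
  \<comment> \<open>Extending G by constants gives a monotone continuous function on the line whose
    Stieltjes measure has no mass outside (a,b].\<close>
  define F where "F x = G (max a (min b x))" for x
  define M where "M = interval_measure F"
  have Fmono: "F x \<le> F y" if "x \<le> y" for x y
    unfolding F_def using that ab by (intro mono) auto
  have FG: "F x = G x" if "x \<in> {a..b}" for x using that by (auto simp: F_def)
  have "continuous_on {a..b} (\<lambda>x. Re (complex_of_real (G x)))"
    by (intro continuous_on_Re abs_cont_on_interval_continuous ac)
  then have Gc: "continuous_on {a..b} G" by simp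
  have "continuous_on UNIV F" unfolding F_def
    by (rule continuous_on_compose2[OF Gc]) (use ab in \<open>auto intro!: continuous_intros\<close>)
  then have Fc: "continuous (at_right x) F" for x
    by (auto simp: continuous_on_eq_continuous_within intro: continuous_within_subset)
  have Mioc: "emeasure M {x<..y} = ennreal (F y - F x)" if "x \<le> y" for x y
    unfolding M_def using that by (intro emeasure_interval_measure_Ioc Fmono Fc)
  have sets[simp]: "sets M = sets borel" "space M = UNIV" by (simp_all add: M_def)
  have null_out: "emeasure M ({..a} \<union> {b<..}) = 0"
  proof -
    have "{..a} = (\<Union>n. {a - real n<..a})" 
    proof (intro equalityI subsetI)
      fix x assume x: "x \<in> {..a}"
      obtain n :: nat where "a - x < n" using reals_Archimedean2 by blast
      then show "x \<in> (\<Union>n. {a - real n<..a})" using x by (auto intro!: exI[of _ n])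
    qed auto
    moreover have "emeasure M (\<Union>n. {a - real n<..a}) = 0"
      by (rule emeasure_UN_eq_0) (auto simp: Mioc F_def)
    ultimately have 1: "emeasure M {..a} = 0" by simp
    have "{b<..} = (\<Union>n. {b<..b + real n})"
    proof (intro equalityI subsetI)
      fix x assume x: "x \<in> {b<..}"
      obtain n :: nat where "x - b < n" using reals_Archimedean2 by blast
      then show "x \<in> (\<Union>n. {b<..b + real n})" using x by (auto intro!: exI[of _ n])
    qed auto
    moreover have "emeasure M (\<Union>n. {b<..b + real n}) = 0"
      by (rule emeasure_UN_eq_0) (use ab in \<open>auto simp: Mioc F_def\<close>)
    ultimately have 2: "emeasure M {b<..} = 0" by simp
    show ?thesis using emeasure_subadditive[of "{..a}" M "{b<..}"] 1 2 by simp
  qed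
  have "absolutely_continuous lborel M"
    unfolding absolutely_continuous_def
  proof
    fix N :: "real set" assume N: "N \<in> null_sets lborel"
    then have Nb[simp]: "N \<in> sets borel" by auto
    have "emeasure M N \<le> ennreal e" if e: "e > 0" for e :: real
    proof -
      obtain d where d: "d > 0" and D: "\<And>(I::nat set) u v. interval_family I u v a b \<Longrightarrow> (\<Sum>i\<in>I. v i - u i) < d \<Longrightarrow>
         (\<Sum>i\<in>I. norm (complex_of_real (G (v i)) - complex_of_real (G (u i)))) < e"
        by (rule abs_cont_on_intervalE[OF ac e], rule that; blast)
      \<comment> \<open>A null set has an open neighbourhood of Lebesgue measure below d. Its dyadic
        cells at any stage have total length below d, hence Stieltjes measure at most e; the stages
        increase to the neighbourhood.\<close>
      obtain U where U: "open U" "N \<subseteq> U" "emeasure lborel (U - N) < ennreal d"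
        using outer_regular_lborel[OF Nb d] by auto
      have Ud: "emeasure lborel U < ennreal d"
      proof -
        have "emeasure lborel U \<le> emeasure lborel (U - N) + emeasure lborel N"
          using emeasure_subadditive[of "U - N" lborel N] U borel_open[OF U(1)] by (simp add: Un_absorb2 sets.Diff)
        also have "\<dots> = emeasure lborel (U - N)" using N by (simp add: null_sets_def)
        finally show ?thesis using U(3) by simp
      qed
      define t where "t k j = a + real j * (b - a) / 2 ^ k" for k j :: nat
      define J where "J k = {j. j < 2 ^ k \<and> {t k j<..t k (Suc j)} \<subseteq> U}" for k :: nat
      define V where "V k = (\<Union>j\<in>J k. {t k j<..t k (Suc j)})" for k
      have exh: "incseq V" "U \<inter> {a<..b} \<subseteq> (\<Union>k. V k)"
        using open_dyadic_exhaustion[OF U(1) ab] unfolding V_def J_def t_def by auto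
      have tmono: "t k i \<le> t k j" if "i \<le> j" for k i j
        using that ab by (auto simp: t_def intro!: divide_right_mono mult_right_mono)
      have t0: "t k 0 = a" "t k (2 ^ k) = b" for k by (auto simp: t_def)
      have finJ[simp]: "finite (J k)" for k by (simp add: J_def)
      have fam: "interval_family (J k) (t k) (\<lambda>j. t k (Suc j)) a b" for k
        unfolding interval_family_def
      proof (intro conjI ballI impI)
        fix j assume "j \<in> J k"
        then show "a \<le> t k j" "t k j \<le> t k (Suc j)" "t k (Suc j) \<le> b"
          using tmono[of 0 j k] tmono[of "Suc j" "2 ^ k" k] tmono[of j "Suc j"] by (auto simp: t0 J_def)
      next
        fix i j assume "i \<in> J k" "j \<in> J k" "i \<noteq> j"
        then consider "Suc i \<le> j" | "Suc j \<le> i" by linarith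
        then show "{t k i<..<t k (Suc i)} \<inter> {t k j<..<t k (Suc j)} = {}"
          using tmono[of "Suc i" j k] tmono[of "Suc j" i k] by cases auto
      qed simp
      have MV: "emeasure M (V k) \<le> ennreal e" for k
      proof -
        have disj: "disjoint_family_on (\<lambda>j. {t k j<..t k (Suc j)}) (J k)"
        proof (unfold disjoint_family_on_def, intro ballI impI)
          fix i j assume "i \<in> J k" "j \<in> J k" "i \<noteq> j"
          then consider "Suc i \<le> j" | "Suc j \<le> i" by linarith
          then show "{t k i<..t k (Suc i)} \<inter> {t k j<..t k (Suc j)} = {}"
            using tmono[of "Suc i" j k] tmono[of "Suc j" i k] by cases auto
        qed
        have "ennreal (\<Sum>j\<in>J k. t k (Suc j) - t k j) = (\<Sum>j\<in>J k. emeasure lborel {t k j<..t k (Suc j)})"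
          using tmono[of _ "Suc _"] by (subst sum_ennreal[symmetric]) (auto intro!: sum.cong)
        also have "\<dots> = emeasure lborel (V k)" unfolding V_def
          using disj by (intro sum_emeasure) auto
        also have "\<dots> \<le> emeasure lborel U" using U(1) by (intro emeasure_mono) (auto simp: V_def J_def)
        also have "\<dots> < ennreal d" by (rule Ud)
        finally have "(\<Sum>j\<in>J k. t k (Suc j) - t k j) < d" using d by (simp add: ennreal_less_iff tmono sum_nonneg)
        from D[OF fam this]
        have less: "(\<Sum>j\<in>J k. norm (complex_of_real (G (t k (Suc j))) - complex_of_real (G (t k j)))) < e" .
        have ge: "F (t k (Suc j)) - F (t k j) \<le> norm (complex_of_real (G (t k (Suc j))) - complex_of_real (G (t k j)))"
          if "j \<in> J k" for j
        proof -
          have "t k j \<in> {a..b}" "t k (Suc j) \<in> {a..b}" using interval_familyD[OF fam that] by auto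
          then show ?thesis by (simp add: FG flip: of_real_diff) 
        qed
        have "emeasure M (V k) = (\<Sum>j\<in>J k. emeasure M {t k j<..t k (Suc j)})"
          unfolding V_def using disj by (intro sum_emeasure[symmetric]) auto
        also have "\<dots> = (\<Sum>j\<in>J k. ennreal (F (t k (Suc j)) - F (t k j)))"
          by (intro sum.cong refl Mioc tmono) simp
        also have "\<dots> = ennreal (\<Sum>j\<in>J k. F (t k (Suc j)) - F (t k j))"
          by (intro sum_ennreal) (simp add: Fmono tmono)
        also have "\<dots> \<le> ennreal e"
          by (intro ennreal_leI order_trans[OF sum_mono[OF ge] less_imp_le[OF less]])
        finally show ?thesis .
      qed
      have Vb[simp]: "V k \<in> sets borel" for k unfolding V_def by (intro sets.finite_UN) auto
      have "emeasure M N \<le> emeasure M (({..a} \<union> {b<..}) \<union> (\<Union>k. V k))"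
        using exh(2) U(2) by (intro emeasure_mono) force+
      also have "\<dots> \<le> emeasure M ({..a} \<union> {b<..}) + emeasure M (\<Union>k. V k)"
        by (intro emeasure_subadditive) auto
      also have "\<dots> = (SUP k. emeasure M (V k))"
        using SUP_emeasure_incseq[of V M] exh(1) by (simp add: null_out image_subset_iff)
      also have "\<dots> \<le> ennreal e" by (rule SUP_least) (rule MV)
      finally show ?thesis .
    qed
    then have "emeasure M N \<le> 0" using ennreal_le_epsilon[of 0 "emeasure M N"] by simp
    then show "N \<in> null_sets M" by (auto simp: null_sets_def)
  qed
  then obtain g where g: "g \<in> borel_measurable lborel" and gM: "density lborel g = M"
    using sigma_finite_measure.Radon_Nikodym[OF sigma_finite_lborel, of M] by auto
  have gi: "(\<integral>\<^sup>+z. g z * indicator {x<..y} z \<partial>lborel) = ennreal (F y - F x)" if "x \<le> y" for x y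
    using Mioc[OF that] g by (simp add: gM[symmetric] emeasure_density)
  \<comment> \<open>The density is finite almost everywhere on (a,b], so passing to
    \<open>enn2real\<close> changes no integral there.\<close>
  have fin: "AE z in lborel. g z * indicator {a<..b} z \<noteq> \<infinity>"
    using g gi[of a b] ab by (intro nn_integral_noteq_infinite) auto
  show thesis
  proof (rule that[of "\<lambda>z. enn2real (g z)"])
    fix x y :: real assume xy: "a \<le> x" "x \<le> y" "y \<le> b"
    have "(\<integral>\<^sup>+z. ennreal (indicator {x<..y} z * enn2real (g z)) \<partial>lborel) = (\<integral>\<^sup>+z. g z * indicator {x<..y} z \<partial>lborel)"
    proof (rule nn_integral_cong_AE, use fin in eventually_elim)
      case (elim z)
      then show ?case using xy by (auto simp: indicator_def less_top split: if_splits)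
    qed
    then have "((\<lambda>z. indicator {x<..y} z * enn2real (g z)) has_integral (F y - F x)) UNIV"
      using g gi[of x y] xy by (intro nn_integral_has_integral) (auto simp: Fmono)
    then have "((\<lambda>z. if z \<in> {x<..y} then enn2real (g z) else 0) has_integral (F y - F x)) UNIV"
      by (rule has_integral_eq[rotated]) (auto simp: indicator_def)
    then have "((\<lambda>z. enn2real (g z)) has_integral (F y - F x)) {x<..y}"
      by (subst (asm) has_integral_restrict_UNIV)
    moreover have "{x<..y} - {x..y} \<union> ({x..y} - {x<..y}) \<subseteq> {x}" by auto
    ultimately have "((\<lambda>z. enn2real (g z)) has_integral (F y - F x)) {x..y}"
      by (subst has_integral_spike_set_eq[of "{x..y}" "{x<..y}"]) (auto intro: negligible_subset[OF negligible_sing])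
    then show "((\<lambda>z. enn2real (g z)) has_integral (G y - G x)) {x..y}" using xy by (simp add: FG)
  qed simp
qed

text \<open>With V the total variation, Re f = (V + Re f) - V, and likewise for Im f; each of the
  three functions V, V + Re f and V + Im f is monotone and has a density.\<close>

lemma abs_cont_density:
  assumes ab: "a < b" and ac: "abs_cont_on_interval a b f"
  obtains h where "h absolutely_integrable_on {a..b}"
    "\<And>x y. a \<le> x \<Longrightarrow> x \<le> y \<Longrightarrow> y \<le> b \<Longrightarrow> (h has_integral (f y - f x)) {x..y}"
proof -
  let ?V = "total_variation f a"
  have g0: "\<bar>0 - (0::real)\<bar> \<le> norm (f y - f x)" for x y by simp
  have gR: "\<bar>Re (f y) - Re (f x)\<bar> \<le> norm (f y - f x)" for x y
    using abs_Re_le_cmod[of "f y - f x"] by simp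
  have gI: "\<bar>Im (f y) - Im (f x)\<bar> \<le> norm (f y - f x)" for x y
    using abs_Im_le_cmod[of "f y - f x"] by simp
  obtain h0 where h0: "\<And>x. h0 x \<ge> 0" "\<And>x y. a \<le> x \<Longrightarrow> x \<le> y \<Longrightarrow> y \<le> b \<Longrightarrow> (h0 has_integral ((?V y + 0) - (?V x + 0))) {x..y}"
    using mono_abs_cont_density[OF ab total_variation_plus_mono[OF ac g0] total_variation_plus_abs_cont[OF ac g0]] by blast
  obtain h1 where h1: "\<And>x. h1 x \<ge> 0" "\<And>x y. a \<le> x \<Longrightarrow> x \<le> y \<Longrightarrow> y \<le> b \<Longrightarrow> (h1 has_integral ((?V y + Re (f y)) - (?V x + Re (f x)))) {x..y}"
    using mono_abs_cont_density[OF ab total_variation_plus_mono[OF ac gR] total_variation_plus_abs_cont[OF ac gR]] by blast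
  obtain h2 where h2: "\<And>x. h2 x \<ge> 0" "\<And>x y. a \<le> x \<Longrightarrow> x \<le> y \<Longrightarrow> y \<le> b \<Longrightarrow> (h2 has_integral ((?V y + Im (f y)) - (?V x + Im (f x)))) {x..y}"
    using mono_abs_cont_density[OF ab total_variation_plus_mono[OF ac gI] total_variation_plus_abs_cont[OF ac gI]] by blast
  define h where "h x = complex_of_real (h1 x - h0 x) + \<i> * complex_of_real (h2 x - h0 x)" for x
  have ai: "h0 absolutely_integrable_on {a..b}" "h1 absolutely_integrable_on {a..b}" "h2 absolutely_integrable_on {a..b}"
    using h0(1) h0(2)[of a b] h1(1) h1(2)[of a b] h2(1) h2(2)[of a b] ab
    by (auto intro!: nonnegative_absolutely_integrable_1 simp: integrable_on_def)
  show thesis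
  proof (rule that[of h])
    have c: "(\<lambda>x. complex_of_real (g x)) absolutely_integrable_on {a..b}" if "g absolutely_integrable_on {a..b}" for g
      using absolutely_integrable_linear[OF that, of complex_of_real] by (simp add: o_def bounded_linear_of_real)
    have "(\<lambda>x. complex_of_real (h1 x - h0 x)) absolutely_integrable_on {a..b}"
      "(\<lambda>x. \<i> * complex_of_real (h2 x - h0 x)) absolutely_integrable_on {a..b}"
      using ai by (auto intro!: c set_integral_diff set_integrable_mult_right)
    then show "h absolutely_integrable_on {a..b}"
      unfolding h_def by (rule set_integral_add(1))
    fix x y assume xy: "a \<le> x" "x \<le> y" "y \<le> b"
    have 1: "((\<lambda>z. h1 z - h0 z) has_integral (Re (f y) - Re (f x))) {x..y}"
      using has_integral_diff[OF h1(2)[OF xy] h0(2)[OF xy]] by (simp add: algebra_simps)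
    have 2: "((\<lambda>z. h2 z - h0 z) has_integral (Im (f y) - Im (f x))) {x..y}"
      using has_integral_diff[OF h2(2)[OF xy] h0(2)[OF xy]] by (simp add: algebra_simps)
    have "(h has_integral (complex_of_real (Re (f y) - Re (f x)) + \<i> * complex_of_real (Im (f y) - Im (f x)))) {x..y}"
      unfolding h_def using has_integral_linear[OF 1, of complex_of_real] has_integral_linear[OF 2, of complex_of_real]
      by (intro has_integral_add has_integral_mult_right) (auto simp: o_def bounded_linear_of_real)
    moreover have "complex_of_real (Re (f y) - Re (f x)) + \<i> * complex_of_real (Im (f y) - Im (f x)) = f y - f x"
      by (simp add: complex_eq_iff)
    ultimately show "(h has_integral (f y - f x)) {x..y}" by simp
  qed
qed

text \<open>The averages on the right converge almost everywhere by the covering argument of the library; reflection gives the averages on the left.\<close>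

lemma integral_has_derivative_ae:
  fixes h :: "real \<Rightarrow> complex"
  assumes h: "h integrable_on {a..b}"
  obtains N where "negligible N"
    "\<And>x. x \<in> {a<..<b} - N \<Longrightarrow> ((\<lambda>t. integral {a..t} h) has_vector_derivative h x) (at x)"
proof -
  \<comment> \<open>Extension by zero makes h integrable over every interval, as the covering
    argument requires.\<close>
  define H where "H x = (if x \<in> {a..b} then h x else 0)" for x
  have HU: "H integrable_on UNIV" unfolding H_def using h by (subst integrable_restrict_UNIV)
  then have Hi: "H integrable_on cbox c d" for c d
    using integrable_on_subcbox[OF HU, of c d] by simp
  have "(\<lambda>x. H (- x)) integrable_on cbox c d" for c d
    using Henstock_Kurzweil_Integration.integrable_reflect_real[where f = H and a = "-d" and b = "-c"] Hi[of "-d" "-c"] by simp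
  from integrable_ccontinuous_explicit[OF Hi] obtain N1 where N1: "negligible N1"
    "\<And>x e. x \<notin> N1 \<Longrightarrow> 0 < e \<Longrightarrow> \<exists>d>0. \<forall>k. 0 < k \<and> k < d \<longrightarrow>
         norm (integral (cbox x (x + k *\<^sub>R One)) H /\<^sub>R k ^ DIM(real) - H x) < e" by blast
  from integrable_ccontinuous_explicit[of "\<lambda>x. H (-x)"] obtain N2 where N2: "negligible N2"
    "\<And>x e. x \<notin> N2 \<Longrightarrow> 0 < e \<Longrightarrow> \<exists>d>0. \<forall>k. 0 < k \<and> k < d \<longrightarrow>
         norm (integral (cbox x (x + k *\<^sub>R One)) (\<lambda>x. H (-x)) /\<^sub>R k ^ DIM(real) - H (-x)) < e"
    using \<open>\<And>d c. (\<lambda>x. H (- x)) integrable_on cbox c d\<close> by blast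
  have "negligible (uminus ` N2)" using N2(1) by (intro negligible_differentiable_image_negligible) (auto intro!: derivative_intros)
  then have neg: "negligible (N1 \<union> uminus ` N2)" using N1(1) by (rule negligible_Un[rotated])
  show thesis
  proof (rule that[OF neg])
    fix x assume x: "x \<in> {a<..<b} - (N1 \<union> uminus ` N2)"
    then have x1: "x \<notin> N1" "- x \<notin> N2" "a < x" "x < b" by (auto simp: image_iff)
    have Hx: "H x = h x" using x1 by (simp add: H_def)
    have hi: "h integrable_on {c..d}" if "a \<le> c" "d \<le> b" for c d
      using integrable_on_subinterval[OF h, of c d] that by auto
    have IH: "integral {c..d} H = integral {c..d} h" if "a \<le> c" "d \<le> b" for c d
      using that by (intro integral_cong) (auto simp: H_def)
    show "((\<lambda>t. integral {a..t} h) has_vector_derivative h x) (at x)"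
      unfolding has_vector_derivative_def has_derivative_at_alt
    proof (intro conjI allI impI)
      fix e :: real assume e: "e > 0"
      obtain d1 where d1: "d1 > 0" "\<And>k. 0 < k \<Longrightarrow> k < d1 \<Longrightarrow> norm (integral {x..x + k} H /\<^sub>R k - H x) < e"
        using N1(2)[OF x1(1) e] by auto
      obtain d2 where d2: "d2 > 0" "\<And>k. 0 < k \<Longrightarrow> k < d2 \<Longrightarrow> norm (integral {-x..-x + k} (\<lambda>x. H (-x)) /\<^sub>R k - H x) < e"
        using N2(2)[OF x1(2) e] by auto
      define d where "d = min (min d1 d2) (min (x - a) (b - x))"
      have d: "d > 0" using d1(1) d2(1) x1 by (simp add: d_def)
      have key: "norm (I - k *\<^sub>R h x) \<le> e * k" if "0 < k" "norm (I /\<^sub>R k - H x) < e" for I and k :: real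
      proof -
        have "I - k *\<^sub>R h x = k *\<^sub>R (I /\<^sub>R k - H x)" using that(1) by (simp add: Hx scaleR_diff_right)
        then have "norm (I - k *\<^sub>R h x) = k * norm (I /\<^sub>R k - H x)" using that(1) by simp
        also have "\<dots> \<le> k * e" using that by (intro mult_left_mono) auto
        finally show ?thesis by (simp add: mult.commute)
      qed
      have "norm (integral {a..y} h - integral {a..x} h - (y - x) *\<^sub>R h x) \<le> e * norm (y - x)" if y: "norm (y - x) < d" for y
      proof -
        consider "y = x" | "y > x" | "y < x" by linarith
        then show ?thesis
        proof cases
          case 2
          have "integral {a..x} h + integral {x..y} h = integral {a..y} h"
            using 2 y x1 d_def by (intro Henstock_Kurzweil_Integration.integral_combine hi) auto
          then have "integral {a..y} h - integral {a..x} h = integral {x..y} h" by (simp add: algebra_simps)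
          moreover have "norm (integral {x..y} H - (y - x) *\<^sub>R h x) \<le> e * (y - x)"
            using 2 y d1(2)[of "y - x"] by (intro key) (auto simp: d_def)
          moreover have "integral {x..y} H = integral {x..y} h" using y x1 2 d_def by (intro IH) auto
          ultimately show ?thesis using 2 by simp
        next
          case 3
          have "integral {a..y} h + integral {y..x} h = integral {a..x} h"
            using 3 y x1 d_def by (intro Henstock_Kurzweil_Integration.integral_combine hi) auto
          moreover have "norm (integral {-x..-y} (\<lambda>x. H (-x)) - (x - y) *\<^sub>R h x) \<le> e * (x - y)"
            using 3 y d2(2)[of "x - y"] by (intro key) (auto simp: d_def)
          moreover have "integral {-x..-y} (\<lambda>x. H (-x)) = integral {y..x} H"
            by (simp add: Henstock_Kurzweil_Integration.integral_reflect_real)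
          moreover have "integral {y..x} H = integral {y..x} h" using y x1 3 d_def by (intro IH) auto
          moreover have "norm (integral {a..y} h - integral {a..x} h - (y - x) *\<^sub>R h x)
              = norm (integral {y..x} h - (x - y) *\<^sub>R h x)"
          proof -
            have "integral {a..y} h - integral {a..x} h - (y - x) *\<^sub>R h x = - (integral {y..x} h - (x - y) *\<^sub>R h x)"
              unfolding calculation(1)[symmetric] by (simp add: algebra_simps)
            then show ?thesis by (metis norm_minus_cancel)
          qed
          ultimately show ?thesis using 3 by simp
        qed simp
      qed
      with d show "\<exists>d>0. \<forall>y. norm (y - x) < d \<longrightarrow>
           norm (integral {a..y} h - integral {a..x} h - (y - x) *\<^sub>R h x) \<le> e * norm (y - x)" by blast
    qed (rule bounded_linear_scaleR_left)
  qed
qed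

text \<open>Otherwise \<open>nth_deriv 1\<close> is rewritten to \<open>nth_deriv (Suc 0)\<close>.\<close>
declare One_nat_def [simp del]

section \<open>Iterated derivatives and locally absolutely continuous functions\<close>

lemma nth_deriv_0 [simp]: "nth_deriv 0 f = f"
  by (simp add: nth_deriv_def)

lemma nth_deriv_1: "nth_deriv 1 f x = vector_derivative f (at x)"
  by (simp add: nth_deriv_def One_nat_def)

lemma nth_deriv_Suc: "nth_deriv (Suc k) f = nth_deriv 1 (nth_deriv k f)"
  by (simp add: nth_deriv_def One_nat_def)

lemma nth_deriv_add: "nth_deriv (k + m) f = nth_deriv k (nth_deriv m f)"
  by (simp add: nth_deriv_def funpow_add)

lemma nth_deriv_Suc': "nth_deriv (Suc k) f = nth_deriv k (nth_deriv 1 f)"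
  using nth_deriv_add[of k 1 f] by (simp add: One_nat_def)

text \<open>Both functions have the same set of derivatives at x, so the value chosen by
  \<open>vector_derivative\<close> agrees even where no derivative exists.\<close>

lemma vector_derivative_cong_open:
  assumes "open S" "\<And>x. x \<in> S \<Longrightarrow> f x = g x" "x \<in> S"
  shows "vector_derivative f (at x) = vector_derivative g (at x)"
proof -
  have "(f has_vector_derivative d) (at x) \<longleftrightarrow> (g has_vector_derivative d) (at x)" for d
    using assms has_vector_derivative_transform_within_open[of f d x S g]
      has_vector_derivative_transform_within_open[of g d x S f] by auto
  then show ?thesis by (simp add: vector_derivative_def)
qed

lemma nth_deriv_cong:
  assumes "\<And>x. x \<in> {-1<..<1} \<Longrightarrow> f x = g x" "x \<in> {-1<..<1}"
  shows "nth_deriv k f x = nth_deriv k g x"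
  using assms(2)
proof (induction k arbitrary: x)
  case 0 then show ?case using assms by simp
next
  case (Suc k)
  then show ?case
    unfolding nth_deriv_Suc nth_deriv_1 by (intro vector_derivative_cong_open[of "{-1<..<1}"]) auto
qed

lemma has_vector_derivative_nth_deriv_1:
  "(f has_vector_derivative d) (at x) \<Longrightarrow> nth_deriv 1 f x = d"
  unfolding nth_deriv_1 by (rule vector_derivative_at)

lemma AC_locD: "f \<in> AC_loc \<Longrightarrow> -1 < a \<Longrightarrow> b < 1 \<Longrightarrow> a \<le> b \<Longrightarrow> abs_cont_on_interval a b f"
  by (auto simp: AC_loc_def)

lemma AC_loc_continuous:
  assumes "f \<in> AC_loc" shows "continuous_on {-1<..<1} f"
proof (rule continuous_at_imp_continuous_on, rule ballI)
  fix x :: real assume x: "x \<in> {-1<..<1}"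
  have "continuous_on {(x - 1) / 2..(x + 1) / 2} f"
    using x by (intro abs_cont_on_interval_continuous AC_locD[OF assms]) auto
  moreover have "x \<in> interior {(x - 1) / 2..(x + 1) / 2}" using x by (auto simp: interior_atLeastAtMost_real)
  ultimately show "isCont f x" by (rule continuous_on_interior)
qed

text \<open>The fundamental theorem of calculus for absolutely continuous functions: f is the
  integral of a density, and an indefinite integral has its integrand as derivative almost
  everywhere. So \<open>nth_deriv 1 f\<close>, with arbitrary values on a null set, can serve as the
  density.\<close>

lemma AC_loc_interval:
  assumes f: "f \<in> AC_loc" and ab: "-1 < a" "a < b" "b < 1"
  shows "\<exists>N. negligible N \<and> (\<forall>x\<in>{a<..<b} - N. (f has_vector_derivative nth_deriv 1 f x) (at x))"
    and "nth_deriv 1 f absolutely_integrable_on {a..b}"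
    and "(nth_deriv 1 f has_integral (f b - f a)) {a..b}"
proof -
  obtain h where h: "h absolutely_integrable_on {a..b}"
    and hi: "\<And>x y. a \<le> x \<Longrightarrow> x \<le> y \<Longrightarrow> y \<le> b \<Longrightarrow> (h has_integral (f y - f x)) {x..y}"
    using abs_cont_density[OF ab(2) AC_locD[OF f ab(1) ab(3)]] ab by auto
  have hint: "h integrable_on {a..b}" using h set_lebesgue_integral_eq_integral(1) by blast
  obtain N where N: "negligible N"
    "\<And>x. x \<in> {a<..<b} - N \<Longrightarrow> ((\<lambda>t. integral {a..t} h) has_vector_derivative h x) (at x)"
    using integral_has_derivative_ae[OF hint] by blast
  have d: "(f has_vector_derivative h x) (at x)" if x: "x \<in> {a<..<b} - N" for x
  proof -
    have "((\<lambda>t. f a + integral {a..t} h) has_vector_derivative 0 + h x) (at x)"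
      by (intro has_vector_derivative_add has_vector_derivative_const N x)
    moreover have "f a + integral {a..t} h = f t" if "t \<in> {a<..<b}" for t
      using hi[of a t] that by (simp add: integral_unique)
    ultimately show ?thesis
      using x by (auto intro: has_vector_derivative_transform_within_open[of _ _ x "{a<..<b}" f])
  qed
  then have e: "nth_deriv 1 f x = h x" if "x \<in> {a<..<b} - N" for x
    using that by (intro has_vector_derivative_nth_deriv_1)
  show "\<exists>N. negligible N \<and> (\<forall>x\<in>{a<..<b} - N. (f has_vector_derivative nth_deriv 1 f x) (at x))"
    using N(1) d e by metis
  have neg: "negligible (N \<union> {a, b})" using N(1) by simp
  have e': "nth_deriv 1 f x = h x" if "x \<in> {a..b} - (N \<union> {a, b})" for x
    using that by (intro e) auto
  show "nth_deriv 1 f absolutely_integrable_on {a..b}"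
    by (rule absolutely_integrable_spike[OF h neg e'])
  show "(nth_deriv 1 f has_integral (f b - f a)) {a..b}"
    using has_integral_spike[OF neg e' hi[of a b]] ab by simp
qed

lemma AC_loc_has_integral:
  assumes f: "f \<in> AC_loc" and ab: "-1 < a" "a \<le> b" "b < 1"
  shows "(nth_deriv 1 f has_integral (f b - f a)) {a..b}"
proof (cases "a = b")
  case True then show ?thesis using has_integral_refl(2)[of "nth_deriv 1 f" a] by simp
qed (use AC_loc_interval(3)[OF f, of a b] ab in simp)

text \<open>Passes from compact subintervals to (-1,1) by a countable union, which preserves null
  sets. The offset 2 keeps every member nonempty.\<close>

lemma exhaust_interval: "{-1<..<1::real} = (\<Union>n. {- 1 + 1 / (real n + 2)<..<1 - 1 / (real n + 2)})"
proof (intro equalityI subsetI)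
  fix x :: real assume x: "x \<in> {-1<..<1}"
  define e where "e = 1 - \<bar>x\<bar>"
  have e: "e > 0" using x by (auto simp: e_def)
  obtain n :: nat where "1 / e < n" using reals_Archimedean2 by blast
  then have "1 < e * n" using e by (simp add: divide_less_eq mult.commute)
  moreover have "e * (real n + 2) = e * n + 2 * e" by (simp add: algebra_simps)
  ultimately have "1 < e * (real n + 2)" using e by linarith
  then have "1 / (real n + 2) < e" by (simp add: divide_less_eq)
  then have "x \<in> {- 1 + 1 / (real n + 2)<..<1 - 1 / (real n + 2)}" by (auto simp: e_def)
  then show "x \<in> (\<Union>n. {- 1 + 1 / (real n + 2)<..<1 - 1 / (real n + 2)})" by blast
next
  fix x :: real assume "x \<in> (\<Union>n. {- 1 + 1 / (real n + 2)<..<1 - 1 / (real n + 2)})"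
  then obtain n where n: "- 1 + 1 / (real n + 2) < x" "x < 1 - 1 / (real n + 2)" by auto
  have "0 < 1 / (real n + 2)" by simp
  with n have "-1 < x" "x < 1" by linarith+
  then show "x \<in> {-1<..<1}" by simp
qed

lemma AC_loc_derivative_ae:
  assumes f: "f \<in> AC_loc"
  shows "\<exists>N. negligible N \<and> (\<forall>x\<in>{-1<..<1} - N. (f has_vector_derivative nth_deriv 1 f x) (at x))"
proof -
  have "\<exists>N. negligible N \<and> (\<forall>x\<in>{-1 + 1 / (real n + 2)<..<1 - 1 / (real n + 2)} - N.
      (f has_vector_derivative nth_deriv 1 f x) (at x))" for n
  proof -
    have "1 / (real n + 2) < 1" "1 / (real n + 2) > 0" by simp_all
    then show ?thesis by (intro AC_loc_interval(1)[OF f]) linarith+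
  qed
  then obtain N where N: "\<And>n. negligible (N n)" "\<And>n x. x \<in> {-1 + 1 / (real n + 2)<..<1 - 1 / (real n + 2)} - N n \<Longrightarrow>
      (f has_vector_derivative nth_deriv 1 f x) (at x)" by metis
  show ?thesis
  proof (intro exI[of _ "\<Union>n. N n"] conjI ballI)
    show "negligible (\<Union>n. N n)" using N(1) by (intro negligible_countable_Union) auto
    fix x assume "x \<in> {-1<..<1} - (\<Union>n. N n)"
    then show "(f has_vector_derivative nth_deriv 1 f x) (at x)"
      using N(2) unfolding exhaust_interval by blast
  qed
qed

lemma AC_loc_cong:
  assumes "f \<in> AC_loc" "\<And>x. x \<in> {-1<..<1} \<Longrightarrow> g x = f x"
  shows "g \<in> AC_loc"
  unfolding AC_loc_def mem_Collect_eq
proof (intro allI impI)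
  fix a b :: real assume ab: "-1 < a \<and> a \<le> b \<and> b < 1"
  show "abs_cont_on_interval a b g"
  proof (rule abs_cont_on_intervalI)
    fix e :: real assume e: "e > 0"
    obtain d where d: "d > 0" and D: "\<And>(I::nat set) u v. interval_family I u v a b \<Longrightarrow> (\<Sum>i\<in>I. v i - u i) < d \<Longrightarrow>
         (\<Sum>i\<in>I. norm (f (v i) - f (u i))) < e"
      by (rule abs_cont_on_intervalE[OF AC_locD[OF assms(1)] e, of a b], (use ab in auto)[3], rule that; blast)
    show "\<exists>d>0. \<forall>(I::nat set) u v. interval_family I u v a b \<longrightarrow> (\<Sum>i\<in>I. v i - u i) < d \<longrightarrow>
       (\<Sum>i\<in>I. norm (g (v i) - g (u i))) < e"
    proof (intro exI[of _ d] conjI allI impI d)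
      fix I :: "nat set" and u v assume I: "interval_family I u v a b" "(\<Sum>i\<in>I. v i - u i) < d"
      have "g (v i) - g (u i) = f (v i) - f (u i)" if "i \<in> I" for i
        using interval_familyD[OF I(1) that] ab by (auto simp: assms(2))
      then show "(\<Sum>i\<in>I. norm (g (v i) - g (u i))) < e" using D[OF I] by simp
    qed
  qed
qed

text \<open>One criterion behind the closure properties: increments of sums and products are
  dominated by those of the two functions, increments of continuously differentiable functions by
  that of the argument.\<close>

lemma AC_loc_dominated:
  assumes f: "f \<in> AC_loc" and g: "g \<in> AC_loc"
    and dom: "\<And>a b. -1 < a \<Longrightarrow> a \<le> b \<Longrightarrow> b < 1 \<Longrightarrow> \<exists>C\<ge>0. \<forall>x\<in>{a..b}. \<forall>y\<in>{a..b}.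
        norm (h y - h x) \<le> C * (norm (f y - f x) + norm (g y - g x) + \<bar>y - x\<bar>)"
  shows "h \<in> AC_loc"
  unfolding AC_loc_def mem_Collect_eq
proof (intro allI impI)
  fix a b :: real assume ab: "-1 < a \<and> a \<le> b \<and> b < 1"
  then obtain C where C: "C \<ge> 0" and le: "\<And>x y. x\<in>{a..b} \<Longrightarrow> y\<in>{a..b} \<Longrightarrow>
        norm (h y - h x) \<le> C * (norm (f y - f x) + norm (g y - g x) + \<bar>y - x\<bar>)"
    using dom[of a b] by blast
  show "abs_cont_on_interval a b h"
  proof (rule abs_cont_on_intervalI)
    fix e :: real assume e: "e > 0"
    \<comment> \<open>The three sums contribute at most 3 C \<eta>; the added 1 makes the inequality
      strict and covers C = 0.\<close>
    define \<eta> where "\<eta> = e / (3 * C + 1)"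
    have eta: "\<eta> > 0" using e C by (simp add: \<eta>_def add_nonneg_pos)
    obtain d1 where d1: "d1 > 0" and D1: "\<And>(I::nat set) u v. interval_family I u v a b \<Longrightarrow> (\<Sum>i\<in>I. v i - u i) < d1 \<Longrightarrow>
         (\<Sum>i\<in>I. norm (f (v i) - f (u i))) < \<eta>"
      by (rule abs_cont_on_intervalE[OF AC_locD[OF f] eta, of a b], (use ab in auto)[3], rule that; blast)
    obtain d2 where d2: "d2 > 0" and D2: "\<And>(I::nat set) u v. interval_family I u v a b \<Longrightarrow> (\<Sum>i\<in>I. v i - u i) < d2 \<Longrightarrow>
         (\<Sum>i\<in>I. norm (g (v i) - g (u i))) < \<eta>"
      by (rule abs_cont_on_intervalE[OF AC_locD[OF g] eta, of a b], (use ab in auto)[3], rule that; blast)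
    define d where "d = min (min d1 d2) \<eta>"
    show "\<exists>d>0. \<forall>(I::nat set) u v. interval_family I u v a b \<longrightarrow> (\<Sum>i\<in>I. v i - u i) < d \<longrightarrow>
       (\<Sum>i\<in>I. norm (h (v i) - h (u i))) < e"
    proof (intro exI[of _ d] conjI allI impI)
      show "d > 0" using d1 d2 eta by (simp add: d_def)
      fix I :: "nat set" and u v assume I: "interval_family I u v a b" "(\<Sum>i\<in>I. v i - u i) < d"
      have "(\<Sum>i\<in>I. norm (h (v i) - h (u i))) \<le>
          (\<Sum>i\<in>I. C * (norm (f (v i) - f (u i)) + norm (g (v i) - g (u i)) + (v i - u i)))"
      proof (rule sum_mono)
        fix i assume "i \<in> I"
        note uv = interval_familyD[OF I(1) this]
        then show "norm (h (v i) - h (u i)) \<le> C * (norm (f (v i) - f (u i)) + norm (g (v i) - g (u i)) + (v i - u i))"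
          using le[of "u i" "v i"] by simp
      qed
      also have "\<dots> = C * ((\<Sum>i\<in>I. norm (f (v i) - f (u i))) + (\<Sum>i\<in>I. norm (g (v i) - g (u i))) + (\<Sum>i\<in>I. v i - u i))"
        by (simp only: sum_distrib_left[symmetric] sum.distrib)
      also have "\<dots> \<le> C * (\<eta> + \<eta> + \<eta>)"
        using D1[OF I(1)] D2[OF I(1)] I(2) C unfolding d_def by (intro mult_left_mono add_mono) auto
      also have "\<dots> < e"
      proof -
        have "C * (\<eta> + \<eta> + \<eta>) < (3 * C + 1) * \<eta>" using eta by (simp add: algebra_simps)
        also have "\<dots> = e" using C by (simp add: \<eta>_def add_nonneg_eq_0_iff)
        finally show ?thesis .
      qed
      finally show "(\<Sum>i\<in>I. norm (h (v i) - h (u i))) < e" .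
    qed
  qed
qed

lemma AC_loc_const [intro]: "(\<lambda>x. c) \<in> AC_loc"
  by (auto simp: AC_loc_def abs_cont_on_interval_def)

lemma AC_loc_add [intro]:
  assumes "f \<in> AC_loc" "g \<in> AC_loc" shows "(\<lambda>x. f x + g x) \<in> AC_loc"
proof (rule AC_loc_dominated[OF assms], intro exI[of _ 1] conjI ballI)
  fix x y
  have "norm ((f y + g y) - (f x + g x)) \<le> norm (f y - f x) + norm (g y - g x)"
    using norm_triangle_ineq[of "f y - f x" "g y - g x"] by (simp add: algebra_simps)
  then show "norm ((f y + g y) - (f x + g x)) \<le> 1 * (norm (f y - f x) + norm (g y - g x) + \<bar>y - x\<bar>)" by simp
qed simp

lemma AC_loc_bounded:
  assumes "f \<in> AC_loc" "-1 < a" "b < 1"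
  shows "\<exists>B\<ge>0. \<forall>x\<in>{a..b}. norm (f x) \<le> B"
proof -
  have "continuous_on {a..b} f"
    using assms by (intro continuous_on_subset[OF AC_loc_continuous]) auto
  then have "bounded (f ` {a..b})" by (intro compact_imp_bounded compact_continuous_image) auto
  then obtain B where "\<forall>x\<in>f ` {a..b}. norm x \<le> B" by (auto simp: bounded_iff)
  then show ?thesis by (intro exI[of _ "max 0 B"]) auto
qed

lemma AC_loc_mult [intro]:
  assumes f: "f \<in> AC_loc" and g: "g \<in> AC_loc" shows "(\<lambda>x. f x * g x) \<in> AC_loc"
proof (rule AC_loc_dominated[OF assms])
  fix a b :: real assume ab: "-1 < a" "a \<le> b" "b < 1"
  obtain B1 where B1: "B1 \<ge> 0" "\<And>x. x \<in> {a..b} \<Longrightarrow> norm (f x) \<le> B1" using AC_loc_bounded[OF f ab(1,3)] by blast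
  obtain B2 where B2: "B2 \<ge> 0" "\<And>x. x \<in> {a..b} \<Longrightarrow> norm (g x) \<le> B2" using AC_loc_bounded[OF g ab(1,3)] by blast
  show "\<exists>C\<ge>0. \<forall>x\<in>{a..b}. \<forall>y\<in>{a..b}. norm (f y * g y - f x * g x) \<le> C * (norm (f y - f x) + norm (g y - g x) + \<bar>y - x\<bar>)"
  proof (intro exI[of _ "B1 + B2"] conjI ballI)
    fix x y assume xy: "x \<in> {a..b}" "y \<in> {a..b}"
    have "f y * g y - f x * g x = f y * (g y - g x) + (f y - f x) * g x" by (simp add: algebra_simps)
    then have "norm (f y * g y - f x * g x) \<le> norm (f y) * norm (g y - g x) + norm (f y - f x) * norm (g x)"
      by (metis norm_mult norm_triangle_ineq)
    also have "\<dots> \<le> B1 * norm (g y - g x) + norm (f y - f x) * B2"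
      using xy B1 B2 by (intro add_mono mult_mono) auto
    also have "\<dots> \<le> (B1 + B2) * norm (g y - g x) + (B1 + B2) * norm (f y - f x)"
      using B1 B2 by (intro add_mono) (auto simp: mult.commute intro!: mult_right_mono)
    also have "\<dots> \<le> (B1 + B2) * (norm (f y - f x) + norm (g y - g x) + \<bar>y - x\<bar>)"
      using B1(1) B2(1) mult_nonneg_nonneg[of "B1 + B2" "\<bar>y - x\<bar>"] by (simp add: distrib_left)
    finally show "norm (f y * g y - f x * g x) \<le> (B1 + B2) * (norm (f y - f x) + norm (g y - g x) + \<bar>y - x\<bar>)" .
  qed (use B1 B2 in auto)
qed

lemma AC_loc_C1:
  assumes d: "\<And>x. x \<in> {-1<..<1} \<Longrightarrow> (f has_vector_derivative f' x) (at x)" and c: "continuous_on {-1<..<1} f'"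
  shows "f \<in> AC_loc"
proof (rule AC_loc_dominated[OF AC_loc_const AC_loc_const])
  fix a b :: real assume ab: "-1 < a" "a \<le> b" "b < 1"
  have "continuous_on {a..b} f'" using ab by (intro continuous_on_subset[OF c]) auto
  then have "bounded (f' ` {a..b})" by (intro compact_imp_bounded compact_continuous_image) auto
  then obtain B where B: "\<forall>x\<in>f' ` {a..b}. norm x \<le> B" by (auto simp: bounded_iff)
  have "norm (f y - f x) \<le> max 0 B * \<bar>y - x\<bar>" if "x \<in> {a..b}" "y \<in> {a..b}" for x y
  proof -
    have "norm (f y - f x) \<le> max 0 B * norm (y - x)"
    proof (rule differentiable_bound[of "{a..b}" f "\<lambda>x t. t *\<^sub>R f' x"])
      fix z assume z: "z \<in> {a..b}"
      show "(f has_derivative (\<lambda>t. t *\<^sub>R f' z)) (at z within {a..b})"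
        using d[of z] z ab by (auto simp: has_vector_derivative_def intro: has_derivative_at_withinI)
      have "norm (f' z) \<le> max 0 B" using B z by (auto simp: le_max_iff_disj)
      then show "onorm (\<lambda>t. t *\<^sub>R f' z) \<le> max 0 B"
        by (intro onorm_bound) (auto simp: mult.commute[of _ "norm (f' z)"] intro!: mult_right_mono)
    qed (use that in auto)
    then show ?thesis by simp
  qed
  then show "\<exists>C\<ge>0. \<forall>x\<in>{a..b}. \<forall>y\<in>{a..b}. norm (f y - f x) \<le> C * (norm ((0::complex) - 0) + norm ((0::complex) - 0) + \<bar>y - x\<bar>)"
    by (intro exI[of _ "max 0 B"]) auto
qed

text \<open>f is the integral of its derivative, hence of the continuous g, and the integral of a
  continuous function is differentiable everywhere. This is how equations valid almost everywhere
  become pointwise ones.\<close>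

lemma AC_loc_C1_if_derivative_continuous:
  assumes f: "f \<in> AC_loc" and c: "continuous_on {-1<..<1} g" and N: "negligible N"
    and eq: "\<And>x. x \<in> {-1<..<1} - N \<Longrightarrow> nth_deriv 1 f x = g x"
    and x: "x \<in> {-1<..<1}"
  shows "(f has_vector_derivative g x) (at x)"
proof -
  define a b where "a = (x - 1) / 2" and "b = (x + 1) / 2"
  have ab: "-1 < a" "a < x" "x < b" "b < 1" using x by (auto simp: a_def b_def)
  have "continuous_on {a..b} g" using ab by (intro continuous_on_subset[OF c]) auto
  then have "((\<lambda>t. integral {a..t} g) has_vector_derivative g x) (at x within {a..b})"
    using ab by (intro integral_has_vector_derivative) auto
  then have "((\<lambda>t. integral {a..t} g) has_vector_derivative g x) (at x)"
    using ab by (simp add: at_within_Icc_at)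
  then have "((\<lambda>t. f a + integral {a..t} g) has_vector_derivative 0 + g x) (at x)"
    by (intro has_vector_derivative_add has_vector_derivative_const)
  moreover have "f a + integral {a..t} g = f t" if t: "t \<in> {a<..<b}" for t
  proof -
    have "(nth_deriv 1 f has_integral (f t - f a)) {a..t}"
      using t ab by (intro AC_loc_has_integral[OF f]) auto
    then have "(g has_integral (f t - f a)) {a..t}"
      using t ab by (intro has_integral_spike[OF N, of "{a..t}" g "nth_deriv 1 f"]) (auto intro!: eq[symmetric])
    then show ?thesis by (simp add: integral_unique)
  qed
  ultimately show ?thesis
    using ab by (auto intro: has_vector_derivative_transform_within_open[of _ _ x "{a<..<b}" f])
qed

lemma AC_loc_nth_deriv_has_derivative:
  assumes "f \<in> AC_loc" "nth_deriv 1 f \<in> AC_loc" "x \<in> {-1<..<1}"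
  shows "(f has_vector_derivative nth_deriv 1 f x) (at x)"
  using assms by (intro AC_loc_C1_if_derivative_continuous[of f "nth_deriv 1 f" "{}"] AC_loc_continuous) auto

lemma AC_loc_norm_diff_le:
  assumes F: "F \<in> AC_loc" and xy: "-1 < x" "x \<le> y" "y < 1" and N: "negligible N"
    and le: "\<And>t. t \<in> {x..y} - N \<Longrightarrow> norm (nth_deriv 1 F t) \<le> g t"
    and g: "g integrable_on {x..y}"
  shows "norm (F y - F x) \<le> integral {x..y} g"
proof -
  define k where "k t = (if t \<in> N then 0 else nth_deriv 1 F t)" for t
  define g' where "g' t = (if t \<in> N then 0 else g t)" for t
  have k: "(k has_integral (F y - F x)) {x..y}"
    by (rule has_integral_spike[OF N _ AC_loc_has_integral[OF F xy]]) (auto simp: k_def)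
  have g': "g' integrable_on {x..y}"
    by (rule integrable_spike[OF g N]) (auto simp: g'_def)
  have "norm (integral {x..y} k) \<le> integral {x..y} g'"
    using k g' le by (intro integral_norm_bound_integral) (auto simp: k_def g'_def integrable_on_def)
  also have "integral {x..y} g' = integral {x..y} g"
    by (rule integral_spike[OF N]) (auto simp: g'_def)
  finally show ?thesis using k by (simp add: integral_unique)
qed

text \<open>The indefinite integral of an integrable derivative is continuous on the closed
  interval, and F differs from it by a constant.\<close>

lemma AC_loc_limits:
  assumes F: "F \<in> AC_loc" and k: "nth_deriv 1 F absolutely_integrable_on {-1<..<1}"
  obtains L R where "(F \<longlongrightarrow> R) (at_left 1)" "(F \<longlongrightarrow> L) (at_right (-1))"
    "R - L = integral {-1<..<1} (nth_deriv 1 F)"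
proof -
  have ki: "nth_deriv 1 F integrable_on {-1..1}"
  proof -
    have "nth_deriv 1 F integrable_on {-1<..<1}" using k set_lebesgue_integral_eq_integral(1) by blast
    then show ?thesis by (simp add: integrable_on_Icc_iff_Ioo)
  qed
  define H where "H x = integral {-1..x} (nth_deriv 1 F)" for x
  have Hc: "continuous_on {-1..1} H" unfolding H_def by (rule indefinite_integral_continuous_1[OF ki])
  have FH: "F x = F 0 - H 0 + H x" if x: "x \<in> {-1<..<1}" for x
  proof -
    have i: "nth_deriv 1 F integrable_on {-1..t}" if "t < 1" for t
      using that by (intro integrable_on_subinterval[OF ki]) auto
    have "F t - F s = H t - H s" if "-1 < s" "s \<le> t" "t < 1" for s t
    proof -
      have "H s + integral {s..t} (nth_deriv 1 F) = H t"
        unfolding H_def using that by (intro Henstock_Kurzweil_Integration.integral_combine i) auto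
      then show ?thesis using AC_loc_has_integral[OF F that] by (simp add: integral_unique algebra_simps)
    qed
    from this[of 0 x] this[of x 0] x show ?thesis by (cases "x \<ge> 0") (auto simp: algebra_simps)
  qed
  have "(H \<longlongrightarrow> H 1) (at 1 within {-1..1})" "(H \<longlongrightarrow> H (-1)) (at (-1) within {-1..1})"
    using Hc by (auto simp: continuous_on_def)
  then have "(H \<longlongrightarrow> H 1) (at_left 1)" "(H \<longlongrightarrow> H (-1)) (at_right (-1))"
    by (simp_all add: at_within_Icc_at_left at_within_Icc_at_right)
  then have *: "((\<lambda>x. F 0 - H 0 + H x) \<longlongrightarrow> F 0 - H 0 + H 1) (at_left 1)"
      "((\<lambda>x. F 0 - H 0 + H x) \<longlongrightarrow> F 0 - H 0 + H (-1)) (at_right (-1))"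
    by (auto intro!: tendsto_intros)
  have ev: "\<forall>\<^sub>F x in at_left 1. F 0 - H 0 + H x = F x" "\<forall>\<^sub>F x in at_right (-1). F 0 - H 0 + H x = F x"
    by (rule eventually_mono[OF eventually_at_left_real[of "-1"] FH[symmetric]], simp, simp)
      (rule eventually_mono[OF eventually_at_right_real[of _ 1] FH[symmetric]], simp, simp)
  show thesis
  proof (rule that[of "F 0 - H 0 + H 1" "F 0 - H 0 + H (-1)"])
    show "F 0 - H 0 + H 1 - (F 0 - H 0 + H (- 1)) = integral {- 1<..<1} (nth_deriv 1 F)"
      by (simp add: H_def integral_open_interval_real)
    show "(F \<longlongrightarrow> F 0 - H 0 + H 1) (at_left 1)" using *(1) unfolding tendsto_cong[OF ev(1)] .
    show "(F \<longlongrightarrow> F 0 - H 0 + H (-1)) (at_right (-1))" using *(2) unfolding tendsto_cong[OF ev(2)] .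
  qed
qed

section \<open>Weights and eigenvalues\<close>

abbreviation cweight :: "real \<Rightarrow> real \<Rightarrow> real \<Rightarrow> complex" where
  "cweight a b x \<equiv> complex_of_real (jacobi_weight a b x)"

text \<open>The coefficient of f' in -\<ell> f. Writing J(a,b) for \<open>jacobi_weight a b\<close>,
  here and below, the derivative of J(a+1,b+1) is J(a,b) times the drift.\<close>

definition drift :: "real \<Rightarrow> real \<Rightarrow> real \<Rightarrow> real" where
  "drift a b x = b - a - (a + b + 2) * x"

text \<open>The eigenvalue belonging to the Jacobi polynomial of degree k with parameters a and
  b.\<close>

definition jacobi_ev :: "real \<Rightarrow> real \<Rightarrow> nat \<Rightarrow> real" where
  "jacobi_ev a b k = real k * (real k + a + b + 1)"

lemma jacobi_weight_pos: "x \<in> {-1<..<1} \<Longrightarrow> jacobi_weight a b x > 0"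
  by (auto simp: jacobi_weight_def)

lemma jacobi_weight_add: "x \<in> {-1<..<1} \<Longrightarrow> jacobi_weight (a + c) (b + d) x = jacobi_weight a b x * jacobi_weight c d x"
  by (simp add: jacobi_weight_def powr_add)

lemma jacobi_weight_1_1: "x \<in> {-1<..<1} \<Longrightarrow> jacobi_weight 1 1 x = 1 - x\<^sup>2"
  by (simp add: jacobi_weight_def power2_eq_square algebra_simps)

lemma jacobi_weight_Suc: "x \<in> {-1<..<1} \<Longrightarrow> jacobi_weight (a + 1) (b + 1) x = (1 - x\<^sup>2) * jacobi_weight a b x"
  using jacobi_weight_add[of x a 1 b 1] by (simp add: jacobi_weight_1_1 mult.commute)

lemma jacobi_weight_has_derivative:
  assumes "x \<in> {-1<..<1}"
  shows "(jacobi_weight a b has_real_derivative jacobi_weight (a - 1) (b - 1) x * (b * (1 - x) - a * (1 + x))) (at x)"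
proof -
  have x: "1 - x > 0" "1 + x > 0" using assms by auto
  have e: "(1 - x) powr a = (1 - x) powr (a - 1) * (1 - x)" "(1 + x) powr b = (1 + x) powr (b - 1) * (1 + x)"
    using powr_add[of "1 - x" "a - 1" 1] powr_add[of "1 + x" "b - 1" 1] x by simp_all
  have "(jacobi_weight a b has_real_derivative
      (a * (1 - x) powr (a - 1) * (-1)) * (1 + x) powr b + (1 - x) powr a * (b * (1 + x) powr (b - 1) * 1)) (at x)"
    unfolding jacobi_weight_def[abs_def] using x
    by (auto intro!: derivative_eq_intros)
  then show ?thesis
    by (rule DERIV_cong) (unfold jacobi_weight_def e, simp add: algebra_simps)
qed

lemma cweight_has_derivative:
  assumes "x \<in> {-1<..<1}"
  shows "(cweight (a + 1) (b + 1) has_vector_derivative cweight a b x * of_real (drift a b x)) (at x)"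
proof -
  have "(jacobi_weight (a + 1) (b + 1) has_real_derivative jacobi_weight a b x * drift a b x) (at x)"
    using jacobi_weight_has_derivative[OF assms, of "a + 1" "b + 1"] 
    by (simp add: drift_def algebra_simps)
  from has_vector_derivative_of_real[OF this] show ?thesis by (simp only: of_real_mult)
qed

section \<open>Repeated differentiability on the open interval\<close>

definition times_diff :: "nat \<Rightarrow> (real \<Rightarrow> complex) \<Rightarrow> bool" where
  "times_diff m f \<longleftrightarrow> (\<forall>k<m. \<forall>x\<in>{-1<..<1}. nth_deriv k f differentiable (at x))"

lemma nth_deriv_works:
  "nth_deriv k f differentiable (at x) \<Longrightarrow> (nth_deriv k f has_vector_derivative nth_deriv (Suc k) f x) (at x)"
  by (simp add: nth_deriv_Suc nth_deriv_1 vector_derivative_works)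

lemma times_diffD:
  "times_diff m f \<Longrightarrow> k < m \<Longrightarrow> x \<in> {-1<..<1} \<Longrightarrow> (nth_deriv k f has_vector_derivative nth_deriv (Suc k) f x) (at x)"
  by (intro nth_deriv_works) (auto simp: times_diff_def)

lemma times_diffD0:
  "times_diff m f \<Longrightarrow> 0 < m \<Longrightarrow> x \<in> {-1<..<1} \<Longrightarrow> (f has_vector_derivative nth_deriv 1 f x) (at x)"
  using times_diffD[of m f 0 x] by (simp add: One_nat_def)

lemma times_diff_mono: "times_diff m f \<Longrightarrow> k \<le> m \<Longrightarrow> times_diff k f"
  by (auto simp: times_diff_def)

lemma times_diff_nth_deriv: "times_diff (m + k) f \<Longrightarrow> times_diff m (nth_deriv k f)"
  unfolding times_diff_def nth_deriv_add[symmetric] by auto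

lemma times_diff_deriv: "times_diff (Suc m) f \<Longrightarrow> times_diff m (nth_deriv 1 f)"
  using times_diff_nth_deriv[of m 1 f] by (simp add: One_nat_def)

lemma nth_deriv_differentiable_cong:
  fixes x :: real
  assumes "\<And>x. x \<in> {-1<..<1} \<Longrightarrow> f x = g x" "x \<in> {-1<..<1}" "f differentiable (at x)"
  shows "g differentiable (at x)"
proof -
  obtain f' where "(f has_derivative f') (at x)" using assms(3) by (auto simp: differentiable_def)
  then have "(g has_derivative f') (at x)"
    using assms by (auto intro: has_derivative_transform_within_open[of f f' x UNIV "{-1<..<1}" g])
  then show ?thesis by (auto simp: differentiable_def)
qed

text \<open>A chain of candidates, each the derivative of its predecessor, identifies all iterated
  derivatives at once.\<close>

lemma nth_deriv_eqI:
  assumes "\<And>k x. k < m \<Longrightarrow> x \<in> {-1<..<1} \<Longrightarrow> (F k has_vector_derivative F (Suc k) x) (at x)"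
    and "\<And>x. x \<in> {-1<..<1} \<Longrightarrow> f x = F 0 x" and "k \<le> m" "x \<in> {-1<..<1}"
  shows "nth_deriv k f x = F k x"
  using assms(3,4)
proof (induction k arbitrary: x)
  case 0 then show ?case using assms(2) by simp
next
  case (Suc k)
  have "nth_deriv (Suc k) f x = nth_deriv 1 (F k) x"
    unfolding nth_deriv_Suc using Suc by (intro nth_deriv_cong) auto
  also have "\<dots> = F (Suc k) x" using Suc by (intro has_vector_derivative_nth_deriv_1 assms(1)) auto
  finally show ?case .
qed

lemma times_diffI:
  assumes "\<And>k x. k < m \<Longrightarrow> x \<in> {-1<..<1} \<Longrightarrow> (F k has_vector_derivative F (Suc k) x) (at x)"
    and "\<And>x. x \<in> {-1<..<1} \<Longrightarrow> f x = F 0 x"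
  shows "times_diff m f"
  unfolding times_diff_def
proof (intro allI impI ballI)
  fix k x assume k: "k < m" and x: "x \<in> {-1<..<1::real}"
  have "F k differentiable (at x)"
    using assms(1)[OF k x] by (rule differentiableI_vector)
  then show "nth_deriv k f differentiable (at x)"
    by (rule nth_deriv_differentiable_cong[rotated 2]) (use nth_deriv_eqI[of m F f k] assms k x in auto)
qed

lemma times_diff_lincomb:
  assumes "\<And>i. i \<in> A \<Longrightarrow> times_diff m (F i)"
  shows "times_diff m (\<lambda>x. \<Sum>i\<in>A. c i * F i x)"
    and "k \<le> m \<Longrightarrow> x \<in> {-1<..<1} \<Longrightarrow> nth_deriv k (\<lambda>x. \<Sum>i\<in>A. c i * F i x) x = (\<Sum>i\<in>A. c i * nth_deriv k (F i) x)"
proof -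
  have d: "((\<lambda>x. \<Sum>i\<in>A. c i * nth_deriv k (F i) x) has_vector_derivative (\<Sum>i\<in>A. c i * nth_deriv (Suc k) (F i) x)) (at x)"
    if "k < m" "x \<in> {-1<..<1}" for k x
    using that assms by (intro has_vector_derivative_sum has_vector_derivative_mult_right times_diffD) auto
  show "times_diff m (\<lambda>x. \<Sum>i\<in>A. c i * F i x)"
    by (rule times_diffI[of m "\<lambda>k x. \<Sum>i\<in>A. c i * nth_deriv k (F i) x"]) (use d in auto)
  show "nth_deriv k (\<lambda>x. \<Sum>i\<in>A. c i * F i x) x = (\<Sum>i\<in>A. c i * nth_deriv k (F i) x)"
    if "k \<le> m" "x \<in> {-1<..<1}"
    using nth_deriv_eqI[of m "\<lambda>k x. \<Sum>i\<in>A. c i * nth_deriv k (F i) x" _ k x] d that by auto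
qed

lemma times_diff_add_scaled:
  assumes "times_diff m f" "times_diff m g"
  shows "times_diff m (\<lambda>x. f x + c * g x)"
    and "k \<le> m \<Longrightarrow> x \<in> {-1<..<1} \<Longrightarrow> nth_deriv k (\<lambda>x. f x + c * g x) x = nth_deriv k f x + c * nth_deriv k g x"
proof -
  have *: "times_diff m (if b then f else g)" for b using assms by simp
  have e: "(\<lambda>x. \<Sum>b\<in>UNIV. (if b then 1 else c) * (if b then f else g) x) = (\<lambda>x. f x + c * g x)"
    by (simp add: UNIV_bool add.commute)
  show "times_diff m (\<lambda>x. f x + c * g x)"
    using times_diff_lincomb(1)[of UNIV m "\<lambda>b. if b then f else g" "\<lambda>b. if b then 1 else c"] * unfolding e by simp
  show "k \<le> m \<Longrightarrow> x \<in> {-1<..<1} \<Longrightarrow> nth_deriv k (\<lambda>x. f x + c * g x) x = nth_deriv k f x + c * nth_deriv k g x"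
    using times_diff_lincomb(2)[of UNIV m "\<lambda>b. if b then f else g" k x "\<lambda>b. if b then 1 else c"] * unfolding e
    by (simp add: UNIV_bool add.commute)
qed

section \<open>The Jacobi expression and its derivatives\<close>

lemma jacobi_ell_weight:
  "jacobi_ell a b f x = - (1 / cweight a b x) * nth_deriv 1 (\<lambda>t. cweight (a + 1) (b + 1) t * nth_deriv 1 f t) x"
  by (simp add: jacobi_ell_def jacobi_weight_def)

text \<open>Only the positive weight is cancelled, so this holds even where the bracket is not
  differentiable, with the same default value on both sides.\<close>

lemma jacobi_ell_divergence:
  assumes "x \<in> {-1<..<1}"
  shows "nth_deriv 1 (\<lambda>t. cweight (a + 1) (b + 1) t * nth_deriv 1 f t) x = - cweight a b x * jacobi_ell a b f x"
  using jacobi_weight_pos[OF assms, of a b] by (simp add: jacobi_ell_weight)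

lemma jacobi_ell_cong:
  assumes "\<And>x. x \<in> {-1<..<1} \<Longrightarrow> f x = g x" "x \<in> {-1<..<1}"
  shows "jacobi_ell a b f x = jacobi_ell a b g x"
  unfolding jacobi_ell_weight using assms
  by (intro arg_cong2[where f = "(*)"] refl nth_deriv_cong) (auto intro!: nth_deriv_cong)

lemma weighted_derivative_has_derivative:
  assumes x: "x \<in> {-1<..<1}" and d: "nth_deriv 1 f differentiable (at x)"
  shows "((\<lambda>t. cweight (a + 1) (b + 1) t * nth_deriv 1 f t) has_vector_derivative
     cweight a b x * (of_real (1 - x\<^sup>2) * nth_deriv 2 f x + of_real (drift a b x) * nth_deriv 1 f x)) (at x)"
proof -
  have "(nth_deriv 1 f has_vector_derivative nth_deriv 2 f x) (at x)"
    using nth_deriv_works[OF d] by (simp add: numeral_2_eq_2 One_nat_def)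
  from has_vector_derivative_mult[OF cweight_has_derivative[OF x, of a b] this]
  have "((\<lambda>t. cweight (a + 1) (b + 1) t * nth_deriv 1 f t) has_vector_derivative
      cweight (a + 1) (b + 1) x * nth_deriv 2 f x + cweight a b x * of_real (drift a b x) * nth_deriv 1 f x) (at x)" .
  moreover have "cweight (a + 1) (b + 1) x * nth_deriv 2 f x + cweight a b x * of_real (drift a b x) * nth_deriv 1 f x
     = cweight a b x * (of_real (1 - x\<^sup>2) * nth_deriv 2 f x + of_real (drift a b x) * nth_deriv 1 f x)"
    by (simp only: jacobi_weight_Suc[OF x] of_real_mult) (simp only: algebra_simps)
  ultimately show ?thesis by (simp only:)
qed

lemma jacobi_ell_eq:
  assumes x: "x \<in> {-1<..<1}" and d: "nth_deriv 1 f differentiable (at x)"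
  shows "jacobi_ell a b f x = - (of_real (1 - x\<^sup>2) * nth_deriv 2 f x + of_real (drift a b x) * nth_deriv 1 f x)"
  unfolding jacobi_ell_weight has_vector_derivative_nth_deriv_1[OF weighted_derivative_has_derivative[OF assms]]
  using jacobi_weight_pos[OF x, of a b] by simp

text \<open>The derivative of order \<open>j + 1\<close> is assumed differentiable at \<open>x\<close> only, so the identity holds almost
  everywhere for functions in the maximal domain.\<close>

lemma nth_deriv_jacobi_ell:
  assumes "times_diff (j + 1) f" "x \<in> {-1<..<1}" "nth_deriv (j + 1) f differentiable (at x)"
  shows "nth_deriv j (jacobi_ell a b f) x =
    - (of_real (1 - x\<^sup>2) * nth_deriv (j + 2) f x + of_real (drift (a + j) (b + j) x) * nth_deriv (j + 1) f x)
    + of_real (jacobi_ev a b j) * nth_deriv j f x"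
  using assms
proof (induction j arbitrary: x)
  case 0 then show ?case using jacobi_ell_eq[of x f a b] by (simp add: jacobi_ev_def flip: numeral_2_eq_2)
next
  case (Suc j)
  let ?R = "\<lambda>x. - (of_real (1 - x\<^sup>2) * nth_deriv (j + 2) f x + of_real (drift (a + j) (b + j) x) * nth_deriv (j + 1) f x)
    + of_real (jacobi_ev a b j) * nth_deriv j f x"
  have eq: "nth_deriv j (jacobi_ell a b f) y = ?R y" if "y \<in> {-1<..<1}" for y
    using Suc.prems that by (intro Suc.IH) (auto simp: times_diff_def)
  have d: "(nth_deriv j f has_vector_derivative nth_deriv (j + 1) f x) (at x)"
    "(nth_deriv (j + 1) f has_vector_derivative nth_deriv (j + 2) f x) (at x)"
    "(nth_deriv (j + 2) f has_vector_derivative nth_deriv (j + 3) f x) (at x)"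
    using Suc.prems nth_deriv_works[of j f x] nth_deriv_works[of "j + 1" f x] nth_deriv_works[of "j + 2" f x]
    by (simp_all add: times_diff_def numeral_2_eq_2 numeral_3_eq_3 One_nat_def)
  have r: "((\<lambda>x. complex_of_real (1 - x\<^sup>2)) has_vector_derivative of_real (- 2 * x)) (at x)"
    by (intro has_vector_derivative_of_real) (auto intro!: derivative_eq_intros)
  have s: "((\<lambda>x. complex_of_real (drift (a + j) (b + j) x)) has_vector_derivative of_real (- (a + b + 2 * j + 2))) (at x)"
    unfolding drift_def
    by (intro has_vector_derivative_of_real) (auto intro!: derivative_eq_intros)
  have "nth_deriv (Suc j) (jacobi_ell a b f) x = nth_deriv 1 ?R x"
    unfolding nth_deriv_Suc by (rule nth_deriv_cong) (use eq Suc.prems in auto)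
  also have "\<dots> = - ((of_real (1 - x\<^sup>2) * nth_deriv (j + 3) f x + of_real (- 2 * x) * nth_deriv (j + 2) f x) +
      (of_real (drift (a + j) (b + j) x) * nth_deriv (j + 2) f x + of_real (- (a + b + 2 * j + 2)) * nth_deriv (j + 1) f x))
      + of_real (jacobi_ev a b j) * nth_deriv (j + 1) f x"
    by (intro has_vector_derivative_nth_deriv_1 has_vector_derivative_add has_vector_derivative_minus
        has_vector_derivative_mult_right has_vector_derivative_mult r s d)
  also have "\<dots> = - (of_real (1 - x\<^sup>2) * nth_deriv (j + 3) f x
      + of_real (- 2 * x + drift (a + j) (b + j) x) * nth_deriv (j + 2) f x)
      + of_real (jacobi_ev a b j + (a + b + 2 * j + 2)) * nth_deriv (j + 1) f x"
    by (simp add: algebra_simps)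
  \<comment> \<open>The derivative of 1 - x^2 contributes -2x, which is exactly the effect on the
    drift of raising both parameters by one; the derivative of the drift supplies the difference of
    consecutive eigenvalues.\<close>
  also have "- 2 * x + drift (a + j) (b + j) x = drift (a + Suc j) (b + Suc j) x"
    by (simp add: drift_def algebra_simps)
  also have "jacobi_ev a b j + (a + b + 2 * j + 2) = jacobi_ev a b (Suc j)"
    by (simp add: jacobi_ev_def algebra_simps)
  finally show ?case by (simp add: numeral_2_eq_2 numeral_3_eq_3 One_nat_def)
qed


lemma jacobi_ell_times_diff:
  assumes "times_diff (m + 2) f"
  shows "times_diff m (jacobi_ell a b f)"
proof (rule times_diffI[of m "\<lambda>j x. nth_deriv j (jacobi_ell a b f) x"])
  fix j x assume j: "j < m" and x: "x \<in> {-1<..<1::real}"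
  let ?R = "\<lambda>x. - (of_real (1 - x\<^sup>2) * nth_deriv (j + 2) f x + of_real (drift (a + j) (b + j) x) * nth_deriv (j + 1) f x)
    + of_real (jacobi_ev a b j) * nth_deriv j f x"
  have eq: "nth_deriv j (jacobi_ell a b f) y = ?R y" if "y \<in> {-1<..<1}" for y
    using assms that j by (intro nth_deriv_jacobi_ell) (auto simp: times_diff_def)
  have "nth_deriv (j + 2) f differentiable (at x)" "nth_deriv (j + 1) f differentiable (at x)" "nth_deriv j f differentiable (at x)"
    using assms j x by (auto simp: times_diff_def)
  moreover have "(\<lambda>x. complex_of_real (1 - x\<^sup>2)) differentiable (at x)" 
      "(\<lambda>x. complex_of_real (drift (a + j) (b + j) x)) differentiable (at x)"
    unfolding drift_def by (auto intro!: derivative_eq_intros differentiableI_vector[OF has_vector_derivative_of_real])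
  ultimately have "?R differentiable (at x)" by (intro derivative_intros)
  then have "nth_deriv j (jacobi_ell a b f) differentiable (at x)"
    by (rule nth_deriv_differentiable_cong[rotated 2]) (use eq x in auto)
  then show "(nth_deriv j (jacobi_ell a b f) has_vector_derivative nth_deriv (Suc j) (jacobi_ell a b f) x) (at x)"
    by (rule nth_deriv_works)
qed simp

lemma jacobi_ell_pow_times_diff:
  assumes "times_diff (m + 2 * i) f"
  shows "times_diff m ((jacobi_ell a b ^^ i) f)"
  using assms
proof (induction i arbitrary: m)
  case (Suc i)
  have "times_diff (m + 2) ((jacobi_ell a b ^^ i) f)" using Suc by (intro Suc.IH) (simp add: algebra_simps)
  then show ?case by (simp add: jacobi_ell_times_diff)
qed simp

lemma jacobi_ell_pow_cong:
  assumes "\<And>x. x \<in> {-1<..<1} \<Longrightarrow> f x = g x" "x \<in> {-1<..<1}"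
  shows "(jacobi_ell a b ^^ i) f x = (jacobi_ell a b ^^ i) g x"
  using assms(2)
proof (induction i arbitrary: x)
  case (Suc i) then show ?case by (auto intro!: jacobi_ell_cong)
qed (use assms in simp)

lemma jacobi_ell_lincomb:
  assumes "\<And>i. i \<in> A \<Longrightarrow> times_diff 2 (F i)" "x \<in> {-1<..<1}"
  shows "jacobi_ell a b (\<lambda>x. \<Sum>i\<in>A. c i * F i x) x = (\<Sum>i\<in>A. c i * jacobi_ell a b (F i) x)"
proof -
  note tl = times_diff_lincomb[where A = A and m = 2 and F = F and c = c, OF assms(1)]
  have d: "nth_deriv 1 f differentiable (at x)" if "times_diff 2 f" for f
    using that assms(2) by (auto simp: times_diff_def)
  have "jacobi_ell a b (\<lambda>x. \<Sum>i\<in>A. c i * F i x) x =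
    - (of_real (1 - x\<^sup>2) * (\<Sum>i\<in>A. c i * nth_deriv 2 (F i) x) + of_real (drift a b x) * (\<Sum>i\<in>A. c i * nth_deriv 1 (F i) x))"
    using tl(2)[where k = 2 and x = x] tl(2)[where k = 1 and x = x] assms(2) by (simp add: jacobi_ell_eq[OF assms(2) d[OF tl(1)]])
  also have "\<dots> = (\<Sum>i\<in>A. c i * (- (of_real (1 - x\<^sup>2) * nth_deriv 2 (F i) x + of_real (drift a b x) * nth_deriv 1 (F i) x)))"
    by (simp only: sum_distrib_left sum.distrib[symmetric] sum_negf[symmetric]) (intro sum.cong refl, simp add: algebra_simps)
  also have "\<dots> = (\<Sum>i\<in>A. c i * jacobi_ell a b (F i) x)"
    using assms by (intro sum.cong refl) (simp only: jacobi_ell_eq d)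
  finally show ?thesis .
qed

lemma jacobi_ell_add_scaled:
  assumes "times_diff 2 f" "times_diff 2 g" "x \<in> {-1<..<1}"
  shows "jacobi_ell a b (\<lambda>x. f x + c * g x) x = jacobi_ell a b f x + c * jacobi_ell a b g x"
proof -
  have e: "(\<lambda>x. \<Sum>b\<in>UNIV. (if b then 1 else c) * (if b then f else g) x) = (\<lambda>x. f x + c * g x)"
    by (simp add: UNIV_bool add.commute)
  show ?thesis
    using jacobi_ell_lincomb[of UNIV "\<lambda>b. if b then f else g" x a b "\<lambda>b. if b then 1 else c"] assms unfolding e
    by (simp add: UNIV_bool add.commute)
qed

lemma jacobi_ell_pow_add_scaled:
  assumes "times_diff (2 * i) f" "times_diff (2 * i) g" "x \<in> {-1<..<1}"
  shows "(jacobi_ell a b ^^ i) (\<lambda>x. f x + c * g x) x = (jacobi_ell a b ^^ i) f x + c * (jacobi_ell a b ^^ i) g x"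
  using assms
proof (induction i arbitrary: x)
  case (Suc i)
  have "(jacobi_ell a b ^^ Suc i) (\<lambda>x. f x + c * g x) x
     = jacobi_ell a b (\<lambda>x. (jacobi_ell a b ^^ i) f x + c * (jacobi_ell a b ^^ i) g x) x"
    using Suc by (auto intro!: jacobi_ell_cong Suc.IH intro: times_diff_mono)
  also have "\<dots> = (jacobi_ell a b ^^ Suc i) f x + c * (jacobi_ell a b ^^ Suc i) g x"
    using Suc.prems by (simp add: jacobi_ell_add_scaled jacobi_ell_pow_times_diff[of 2 i])
  finally show ?case .
qed simp

section \<open>Polynomials in the Jacobi expression\<close>

definition ell_poly :: "real \<Rightarrow> real \<Rightarrow> complex poly \<Rightarrow> (real \<Rightarrow> complex) \<Rightarrow> real \<Rightarrow> complex" where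
  "ell_poly a b r f x = (\<Sum>i\<le>degree r. coeff r i * (jacobi_ell a b ^^ i) f x)"

lemma ell_poly_sum:
  assumes "degree r \<le> N"
  shows "ell_poly a b r f x = (\<Sum>i\<le>N. coeff r i * (jacobi_ell a b ^^ i) f x)"
  unfolding ell_poly_def using assms
  by (intro sum.mono_neutral_left) (auto simp: coeff_eq_0)

lemma ell_poly_add: "ell_poly a b (r + s) f x = ell_poly a b r f x + ell_poly a b s f x"
proof -
  let ?N = "max (degree r) (degree s)"
  have "degree (r + s) \<le> ?N" by (rule degree_add_le_max)
  then show ?thesis
    by (simp add: ell_poly_sum[of _ ?N] sum.distrib[symmetric] algebra_simps)
qed

lemma ell_poly_smult: "ell_poly a b (smult c r) f x = c * ell_poly a b r f x"
  by (simp add: ell_poly_sum[of _ "degree r"] degree_smult_le sum_distrib_left mult.assoc)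

lemma ell_poly_0 [simp]: "ell_poly a b 0 f x = 0"
  by (simp add: ell_poly_def)

lemma ell_poly_sum_polys: "ell_poly a b (\<Sum>i\<in>A. r i) f x = (\<Sum>i\<in>A. ell_poly a b (r i) f x)"
  by (induction A rule: infinite_finite_induct) (simp_all add: ell_poly_add)

text \<open>Here \<ell> is applied to f first, so the recursion merely regroups the sum. In
  \<open>jacobi_ell_ell_poly\<close> it is applied last, and linearity of \<ell>, hence
  differentiability, enters.\<close>

lemma ell_poly_pCons: "ell_poly a b (pCons c r) f x = c * f x + ell_poly a b r (jacobi_ell a b f) x"
proof -
  have "ell_poly a b (pCons c r) f x = (\<Sum>i\<le>Suc (degree r). coeff (pCons c r) i * (jacobi_ell a b ^^ i) f x)"
    by (rule ell_poly_sum) (rule degree_pCons_le)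
  also have "\<dots> = c * f x + (\<Sum>i\<le>degree r. coeff r i * (jacobi_ell a b ^^ Suc i) f x)"
    by (subst sum.atMost_Suc_shift) simp
  also have "(\<Sum>i\<le>degree r. coeff r i * (jacobi_ell a b ^^ Suc i) f x) = ell_poly a b r (jacobi_ell a b f) x"
    unfolding ell_poly_def by (simp only: funpow_Suc_right o_apply)
  finally show ?thesis .
qed

lemma ell_poly_cong:
  assumes "\<And>x. x \<in> {-1<..<1} \<Longrightarrow> f x = g x" "x \<in> {-1<..<1}"
  shows "ell_poly a b r f x = ell_poly a b r g x"
  unfolding ell_poly_def using jacobi_ell_pow_cong[of f g x, OF assms] by simp

lemma ell_poly_add_scaled:
  assumes "times_diff (2 * degree r) f" "times_diff (2 * degree r) g" "x \<in> {-1<..<1}"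
  shows "ell_poly a b r (\<lambda>x. f x + c * g x) x = ell_poly a b r f x + c * ell_poly a b r g x"
proof -
  have "(jacobi_ell a b ^^ i) (\<lambda>x. f x + c * g x) x = (jacobi_ell a b ^^ i) f x + c * (jacobi_ell a b ^^ i) g x"
    if "i \<le> degree r" for i
    using that assms by (intro jacobi_ell_pow_add_scaled) (auto intro: times_diff_mono)
  then show ?thesis
    by (simp add: ell_poly_def sum_distrib_left sum.distrib[symmetric] algebra_simps)
qed

lemma ell_poly_times_diff:
  assumes "times_diff (m + 2 * degree r) f"
  shows "times_diff m (ell_poly a b r f)"
  unfolding ell_poly_def[abs_def] using assms
  by (intro times_diff_lincomb jacobi_ell_pow_times_diff) (auto elim: times_diff_mono)

lemma nth_deriv_ell_poly_sum:
  assumes "times_diff (1 + 2 * degree r) f" "x \<in> {-1<..<1}"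
  shows "nth_deriv 1 (ell_poly a b r f) x = (\<Sum>i\<le>degree r. coeff r i * nth_deriv 1 ((jacobi_ell a b ^^ i) f) x)"
proof -
  have "times_diff 1 ((jacobi_ell a b ^^ i) f)" if "i \<in> {..degree r}" for i
    using assms that by (intro jacobi_ell_pow_times_diff) (auto elim: times_diff_mono)
  from times_diff_lincomb(2)[OF this, of "{..degree r}" "\<lambda>i. i" 1 x "coeff r"] assms
  show ?thesis unfolding ell_poly_def[abs_def] by simp
qed

lemma jacobi_ell_ell_poly:
  assumes "times_diff (2 + 2 * degree r) f" "x \<in> {-1<..<1}"
  shows "jacobi_ell a b (ell_poly a b r f) x = ell_poly a b (pCons 0 r) f x"
proof -
  have "times_diff 2 ((jacobi_ell a b ^^ i) f)" if "i \<in> {..degree r}" for i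
    using assms that by (intro jacobi_ell_pow_times_diff) (auto elim: times_diff_mono)
  from jacobi_ell_lincomb[OF this, of "{..degree r}" "\<lambda>i. i" x a b "coeff r"] assms
  have "jacobi_ell a b (ell_poly a b r f) x = (\<Sum>i\<le>degree r. coeff r i * (jacobi_ell a b ^^ Suc i) f x)"
    unfolding ell_poly_def[abs_def] by simp
  also have "\<dots> = ell_poly a b r (jacobi_ell a b f) x"
    unfolding ell_poly_def by (simp only: funpow_Suc_right o_apply)
  finally show ?thesis by (simp add: ell_poly_pCons)
qed

lemma jacobi_ell_pow_eigen:
  assumes g: "times_diff 2 g" and eig: "\<And>x. x \<in> {-1<..<1} \<Longrightarrow> jacobi_ell a b g x = l * g x" and x: "x \<in> {-1<..<1}"
  shows "(jacobi_ell a b ^^ i) g x = l ^ i * g x"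
  using x
proof (induction i arbitrary: x)
  case (Suc i)
  have "(jacobi_ell a b ^^ Suc i) g x = jacobi_ell a b (\<lambda>x. \<Sum>j\<in>{()}. l ^ i * g x) x"
    using Suc by (auto intro!: jacobi_ell_cong)
  also have "\<dots> = l ^ i * jacobi_ell a b g x"
    using jacobi_ell_lincomb[of "{()}" "\<lambda>_. g" x a b "\<lambda>_. l ^ i"] g Suc by simp
  finally show ?case using eig Suc by simp
qed simp

lemma ell_poly_eigen:
  assumes "times_diff 2 g" "\<And>x. x \<in> {-1<..<1} \<Longrightarrow> jacobi_ell a b g x = l * g x" "x \<in> {-1<..<1}"
  shows "ell_poly a b r g x = poly r l * g x"
  unfolding ell_poly_def poly_altdef sum_distrib_right
  using jacobi_ell_pow_eigen[of g a b l x] assms by (intro sum.cong) auto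

text \<open>The first-order case of \<open>nth_deriv_jacobi_ell\<close>, read as an intertwining
  relation: the new drift is that of the raised parameters.\<close>

lemma deriv_jacobi_ell:
  assumes "times_diff 3 f" "x \<in> {-1<..<1}"
  shows "nth_deriv 1 (jacobi_ell a b f) x = jacobi_ell (a + 1) (b + 1) (nth_deriv 1 f) x + of_real (jacobi_ev a b 1) * nth_deriv 1 f x"
proof -
  have d: "nth_deriv 2 f differentiable (at x)" "times_diff 2 f" using assms by (auto simp: times_diff_def)
  have e: "nth_deriv 1 (nth_deriv 1 f) = nth_deriv 2 f" "nth_deriv 2 (nth_deriv 1 f) = nth_deriv 3 f"
    by (simp_all flip: nth_deriv_add)
  have "nth_deriv 1 (jacobi_ell a b f) x =
    - (of_real (1 - x\<^sup>2) * nth_deriv 3 f x + of_real (drift (a + 1) (b + 1) x) * nth_deriv 2 f x)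
    + of_real (jacobi_ev a b 1) * nth_deriv 1 f x"
    using nth_deriv_jacobi_ell[of 1 f x a b] d assms by simp
  also have "- (of_real (1 - x\<^sup>2) * nth_deriv 3 f x + of_real (drift (a + 1) (b + 1) x) * nth_deriv 2 f x)
     = jacobi_ell (a + 1) (b + 1) (nth_deriv 1 f) x"
    using jacobi_ell_eq[of x "nth_deriv 1 f" "a + 1" "b + 1"] d assms unfolding e by simp
  finally show ?thesis .
qed

text \<open>Iterating the intertwining relation replaces \<ell>(a,b) by \<ell>(a+1,b+1) plus the
  first eigenvalue in every power, which is composition of r with a shift. The induction peels off
  the innermost \<ell>.\<close>

lemma deriv_ell_poly:
  assumes "times_diff (2 * degree r + 1) f" "x \<in> {-1<..<1}"
  shows "nth_deriv 1 (ell_poly a b r f) x =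
    ell_poly (a + 1) (b + 1) (r \<circ>\<^sub>p [:of_real (jacobi_ev a b 1), 1:]) (nth_deriv 1 f) x"
  using assms
proof (induction r arbitrary: f x)
  case 0
  have "nth_deriv 1 (ell_poly a b 0 f) x = nth_deriv 1 (\<lambda>x. 0) x"
    by (rule nth_deriv_cong) (use 0 in auto)
  then show ?case using has_vector_derivative_nth_deriv_1[OF has_vector_derivative_const[of 0 "at x"]] by simp
next
  case (pCons c r)
  let ?q = "[:complex_of_real (jacobi_ev a b 1), 1:]"
  show ?case
  proof (cases "r = 0")
    case True
    have f: "(f has_vector_derivative nth_deriv 1 f x) (at x)" 
      using pCons.prems by (intro times_diffD0[of "2 * degree (pCons c r) + 1"]) auto
    have "nth_deriv 1 (ell_poly a b (pCons c r) f) x = nth_deriv 1 (\<lambda>x. c * f x) x"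
      by (rule nth_deriv_cong) (use pCons.prems True in \<open>auto simp: ell_poly_pCons\<close>)
    also have "\<dots> = c * nth_deriv 1 f x"
      by (intro has_vector_derivative_nth_deriv_1 has_vector_derivative_mult_right f)
    also have "\<dots> = ell_poly (a + 1) (b + 1) (pCons c r \<circ>\<^sub>p ?q) (nth_deriv 1 f) x"
      using True by (simp add: ell_poly_pCons pcompose_pCons)
    finally show ?thesis .
  next
    case False
    then have deg: "degree (pCons c r) = degree r + 1" by simp
    have td: "times_diff (2 * degree r + 3) f" using pCons.prems(1) unfolding deg by (rule times_diff_mono) simp
    have tl: "times_diff (2 * degree r + 1) (jacobi_ell a b f)"
      by (rule jacobi_ell_times_diff) (use td in \<open>rule times_diff_mono, simp\<close>)
    let ?F = "nth_deriv 1 f" and ?s = "r \<circ>\<^sub>p ?q" and ?E = "ell_poly (a + 1) (b + 1)"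
    have degs: "degree ?s = degree r" by (simp add: degree_pcompose)
    have tF: "times_diff (2 * degree r + 2) ?F" by (rule times_diff_deriv) (use td in \<open>rule times_diff_mono, simp\<close>)
    have tlF: "times_diff (2 * degree r) (jacobi_ell (a + 1) (b + 1) ?F)"
      by (rule jacobi_ell_times_diff) (use tF in simp)
    have e: "ell_poly a b (pCons c r) f = (\<lambda>x. ell_poly a b r (jacobi_ell a b f) x + c * f x)"
      by (simp add: ell_poly_pCons[abs_def] fun_eq_iff ell_poly_pCons)
    have "nth_deriv 1 (ell_poly a b (pCons c r) f) x = nth_deriv 1 (ell_poly a b r (jacobi_ell a b f)) x + c * ?F x"
      unfolding e
    proof (rule times_diff_add_scaled(2)[of 1])
      show "times_diff 1 (ell_poly a b r (jacobi_ell a b f))"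
        using tl by (intro ell_poly_times_diff) (simp add: add.commute)
      show "times_diff 1 f" using td by (rule times_diff_mono) simp
    qed (use pCons.prems in auto)
    also have "nth_deriv 1 (ell_poly a b r (jacobi_ell a b f)) x = ?E ?s (nth_deriv 1 (jacobi_ell a b f)) x"
      by (rule pCons.IH) (use tl pCons.prems in auto)
    also have "\<dots> = ?E ?s (\<lambda>x. jacobi_ell (a + 1) (b + 1) ?F x + of_real (jacobi_ev a b 1) * ?F x) x"
      by (rule ell_poly_cong) (use pCons.prems td in \<open>auto intro!: deriv_jacobi_ell intro: times_diff_mono\<close>)
    also have "\<dots> = ?E ?s (jacobi_ell (a + 1) (b + 1) ?F) x + of_real (jacobi_ev a b 1) * ?E ?s ?F x"
      unfolding degs[symmetric] using tF tlF pCons.prems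
      by (intro ell_poly_add_scaled) (auto simp: degs intro: times_diff_mono)
    also have "\<dots> + c * ?F x = ?E (pCons c r \<circ>\<^sub>p ?q) ?F x"
    proof -
      have "pCons c r \<circ>\<^sub>p ?q = pCons c ?s + smult (of_real (jacobi_ev a b 1)) ?s"
        by (simp add: pcompose_pCons)
      then show ?thesis by (simp add: ell_poly_add ell_poly_smult ell_poly_pCons)
    qed
    finally show ?thesis .
  qed
qed

section \<open>Newton polynomials at the eigenvalues\<close>

definition npoly :: "real \<Rightarrow> real \<Rightarrow> nat \<Rightarrow> complex poly" where
  "npoly a b k = (\<Prod>i<k. [:- of_real (jacobi_ev a b (Suc i)), 1:])"

text \<open>The Newton basis at all eigenvalues, including 0. Since \<open>npoly\<close> starts at
  the first positive index, x times its k-th member is the member of index k + 1 here.\<close>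

definition rpoly :: "real \<Rightarrow> real \<Rightarrow> nat \<Rightarrow> complex poly" where
  "rpoly a b k = (\<Prod>i<k. [:- of_real (jacobi_ev a b i), 1:])"

lemma jacobi_ev_0 [simp]: "jacobi_ev a b 0 = 0"
  by (simp add: jacobi_ev_def)

lemma jacobi_ev_shift: "jacobi_ev (a + 1) (b + 1) i + jacobi_ev a b 1 = jacobi_ev a b (Suc i)"
  by (simp add: jacobi_ev_def algebra_simps)

lemma degree_npoly: "degree (npoly a b k) = k"
  unfolding npoly_def by (subst degree_prod_eq_sum_degree) auto

lemma rpoly_Suc: "rpoly a b (Suc k) = pCons 0 (npoly a b k)"
  by (simp add: rpoly_def npoly_def prod.lessThan_Suc_shift del: prod.lessThan_Suc)

text \<open>The eigenvalues of the raised parameters, increased by the first eigenvalue of the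
  original ones, are the original eigenvalues without the zeroth.\<close>

lemma npoly_pcompose_up:
  "npoly a b k \<circ>\<^sub>p [:of_real (jacobi_ev a b 1), 1:] = rpoly (a + 1) (b + 1) k"
  unfolding npoly_def rpoly_def pcompose_prod
  by (intro prod.cong refl) (simp add: pcompose_pCons flip: jacobi_ev_shift)

lemma rpoly_pcompose_down:
  "rpoly (a + 1) (b + 1) k \<circ>\<^sub>p [:- of_real (jacobi_ev a b 1), 1:] = npoly a b k"
  unfolding npoly_def rpoly_def pcompose_prod
  by (intro prod.cong refl) (simp add: pcompose_pCons flip: jacobi_ev_shift)

lemma deriv_scaled_divergence:
  assumes "times_diff 2 h" "x \<in> {-1<..<1}"
  shows "nth_deriv 1 (\<lambda>t. c * (cweight (a + 1) (b + 1) t * nth_deriv 1 h t)) x = - c * cweight a b x * jacobi_ell a b h x"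
proof -
  have d: "nth_deriv 1 h differentiable (at x)" using assms by (auto simp: times_diff_def)
  have "nth_deriv 1 (\<lambda>t. c * (cweight (a + 1) (b + 1) t * nth_deriv 1 h t)) x
      = c * (cweight a b x * (of_real (1 - x\<^sup>2) * nth_deriv 2 h x + of_real (drift a b x) * nth_deriv 1 h x))"
    by (intro has_vector_derivative_nth_deriv_1 has_vector_derivative_mult_right
        weighted_derivative_has_derivative assms(2) d)
  then show ?thesis by (simp add: jacobi_ell_eq[OF assms(2) d] algebra_simps)
qed

text \<open>By induction on \<open>k\<close>: passing from \<open>f\<close> to \<open>f'\<close> raises both parameters by one and shifts the eigenvalues.\<close>

lemma symmetric_term:
  fixes a b :: real
  assumes "times_diff (2 * k + 1) f" "x \<in> {-1<..<1}"
  shows "nth_deriv k (\<lambda>t. c * cweight (a + k + 1) (b + k + 1) t * nth_deriv (Suc k) f t) x =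
    c * (-1) ^ k * (cweight (a + 1) (b + 1) x * nth_deriv 1 (ell_poly a b (npoly a b k) f) x)"
  using assms
proof (induction k arbitrary: a b f x)
  case 0
  have "nth_deriv 1 (ell_poly a b 1 f) x = nth_deriv 1 f x"
    by (rule nth_deriv_cong) (use 0 in \<open>auto simp: one_pCons ell_poly_pCons\<close>)
  then show ?case by (simp add: npoly_def flip: One_nat_def)
next
  case (Suc k)
  let ?F = "nth_deriv 1 f" and ?a = "a + 1" and ?b = "b + 1"
  let ?h = "ell_poly ?a ?b (npoly ?a ?b k) ?F"
  have tF: "times_diff (2 * k + 2) ?F" by (rule times_diff_deriv) (use Suc.prems in \<open>auto elim: times_diff_mono\<close>)
  have th: "times_diff 2 ?h" using tF by (intro ell_poly_times_diff) (simp add: degree_npoly add.commute)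
  have ab: "a + real (Suc k) + 1 = ?a + real k + 1" "b + real (Suc k) + 1 = ?b + real k + 1" by simp_all
  have "nth_deriv (Suc k) (\<lambda>t. c * cweight (a + Suc k + 1) (b + Suc k + 1) t * nth_deriv (Suc (Suc k)) f t) x
     = nth_deriv 1 (nth_deriv k (\<lambda>t. c * cweight (?a + k + 1) (?b + k + 1) t * nth_deriv (Suc k) ?F t)) x"
    unfolding ab by (simp only: nth_deriv_Suc[of k "\<lambda>t. _ t"] nth_deriv_Suc'[of "Suc k" f])
  also have "\<dots> = nth_deriv 1 (\<lambda>t. (c * (-1) ^ k) * (cweight (?a + 1) (?b + 1) t * nth_deriv 1 ?h t)) x"
  proof (rule nth_deriv_cong)
    fix y :: real assume y: "y \<in> {-1<..<1}"
    show "nth_deriv k (\<lambda>t. c * cweight (?a + k + 1) (?b + k + 1) t * nth_deriv (Suc k) ?F t) y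
      = (c * (-1) ^ k) * (cweight (?a + 1) (?b + 1) y * nth_deriv 1 ?h y)"
      by (rule Suc.IH[OF times_diff_mono[OF tF] y]) simp
  qed (use Suc.prems in simp)
  also have "\<dots> = - (c * (-1) ^ k) * cweight ?a ?b x * jacobi_ell ?a ?b ?h x"
    by (rule deriv_scaled_divergence[OF th Suc.prems(2)])
  also have "jacobi_ell ?a ?b ?h x = ell_poly ?a ?b (rpoly ?a ?b (Suc k)) ?F x"
    unfolding rpoly_Suc using tF Suc.prems by (intro jacobi_ell_ell_poly) (auto simp: degree_npoly add.commute)
  also have "\<dots> = nth_deriv 1 (ell_poly a b (npoly a b (Suc k)) f) x"
    using Suc.prems by (subst deriv_ell_poly) (auto simp: degree_npoly npoly_pcompose_up)
  finally show ?case by simp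
qed

text \<open>One more derivative turns p h' into -w \<ell> h, and the extra factor \<ell> completes
  \<open>npoly\<close> to \<open>rpoly\<close>. So a symmetric term divided by w is a Newton
  polynomial in \<ell>.\<close>

lemma symmetric_term_full:
  fixes a b :: real
  assumes "times_diff (2 * k + 2) f" "x \<in> {-1<..<1}"
  shows "nth_deriv (Suc k) (\<lambda>t. c * cweight (a + k + 1) (b + k + 1) t * nth_deriv (Suc k) f t) x =
    c * (-1) ^ Suc k * cweight a b x * ell_poly a b (rpoly a b (Suc k)) f x"
proof -
  let ?h = "ell_poly a b (npoly a b k) f"
  have th: "times_diff 2 ?h" using assms by (intro ell_poly_times_diff) (simp add: degree_npoly add.commute)
  have "nth_deriv (Suc k) (\<lambda>t. c * cweight (a + k + 1) (b + k + 1) t * nth_deriv (Suc k) f t) x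
     = nth_deriv 1 (nth_deriv k (\<lambda>t. c * cweight (a + k + 1) (b + k + 1) t * nth_deriv (Suc k) f t)) x"
    by (simp only: nth_deriv_Suc[of k "\<lambda>t. _ t"])
  also have "\<dots> = nth_deriv 1 (\<lambda>t. (c * (-1) ^ k) * (cweight (a + 1) (b + 1) t * nth_deriv 1 ?h t)) x"
    by (rule nth_deriv_cong) (use assms in \<open>auto intro!: symmetric_term times_diff_mono[OF assms(1)]\<close>)
  also have "\<dots> = - (c * (-1) ^ k) * cweight a b x * jacobi_ell a b ?h x"
    by (rule deriv_scaled_divergence[OF th assms(2)])
  also have "jacobi_ell a b ?h x = ell_poly a b (rpoly a b (Suc k)) f x"
    unfolding rpoly_Suc using assms by (intro jacobi_ell_ell_poly) (auto simp: degree_npoly add.commute)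
  finally show ?thesis by simp
qed

text \<open>Newton interpolation of \<open>x ^ n\<close> at the eigenvalues: these are the constants \<open>C(n,k,\<alpha>,\<beta>)\<close>.\<close>

fun jacobi_stirling :: "real \<Rightarrow> real \<Rightarrow> nat \<Rightarrow> nat \<Rightarrow> real" where
  "jacobi_stirling a b 0 0 = 1"
| "jacobi_stirling a b 0 (Suc k) = 0"
| "jacobi_stirling a b (Suc n) 0 = 0"
| "jacobi_stirling a b (Suc n) (Suc k) = jacobi_stirling a b n k + jacobi_ev a b (Suc k) * jacobi_stirling a b n (Suc k)"

lemma jacobi_stirling_0: "n < k \<Longrightarrow> jacobi_stirling a b n k = 0"
  by (induction a b n k rule: jacobi_stirling.induct) auto

text \<open>The recursion adds nonnegative terms, and eigenvalues of positive index are positive.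
  Positivity later permits division by the constants.\<close>

lemma jacobi_stirling_pos:
  assumes "a > 0" "b > 0"
  shows "1 \<le> k \<Longrightarrow> k \<le> n \<Longrightarrow> jacobi_stirling a b n k > 0"
proof (induction n arbitrary: k)
  case (Suc n)
  then obtain k' where k: "k = Suc k'" by (cases k) auto
  have ev: "jacobi_ev a b k > 0" using assms Suc.prems by (auto simp: jacobi_ev_def k intro!: mult_pos_pos)
  have nn: "jacobi_stirling a b n k \<ge> 0" using Suc.IH[of k] Suc.prems jacobi_stirling_0[of n k a b] by (cases "k \<le> n") auto
  show ?case
  proof (cases "k' = 0")
    case True
    show ?thesis
    proof (cases n)
      case 0 then show ?thesis using True k by simp
    next
      case (Suc m)
      then have "jacobi_stirling a b n k > 0" using Suc.IH[of k] True k by (simp add: One_nat_def)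
      then show ?thesis using ev True k Suc by simp
    qed
  next
    case False
    then have "jacobi_stirling a b n k' > 0" using Suc.IH[of k'] Suc.prems k by (simp add: One_nat_def)
    then show ?thesis using ev nn k by (simp add: add_pos_nonneg)
  qed
qed (simp add: One_nat_def)

text \<open>Multiplying the k-th Newton polynomial by x gives the next one plus the k-th eigenvalue
  times itself; collecting coefficients is the recursion of \<open>jacobi_stirling\<close>.\<close>

lemma monom_eq_jacobi_stirling:
  "monom 1 n = (\<Sum>k\<le>n. smult (of_real (jacobi_stirling a b n k)) (rpoly a b k))"
proof (induction n)
  case 0 then show ?case by (simp add: rpoly_def one_pCons monom_0)
next
  case (Suc n)
  let ?S = "\<lambda>n k. complex_of_real (jacobi_stirling a b n k)" and ?e = "\<lambda>k. complex_of_real (jacobi_ev a b k)"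
  have step: "[:0, 1:] * rpoly a b k = rpoly a b (Suc k) + smult (?e k) (rpoly a b k)" for k
    by (simp add: rpoly_def mult.commute)
  have "monom 1 (Suc n) = [:0, 1:] * monom (1::complex) n" by (simp add: monom_Suc)
  also have "\<dots> = (\<Sum>k\<le>n. smult (?S n k) (rpoly a b (Suc k)) + smult (?S n k * ?e k) (rpoly a b k))"
    unfolding Suc sum_distrib_left mult_smult_right step by (simp add: smult_add_right)
  also have "\<dots> = (\<Sum>k\<le>n. smult (?S n k) (rpoly a b (Suc k))) + (\<Sum>k\<le>Suc n. smult (?S n k * ?e k) (rpoly a b k))"
    by (simp add: sum.distrib jacobi_stirling_0)
  also have "(\<Sum>k\<le>Suc n. smult (?S n k * ?e k) (rpoly a b k)) = (\<Sum>k\<le>n. smult (?S n (Suc k) * ?e (Suc k)) (rpoly a b (Suc k)))"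
    by (subst sum.atMost_Suc_shift) simp
  also have "(\<Sum>k\<le>n. smult (?S n k) (rpoly a b (Suc k))) + \<dots> = (\<Sum>k\<le>n. smult (?S (Suc n) (Suc k)) (rpoly a b (Suc k)))"
    by (simp add: sum.distrib[symmetric] smult_add_left[symmetric] mult.commute)
  also have "\<dots> = (\<Sum>k\<le>Suc n. smult (?S (Suc n) k) (rpoly a b k))"
    by (subst sum.atMost_Suc_shift) simp
  finally show ?case .
qed

lemma monom_eq_jacobi_stirling':
  assumes "n \<ge> 1"
  shows "monom 1 n = (\<Sum>k<n. smult (of_real (jacobi_stirling a b n (Suc k))) (rpoly a b (Suc k)))"
proof -
  obtain m where n: "n = Suc m" using assms by (cases n) (auto simp: One_nat_def)
  show ?thesis using monom_eq_jacobi_stirling[of "Suc m" a b] unfolding n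
    by (subst (asm) sum.atMost_Suc_shift) (simp add: lessThan_Suc_atMost)
qed

lemma ell_poly_monom: "ell_poly a b (monom 1 n) f x = (jacobi_ell a b ^^ n) f x"
proof -
  have "ell_poly a b (monom 1 n) f x = (\<Sum>i\<le>n. (if i = n then (jacobi_ell a b ^^ n) f x else 0))"
    unfolding ell_poly_def by (rule sum.cong) (auto simp: degree_monom_eq)
  then show ?thesis by simp
qed

section \<open>Identification of the constants of the Lagrangian symmetric form\<close>

lemma sym_coeff_cweight:
  "sym_coeff c a b (Suc k) t = of_real (c (Suc k)) * cweight (a + k + 1) (b + k + 1) t"
  by (simp add: sym_coeff_def jacobi_weight_def algebra_simps)

lemma symmetric_sum:
  assumes "times_diff (2 * n) f" "x \<in> {-1<..<1}"
  shows "1 / of_real (jacobi_weight a b x) * (\<Sum>k=1..n. (-1) ^ k *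
               nth_deriv k (\<lambda>t. sym_coeff c a b k t * nth_deriv k f t) x)
       = (\<Sum>k<n. of_real (c (Suc k)) * ell_poly a b (rpoly a b (Suc k)) f x)"
proof -
  have "(\<Sum>k=1..n. (-1) ^ k * nth_deriv k (\<lambda>t. sym_coeff c a b k t * nth_deriv k f t) x)
     = (\<Sum>k<n. (-1) ^ Suc k * nth_deriv (Suc k) (\<lambda>t. sym_coeff c a b (Suc k) t * nth_deriv (Suc k) f t) x)"
    unfolding One_nat_def by (rule sum.atLeast1_atMost_eq)
  also have "\<dots> = (\<Sum>k<n. (-1) ^ Suc k * (of_real (c (Suc k)) * (-1) ^ Suc k * cweight a b x * ell_poly a b (rpoly a b (Suc k)) f x))"
    unfolding sym_coeff_cweight using assms
    by (intro sum.cong refl arg_cong2[where f = "(*)"] symmetric_term_full) (auto elim: times_diff_mono)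
  also have "\<dots> = cweight a b x * (\<Sum>k<n. of_real (c (Suc k)) * ell_poly a b (rpoly a b (Suc k)) f x)"
    unfolding sum_distrib_left by (rule sum.cong) (auto simp: power_mult_distrib[symmetric])
  finally show ?thesis using jacobi_weight_pos[OF assms(2), of a b] by simp
qed

text \<open>Reduces the defining identity to the expansion of \<ell>^n in Newton polynomials of
  \<ell>, so that only polynomial algebra remains.\<close>

lemma lagrange_symmetric_iff:
  "lagrange_symmetric n a b c \<longleftrightarrow> (\<forall>f. times_diff (2 * n) f \<longrightarrow> (\<forall>x\<in>{-1<..<1}.
      (jacobi_ell a b ^^ n) f x = (\<Sum>k<n. of_real (c (Suc k)) * ell_poly a b (rpoly a b (Suc k)) f x)))"
  unfolding lagrange_symmetric_def times_diff_def[symmetric] jacobi_ell_pow_def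
  by (intro iff_allI imp_cong ball_cong refl) (simp only: symmetric_sum)

lemma lagrange_symmetric_jacobi_stirling:
  assumes "n \<ge> 1" shows "lagrange_symmetric n a b (jacobi_stirling a b n)"
  unfolding lagrange_symmetric_iff
  by (simp add: ell_poly_monom[symmetric] monom_eq_jacobi_stirling'[OF assms, of a b] ell_poly_sum_polys ell_poly_smult)

lemma jacobi_ev_strict_mono:
  assumes "a > 0" "b > 0" "i < j" shows "jacobi_ev a b i < jacobi_ev a b j"
proof -
  have "real i * (real i + a + b + 1) \<le> real i * (real j + a + b + 1)" using assms by (intro mult_left_mono) auto
  also have "\<dots> < real j * (real j + a + b + 1)" using assms by (intro mult_strict_right_mono) auto
  finally show ?thesis by (simp add: jacobi_ev_def)
qed

text \<open>On an eigenfunction the identity compares values of Newton polynomials at the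
  eigenvalue. \<open>rpoly a b (Suc k)\<close> vanishes at the eigenvalue of index m + 1 for k > m
  and not for k = m, so the system is triangular. Eigenfunctions are a hypothesis because the Jacobi
  polynomials are recognised as such only through the operator A.\<close>

lemma lagrange_symmetric_unique:
  assumes ab: "a > 0" "b > 0"
    and eig: "\<And>m. \<exists>g. times_diff (2 * n) g \<and> (\<forall>x\<in>{-1<..<1}. jacobi_ell a b g x = of_real (jacobi_ev a b m) * g x) \<and>
        (\<exists>x\<in>{-1<..<1}. g x \<noteq> 0)"
    and c: "lagrange_symmetric n a b c" and d: "lagrange_symmetric n a b d" and k: "1 \<le> k" "k \<le> n"
  shows "c k = d k"
proof -
  let ?r = "\<lambda>m k. poly (rpoly a b (Suc k)) (of_real (jacobi_ev a b m))"
  have eq: "(\<Sum>k<n. of_real (c (Suc k) - d (Suc k)) * ?r m k) = 0" for m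
  proof -
    obtain g x where g: "times_diff (2 * n) g" "\<And>x. x\<in>{-1<..<1} \<Longrightarrow> jacobi_ell a b g x = of_real (jacobi_ev a b m) * g x"
        and x: "x \<in> {-1<..<1}" "g x \<noteq> 0" using eig[of m] by blast
    have g2: "times_diff 2 g" using g(1) k by (auto elim!: times_diff_mono)
    have "(\<Sum>k<n. of_real (c (Suc k)) * ell_poly a b (rpoly a b (Suc k)) g x) =
        (\<Sum>k<n. of_real (d (Suc k)) * ell_poly a b (rpoly a b (Suc k)) g x)"
      using c d g(1) x(1) unfolding lagrange_symmetric_iff by auto
    moreover have "ell_poly a b r g x = poly r (of_real (jacobi_ev a b m)) * g x" for r
      by (rule ell_poly_eigen[OF g2]) (use g(2) x(1) in auto)
    ultimately have "g x * (\<Sum>k<n. of_real (c (Suc k) - d (Suc k)) * ?r m k) = 0"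
      by (simp add: sum_distrib_left algebra_simps sum_subtractf)
    then show ?thesis using x(2) by simp
  qed
  have "c (Suc m) = d (Suc m)" if "m < n" for m
    using that
  proof (induction m rule: less_induct)
    case (less m)
    have "(\<Sum>k<n. of_real (c (Suc k) - d (Suc k)) * ?r (Suc m) k) = of_real (c (Suc m) - d (Suc m)) * ?r (Suc m) m"
    proof -
      have "of_real (c (Suc k) - d (Suc k)) * ?r (Suc m) k = 0" if "k \<in> {..<n} - {m}" for k
      proof (cases "k < m")
        case True then show ?thesis using less by simp
      next
        case False
        then have "Suc m \<in> {..<Suc k}" using that by auto
        then have "?r (Suc m) k = 0" unfolding rpoly_def poly_prod by (intro prod_zero) auto
        then show ?thesis by simp
      qed
      then have "(\<Sum>k\<in>{..<n} - {m}. of_real (c (Suc k) - d (Suc k)) * ?r (Suc m) k) = 0" by (rule sum.neutral[OF ballI])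
      then show ?thesis using less.prems by (subst sum.remove[of _ m]) auto
    qed
    moreover have "?r (Suc m) m \<noteq> 0"
    proof -
      have "complex_of_real (jacobi_ev a b (Suc m)) \<noteq> of_real (jacobi_ev a b i)" if "i < Suc m" for i
        using jacobi_ev_strict_mono[OF ab that] by simp
      then show ?thesis unfolding rpoly_def poly_prod by (auto simp del: of_real_eq_iff prod.lessThan_Suc)
    qed
    ultimately show ?case using eq[of "Suc m"] by simp
  qed
  then show ?thesis using k by (cases k) (auto simp: One_nat_def)
qed


section \<open>The bilinear concomitant with an eigenfunction\<close>

text \<open>The divided difference \<open>(r\<^sub>K(x) - r\<^sub>K(l)) / (x - l)\<close> of \<open>rpoly a b (Suc K)\<close>.\<close>

fun dpoly :: "real \<Rightarrow> real \<Rightarrow> complex \<Rightarrow> nat \<Rightarrow> complex poly" where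
  "dpoly a b l 0 = 1"
| "dpoly a b l (Suc K) = pCons (poly (npoly a b (Suc K)) l)
     (dpoly (a + 1) (b + 1) (l - of_real (jacobi_ev a b 1)) K \<circ>\<^sub>p [:- of_real (jacobi_ev a b 1), 1:])"

lemma degree_dpoly: "degree (dpoly a b l K) \<le> K"
proof (induction a b l K rule: dpoly.induct)
  case (2 a b l K)
  then show ?case
    by (simp add: degree_pcompose)
qed simp

text \<open>Carries a divided difference through the shift by the first eigenvalue, from the raised
  to the original parameters.\<close>

lemma dpoly_shift_mult:
  assumes "[:-(l - of_real (jacobi_ev a b 1)), 1:] * s = rpoly (a + 1) (b + 1) k - [:poly (rpoly (a + 1) (b + 1) k) (l - of_real (jacobi_ev a b 1)):]"
  shows "[:-l, 1:] * (s \<circ>\<^sub>p [:- of_real (jacobi_ev a b 1), 1:]) = npoly a b k - [:poly (npoly a b k) l:]"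
proof -
  let ?q = "[:- complex_of_real (jacobi_ev a b 1), 1:]"
  have "[:-l, 1:] = [:-(l - of_real (jacobi_ev a b 1)), 1:] \<circ>\<^sub>p ?q" by (simp add: pcompose_pCons)
  then have "[:-l, 1:] * (s \<circ>\<^sub>p ?q) = ([:-(l - of_real (jacobi_ev a b 1)), 1:] * s) \<circ>\<^sub>p ?q"
    by (simp only: pcompose_mult)
  also have "\<dots> = npoly a b k - [:poly (rpoly (a + 1) (b + 1) k) (l - of_real (jacobi_ev a b 1)):]"
    unfolding assms by (simp add: pcompose_diff rpoly_pcompose_down pcompose_const)
  also have "poly (rpoly (a + 1) (b + 1) k) (l - of_real (jacobi_ev a b 1)) = poly (npoly a b k) l"
    unfolding rpoly_pcompose_down[symmetric] poly_pcompose by simp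
  finally show ?thesis .
qed

text \<open>The defining property of a divided difference, free of division. The step uses x N(x) -
  l N(l) = (x - l) N(l) + x (N(x) - N(l)).\<close>

lemma dpoly_mult:
  "[:-l, 1:] * dpoly a b l K = rpoly a b (Suc K) - [:poly (rpoly a b (Suc K)) l:]"
proof (induction a b l K rule: dpoly.induct)
  case (1 a b l)
  show ?case by (simp add: rpoly_Suc npoly_def one_pCons)
next
  case (2 a b l K)
  let ?n = "npoly a b (Suc K)"
  let ?s = "dpoly (a + 1) (b + 1) (l - of_real (jacobi_ev a b 1)) K \<circ>\<^sub>p [:- of_real (jacobi_ev a b 1), 1:]"
  have "[:-l, 1:] * dpoly a b l (Suc K) = [:-l, 1:] * ([:poly ?n l:] + [:0, 1:] * ?s)"
    by simp
  also have "\<dots> = [:-l, 1:] * [:poly ?n l:] + [:0, 1:] * ([:-l, 1:] * ?s)"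
    by (simp only: distrib_left mult.left_commute)
  also have "\<dots> = [:-l, 1:] * [:poly ?n l:] + [:0, 1:] * (?n - [:poly ?n l:])"
    by (simp only: dpoly_shift_mult[OF 2])
  also have "\<dots> = rpoly a b (Suc (Suc K)) - [:poly (rpoly a b (Suc (Suc K))) l:]"
    by (simp add: rpoly_Suc[of a b "Suc K"])
  finally show ?case .
qed

text \<open>The inner sum of the form for k = K + 1 collapses to the first-order form of d(\<ell>) f
  and g, with d the divided difference. In the induction the summand j = 0 is evaluated by
  \<open>symmetric_term\<close>; the others are the same sum for f' and g' with raised parameters,
  g' being an eigenfunction for l minus the first eigenvalue.\<close>

lemma symmetric_form_eigen:
  fixes a b :: real
  assumes "times_diff (2 * K + 1) f" "times_diff (2 * K + 2) g"
    and "\<And>x. x \<in> {-1<..<1} \<Longrightarrow> jacobi_ell a b g x = l * g x" and "x \<in> {-1<..<1}"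
  shows "(\<Sum>j\<le>K. (-1) ^ (K + j) *
      (nth_deriv (K - j) (\<lambda>t. c * cweight (a + K + 1) (b + K + 1) t * nth_deriv (Suc K) g t) x * nth_deriv j f x
     - nth_deriv (K - j) (\<lambda>t. c * cweight (a + K + 1) (b + K + 1) t * nth_deriv (Suc K) f t) x * nth_deriv j g x))
   = c * cweight (a + 1) (b + 1) x * (ell_poly a b (dpoly a b l K) f x * nth_deriv 1 g x
        - nth_deriv 1 (ell_poly a b (dpoly a b l K) f) x * g x)"
  using assms
proof (induction K arbitrary: a b f g l x)
  case 0
  have "nth_deriv 1 (ell_poly a b 1 f) x = nth_deriv 1 f x"
    by (rule nth_deriv_cong) (use 0 in \<open>auto simp: one_pCons ell_poly_pCons\<close>)
  moreover have "ell_poly a b 1 f x = f x" by (simp add: one_pCons ell_poly_pCons)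
  ultimately show ?case by (simp add: algebra_simps flip: One_nat_def)
next
  case (Suc K)
  define e where "e = complex_of_real (jacobi_ev a b 1)"
  let ?F = "nth_deriv 1 f" and ?G = "nth_deriv 1 g" and ?a = "a + 1" and ?b = "b + 1"
  let ?s = "dpoly ?a ?b (l - e) K \<circ>\<^sub>p [:- e, 1:]" and ?N = "npoly a b (Suc K)"
  let ?h = "ell_poly a b ?s f"
  note x = Suc.prems(4)
  have tf: "times_diff (2 * K + 3) f" using Suc.prems(1) by (rule times_diff_mono) simp
  have tg: "times_diff (2 * K + 4) g" using Suc.prems(2) by (rule times_diff_mono) simp
  have tF: "times_diff (2 * K + 2) ?F" by (rule times_diff_deriv) (use tf in \<open>auto elim: times_diff_mono\<close>)
  have tG: "times_diff (2 * K + 3) ?G" by (rule times_diff_deriv) (use tg in \<open>auto elim: times_diff_mono\<close>)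
  have tg3: "times_diff 3 g" "times_diff 2 g" using tg by (auto elim: times_diff_mono)
  have degs: "degree ?s \<le> K" using degree_dpoly[of ?a ?b "l - e" K] by (simp add: degree_pcompose)
  have th: "times_diff 3 ?h"
    by (rule ell_poly_times_diff) (use tf degs in \<open>auto elim!: times_diff_mono\<close>)
  have tlh: "times_diff 1 (jacobi_ell a b ?h)"
    by (rule jacobi_ell_times_diff) (use th in \<open>auto elim: times_diff_mono\<close>)
  have eigG: "jacobi_ell ?a ?b ?G y = (l - e) * ?G y" if y: "y \<in> {-1<..<1}" for y
  proof -
    have g1: "(g has_vector_derivative ?G y) (at y)" using tg3(1) y by (intro times_diffD0) auto
    have "jacobi_ell ?a ?b ?G y = nth_deriv 1 (jacobi_ell a b g) y - e * ?G y"
      using deriv_jacobi_ell[OF tg3(1) y] by (simp add: e_def)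
    also have "nth_deriv 1 (jacobi_ell a b g) y = nth_deriv 1 (\<lambda>x. l * g x) y"
      by (rule nth_deriv_cong) (use Suc.prems(3) y in auto)
    also have "\<dots> = l * ?G y"
      by (intro has_vector_derivative_nth_deriv_1 has_vector_derivative_mult_right g1)
    finally show ?thesis by (simp add: algebra_simps)
  qed
  have hF: "ell_poly ?a ?b (dpoly ?a ?b (l - e) K) ?F y = nth_deriv 1 ?h y" if y: "y \<in> {-1<..<1}" for y
  proof -
    have "nth_deriv 1 ?h y = ell_poly ?a ?b (?s \<circ>\<^sub>p [:e, 1:]) ?F y"
      unfolding e_def by (rule deriv_ell_poly) (use tf degs y in \<open>auto simp: e_def elim!: times_diff_mono\<close>)
    also have "?s \<circ>\<^sub>p [:e, 1:] = dpoly ?a ?b (l - e) K"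
      by (simp add: pcompose_assoc[symmetric] pcompose_pCons)
    finally show ?thesis by simp
  qed
  define P where "P = cweight ?a ?b x"
  define T where "T u = nth_deriv (Suc K) (\<lambda>t. c * cweight (a + Suc K + 1) (b + Suc K + 1) t * nth_deriv (Suc (Suc K)) u t) x" for u
  have T: "T u = c * (-1) ^ Suc K * (P * nth_deriv 1 (ell_poly a b ?N u) x)" if "times_diff (2 * K + 3) u" for u
    unfolding T_def P_def using x by (intro symmetric_term times_diff_mono[OF that]) auto
  have "nth_deriv 1 (ell_poly a b ?N g) x = nth_deriv 1 (\<lambda>x. poly ?N l * g x) x"
    by (rule nth_deriv_cong) (use ell_poly_eigen[OF tg3(2)] Suc.prems(3) x in auto)
  also have "\<dots> = poly ?N l * ?G x"
    using tg3(1) x by (intro has_vector_derivative_nth_deriv_1 has_vector_derivative_mult_right times_diffD0) auto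
  finally have Tg: "T g = c * (-1) ^ Suc K * (P * (poly ?N l * ?G x))"
    using T[of g] tg by (simp add: times_diff_mono[OF tg])
  have ab: "a + real (Suc K) + 1 = ?a + real K + 1" "b + real (Suc K) + 1 = ?b + real K + 1" by simp_all
  let ?term = "\<lambda>j. (-1) ^ (Suc K + j) *
      (nth_deriv (Suc K - j) (\<lambda>t. c * cweight (a + Suc K + 1) (b + Suc K + 1) t * nth_deriv (Suc (Suc K)) g t) x * nth_deriv j f x
     - nth_deriv (Suc K - j) (\<lambda>t. c * cweight (a + Suc K + 1) (b + Suc K + 1) t * nth_deriv (Suc (Suc K)) f t) x * nth_deriv j g x)"
  have "(\<Sum>j\<le>Suc K. ?term j) = ?term 0 + (\<Sum>j\<le>K. ?term (Suc j))"
    by (rule sum.atMost_Suc_shift)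
  also have "?term 0 = (-1) ^ Suc K * (T g * f x - T f * g x)" unfolding T_def by simp
  also have "\<dots> = c * P * (poly ?N l * ?G x * f x - nth_deriv 1 (ell_poly a b ?N f) x * g x)"
    unfolding Tg T[OF tf] by (simp add: algebra_simps power_mult_distrib[symmetric] flip: power_add)
  also have "(\<Sum>j\<le>K. ?term (Suc j)) = (\<Sum>j\<le>K. (-1) ^ (K + j) *
      (nth_deriv (K - j) (\<lambda>t. c * cweight (?a + K + 1) (?b + K + 1) t * nth_deriv (Suc K) ?G t) x * nth_deriv j ?F x
     - nth_deriv (K - j) (\<lambda>t. c * cweight (?a + K + 1) (?b + K + 1) t * nth_deriv (Suc K) ?F t) x * nth_deriv j ?G x))"
    by (intro sum.cong refl) (simp only: ab nth_deriv_Suc' diff_Suc_Suc add_Suc add_Suc_right power_Suc, simp)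
  also have "\<dots> = c * cweight (?a + 1) (?b + 1) x * (ell_poly ?a ?b (dpoly ?a ?b (l - e) K) ?F x * nth_deriv 1 ?G x
        - nth_deriv 1 (ell_poly ?a ?b (dpoly ?a ?b (l - e) K) ?F) x * ?G x)"
    by (rule Suc.IH) (use tF tG eigG x in \<open>auto elim: times_diff_mono\<close>)
  also have "nth_deriv 1 (ell_poly ?a ?b (dpoly ?a ?b (l - e) K) ?F) x = nth_deriv 2 ?h x"
  proof -
    have "nth_deriv 1 (ell_poly ?a ?b (dpoly ?a ?b (l - e) K) ?F) x = nth_deriv 1 (nth_deriv 1 ?h) x"
      by (rule nth_deriv_cong) (use hF x in auto)
    then show ?thesis by (simp flip: nth_deriv_add)
  qed
  also have "ell_poly ?a ?b (dpoly ?a ?b (l - e) K) ?F x = nth_deriv 1 ?h x" by (rule hF[OF x])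
  also have "nth_deriv 1 ?G x = nth_deriv 2 g x" by (simp flip: nth_deriv_add)
  \<comment> \<open>The second derivatives are eliminated by means of \<ell>; the drift terms cancel
    in the antisymmetric combination.\<close>
  also have "c * cweight (?a + 1) (?b + 1) x * (nth_deriv 1 ?h x * nth_deriv 2 g x - nth_deriv 2 ?h x * ?G x)
     = c * P * (jacobi_ell a b ?h x * ?G x - l * g x * nth_deriv 1 ?h x)"
  proof -
    have dg: "nth_deriv 1 g differentiable (at x)" "nth_deriv 1 ?h differentiable (at x)"
      using tg3 th x by (auto simp: times_diff_def)
    have g2: "of_real (1 - x\<^sup>2) * nth_deriv 2 g x = - l * g x - of_real (drift a b x) * ?G x"
      using jacobi_ell_eq[OF x dg(1), of a b] Suc.prems(3)[OF x] by (simp add: algebra_simps)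
    have h2: "of_real (1 - x\<^sup>2) * nth_deriv 2 ?h x = - jacobi_ell a b ?h x - of_real (drift a b x) * nth_deriv 1 ?h x"
      using jacobi_ell_eq[OF x dg(2), of a b] by (simp add: algebra_simps)
    have "c * cweight (?a + 1) (?b + 1) x * (nth_deriv 1 ?h x * nth_deriv 2 g x - nth_deriv 2 ?h x * ?G x)
       = c * P * (nth_deriv 1 ?h x * (of_real (1 - x\<^sup>2) * nth_deriv 2 g x) - (of_real (1 - x\<^sup>2) * nth_deriv 2 ?h x) * ?G x)"
      unfolding jacobi_weight_Suc[OF x, of ?a ?b] P_def of_real_mult by (simp only: algebra_simps)
    also have "\<dots> = c * P * (jacobi_ell a b ?h x * ?G x - l * g x * nth_deriv 1 ?h x)"
      unfolding g2 h2 by (simp add: algebra_simps)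
    finally show ?thesis .
  qed
  also have "c * P * (poly ?N l * ?G x * f x - nth_deriv 1 (ell_poly a b ?N f) x * g x) +
      c * P * (jacobi_ell a b ?h x * ?G x - l * g x * nth_deriv 1 ?h x)
     = c * P * ((jacobi_ell a b ?h x + poly ?N l * f x) * ?G x - (nth_deriv 1 (ell_poly a b ?N f) x + l * nth_deriv 1 ?h x) * g x)"
    by (simp add: algebra_simps)
  also have "jacobi_ell a b ?h x + poly ?N l * f x = ell_poly a b (dpoly a b l (Suc K)) f x"
  proof -
    have "jacobi_ell a b ?h x = ell_poly a b (pCons 0 ?s) f x"
      by (rule jacobi_ell_ell_poly) (use tf degs x in \<open>auto elim!: times_diff_mono\<close>)
    then show ?thesis by (simp add: ell_poly_pCons e_def)
  qed
  also have "nth_deriv 1 (ell_poly a b ?N f) x + l * nth_deriv 1 ?h x = nth_deriv 1 (ell_poly a b (dpoly a b l (Suc K)) f) x"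
  proof -
    \<comment> \<open>From (x - l) s = N - N(l) follows N + l s = x s + N(l), which is the next
      divided difference.\<close>
    have key: "?N + smult l ?s = pCons 0 ?s + [:poly ?N l:]"
    proof -
      have "[:-l, 1:] * ?s = ?N - [:poly ?N l:]"
        unfolding e_def by (rule dpoly_shift_mult) (rule dpoly_mult)
      then have "?N = [:-l, 1:] * ?s + [:poly ?N l:]" by (simp add: eq_diff_eq)
      also have "[:-l, 1:] * ?s = pCons 0 ?s - smult l ?s" by simp
      finally have "?N = pCons 0 ?s - smult l ?s + [:poly ?N l:]" .
      moreover have "u + w = v + z" if "u = v - w + z" for u v w z :: "complex poly"
        using that by simp
      ultimately show ?thesis by blast
    qed
    have tN: "times_diff 1 (ell_poly a b ?N f)"
      by (rule ell_poly_times_diff, rule times_diff_mono[OF tf]) (simp add: degree_npoly)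
    have "nth_deriv 1 (ell_poly a b ?N f) x + l * nth_deriv 1 ?h x = nth_deriv 1 (\<lambda>x. ell_poly a b ?N f x + l * ?h x) x"
      using tN th x by (intro times_diff_add_scaled(2)[of 1, symmetric]) (auto elim: times_diff_mono)
    also have "(\<lambda>x. ell_poly a b ?N f x + l * ?h x) = ell_poly a b (?N + smult l ?s) f"
      by (simp add: fun_eq_iff ell_poly_add ell_poly_smult)
    also have "?N + smult l ?s = dpoly a b l (Suc K)"
      unfolding key by (simp add: e_def)
    finally show ?thesis .
  qed
  finally show ?case unfolding P_def .
qed

text \<open>The weight is positive on (-1,1), so the null sets there are the Lebesgue null sets,
  whatever the parameters.\<close>

lemma AE_jacobi_measure:
  "(AE x in jacobi_measure a b. Q x) \<longleftrightarrow> (\<exists>N. negligible N \<and> (\<forall>x\<in>{-1<..<1} - N. Q x))"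
proof -
  have m: "jacobi_weight a b \<in> borel_measurable (lebesgue_on {-1<..<1})"
  proof (rule continuous_imp_measurable_on_sets_lebesgue)
    show "continuous_on {-1<..<1} (jacobi_weight a b)"
      by (intro continuous_at_imp_continuous_on ballI DERIV_isCont[OF jacobi_weight_has_derivative])
  qed simp
  have "(AE x in jacobi_measure a b. Q x) \<longleftrightarrow> (AE x in lebesgue_on {-1<..<1}. 0 < ennreal (jacobi_weight a b x) \<longrightarrow> Q x)"
    unfolding jacobi_measure_def using m by (subst AE_density) auto
  also have "\<dots> \<longleftrightarrow> (AE x in lebesgue. x \<in> {-1<..<1} \<longrightarrow> Q x)"
    by (subst AE_restrict_space_iff) (auto simp: jacobi_weight_pos)
  also have "\<dots> \<longleftrightarrow> (\<exists>N. negligible N \<and> (\<forall>x\<in>{-1<..<1} - N. Q x))"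
  proof
    assume "AE x in lebesgue. x \<in> {-1<..<1} \<longrightarrow> Q x"
    then obtain N where "N \<in> null_sets lebesgue" "{x \<in> space lebesgue. \<not> (x \<in> {-1<..<1} \<longrightarrow> Q x)} \<subseteq> N"
      by (rule AE_E3) blast
    then show "\<exists>N. negligible N \<and> (\<forall>x\<in>{-1<..<1} - N. Q x)"
      by (intro exI[of _ N]) (auto simp: negligible_iff_null_sets)
  next
    assume "\<exists>N. negligible N \<and> (\<forall>x\<in>{-1<..<1} - N. Q x)"
    then obtain N where "negligible N" "\<forall>x\<in>{-1<..<1} - N. Q x" by blast
    then show "AE x in lebesgue. x \<in> {-1<..<1} \<longrightarrow> Q x"
      by (intro AE_I'[of N]) (auto simp: negligible_iff_null_sets)
  qed
  finally show ?thesis .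
qed

lemma negligible_complement_infinite:
  assumes "negligible N" shows "infinite ({-1<..<1::real} - N)"
proof
  assume "finite ({-1<..<1} - N)"
  then have "negligible ({-1<..<1} - N)" by (rule negligible_finite)
  then have "negligible (({-1<..<1} - N) \<union> N)" using assms by (rule negligible_Un)
  then have "negligible {-1<..<1::real}" by (rule negligible_subset) auto
  then show False using negligible_interval(2)[of "-1" "1::real"] by (simp add: box_real)
qed

text \<open>The set where two continuous functions differ is open, and a nonempty open set is not
  negligible.\<close>

lemma continuous_eq_if_AE:
  fixes f g :: "real \<Rightarrow> complex"
  assumes f: "continuous_on {-1<..<1} f" and g: "continuous_on {-1<..<1} g"
    and N: "negligible N" and eq: "\<And>x. x \<in> {-1<..<1} - N \<Longrightarrow> f x = g x" and x: "x \<in> {-1<..<1}"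
  shows "f x = g x"
proof (rule ccontr)
  assume ne: "f x \<noteq> g x"
  have "continuous_on {-1<..<1} (\<lambda>x. f x - g x)" by (intro continuous_intros f g)
  then have "\<forall>B. open B \<longrightarrow> open ((\<lambda>x. f x - g x) -` B \<inter> {-1<..<1})"
    by (simp add: continuous_on_open_vimage)
  then have "open ((\<lambda>x. f x - g x) -` (- {0}) \<inter> {-1<..<1})" by (simp add: open_Compl)
  moreover have "x \<in> (\<lambda>x. f x - g x) -` (- {0}) \<inter> {-1<..<1}" using ne x by auto
  moreover have "(\<lambda>x. f x - g x) -` (- {0}) \<inter> {-1<..<1} \<subseteq> N" using eq by auto
  ultimately show False
    using N negligible_subset open_not_negligible by blast
qed

section \<open>Jacobi polynomials\<close>

lemma poly_has_vector_derivative: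
  "((\<lambda>x. poly q (complex_of_real x)) has_vector_derivative poly (pderiv q) (of_real x)) (at x)"
  using has_vector_derivative_real_field[OF poly_DERIV[of q "of_real x"]] by simp

lemma nth_deriv_poly:
  "nth_deriv k (\<lambda>x. poly q (complex_of_real x)) = (\<lambda>x. poly ((pderiv ^^ k) q) (of_real x))"
proof (induction k)
  case (Suc k)
  show ?case
    unfolding nth_deriv_Suc Suc
    using has_vector_derivative_nth_deriv_1[OF poly_has_vector_derivative] by (simp add: fun_eq_iff)
qed simp

lemma times_diff_poly: "times_diff m (\<lambda>x. poly q (complex_of_real x))"
  unfolding times_diff_def nth_deriv_poly using poly_has_vector_derivative differentiableI_vector by blast

lemma gbinomial_pos: "k \<le> m \<Longrightarrow> a > 0 \<Longrightarrow> (real m + a) gchoose k > 0"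
  unfolding gbinomial_prod_rev by (intro divide_pos_pos prod_pos) auto

text \<open>Every summand has degree m, and the leading coefficients are 2^(-m) times products of
  binomials that are positive for positive parameters, so they cannot cancel.\<close>

lemma jacobi_P_poly:
  assumes "a > 0" "b > 0"
  obtains q where "degree q = m" "jacobi_P a b m = (\<lambda>x. poly q (of_real x))"
proof -
  define c where "c s = ((real m + a) gchoose (m - s)) * ((real m + b) gchoose s)" for s
  define t where "t s = [:-1/2, 1/2:] ^ s * [:1/2, 1/2 :: complex:] ^ (m - s)" for s
  define q where "q = (\<Sum>s\<le>m. smult (of_real (c s)) (t s))"
  have t: "degree (t s) = m" "coeff (t s) m = (1/2) ^ m" if "s \<le> m" for s
  proof -
    show d: "degree (t s) = m" using that by (simp add: t_def degree_mult_eq degree_power_eq)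
    have "lead_coeff (t s) = (1/2) ^ s * (1/2) ^ (m - s)"
      by (simp add: t_def lead_coeff_mult lead_coeff_power)
    then show "coeff (t s) m = (1/2) ^ m" using that by (simp add: d flip: power_add)
  qed
  have "coeff q m = of_real (\<Sum>s\<le>m. c s) * (1/2) ^ m"
    by (simp add: q_def coeff_sum t sum_distrib_right)
  moreover have "(\<Sum>s\<le>m. c s) > 0" unfolding c_def using assms by (intro sum_pos mult_pos_pos gbinomial_pos) auto
  ultimately have nz: "coeff q m \<noteq> 0" by (simp del: of_real_sum)
  have "degree q \<le> m" unfolding q_def by (intro degree_sum_le) (auto intro: order_trans[OF degree_smult_le] simp: t)
  then have "degree q = m" using le_degree[OF nz] by simp
  moreover have "jacobi_P a b m = (\<lambda>x. poly q (of_real x))"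
  proof
    fix x :: real
    have e: "poly [:-1/2, 1/2:] (complex_of_real x) = of_real ((x - 1) / 2)"
      "poly [:1/2, 1/2:] (complex_of_real x) = of_real ((x + 1) / 2)"
      by (simp_all add: field_simps)
    have "poly q (of_real x) = (\<Sum>s\<le>m. of_real (c s) * (of_real ((x - 1) / 2) ^ s * of_real ((x + 1) / 2) ^ (m - s)))"
      unfolding q_def t_def poly_sum poly_smult poly_mult poly_power e ..
    also have "\<dots> = jacobi_P a b m x"
      unfolding jacobi_P_def c_def of_real_sum of_real_mult of_real_power by (intro sum.cong refl) (simp only: mult.assoc)
    finally show "jacobi_P a b m x = poly q (of_real x)" by simp
  qed
  ultimately show ?thesis by (rule that)
qed

text \<open>A single summand survives at each endpoint. Nonvanishing there lets boundary conditions
  against P be divided by its endpoint value.\<close>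

lemma jacobi_P_endpoints:
  assumes "a > 0" "b > 0"
  shows "jacobi_P a b m 1 \<noteq> 0" "jacobi_P a b m (-1) \<noteq> 0"
proof -
  have "(\<Sum>s\<le>m. ((real m + a) gchoose (m - s)) * ((real m + b) gchoose s) * ((1 - 1) / 2) ^ s * ((1 + 1) / 2) ^ (m - s))
      = (\<Sum>s\<in>{0}. ((real m + a) gchoose (m - s)) * ((real m + b) gchoose s) * ((1 - 1) / 2) ^ s * ((1 + 1) / 2) ^ (m - s))"
    by (rule sum.mono_neutral_right) (auto simp: power_0_left)
  then show "jacobi_P a b m 1 \<noteq> 0" unfolding jacobi_P_def using gbinomial_pos[of m m a] assms by simp
  have "(\<Sum>s\<le>m. ((real m + a) gchoose (m - s)) * ((real m + b) gchoose s) * ((-1 - 1) / 2) ^ s * ((-1 + 1) / 2) ^ (m - s))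
      = (\<Sum>s\<in>{m}. ((real m + a) gchoose (m - s)) * ((real m + b) gchoose s) * ((-1 - 1) / 2) ^ s * ((-1 + 1) / 2) ^ (m - s))"
    by (rule sum.mono_neutral_right) (auto simp: power_0_left)
  then show "jacobi_P a b m (-1) \<noteq> 0" unfolding jacobi_P_def using gbinomial_pos[of m m b] assms by simp
qed

lemma jacobi_P_0: "jacobi_P a b 0 x = 1"
  by (simp add: jacobi_P_def)

lemma jacobi_P_1: "jacobi_P a b 1 1 = of_real (a + 1)" "jacobi_P a b 1 (-1) = of_real (- (b + 1))"
  by (simp_all add: jacobi_P_def One_nat_def gbinomial_1)

text \<open>\<ell> maps polynomials to polynomials, so an eigenvalue equation at infinitely many
  points is an identity, and the coefficient of x^m determines z. The points are supplied by the
  operator A, for which the equation holds almost everywhere; the explicit sum is not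
  differentiated.\<close>

lemma jacobi_P_eigen:
  assumes ab: "a > 0" "b > 0"
    and inf: "infinite {x \<in> {-1<..<1}. jacobi_ell a b (jacobi_P a b m) x = z * jacobi_P a b m x}"
  shows "z = of_real (jacobi_ev a b m)"
    and "x \<in> {-1<..<1} \<Longrightarrow> jacobi_ell a b (jacobi_P a b m) x = z * jacobi_P a b m x"
proof -
  obtain q where q: "degree q = m" "jacobi_P a b m = (\<lambda>x. poly q (of_real x))" using jacobi_P_poly[OF ab] .
  define L where "L = - ([:1, 0, -1:] * pderiv (pderiv q) + [:of_real (b - a), - of_real (a + b + 2):] * pderiv q)"
  have L: "jacobi_ell a b (jacobi_P a b m) x = poly L (of_real x)" if x: "x \<in> {-1<..<1}" for x
  proof -
    have d: "nth_deriv 1 (jacobi_P a b m) differentiable (at x)"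
      using times_diff_poly[of 2 q] x unfolding q(2) by (auto simp: times_diff_def)
    show ?thesis
      unfolding jacobi_ell_eq[OF x d] unfolding q(2) nth_deriv_poly L_def drift_def
      by (simp add: numeral_2_eq_2 One_nat_def power2_eq_square algebra_simps)
  qed
  have "infinite {y. poly (L - smult z q) y = 0}"
  proof
    assume fin: "finite {y. poly (L - smult z q) y = 0}"
    have "complex_of_real ` {x \<in> {-1<..<1}. jacobi_ell a b (jacobi_P a b m) x = z * jacobi_P a b m x} \<subseteq> {y. poly (L - smult z q) y = 0}"
      using L q(2) by auto
    from finite_subset[OF this fin] inf show False
      using finite_imageD[of complex_of_real] by (meson inj_onI of_real_eq_iff)
  qed
  then have Lq: "L = smult z q" using poly_roots_finite[of "L - smult z q"] by auto
  have nz: "coeff q m \<noteq> 0"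
  proof
    assume "coeff q m = 0"
    then have "q = 0" using q(1) leading_coeff_0_iff[of q] by simp
    then have "jacobi_P a b m 1 = 0" using q(2) by simp
    then show False using jacobi_P_endpoints(1)[OF ab] by simp
  qed
  have z0: "coeff q k = 0" if "k > m" for k using that q(1) by (simp add: coeff_eq_0)
  have "coeff L m = of_real (jacobi_ev a b m) * coeff q m"
  proof (cases m)
    case 0
    then have "pderiv q = 0" using q(1) by (simp add: pderiv_eq_0_iff)
    then show ?thesis using 0 by (simp add: L_def)
  next
    case (Suc m1)
    show ?thesis
    proof (cases m1)
      case 0
      then show ?thesis using Suc z0[of 2] z0[of 3]
        by (simp add: L_def coeff_pderiv jacobi_ev_def numeral_2_eq_2 numeral_3_eq_3 One_nat_def algebra_simps)
    next
      case (Suc m2)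
      then show ?thesis using \<open>m = Suc m1\<close> z0[of "Suc m"] z0[of "Suc (Suc m)"]
        by (simp add: L_def coeff_pderiv jacobi_ev_def algebra_simps)
    qed
  qed
  then show zz: "z = of_real (jacobi_ev a b m)" using nz by (simp add: Lq)
  show "x \<in> {-1<..<1} \<Longrightarrow> jacobi_ell a b (jacobi_P a b m) x = z * jacobi_P a b m x"
    using L[of x] Lq q(2) by simp
qed

section \<open>Regularity\<close>

lemma nth_deriv_1_Suc: "nth_deriv 1 (nth_deriv (j + 1) f) = nth_deriv (j + 2) f"
  using nth_deriv_add[of 1 "j + 1" f] by (simp add: numeral_2_eq_2 One_nat_def)

definition AC_upto :: "nat \<Rightarrow> (real \<Rightarrow> complex) \<Rightarrow> bool" where
  "AC_upto m f \<longleftrightarrow> (\<forall>k<m. nth_deriv k f \<in> AC_loc)"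

lemma AC_upto_mono: "AC_upto m f \<Longrightarrow> k \<le> m \<Longrightarrow> AC_upto k f"
  by (auto simp: AC_upto_def)

text \<open>A derivative is differentiable at every point if the next one is absolutely continuous
  as well, which costs one order; at the top order only \<open>AC_upto_top_ae\<close>
  remains.\<close>

lemma AC_upto_times_diff:
  assumes "AC_upto (Suc m) f" shows "times_diff m f"
  unfolding times_diff_def
proof (intro allI impI ballI)
  fix k x assume "k < m" "x \<in> {-1<..<1::real}"
  then have "(nth_deriv k f has_vector_derivative nth_deriv 1 (nth_deriv k f) x) (at x)"
    using assms by (intro AC_loc_nth_deriv_has_derivative) (auto simp: AC_upto_def simp flip: nth_deriv_Suc)
  then show "nth_deriv k f differentiable (at x)" by (rule differentiableI_vector)
qed

lemma AC_upto_top_ae: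
  assumes "AC_upto (Suc m) f"
  shows "\<exists>N. negligible N \<and> (\<forall>x\<in>{-1<..<1} - N. nth_deriv m f differentiable (at x))"
proof -
  have "nth_deriv m f \<in> AC_loc" using assms by (simp add: AC_upto_def)
  from AC_loc_derivative_ae[OF this] show ?thesis using differentiableI_vector by metis
qed

lemma AC_loc_of_real_drift: "(\<lambda>x. complex_of_real (drift a b x)) \<in> AC_loc"
proof (rule AC_loc_C1[where f' = "\<lambda>x. of_real (- (a + b + 2))"])
  show "((\<lambda>x. complex_of_real (drift a b x)) has_vector_derivative of_real (- (a + b + 2))) (at x)" for x
    unfolding drift_def by (intro has_vector_derivative_of_real) (auto intro!: derivative_eq_intros)
qed simp

lemma AC_loc_of_real_rho: "(\<lambda>x. complex_of_real (1 - x\<^sup>2)) \<in> AC_loc"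
proof (rule AC_loc_C1[where f' = "\<lambda>x. of_real (- 2 * x)"])
  show "((\<lambda>x. complex_of_real (1 - x\<^sup>2)) has_vector_derivative of_real (- 2 * x)) (at x)" for x
    by (intro has_vector_derivative_of_real) (auto intro!: derivative_eq_intros)
qed (intro continuous_intros)

lemma one_minus_square_pos: "x \<in> {-1<..<1} \<Longrightarrow> 1 - x\<^sup>2 > (0::real)"
  by (simp add: abs_square_less_1 abs_less_iff)

lemma AC_loc_of_real_inverse_rho: "(\<lambda>x. complex_of_real (1 / (1 - x\<^sup>2))) \<in> AC_loc"
proof (rule AC_loc_C1[where f' = "\<lambda>x. of_real (2 * x / (1 - x\<^sup>2)\<^sup>2)"])
  fix x :: real assume x: "x \<in> {-1<..<1}"
  have "((\<lambda>x. 1 / (1 - x\<^sup>2)) has_real_derivative 2 * x / (1 - x\<^sup>2)\<^sup>2) (at x)"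
    using one_minus_square_pos[OF x] by (auto intro!: derivative_eq_intros simp: power2_eq_square field_simps)
  then show "((\<lambda>x. complex_of_real (1 / (1 - x\<^sup>2))) has_vector_derivative of_real (2 * x / (1 - x\<^sup>2)\<^sup>2)) (at x)"
    by (rule has_vector_derivative_of_real)
next
  show "continuous_on {-1<..<1} (\<lambda>x. complex_of_real (2 * x / (1 - x\<^sup>2)\<^sup>2))"
    by (intro continuous_intros) (use one_minus_square_pos in fastforce)
qed

lemma AC_upto_jacobi_ell:
  assumes "AC_upto (m + 2) f"
  shows "AC_upto m (jacobi_ell a b f)"
  unfolding AC_upto_def
proof (intro allI impI)
  fix j assume j: "j < m"
  have A: "nth_deriv i f \<in> AC_loc" if "i \<le> j + 2" for i using assms j that by (auto simp: AC_upto_def)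
  have td: "times_diff (j + 2) f"
    by (rule AC_upto_times_diff) (use assms j in \<open>auto elim!: AC_upto_mono\<close>)
  show "nth_deriv j (jacobi_ell a b f) \<in> AC_loc"
  proof (rule AC_loc_cong)
    show "(\<lambda>x. (-1) * (of_real (1 - x\<^sup>2) * nth_deriv (j + 2) f x + of_real (drift (a + j) (b + j) x) * nth_deriv (j + 1) f x)
    + of_real (jacobi_ev a b j) * nth_deriv j f x) \<in> AC_loc"
      by (intro AC_loc_add AC_loc_mult AC_loc_const AC_loc_of_real_drift AC_loc_of_real_rho A) auto
    fix x :: real assume "x \<in> {-1<..<1}"
    then show "nth_deriv j (jacobi_ell a b f) x = (-1) * (of_real (1 - x\<^sup>2) * nth_deriv (j + 2) f x 
       + of_real (drift (a + j) (b + j) x) * nth_deriv (j + 1) f x) + of_real (jacobi_ev a b j) * nth_deriv j f x"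
      using td by (subst nth_deriv_jacobi_ell) (auto simp: times_diff_def)
  qed
qed

lemma AC_upto_jacobi_ell_pow:
  assumes "AC_upto (m + 2 * i) f"
  shows "AC_upto m ((jacobi_ell a b ^^ i) f)"
  using assms
proof (induction i arbitrary: m)
  case (Suc i)
  have "AC_upto (m + 2) ((jacobi_ell a b ^^ i) f)" using Suc by (intro Suc.IH) (simp add: algebra_simps)
  then show ?case by (simp add: AC_upto_jacobi_ell)
qed simp

lemma second_derivative_eq:
  assumes "x \<in> {-1<..<1}" "u = - (complex_of_real (1 - x\<^sup>2) * y + v) + w"
  shows "y = of_real (1 / (1 - x\<^sup>2)) * (- u - v + w)"
proof -
  have "complex_of_real (1 - x\<^sup>2) \<noteq> 0" using one_minus_square_pos[OF assms(1)] by (metis less_irrefl of_real_eq_0_iff)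
  moreover have "complex_of_real (1 - x\<^sup>2) * y = - u - v + w" unfolding assms(2) by simp
  ultimately show ?thesis by (simp add: field_simps)
qed

text \<open>Solved for f'', the equation shows that f'' agrees almost everywhere with a continuous
  function. Hence f' is continuously differentiable and the equation holds at every point.\<close>

lemma jacobi_ell_eq_everywhere:
  assumes f: "AC_upto 2 f" and g: "g \<in> AC_loc" and N: "negligible N"
    and eq: "\<And>x. x \<in> {-1<..<1} - N \<Longrightarrow> jacobi_ell a b f x = g x" and x: "x \<in> {-1<..<1}"
  shows "nth_deriv 1 f differentiable (at x)" "jacobi_ell a b f x = g x"
proof -
  let ?r = "\<lambda>x. of_real (1 / (1 - x\<^sup>2)) * (- g x - of_real (drift a b x) * nth_deriv 1 f x + 0)"
  have f1: "nth_deriv 1 f \<in> AC_loc" using f by (simp add: AC_upto_def)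
  obtain N' where N': "negligible N'" "\<And>x. x\<in>{-1<..<1} - N' \<Longrightarrow> nth_deriv 1 f differentiable (at x)"
    using AC_upto_top_ae[of 1 f] f by (auto simp: numeral_2_eq_2 One_nat_def)
  have e: "nth_deriv 2 f x = ?r x" if "x \<in> {-1<..<1} - (N \<union> N')" for x
    using that jacobi_ell_eq[of x f a b] N'(2)[of x] eq[of x] by (intro second_derivative_eq) auto
  have h: "(nth_deriv 1 f has_vector_derivative ?r x) (at x)"
  proof (rule AC_loc_C1_if_derivative_continuous[OF f1])
    show "continuous_on {-1<..<1} ?r"
      by (intro AC_loc_continuous continuous_intros AC_loc_of_real_inverse_rho AC_loc_of_real_drift f1 g)
    show "negligible (N \<union> N')" using N N' by simp
    show "nth_deriv 1 (nth_deriv 1 f) x = ?r x" if "x \<in> {-1<..<1} - (N \<union> N')" for x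
      using e[OF that] by (simp flip: nth_deriv_add)
  qed (rule x)
  then show d: "nth_deriv 1 f differentiable (at x)" by (rule differentiableI_vector)
  have "(1 - x\<^sup>2) * (1 / (1 - x\<^sup>2)) = 1" using one_minus_square_pos[OF x] by simp
  then have "complex_of_real (1 - x\<^sup>2) * complex_of_real (1 / (1 - x\<^sup>2)) = 1" by (metis of_real_mult of_real_1)
  moreover have "nth_deriv 2 f x = ?r x" using has_vector_derivative_nth_deriv_1[OF h] by (simp flip: nth_deriv_add)
  ultimately have "of_real (1 - x\<^sup>2) * nth_deriv 2 f x = - g x - of_real (drift a b x) * nth_deriv 1 f x"
    by (simp only: mult.assoc[symmetric]) simp
  then show "jacobi_ell a b f x = g x" by (simp add: jacobi_ell_eq[OF x d])
qed

text \<open>The j-th derivative of the equation, solved for the derivative of f of order j + 2,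
  expresses it by lower derivatives of f and the j-th one of g, all locally absolutely continuous.
  The formula holds almost everywhere first and is upgraded by continuity.\<close>

lemma AC_upto_lift:
  assumes f: "AC_upto 2 f" and g: "AC_upto m g"
    and eq: "\<And>x. x \<in> {-1<..<1} \<Longrightarrow> jacobi_ell a b f x = g x"
  shows "AC_upto (m + 2) f"
proof -
  have "nth_deriv k f \<in> AC_loc" if "k < m + 2" for k
    using that
  proof (induction k rule: less_induct)
    case (less k)
    show ?case
    proof (cases "k < 2")
      case True then show ?thesis using f by (simp add: AC_upto_def)
    next
      case False
      then obtain j where j: "k = j + 2" by (metis add.commute le_Suc_ex not_less)
      have jm: "j < m" using less.prems j by simp
      have A: "nth_deriv i f \<in> AC_loc" if "i < j + 2" for i using less that j by simp
      then have acj: "AC_upto (Suc (Suc j)) f" by (simp add: AC_upto_def)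
      then have td: "times_diff (j + 1) f" using AC_upto_times_diff[of "Suc j" f] by (simp add: One_nat_def)
      let ?r = "\<lambda>x. of_real (1 / (1 - x\<^sup>2)) * ((-1) * nth_deriv j g x + (-1) * (of_real (drift (a + j) (b + j) x) * nth_deriv (j + 1) f x)
        + of_real (jacobi_ev a b j) * nth_deriv j f x)"
      have r: "?r \<in> AC_loc"
        using g jm by (intro AC_loc_add AC_loc_mult AC_loc_const AC_loc_of_real_inverse_rho AC_loc_of_real_drift A) (auto simp: AC_upto_def)
      obtain N where N: "negligible N" "\<And>x. x\<in>{-1<..<1} - N \<Longrightarrow> nth_deriv (j + 1) f differentiable (at x)"
        using AC_upto_top_ae[OF acj] by (auto simp: One_nat_def)
      have e: "nth_deriv (j + 2) f x = ?r x" if x: "x \<in> {-1<..<1} - N" for x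
      proof -
        have "nth_deriv j g x = nth_deriv j (jacobi_ell a b f) x"
          by (rule nth_deriv_cong) (use eq x in auto)
        then have "nth_deriv j g x = - (of_real (1 - x\<^sup>2) * nth_deriv (j + 2) f x + of_real (drift (a + j) (b + j) x) * nth_deriv (j + 1) f x)
          + of_real (jacobi_ev a b j) * nth_deriv j f x"
          using nth_deriv_jacobi_ell[OF td, of x a b] N(2)[OF x] x by auto
        then show ?thesis using x by (subst second_derivative_eq[of x]) auto
      qed
      have "nth_deriv (j + 2) f x = ?r x" if x: "x \<in> {-1<..<1}" for x
      proof -
        have "(nth_deriv (j + 1) f has_vector_derivative ?r x) (at x)"
        proof (rule AC_loc_C1_if_derivative_continuous[OF A AC_loc_continuous[OF r] N(1) _ x])
          show "nth_deriv 1 (nth_deriv (j + 1) f) y = ?r y" if "y \<in> {-1<..<1} - N" for y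
            using e[OF that] by (simp only: nth_deriv_1_Suc)
        qed simp
        from has_vector_derivative_nth_deriv_1[OF this] show ?thesis by (simp only: nth_deriv_1_Suc)
      qed
      then show ?thesis unfolding j by (rule AC_loc_cong[OF r])
    qed
  qed
  then show ?thesis by (simp add: AC_upto_def)
qed

section \<open>Weighted bounds\<close>

text \<open>The class O(J(a,b)) on the whole interval, with separate exponents at 1 and at -1;
  larger exponents mean stronger bounds.\<close>

definition bigJ :: "real \<Rightarrow> real \<Rightarrow> (real \<Rightarrow> complex) \<Rightarrow> bool" where
  "bigJ a b f \<longleftrightarrow> (\<exists>C\<ge>0. \<forall>x\<in>{-1<..<1}. norm (f x) \<le> C * jacobi_weight a b x)"

lemma bigJI: "(\<And>x. x \<in> {-1<..<1} \<Longrightarrow> norm (f x) \<le> C * jacobi_weight a b x) \<Longrightarrow> bigJ a b f"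
  unfolding bigJ_def
proof (intro exI[of _ "max 0 C"] conjI ballI)
  fix x :: real assume x: "x \<in> {-1<..<1}" and H: "\<And>x. x \<in> {-1<..<1} \<Longrightarrow> norm (f x) \<le> C * jacobi_weight a b x"
  have "C * jacobi_weight a b x \<le> max 0 C * jacobi_weight a b x"
    using jacobi_weight_pos[OF x, of a b] by (intro mult_right_mono) auto
  then show "norm (f x) \<le> max 0 C * jacobi_weight a b x" using H[OF x] by linarith
qed simp

lemma bigJ_add:
  assumes "bigJ a b f" "bigJ a b g" shows "bigJ a b (\<lambda>x. f x + g x)"
proof -
  obtain C D where C: "\<And>x. x \<in> {-1<..<1} \<Longrightarrow> norm (f x) \<le> C * jacobi_weight a b x"
    and D: "\<And>x. x \<in> {-1<..<1} \<Longrightarrow> norm (g x) \<le> D * jacobi_weight a b x"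
    using assms unfolding bigJ_def by blast
  show ?thesis
  proof (rule bigJI[of _ "C + D"])
    fix x :: real assume x: "x \<in> {-1<..<1}"
    have "norm (f x + g x) \<le> norm (f x) + norm (g x)" by (rule norm_triangle_ineq)
    then show "norm (f x + g x) \<le> (C + D) * jacobi_weight a b x" using C[OF x] D[OF x] by (simp add: distrib_right)
  qed
qed

lemma bigJ_mult:
  assumes "bigJ a b f" "bigJ c d g" shows "bigJ (a + c) (b + d) (\<lambda>x. f x * g x)"
proof -
  obtain C D where C: "C \<ge> 0" "\<And>x. x \<in> {-1<..<1} \<Longrightarrow> norm (f x) \<le> C * jacobi_weight a b x"
    and D: "D \<ge> 0" "\<And>x. x \<in> {-1<..<1} \<Longrightarrow> norm (g x) \<le> D * jacobi_weight c d x"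
    using assms unfolding bigJ_def by blast
  show ?thesis
  proof (rule bigJI[of _ "C * D"])
    fix x :: real assume x: "x \<in> {-1<..<1}"
    have "norm (f x * g x) \<le> (C * jacobi_weight a b x) * (D * jacobi_weight c d x)"
      unfolding norm_mult using C D x jacobi_weight_pos[OF x, of a b] by (intro mult_mono) auto
    then show "norm (f x * g x) \<le> C * D * jacobi_weight (a + c) (b + d) x"
      by (simp add: jacobi_weight_add[OF x] mult.assoc mult.left_commute)
  qed
qed

lemma jacobi_weight_le_2:
  assumes "x \<in> {-1<..<1}" "a \<ge> 0" "b \<ge> 0"
  shows "jacobi_weight a b x \<le> 2 powr a * 2 powr b"
  unfolding jacobi_weight_def using assms by (intro mult_mono powr_mono2) auto

lemma bigJ_mono:
  assumes f: "bigJ a b f" and "c \<le> a" "d \<le> b" shows "bigJ c d f"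
proof -
  obtain C where C: "C \<ge> 0" "\<And>x. x \<in> {-1<..<1} \<Longrightarrow> norm (f x) \<le> C * jacobi_weight a b x"
    using f unfolding bigJ_def by blast
  show ?thesis
  proof (rule bigJI)
    fix x :: real assume x: "x \<in> {-1<..<1}"
    have "jacobi_weight a b x = jacobi_weight c d x * jacobi_weight (a - c) (b - d) x"
      using jacobi_weight_add[OF x, of c "a - c" d "b - d"] by simp
    also have "\<dots> \<le> jacobi_weight c d x * (2 powr (a - c) * 2 powr (b - d))"
      using assms x jacobi_weight_pos[OF x, of c d] by (intro mult_left_mono jacobi_weight_le_2) auto
    finally have "C * jacobi_weight a b x \<le> C * (jacobi_weight c d x * (2 powr (a - c) * 2 powr (b - d)))"
      using C(1) by (rule mult_left_mono)
    also have "\<dots> = C * (2 powr (a - c) * 2 powr (b - d)) * jacobi_weight c d x" by (simp only: ac_simps)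
    finally show "norm (f x) \<le> C * (2 powr (a - c) * 2 powr (b - d)) * jacobi_weight c d x"
      using C(2)[OF x] by linarith
  qed
qed

lemma bigJ_cweight: "bigJ a b (cweight a b)"
  by (rule bigJI[of _ 1]) (use jacobi_weight_pos in \<open>auto simp: less_imp_le\<close>)

lemma bigJ_bounded: "(\<And>x. x \<in> {-1<..<1} \<Longrightarrow> norm (f x) \<le> C) \<Longrightarrow> bigJ 0 0 f"
  by (rule bigJI[of _ C]) (simp add: jacobi_weight_def)

lemma bigJ_continuous: "continuous_on {-1..1} f \<Longrightarrow> bigJ 0 0 f"
proof -
  assume "continuous_on {-1..1} f"
  then have "bounded (f ` {-1..1})" by (intro compact_imp_bounded compact_continuous_image) auto
  then obtain B where "\<forall>x\<in>f ` {-1..1}. norm x \<le> B" by (auto simp: bounded_iff)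
  then show "bigJ 0 0 f" by (intro bigJ_bounded[of f B]) auto
qed

lemma bigJ_cong: "bigJ a b f \<Longrightarrow> (\<And>x. x \<in> {-1<..<1} \<Longrightarrow> g x = f x) \<Longrightarrow> bigJ a b g"
  by (auto simp: bigJ_def)

lemma bigJ_mult_bounded: "bigJ 0 0 g \<Longrightarrow> bigJ a b f \<Longrightarrow> bigJ a b (\<lambda>x. g x * f x)"
  using bigJ_mult[of 0 0 g a b f] by simp

lemma bigJ_tendsto:
  assumes f: "bigJ a b f" and ab: "a > 0" "b > 0"
  shows "(f \<longlongrightarrow> 0) (at_left 1)" "(f \<longlongrightarrow> 0) (at_right (-1))"
proof -
  obtain C where C: "C \<ge> 0" "\<And>x. x \<in> {-1<..<1} \<Longrightarrow> norm (f x) \<le> C * jacobi_weight a b x"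
    using f unfolding bigJ_def by blast
  have "continuous_on UNIV (\<lambda>x. C * (max 0 (1 - x) powr a * max 0 (1 + x) powr b))"
    using ab by (intro continuous_intros continuous_on_powr') auto
  then have lim: "((\<lambda>x. C * (max 0 (1 - x) powr a * max 0 (1 + x) powr b)) \<longlongrightarrow> C * (max 0 (1 - x) powr a * max 0 (1 + x) powr b)) (at x within S)" for x S
    by (intro continuous_on_tendsto_compose[of UNIV "\<lambda>x. C * (max 0 (1 - x) powr a * max 0 (1 + x) powr b)" "\<lambda>x. x"] tendsto_ident_at) auto
  have le: "norm (f x) \<le> C * (max 0 (1 - x) powr a * max 0 (1 + x) powr b)" if "x \<in> {-1<..<1}" for x
    using C(2)[OF that] that by (simp add: jacobi_weight_def)
  show "(f \<longlongrightarrow> 0) (at_left 1)"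
    by (rule Lim_null_comparison[OF eventually_mono[OF eventually_at_left_real[of "-1"] le]])
      (use lim[of 1] ab in simp_all)
  show "(f \<longlongrightarrow> 0) (at_right (-1))"
    by (rule Lim_null_comparison[OF eventually_mono[OF eventually_at_right_real[of _ 1] le]])
      (use lim[of "-1"] ab in simp_all)
qed

text \<open>Integration from 0 yields (C / a) (1-x)^(-a); the value at 0 is absorbed because
  (1-x)^(-a) is at least 1.\<close>

lemma one_sided_bound:
  assumes d: "\<And>x. x \<in> {-1<..<1} \<Longrightarrow> (f has_vector_derivative f' x) (at x)"
    and le: "\<And>x. x \<in> {0<..<1} \<Longrightarrow> norm (f' x) \<le> C * (1 - x) powr (-a-1)" and a: "a > 0" and C: "C \<ge> 0"
    and x: "x \<in> {0..<1}"
  shows "norm (f x) \<le> (norm (f 0) + C / a) * (1 - x) powr (-a)"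
proof -
  define \<phi> where "\<phi> t = (C / a) * (1 - t) powr (-a)" for t
  have df: "(f has_vector_derivative f' t) (at t)" if "t \<in> {0..x}" for t using d[of t] that x by auto
  have d\<phi>: "(\<phi> has_vector_derivative C * (1 - t) powr (-a-1)) (at t)" if "t \<in> {0..x}" for t
    unfolding \<phi>_def has_real_derivative_iff_has_vector_derivative[symmetric] using that x a
    by (auto intro!: derivative_eq_intros)
  have ge1: "(1 - x) powr (-a) \<ge> 1"
  proof -
    have "(1 - x) powr a \<le> 1" using x a by (intro powr_le1) auto
    then show ?thesis using x by (simp add: powr_minus one_le_inverse_iff)
  qed
  have "norm (f x - f 0) \<le> \<phi> x - \<phi> 0"
  proof (cases "x = 0")
    case False
    show ?thesis
    proof (rule differentiable_bound_general[of 0 x f \<phi> f' "\<lambda>t. C * (1 - t) powr (-a-1)"])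
      show "continuous_on {0..x} f" "continuous_on {0..x} \<phi>"
        by (intro continuous_at_imp_continuous_on ballI has_vector_derivative_continuous[OF df]
            has_vector_derivative_continuous[OF d\<phi>]; assumption)+
    qed (use df d\<phi> le x False in auto)
  qed simp
  also have "\<dots> \<le> C / a * (1 - x) powr (-a)" using a C by (simp add: \<phi>_def)
  finally have "norm (f x) \<le> norm (f 0) + C / a * (1 - x) powr (-a)"
    using norm_triangle_ineq2[of "f x" "f 0"] by linarith
  also have "norm (f 0) \<le> norm (f 0) * (1 - x) powr (-a)" using ge1 mult_left_mono[OF ge1, of "norm (f 0)"] by simp
  finally show ?thesis by (simp add: distrib_right)
qed

text \<open>Integration gains one power at each end. As a and b are positive the resulting bound
  still blows up, so the constant of integration is absorbed. The left end is treated as the right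
  end of the reflected function.\<close>

lemma bigJ_antiderivative:
  assumes d: "\<And>x. x \<in> {-1<..<1} \<Longrightarrow> (f has_vector_derivative f' x) (at x)"
    and f': "bigJ (-a-1) (-b-1) f'" and ab: "a > 0" "b > 0"
  shows "bigJ (-a) (-b) f"
proof -
  obtain C where C: "C \<ge> 0" "\<And>x. x \<in> {-1<..<1} \<Longrightarrow> norm (f' x) \<le> C * jacobi_weight (-a-1) (-b-1) x"
    using f' unfolding bigJ_def by blast
  have small: "y powr (-c-1) \<le> 1" if "y \<ge> 1" "c > 0" for y c :: real
    using that powr_mono[of "-c-1" 0 y] by simp
  have right: "norm (f x) \<le> (norm (f 0) + C / a) * (1 - x) powr (-a)" if x: "x \<in> {0..<1}" for x
  proof (rule one_sided_bound[OF d _ ab(1) C(1) x])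
    fix x :: real assume x: "x \<in> {0<..<1}"
    have "jacobi_weight (-a-1) (-b-1) x \<le> (1 - x) powr (-a-1) * 1"
      unfolding jacobi_weight_def using x ab by (intro mult_left_mono small) auto
    then show "norm (f' x) \<le> C * (1 - x) powr (-a-1)"
      using C(2)[of x] x mult_left_mono[OF _ C(1)] by (fastforce intro: order_trans)
  qed
  have left: "norm (f (- x)) \<le> (norm (f (- 0)) + C / b) * (1 - x) powr (-b)" if x: "x \<in> {0..<1}" for x
  proof (rule one_sided_bound[of "\<lambda>x. f (- x)" "\<lambda>x. - f' (- x)", OF _ _ ab(2) C(1) x])
    fix x :: real assume "x \<in> {-1<..<1}"
    then have "(f has_vector_derivative f' (- x)) (at (- x))" by (intro d) auto
    moreover have "((\<lambda>x::real. - x) has_vector_derivative -1) (at x)"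
      by (auto intro!: derivative_eq_intros)
    ultimately show "((\<lambda>x. f (- x)) has_vector_derivative - f' (- x)) (at x)"
      using vector_diff_chain_at[of "\<lambda>x. - x" "-1" x f "f' (- x)"] by (simp add: o_def)
  next
    fix x :: real assume x: "x \<in> {0<..<1}"
    have "jacobi_weight (-a-1) (-b-1) (-x) \<le> 1 * (1 - x) powr (-b-1)"
      unfolding jacobi_weight_def using x ab small[of "1 + x" a] by (intro mult_mono) auto
    then show "norm (- f' (- x)) \<le> C * (1 - x) powr (-b-1)"
      using C(2)[of "-x"] x mult_left_mono[OF _ C(1)] by (fastforce intro: order_trans)
  qed
  have big: "1 \<le> 2 powr c * y powr (-c)" if "0 < y" "y < 2" "c > 0" for y c :: real
  proof -
    have "y powr c \<le> 2 powr c" using that by (intro powr_mono2) auto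
    then show ?thesis using that by (simp add: powr_minus field_simps)
  qed
  define A where "A = norm (f 0) + C / a"
  define B where "B = norm (f 0) + C / b"
  have AB: "A \<ge> 0" "B \<ge> 0" using ab C by (simp_all add: A_def B_def)
  show ?thesis
  proof (rule bigJI[of _ "A * 2 powr b + B * 2 powr a"])
    fix x :: real assume x: "x \<in> {-1<..<1}"
    have nn: "0 \<le> A * 2 powr b * jacobi_weight (-a) (-b) x" "0 \<le> B * 2 powr a * jacobi_weight (-a) (-b) x"
      using AB jacobi_weight_pos[OF x, of "-a" "-b"] by simp_all
    show "norm (f x) \<le> (A * 2 powr b + B * 2 powr a) * jacobi_weight (-a) (-b) x"
    proof (cases "x \<ge> 0")
      case True
      then have "norm (f x) \<le> A * (1 - x) powr (-a) * 1" using right[of x] x by (simp add: A_def)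
      also have "\<dots> \<le> A * (1 - x) powr (-a) * (2 powr b * (1 + x) powr (-b))"
        using x AB ab by (intro mult_left_mono big) auto
      also have "\<dots> = A * 2 powr b * jacobi_weight (-a) (-b) x" by (simp add: jacobi_weight_def algebra_simps)
      finally show ?thesis using nn by (simp add: distrib_right)
    next
      case False
      then have "norm (f x) \<le> B * (1 + x) powr (-b) * 1" using left[of "-x"] x by (simp add: B_def)
      also have "\<dots> \<le> B * (1 + x) powr (-b) * (2 powr a * (1 - x) powr (-a))"
        using x AB ab by (intro mult_left_mono big) auto
      also have "\<dots> = B * 2 powr a * jacobi_weight (-a) (-b) x" by (simp add: jacobi_weight_def algebra_simps)
      finally show ?thesis using nn by (simp add: distrib_right)
    qed
  qed
qed

section \<open>Weighted square integrability\<close>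

lemma continuous_measurable_lebesgue_on:
  fixes f :: "real \<Rightarrow> 'a::euclidean_space"
  assumes "continuous_on {-1<..<1} f" shows "f \<in> borel_measurable (lebesgue_on {-1<..<1})"
  using assms by (rule continuous_imp_measurable_on_sets_lebesgue) simp

lemma continuous_jacobi_weight: "S \<subseteq> {-1<..<1} \<Longrightarrow> continuous_on S (jacobi_weight a b)"
  by (intro continuous_at_imp_continuous_on ballI DERIV_isCont[OF jacobi_weight_has_derivative]) auto

lemma measurable_jacobi_measure:
  "f \<in> borel_measurable (jacobi_measure a b) \<longleftrightarrow> f \<in> borel_measurable (lebesgue_on {-1<..<1})"
  by (simp add: jacobi_measure_def)

lemma measurable_jacobi_weight: "jacobi_weight a b \<in> borel_measurable (lebesgue_on {-1<..<1})"
  by (intro continuous_measurable_lebesgue_on continuous_jacobi_weight) simp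

lemma integrable_lebesgue_on_iff:
  fixes f :: "real \<Rightarrow> 'a::euclidean_space"
  shows "integrable (lebesgue_on {-1<..<1}) f \<longleftrightarrow> f absolutely_integrable_on {-1<..<1}"
  unfolding set_integrable_def by (rule integrable_restrict_space) simp

lemma integrable_jacobi_measure:
  fixes f :: "real \<Rightarrow> 'a::euclidean_space"
  assumes "f \<in> borel_measurable (lebesgue_on {-1<..<1})"
  shows "integrable (jacobi_measure a b) f \<longleftrightarrow> (\<lambda>x. jacobi_weight a b x *\<^sub>R f x) absolutely_integrable_on {-1<..<1}"
proof -
  have "integrable (jacobi_measure a b) f \<longleftrightarrow> integrable (lebesgue_on {-1<..<1}) (\<lambda>x. jacobi_weight a b x *\<^sub>R f x)"
    unfolding jacobi_measure_def using assms measurable_jacobi_weight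
    by (intro integrable_density) (auto intro!: AE_I2 simp: less_imp_le jacobi_weight_pos)
  then show ?thesis by (simp only: integrable_lebesgue_on_iff)
qed

lemma integral_jacobi_measure:
  fixes f :: "real \<Rightarrow> complex"
  assumes "f \<in> borel_measurable (lebesgue_on {-1<..<1})" "integrable (jacobi_measure a b) f"
  shows "(LINT x|jacobi_measure a b. f x) = integral {-1<..<1} (\<lambda>x. jacobi_weight a b x *\<^sub>R f x)"
proof -
  have "(LINT x|jacobi_measure a b. f x) = (LINT x|lebesgue_on {-1<..<1}. jacobi_weight a b x *\<^sub>R f x)"
    unfolding jacobi_measure_def using assms measurable_jacobi_weight
    by (intro integral_density) (auto intro!: AE_I2 simp: less_imp_le jacobi_weight_pos)
  also have "\<dots> = integral {-1<..<1} (\<lambda>x. jacobi_weight a b x *\<^sub>R f x)"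
    using assms by (intro lebesgue_integral_eq_integral) (auto simp only: integrable_jacobi_measure integrable_lebesgue_on_iff lmeasurable_interval fmeasurableD)
  finally show ?thesis .
qed

lemma L2_jacobi_measure:
  "f \<in> L2 (jacobi_measure a b) \<longleftrightarrow> f \<in> borel_measurable (lebesgue_on {-1<..<1}) \<and>
     (\<lambda>x. jacobi_weight a b x * (norm (f x))\<^sup>2) absolutely_integrable_on {-1<..<1}"
proof -
  have "f \<in> borel_measurable (lebesgue_on {-1<..<1}) \<Longrightarrow> (\<lambda>x. (norm (f x))\<^sup>2) \<in> borel_measurable (lebesgue_on {-1<..<1})"
    by measurable
  then show ?thesis
    unfolding L2_def by (auto simp: measurable_jacobi_measure integrable_jacobi_measure)
qed

lemma absolutely_integrable_dominated:
  fixes f :: "real \<Rightarrow> 'a::euclidean_space" and g :: "real \<Rightarrow> real"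
  assumes "f \<in> borel_measurable (lebesgue_on {-1<..<1})" "g absolutely_integrable_on {-1<..<1}"
    and "\<And>x. x \<in> {-1<..<1} \<Longrightarrow> norm (f x) \<le> g x"
  shows "f absolutely_integrable_on {-1<..<1}"
  by (rule measurable_bounded_by_integrable_imp_absolutely_integrable)
    (use assms set_lebesgue_integral_eq_integral(1) in auto)

lemma absolutely_integrable_bounded:
  fixes f :: "real \<Rightarrow> 'a::euclidean_space"
  assumes "f \<in> borel_measurable (lebesgue_on {-1<..<1})"
    and "\<And>x. x \<in> {-1<..<1} \<Longrightarrow> norm (f x) \<le> C"
  shows "f absolutely_integrable_on {-1<..<1}"
  by (rule absolutely_integrable_dominated[OF assms(1), of "\<lambda>_. C"])
    (use assms in \<open>auto intro!: absolutely_integrable_on_const\<close>)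

lemma L2_cmult_bounded:
  assumes f: "f \<in> L2 (jacobi_measure a b)" and g: "g \<in> borel_measurable (lebesgue_on {-1<..<1})"
    and le: "\<And>x. x \<in> {-1<..<1} \<Longrightarrow> norm (g x) \<le> C"
  shows "(\<lambda>x. g x * f x) \<in> L2 (jacobi_measure a b)"
  unfolding L2_jacobi_measure
proof
  have fm: "f \<in> borel_measurable (lebesgue_on {-1<..<1})" using f by (simp add: L2_jacobi_measure)
  then show m: "(\<lambda>x. g x * f x) \<in> borel_measurable (lebesgue_on {-1<..<1})" using g by measurable
  show "(\<lambda>x. jacobi_weight a b x * (norm (g x * f x))\<^sup>2) absolutely_integrable_on {-1<..<1}"
  proof (rule absolutely_integrable_dominated)
    show "(\<lambda>x. jacobi_weight a b x * (norm (g x * f x))\<^sup>2) \<in> borel_measurable (lebesgue_on {-1<..<1})"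
      using m measurable_jacobi_weight[of a b] by measurable
    show "(\<lambda>x. C\<^sup>2 * (jacobi_weight a b x * (norm (f x))\<^sup>2)) absolutely_integrable_on {-1<..<1}"
      using f by (intro set_integrable_mult_right) (simp add: L2_jacobi_measure)
    fix x :: real assume x: "x \<in> {-1<..<1}"
    have "jacobi_weight a b x * ((norm (g x))\<^sup>2 * (norm (f x))\<^sup>2) \<le> jacobi_weight a b x * (C\<^sup>2 * (norm (f x))\<^sup>2)"
      using jacobi_weight_pos[OF x, of a b] le[OF x] by (intro mult_left_mono mult_right_mono power_mono) auto
    then show "norm (jacobi_weight a b x * (norm (g x * f x))\<^sup>2) \<le> C\<^sup>2 * (jacobi_weight a b x * (norm (f x))\<^sup>2)"
      using jacobi_weight_pos[OF x, of a b] by (simp add: norm_mult power_mult_distrib mult.left_commute)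
  qed
qed

lemma L2_add:
  assumes f: "f \<in> L2 (jacobi_measure a b)" and g: "g \<in> L2 (jacobi_measure a b)"
  shows "(\<lambda>x. f x + g x) \<in> L2 (jacobi_measure a b)"
  unfolding L2_jacobi_measure
proof
  have m: "f \<in> borel_measurable (lebesgue_on {-1<..<1})" "g \<in> borel_measurable (lebesgue_on {-1<..<1})"
    using f g by (auto simp: L2_jacobi_measure)
  then show m': "(\<lambda>x. f x + g x) \<in> borel_measurable (lebesgue_on {-1<..<1})" by measurable
  show "(\<lambda>x. jacobi_weight a b x * (norm (f x + g x))\<^sup>2) absolutely_integrable_on {-1<..<1}"
  proof (rule absolutely_integrable_dominated)
    show "(\<lambda>x. jacobi_weight a b x * (norm (f x + g x))\<^sup>2) \<in> borel_measurable (lebesgue_on {-1<..<1})"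
      using m' measurable_jacobi_weight[of a b] by measurable
    show "(\<lambda>x. 2 * (jacobi_weight a b x * (norm (f x))\<^sup>2) + 2 * (jacobi_weight a b x * (norm (g x))\<^sup>2)) absolutely_integrable_on {-1<..<1}"
      using f g by (intro set_integral_add set_integrable_mult_right) (simp_all add: L2_jacobi_measure)
    fix x :: real assume x: "x \<in> {-1<..<1}"
    have "(norm (f x + g x))\<^sup>2 \<le> (norm (f x) + norm (g x))\<^sup>2" by (intro power_mono norm_triangle_ineq) auto
    also have "\<dots> \<le> 2 * (norm (f x))\<^sup>2 + 2 * (norm (g x))\<^sup>2"
      using sum_squares_bound[of "norm (f x)" "norm (g x)"] by (simp add: power2_sum)
    finally have "jacobi_weight a b x * (norm (f x + g x))\<^sup>2 \<le> jacobi_weight a b x * (2 * (norm (f x))\<^sup>2 + 2 * (norm (g x))\<^sup>2)"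
      using jacobi_weight_pos[OF x, of a b] by (intro mult_left_mono) auto
    then show "norm (jacobi_weight a b x * (norm (f x + g x))\<^sup>2) \<le>
        2 * (jacobi_weight a b x * (norm (f x))\<^sup>2) + 2 * (jacobi_weight a b x * (norm (g x))\<^sup>2)"
      using jacobi_weight_pos[OF x, of a b] by (simp add: algebra_simps)
  qed
qed

text \<open>Measurability survives a change on a null set because Lebesgue measure is
  complete.\<close>

lemma L2_AE_cong:
  assumes "f \<in> L2 (jacobi_measure a b)" and N: "negligible N" and eq: "\<And>x. x \<in> {-1<..<1} - N \<Longrightarrow> g x = f x"
  shows "g \<in> L2 (jacobi_measure a b)"
  unfolding L2_jacobi_measure
proof
  have "f \<in> borel_measurable (lebesgue_on {-1<..<1})" using assms by (simp add: L2_jacobi_measure)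
  then have "(\<lambda>x. if x \<in> {-1<..<1} then f x else 0) \<in> borel_measurable lebesgue"
    by (subst borel_measurable_if) simp_all
  then have "(\<lambda>x. if x \<in> {-1<..<1} then g x else 0) \<in> borel_measurable lebesgue"
  proof (rule borel_measurable_AE)
    show "AE x in lebesgue. (if x \<in> {-1<..<1} then f x else 0) = (if x \<in> {-1<..<1} then g x else 0)"
    proof (rule AE_I'[of N])
      show "N \<in> null_sets lebesgue" using N by (simp add: negligible_iff_null_sets)
      show "{x \<in> space lebesgue. (if x \<in> {-1<..<1} then f x else 0) \<noteq> (if x \<in> {-1<..<1} then g x else 0)} \<subseteq> N"
      proof
        fix x assume "x \<in> {x \<in> space lebesgue. (if x \<in> {-1<..<1} then f x else 0) \<noteq> (if x \<in> {-1<..<1} then g x else 0)}"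
        then have "x \<in> {-1<..<1}" "g x \<noteq> f x" by (auto split: if_splits)
        then show "x \<in> N" using eq[of x] by (metis DiffI)
      qed
    qed
  qed
  then show "g \<in> borel_measurable (lebesgue_on {-1<..<1})"
    by (subst (asm) borel_measurable_if) simp_all
  have "(\<lambda>x. jacobi_weight a b x * (norm (f x))\<^sup>2) absolutely_integrable_on {-1<..<1}"
    using assms by (simp add: L2_jacobi_measure)
  then show "(\<lambda>x. jacobi_weight a b x * (norm (g x))\<^sup>2) absolutely_integrable_on {-1<..<1}"
    by (rule absolutely_integrable_spike[OF _ N]) (auto simp: eq)
qed

lemma has_integral_le_AE:
  fixes f g :: "real \<Rightarrow> real"
  assumes f: "(f has_integral i) S" and g: "(g has_integral j) S" and N: "negligible N"
    and le: "\<And>x. x \<in> S - N \<Longrightarrow> f x \<le> g x"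
  shows "i \<le> j"
proof (rule has_integral_le)
  show "((\<lambda>x. if x \<in> N then 0 else f x) has_integral i) S" "((\<lambda>x. if x \<in> N then 0 else g x) has_integral j) S"
    by (rule has_integral_spike[OF N _ f], simp) (rule has_integral_spike[OF N _ g], simp)
qed (use le in auto)

lemma has_vector_derivative_cnj:
  "(f has_vector_derivative d) (at x) \<Longrightarrow> ((\<lambda>x. cnj (f x)) has_vector_derivative cnj d) (at x)"
  by (rule bounded_linear.has_vector_derivative[OF bounded_linear_cnj])

section \<open>Endpoint estimates from a square integrable derivative, and Hardy's
  inequality\<close>

lemma norm_le_AM_GM:
  fixes y A \<eta> :: real
  assumes "A > 0" "\<eta> > 0"
  shows "y \<le> \<eta> / 2 * (A * y\<^sup>2) + 1 / (2 * \<eta>) * (1 / A)"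
proof -
  have "0 \<le> (\<eta> * A * y - 1)\<^sup>2" by simp
  then have "y * (2 * \<eta> * A) \<le> \<eta>\<^sup>2 * A\<^sup>2 * y\<^sup>2 + 1" by (simp add: power2_diff power_mult_distrib algebra_simps)
  then have "y \<le> (\<eta>\<^sup>2 * A\<^sup>2 * y\<^sup>2 + 1) / (2 * \<eta> * A)" using assms by (simp add: le_divide_eq)
  also have "\<dots> = \<eta> / 2 * (A * y\<^sup>2) + 1 / (2 * \<eta>) * (1 / A)"
    using assms by (simp add: field_simps power2_eq_square)
  finally show ?thesis .
qed

lemma jacobi_weight_minus: "x \<in> {-1<..<1} \<Longrightarrow> jacobi_weight (-a) (-b) x = 1 / jacobi_weight a b x"
  by (simp add: jacobi_weight_def powr_minus field_simps)

text \<open>Cauchy-Schwarz in the form of the arithmetic-geometric mean inequality with a free parameter \<open>\<eta>\<close>.\<close>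

lemma AC_loc_increment:
  assumes F: "F \<in> AC_loc"
    and K: "(\<lambda>x. jacobi_weight (-g) (-d) x * (norm (nth_deriv 1 F x))\<^sup>2) absolutely_integrable_on {-1<..<1}"
    and st: "-1 < s" "s \<le> t" "t < 1" and m: "integral {s..t} (jacobi_weight g d) \<le> m" and eta: "\<eta> > 0"
  shows "norm (F t - F s) \<le> \<eta> / 2 * integral {-1<..<1} (\<lambda>x. jacobi_weight (-g) (-d) x * (norm (nth_deriv 1 F x))\<^sup>2) + m / (2 * \<eta>)"
proof -
  let ?K = "\<lambda>x. jacobi_weight (-g) (-d) x * (norm (nth_deriv 1 F x))\<^sup>2"
  have KI: "?K integrable_on {-1<..<1}" using K set_lebesgue_integral_eq_integral(1) by blast
  have sub: "{s..t} \<subseteq> {-1<..<1}" using st by auto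
  have Kst: "?K integrable_on {s..t}" by (rule integrable_on_subinterval[OF KI sub])
  have Jst: "jacobi_weight g d integrable_on {s..t}"
    by (intro integrable_continuous_interval continuous_jacobi_weight sub)
  have "norm (F t - F s) \<le> integral {s..t} (\<lambda>x. \<eta> / 2 * ?K x + 1 / (2 * \<eta>) * jacobi_weight g d x)"
  proof (rule AC_loc_norm_diff_le[OF F st negligible_empty])
    fix x assume x: "x \<in> {s..t} - {}"
    then have xI: "x \<in> {-1<..<1}" using sub by auto
    show "norm (nth_deriv 1 F x) \<le> \<eta> / 2 * ?K x + 1 / (2 * \<eta>) * jacobi_weight g d x"
      using norm_le_AM_GM[OF jacobi_weight_pos[OF xI, of "-g" "-d"] eta, of "norm (nth_deriv 1 F x)"]
        jacobi_weight_minus[OF xI, of "-g" "-d"] by simp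
  qed (intro integrable_add integrable_on_mult_right Kst Jst)
  also have "\<dots> = \<eta> / 2 * integral {s..t} ?K + 1 / (2 * \<eta>) * integral {s..t} (jacobi_weight g d)"
  proof -
    have i: "(\<lambda>x. \<eta> / 2 * ?K x) integrable_on {s..t}" "(\<lambda>x. 1 / (2 * \<eta>) * jacobi_weight g d x) integrable_on {s..t}"
      by (intro integrable_on_mult_right Kst Jst)+
    show ?thesis unfolding integral_add[OF i] integral_mult_right ..
  qed
  also have "\<dots> \<le> \<eta> / 2 * integral {-1<..<1} ?K + 1 / (2 * \<eta>) * m"
  proof (intro add_mono mult_left_mono m)
    show "integral {s..t} ?K \<le> integral {-1<..<1} ?K"
      using jacobi_weight_pos by (intro integral_subset_le sub Kst KI) (auto simp: less_imp_le)
  qed (use eta in auto)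
  finally show ?thesis by simp
qed

text \<open>With \<eta> = y^(e/2) and an integral of size y^e, both terms of
  \<open>AC_loc_increment\<close> have the same order.\<close>

lemma powr_half_scale:
  fixes y N m e :: real
  assumes "y > 0" shows "y powr (e / 2) / 2 * N + (y powr e * m) / (2 * y powr (e / 2)) = (N + m) / 2 * y powr (e / 2)"
proof -
  have "y powr e = y powr (e / 2) * y powr (e / 2)" by (simp flip: powr_add)
  then show ?thesis using assms by (simp add: field_simps)
qed

text \<open>As F vanishes at the endpoint, F(x) is an integral of F' from x to that endpoint. Near 1
  the weight J(g,d) integrates to O((1-x)^(1+g)), and Cauchy-Schwarz gives the square root as rate;
  similarly at -1.\<close>

lemma AC_loc_vanishing_bigJ:
  assumes F: "F \<in> AC_loc" and gd: "g \<ge> 0" "d \<ge> 0"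
    and K: "(\<lambda>x. jacobi_weight (-g) (-d) x * (norm (nth_deriv 1 F x))\<^sup>2) absolutely_integrable_on {-1<..<1}"
    and lim: "(F \<longlongrightarrow> 0) (at_left 1)" "(F \<longlongrightarrow> 0) (at_right (-1))"
  shows "bigJ ((1 + g) / 2) ((1 + d) / 2) F"
proof -
  define N where "N = integral {-1<..<1} (\<lambda>x. jacobi_weight (-g) (-d) x * (norm (nth_deriv 1 F x))\<^sup>2)"
  have N0: "N \<ge> 0" unfolding N_def using jacobi_weight_pos
    by (intro integral_nonneg) (use K set_lebesgue_integral_eq_integral(1) in \<open>auto simp: less_imp_le\<close>)
  have J: "jacobi_weight g d integrable_on {s..t}" if "-1 < s" "t < 1" for s t
    using that by (intro integrable_continuous_interval continuous_jacobi_weight) auto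
  have right: "norm (F x) \<le> (N + 2 powr d) / 2 * (1 - x) powr ((1 + g) / 2)" if x: "x \<in> {0..<1}" for x
  proof -
    have "norm (F y - F x) \<le> (N + 2 powr d) / 2 * (1 - x) powr ((1 + g) / 2)" if y: "y \<in> {x<..<1}" for y
    proof -
      have "integral {x..y} (jacobi_weight g d) \<le> integral {x..y} (\<lambda>_. (1 - x) powr g * 2 powr d)"
        unfolding jacobi_weight_def[abs_def] using x y gd J[of x y, unfolded jacobi_weight_def[abs_def]]
        by (intro integral_le mult_mono powr_mono2) auto
      also have "\<dots> = (y - x) * ((1 - x) powr g * 2 powr d)" using y by simp
      also have "\<dots> \<le> (1 - x) * ((1 - x) powr g * 2 powr d)" using y by (intro mult_right_mono) auto
      also have "\<dots> = (1 - x) powr (1 + g) * 2 powr d" using x by (simp add: powr_add)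
      finally have "norm (F y - F x) \<le> (1 - x) powr ((1 + g) / 2) / 2 * N + ((1 - x) powr (1 + g) * 2 powr d) / (2 * (1 - x) powr ((1 + g) / 2))"
        unfolding N_def using x y by (intro AC_loc_increment[OF F K]) auto
      then show ?thesis using powr_half_scale[of "1 - x" "1 + g" N "2 powr d"] x by simp
    qed
    then have ev: "\<forall>\<^sub>F y in at_left 1. norm (F y - F x) \<le> (N + 2 powr d) / 2 * (1 - x) powr ((1 + g) / 2)"
      using x by (intro eventually_mono[OF eventually_at_left_real[of x 1]]) auto
    have "((\<lambda>y. norm (F y - F x)) \<longlongrightarrow> norm (0 - F x)) (at_left 1)" by (intro tendsto_intros lim)
    from tendsto_upperbound[OF this ev] show ?thesis by simp
  qed
  have left: "norm (F x) \<le> (N + 2 powr g) / 2 * (1 + x) powr ((1 + d) / 2)" if x: "x \<in> {-1<..0}" for x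
  proof -
    have "norm (F x - F y) \<le> (N + 2 powr g) / 2 * (1 + x) powr ((1 + d) / 2)" if y: "y \<in> {-1<..<x}" for y
    proof -
      have "integral {y..x} (jacobi_weight g d) \<le> integral {y..x} (\<lambda>_. 2 powr g * (1 + x) powr d)"
        unfolding jacobi_weight_def[abs_def] using x y gd J[of y x, unfolded jacobi_weight_def[abs_def]]
        by (intro integral_le mult_mono powr_mono2) auto
      also have "\<dots> = (x - y) * (2 powr g * (1 + x) powr d)" using y by simp
      also have "\<dots> \<le> (1 + x) * (2 powr g * (1 + x) powr d)" using y by (intro mult_right_mono) auto
      also have "\<dots> = (1 + x) powr (1 + d) * 2 powr g" using x by (simp add: powr_add)
      finally have "norm (F x - F y) \<le> (1 + x) powr ((1 + d) / 2) / 2 * N + ((1 + x) powr (1 + d) * 2 powr g) / (2 * (1 + x) powr ((1 + d) / 2))"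
        unfolding N_def using x y by (intro AC_loc_increment[OF F K]) auto
      then show ?thesis using powr_half_scale[of "1 + x" "1 + d" N "2 powr g"] x by simp
    qed
    then have ev: "\<forall>\<^sub>F y in at_right (-1). norm (F x - F y) \<le> (N + 2 powr g) / 2 * (1 + x) powr ((1 + d) / 2)"
      using x by (intro eventually_mono[OF eventually_at_right_real[of "-1" x]]) auto
    have "((\<lambda>y. norm (F x - F y)) \<longlongrightarrow> norm (F x - 0)) (at_right (-1))" by (intro tendsto_intros lim)
    from tendsto_upperbound[OF this ev] show ?thesis by simp
  qed
  show ?thesis
  proof (rule bigJI[of _ "(N + 2 powr d) / 2 + (N + 2 powr g) / 2"])
    fix x :: real assume x: "x \<in> {-1<..<1}"
    let ?J = "jacobi_weight ((1 + g) / 2) ((1 + d) / 2) x"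
    have nn: "0 \<le> (N + 2 powr d) / 2 * ?J" "0 \<le> (N + 2 powr g) / 2 * ?J"
      using N0 jacobi_weight_pos[OF x, of "(1 + g) / 2" "(1 + d) / 2"] by simp_all
    have one: "1 \<le> y powr e" if "1 \<le> y" "e \<ge> 0" for y e :: real
      using that powr_mono[of 0 e y] by simp
    show "norm (F x) \<le> ((N + 2 powr d) / 2 + (N + 2 powr g) / 2) * ?J"
    proof (cases "x \<ge> 0")
      case True
      have "norm (F x) \<le> (N + 2 powr d) / 2 * ((1 - x) powr ((1 + g) / 2) * 1)" using right[of x] True x by simp
      also have "\<dots> \<le> (N + 2 powr d) / 2 * ?J" unfolding jacobi_weight_def
        using N0 True gd by (intro mult_left_mono one) auto
      finally show ?thesis using nn by (simp only: distrib_right)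
    next
      case False
      have "norm (F x) \<le> (N + 2 powr g) / 2 * (1 * (1 + x) powr ((1 + d) / 2))" using left[of x] False x by simp
      also have "\<dots> \<le> (N + 2 powr g) / 2 * ?J" unfolding jacobi_weight_def
        using N0 False gd by (intro mult_left_mono mult_right_mono one) auto
      finally show ?thesis using nn by (simp only: distrib_right)
    qed
  qed
qed

lemma one_le_powr_scaled: "1 \<le> 2 powr c * y powr (-c)" if "0 < y" "y < 2" "c \<ge> 0" for y c :: real
proof -
  have "y powr c \<le> 2 powr c" using that by (intro powr_mono2) auto
  then show ?thesis using that by (simp add: powr_minus field_simps)
qed

lemma powr_integral_right:
  fixes c :: real
  assumes "c > 1" "0 \<le> x" "x < 1"
  shows "((\<lambda>s. (1 - s) powr (-c)) has_integral ((1 - x) powr (1 - c) - 1) / (c - 1)) {0..x}"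
proof -
  have "((\<lambda>s. (1 - s) powr (-c)) has_integral ((1 - x) powr (1 - c) / (c - 1) - (1 - 0) powr (1 - c) / (c - 1))) {0..x}"
  proof (rule fundamental_theorem_of_calculus)
    fix s assume s: "s \<in> {0..x}"
    have "((\<lambda>s. (1 - s) powr (1 - c) / (c - 1)) has_real_derivative (1 - s) powr (-c)) (at s)"
    proof -
      have "((\<lambda>s. (1 - s) powr (1 - c)) has_real_derivative (1 - c) * (1 - s) powr (1 - c - 1) * (0 - 1)) (at s)"
        using s assms by (auto intro!: derivative_eq_intros)
      from DERIV_cdivide[OF this, of "c - 1"] show ?thesis
        by (rule DERIV_cong) (use assms in \<open>simp add: field_simps\<close>)
    qed
    then show "((\<lambda>s. (1 - s) powr (1 - c) / (c - 1)) has_vector_derivative (1 - s) powr (-c)) (at s within {0..x})"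
      by (simp add: has_real_derivative_iff_has_vector_derivative has_vector_derivative_at_within)
  qed (use assms in simp)
  then show ?thesis by (simp add: diff_divide_distrib)
qed

text \<open>Counterpart of \<open>AC_loc_vanishing_bigJ\<close> for a degenerate weight: increments
  are taken from 0, and the integral of (1-s)^(-c) is at most (1-x)^(1-c) / (c-1), whose square root
  is the growth rate.\<close>

lemma AC_loc_growth_bigJ:
  assumes F: "F \<in> AC_loc" and cd: "c > 1" "d > 1"
    and K: "(\<lambda>x. jacobi_weight c d x * (norm (nth_deriv 1 F x))\<^sup>2) absolutely_integrable_on {-1<..<1}"
  shows "bigJ (-((c - 1) / 2)) (-((d - 1) / 2)) F"
proof -
  define N where "N = integral {-1<..<1} (\<lambda>x. jacobi_weight c d x * (norm (nth_deriv 1 F x))\<^sup>2)"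
  have N0: "N \<ge> 0" unfolding N_def using jacobi_weight_pos
    by (intro integral_nonneg) (use K set_lebesgue_integral_eq_integral(1) in \<open>auto simp: less_imp_le\<close>)
  have K': "(\<lambda>x. jacobi_weight (-(-c)) (-(-d)) x * (norm (nth_deriv 1 F x))\<^sup>2) absolutely_integrable_on {-1<..<1}"
    using K by simp
  have J: "jacobi_weight (-c) (-d) integrable_on {s..t}" if "-1 < s" "t < 1" for s t
    using that by (intro integrable_continuous_interval continuous_jacobi_weight) auto
  have le1: "y powr (-e) \<le> 1" if "1 \<le> y" "e > 0" for y e :: real
    using that powr_mono[of "-e" 0 y] by simp
  have ge1: "1 \<le> y powr (-e)" if "0 < y" "y \<le> 1" "e > 0" for y e :: real
    using that powr_le1[of e y] by (simp add: powr_minus one_le_inverse_iff)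
  have right: "norm (F x) \<le> (norm (F 0) + (N + 1 / (c - 1)) / 2) * (1 - x) powr (-((c - 1) / 2))" if x: "x \<in> {0..<1}" for x
  proof -
    have "integral {0..x} (jacobi_weight (-c) (-d)) \<le> integral {0..x} (\<lambda>s. (1 - s) powr (-c))"
    proof (rule integral_le)
      fix s assume "s \<in> {0..x}"
      then have "jacobi_weight (-c) (-d) s \<le> (1 - s) powr (-c) * 1"
        unfolding jacobi_weight_def using x cd by (intro mult_left_mono le1) auto
      then show "jacobi_weight (-c) (-d) s \<le> (1 - s) powr (-c)" by simp
    qed (use x J powr_integral_right[OF cd(1), of x] in \<open>auto simp: integrable_on_def\<close>)
    also have "\<dots> = ((1 - x) powr (1 - c) - 1) / (c - 1)"
      using x by (intro integral_unique powr_integral_right cd) auto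
    also have "\<dots> \<le> (1 - x) powr (1 - c) * (1 / (c - 1))" using cd by (simp add: divide_right_mono)
    finally have "norm (F x - F 0) \<le> (1 - x) powr ((1 - c) / 2) / 2 * N + ((1 - x) powr (1 - c) * (1 / (c - 1))) / (2 * (1 - x) powr ((1 - c) / 2))"
      unfolding N_def using x AC_loc_increment[OF F K', of 0 x "(1 - x) powr (1 - c) * (1 / (c - 1))" "(1 - x) powr ((1 - c) / 2)"] by simp
    then have "norm (F x - F 0) \<le> (N + 1 / (c - 1)) / 2 * (1 - x) powr ((1 - c) / 2)"
    proof -
      have "1 - x > 0" using x by simp
      with \<open>norm (F x - F 0) \<le> _\<close> show ?thesis by (simp only: powr_half_scale)
    qed
    moreover have "(1 - c) / 2 = - ((c - 1) / 2)" by (simp add: field_simps)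
    moreover have "norm (F 0) * 1 \<le> norm (F 0) * (1 - x) powr (-((c - 1) / 2))"
      using x cd by (intro mult_left_mono ge1) auto
    ultimately show ?thesis using norm_triangle_ineq2[of "F x" "F 0"] by (simp only: distrib_right)
  qed
  have left: "norm (F x) \<le> (norm (F 0) + (N + 1 / (d - 1)) / 2) * (1 + x) powr (-((d - 1) / 2))" if x: "x \<in> {-1<..0}" for x
  proof -
    have h: "((\<lambda>s. (1 + s) powr (-d)) has_integral ((1 + x) powr (1 - d) - 1) / (d - 1)) {x..0}"
      using has_integral_reflect_real[where f = "\<lambda>s. (1 - s) powr (-d)" and a = 0 and b = "-x"]
        powr_integral_right[OF cd(2), of "-x"] x by simp
    have "integral {x..0} (jacobi_weight (-c) (-d)) \<le> integral {x..0} (\<lambda>s. (1 + s) powr (-d))"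
    proof (rule integral_le)
      fix s assume "s \<in> {x..0}"
      then have "jacobi_weight (-c) (-d) s \<le> 1 * (1 + s) powr (-d)"
        unfolding jacobi_weight_def using x cd by (intro mult_right_mono le1) auto
      then show "jacobi_weight (-c) (-d) s \<le> (1 + s) powr (-d)" by simp
    qed (use x J h in \<open>auto simp: integrable_on_def\<close>)
    also have "\<dots> = ((1 + x) powr (1 - d) - 1) / (d - 1)" by (rule integral_unique[OF h])
    also have "\<dots> \<le> (1 + x) powr (1 - d) * (1 / (d - 1))" using cd by (simp add: divide_right_mono)
    finally have "norm (F 0 - F x) \<le> (1 + x) powr ((1 - d) / 2) / 2 * N + ((1 + x) powr (1 - d) * (1 / (d - 1))) / (2 * (1 + x) powr ((1 - d) / 2))"
      unfolding N_def using x AC_loc_increment[OF F K', of x 0 "(1 + x) powr (1 - d) * (1 / (d - 1))" "(1 + x) powr ((1 - d) / 2)"] by simp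
    then have "norm (F x - F 0) \<le> (N + 1 / (d - 1)) / 2 * (1 + x) powr ((1 - d) / 2)"
    proof -
      have "1 + x > 0" using x by simp
      with \<open>norm (F 0 - F x) \<le> _\<close> show ?thesis by (simp only: powr_half_scale norm_minus_commute)
    qed
    moreover have "(1 - d) / 2 = - ((d - 1) / 2)" by (simp add: field_simps)
    moreover have "norm (F 0) * 1 \<le> norm (F 0) * (1 + x) powr (-((d - 1) / 2))"
      using x cd by (intro mult_left_mono ge1) auto
    ultimately show ?thesis using norm_triangle_ineq2[of "F x" "F 0"] by (simp only: distrib_right)
  qed
  define A where "A = norm (F 0) + (N + 1 / (c - 1)) / 2"
  define B where "B = norm (F 0) + (N + 1 / (d - 1)) / 2"
  have AB: "A \<ge> 0" "B \<ge> 0" using cd N0 by (simp_all add: A_def B_def)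
  let ?c = "(c - 1) / 2" and ?d = "(d - 1) / 2"
  show ?thesis
  proof (rule bigJI[of _ "A * 2 powr ?d + B * 2 powr ?c"])
    fix x :: real assume x: "x \<in> {-1<..<1}"
    have nn: "0 \<le> A * 2 powr ?d * jacobi_weight (-?c) (-?d) x" "0 \<le> B * 2 powr ?c * jacobi_weight (-?c) (-?d) x"
      using AB jacobi_weight_pos[OF x, of "-?c" "-?d"] by simp_all
    show "norm (F x) \<le> (A * 2 powr ?d + B * 2 powr ?c) * jacobi_weight (-?c) (-?d) x"
    proof (cases "x \<ge> 0")
      case True
      then have "norm (F x) \<le> A * (1 - x) powr (-?c) * 1" using right[of x] x by (simp add: A_def)
      also have "\<dots> \<le> A * (1 - x) powr (-?c) * (2 powr ?d * (1 + x) powr (-?d))"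
        using x AB cd by (intro mult_left_mono one_le_powr_scaled) auto
      also have "\<dots> = A * 2 powr ?d * jacobi_weight (-?c) (-?d) x" by (simp only: jacobi_weight_def ac_simps)
      finally show ?thesis using nn by (simp only: distrib_right)
    next
      case False
      then have "norm (F x) \<le> B * (1 + x) powr (-?d) * 1" using left[of x] x by (simp add: B_def)
      also have "\<dots> \<le> B * (1 + x) powr (-?d) * (2 powr ?c * (1 - x) powr (-?c))"
        using x AB cd by (intro mult_left_mono one_le_powr_scaled) auto
      also have "\<dots> = B * 2 powr ?c * jacobi_weight (-?c) (-?d) x" by (simp only: jacobi_weight_def ac_simps)
      finally show ?thesis using nn by (simp only: distrib_right)
    qed
  qed
qed

text \<open>Monotone convergence along a compact exhaustion: a uniform bound on the integrals over
  compact subintervals suffices.\<close>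

lemma nonneg_integrable_exhaustion:
  fixes h :: "real \<Rightarrow> real"
  assumes c: "continuous_on {-1<..<1} h" and nn: "\<And>x. x \<in> {-1<..<1} \<Longrightarrow> h x \<ge> 0"
    and bd: "\<And>s t. -1 < s \<Longrightarrow> s \<le> t \<Longrightarrow> t < 1 \<Longrightarrow> integral {s..t} h \<le> B"
  shows "h absolutely_integrable_on {-1<..<1}"
proof -
  define a where "a n = - 1 + 1 / (real n + 2)" for n
  have a: "-1 < a n" "a n \<le> - a n" "- a n < 1" for n
  proof -
    have "1 / (real n + 2) < 1" "1 / (real n + 2) > 0" by simp_all
    then show "-1 < a n" "a n \<le> - a n" "- a n < 1" unfolding a_def by linarith+
  qed
  define f where "f n x = (if x \<in> {a n..- a n} then h x else 0)" for n x
  have hi: "h integrable_on {a n..- a n}" for n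
    using a[of n] by (intro integrable_continuous_interval continuous_on_subset[OF c]) auto
  have sub: "{a n..- a n} \<subseteq> {-1<..<1}" for n using a[of n] by auto
  have fi: "(f n has_integral integral {a n..- a n} h) {-1<..<1}" for n
    unfolding f_def using hi[of n] has_integral_restrict[OF sub[of n], of h] integrable_integral by blast
  have amono: "a n \<le> a k" if "n \<ge> k" for n k using that by (auto simp: a_def intro!: divide_left_mono)
  have "h integrable_on {-1<..<1} \<and> (\<lambda>n. integral {-1<..<1} (f n)) \<longlonglongrightarrow> integral {-1<..<1} h"
  proof (rule monotone_convergence_increasing)
    show "f n integrable_on {-1<..<1}" for n using fi[of n] by (auto simp: integrable_on_def)
    show "f n x \<le> f (Suc n) x" if "x \<in> {-1<..<1}" for n x
      using nn[OF that] amono[of n "Suc n"] by (auto simp: f_def)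
    show "(\<lambda>n. f n x) \<longlonglongrightarrow> h x" if "x \<in> {-1<..<1}" for x
    proof -
      from that have "x \<in> (\<Union>n. {- 1 + 1 / (real n + 2)<..<1 - 1 / (real n + 2)})"
        unfolding exhaust_interval[symmetric] by simp
      then obtain k where k: "a k < x" "x < - a k" by (auto simp: a_def)
      have "f n x = h x" if "n \<ge> k" for n using amono[OF that] k by (auto simp: f_def)
      then have "\<forall>\<^sub>F n in sequentially. f n x = h x" by (auto simp: eventually_sequentially intro!: exI[of _ k])
      then show ?thesis by (rule tendsto_eventually)
    qed
    show "bounded (range (\<lambda>n. integral {-1<..<1} (f n)))"
    proof (rule boundedI)
      fix y assume "y \<in> range (\<lambda>n. integral {-1<..<1} (f n))"
      then obtain n where y: "y = integral {a n..- a n} h" using integral_unique[OF fi] by auto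
      have "0 \<le> y" unfolding y using sub[of n] nn by (intro integral_nonneg hi) auto
      moreover have "y \<le> B" unfolding y by (rule bd[OF a])
      ultimately show "norm y \<le> B" by simp
    qed
  qed
  then show ?thesis using nn by (intro nonnegative_absolutely_integrable_1) auto
qed

text \<open>Hardy's inequality at both endpoints at once: \<open>(x - x0) J(-g-1,-d-1)\<close> has a derivative that dominates
  \<open>J(-g-2,-d-2)\<close> when \<open>x0\<close> is the minimum point of \<open>J(-g-1,-d-1)\<close>.\<close>

lemma hardy_integrable:
  assumes F: "F \<in> AC_loc" and gd: "g \<ge> 0" "d \<ge> 0"
    and K: "(\<lambda>x. jacobi_weight (-g) (-d) x * (norm (nth_deriv 1 F x))\<^sup>2) absolutely_integrable_on {-1<..<1}"
    and lim: "(F \<longlongrightarrow> 0) (at_left 1)" "(F \<longlongrightarrow> 0) (at_right (-1))"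
  shows "(\<lambda>x. jacobi_weight (-g-2) (-d-2) x * (norm (F x))\<^sup>2) absolutely_integrable_on {-1<..<1}"
proof -
  let ?K = "\<lambda>x. jacobi_weight (-g) (-d) x * (norm (nth_deriv 1 F x))\<^sup>2"
  let ?h = "\<lambda>x. jacobi_weight (-g-2) (-d-2) x * (norm (F x))\<^sup>2"
  obtain C where C: "C \<ge> 0" "\<And>x. x \<in> {-1<..<1} \<Longrightarrow> norm (F x) \<le> C * jacobi_weight ((1 + g) / 2) ((1 + d) / 2) x"
    using AC_loc_vanishing_bigJ[OF assms] unfolding bigJ_def by blast
  define x0 where "x0 = (d - g) / (g + d + 2)"
  define \<phi> where "\<phi> x = (x - x0) * jacobi_weight (-g-1) (-d-1) x" for x
  define Q where "Q x = 1 - x\<^sup>2 + (g + d + 2) * (x - x0)\<^sup>2" for x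
  have x0: "\<bar>x0\<bar> < 1" using gd by (auto simp: x0_def abs_less_iff field_simps)
  have kx0: "(g + d + 2) * x0 = d - g" using gd by (simp add: x0_def)
  \<comment> \<open>Q is positive on the closed interval: inside because of 1 - x^2, at the ends
    because x0 is an interior point. Compactness gives the lower bound.\<close>
  obtain c where c: "c > 0" "\<And>x. x \<in> {-1<..<1} \<Longrightarrow> c \<le> Q x"
  proof -
    obtain z where z: "z \<in> {-1..1}" "\<forall>y\<in>{-1..1}. Q z \<le> Q y"
      using continuous_attains_inf[of "{-1..1::real}" Q] by (force simp: Q_def[abs_def] intro!: continuous_intros)
    have "Q z > 0"
    proof (cases "z \<in> {-1<..<1}")
      case True
      then have "1 - z\<^sup>2 > 0" by (rule one_minus_square_pos)
      moreover have "(g + d + 2) * (z - x0)\<^sup>2 \<ge> 0" using gd by simp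
      ultimately show ?thesis by (simp add: Q_def)
    next
      case False
      then have "z = 1 \<or> z = -1" using z(1) by auto
      then have "z - x0 \<noteq> 0" "z\<^sup>2 = 1" using x0 by auto
      then have "(g + d + 2) * (z - x0)\<^sup>2 > 0" using gd by simp
      then show ?thesis using \<open>z\<^sup>2 = 1\<close> by (simp add: Q_def)
    qed
    then show ?thesis using z(2) by (intro that[of "Q z"]) auto
  qed
  have d\<phi>: "(\<phi> has_real_derivative jacobi_weight (-g-2) (-d-2) x * Q x) (at x)" if x: "x \<in> {-1<..<1}" for x
  proof -
    have "(\<phi> has_real_derivative (1 - 0) * jacobi_weight (-g-1) (-d-1) x +
        (jacobi_weight (-g-1-1) (-d-1-1) x * ((-d-1) * (1 - x) - (-g-1) * (1 + x))) * (x - x0)) (at x)"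
      unfolding \<phi>_def by (intro DERIV_mult DERIV_diff DERIV_ident DERIV_const jacobi_weight_has_derivative x)
    moreover have "jacobi_weight (-g-1) (-d-1) x = (1 - x\<^sup>2) * jacobi_weight (-g-2) (-d-2) x"
    proof -
      have "-g-2+1 = -g-1" "-d-2+1 = -d-1" by simp_all
      then show ?thesis using jacobi_weight_Suc[OF x, of "-g-2" "-d-2"] by (simp only:)
    qed
    moreover have "-g-1-1 = -g-2" "-d-1-1 = -d-2" by simp_all
    moreover have "(1 - x\<^sup>2) + ((-d-1) * (1 - x) - (-g-1) * (1 + x)) * (x - x0) = Q x"
    proof -
      have "((-d-1) * (1 - x) - (-g-1) * (1 + x)) = (g + d + 2) * x - (d - g)" by (simp add: algebra_simps)
      also have "\<dots> = (g + d + 2) * (x - x0)" unfolding kx0[symmetric] by (simp add: algebra_simps)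
      finally show ?thesis by (simp add: Q_def power2_eq_square)
    qed
    ultimately have "(\<phi> has_real_derivative (1 - 0) * ((1 - x\<^sup>2) * jacobi_weight (-g-2) (-d-2) x) +
        (jacobi_weight (-g-2) (-d-2) x * ((-d-1) * (1 - x) - (-g-1) * (1 + x))) * (x - x0)) (at x)"
      "Q x = (1 - x\<^sup>2) + ((-d-1) * (1 - x) - (-g-1) * (1 + x)) * (x - x0)" by (simp_all only:)
    moreover have "(1 - 0) * (u * J) + (J * v) * w = J * (u + v * w)" for J u v w :: real
      by (simp add: algebra_simps)
    ultimately show ?thesis by (simp only:)
  qed
  have \<phi>b: "\<bar>\<phi> x\<bar> \<le> 2 * jacobi_weight (-g-1) (-d-1) x" if x: "x \<in> {-1<..<1}" for x
    unfolding \<phi>_def abs_mult using x x0 jacobi_weight_pos[OF x, of "-g-1" "-d-1"] by (intro mult_mono) auto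
  have \<phi>AC: "(\<lambda>x. complex_of_real (\<phi> x)) \<in> AC_loc"
  proof (rule AC_loc_C1)
    show "((\<lambda>x. complex_of_real (\<phi> x)) has_vector_derivative of_real (jacobi_weight (-g-2) (-d-2) x * Q x)) (at x)"
      if "x \<in> {-1<..<1}" for x by (rule has_vector_derivative_of_real[OF d\<phi>[OF that]])
    show "continuous_on {-1<..<1} (\<lambda>x. complex_of_real (jacobi_weight (-g-2) (-d-2) x * Q x))"
      unfolding Q_def by (intro continuous_intros continuous_jacobi_weight) auto
  qed
  have cF: "(\<lambda>x. cnj (F x)) \<in> AC_loc"
    by (rule AC_loc_dominated[OF F F]) (auto intro!: exI[of _ 1] simp flip: complex_cnj_diff)
  \<comment> \<open>Integrating the derivative of \<phi> |F|^2 takes the place of an integration by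
    parts.\<close>
  define \<Psi> where "\<Psi> x = complex_of_real (\<phi> x) * (F x * cnj (F x))" for x
  have \<Psi>AC: "\<Psi> \<in> AC_loc" unfolding \<Psi>_def by (intro AC_loc_mult \<phi>AC F cF)
  obtain N where N: "negligible N" "\<And>x. x \<in> {-1<..<1} - N \<Longrightarrow> (F has_vector_derivative nth_deriv 1 F x) (at x)"
    using AC_loc_derivative_ae[OF F] by blast
  \<comment> \<open>J(-g-1,-d-1) exactly compensates the square of the rate of F, so the boundary
    terms are bounded, uniformly in s and t.\<close>
  have \<Psi>b: "\<bar>Re (\<Psi> x)\<bar> \<le> 2 * C\<^sup>2" if x: "x \<in> {-1<..<1}" for x
  proof -
    have JJ: "(jacobi_weight ((1 + g) / 2) ((1 + d) / 2) x)\<^sup>2 = jacobi_weight (1 + g) (1 + d) x"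
      using jacobi_weight_add[OF x, of "(1 + g) / 2" "(1 + g) / 2" "(1 + d) / 2" "(1 + d) / 2"] by (simp add: power2_eq_square)
    have "\<bar>Re (\<Psi> x)\<bar> = \<bar>\<phi> x\<bar> * (norm (F x))\<^sup>2"
      by (simp add: \<Psi>_def complex_norm_square[symmetric] abs_mult flip: of_real_power)
    also have "\<dots> \<le> (2 * jacobi_weight (-g-1) (-d-1) x) * (C * jacobi_weight ((1 + g) / 2) ((1 + d) / 2) x)\<^sup>2"
      using C x jacobi_weight_pos[OF x, of "-g-1" "-d-1"] by (intro mult_mono \<phi>b power_mono) auto
    also have "\<dots> = 2 * C\<^sup>2 * (jacobi_weight (-(1+g)) (-(1+d)) x * jacobi_weight (1 + g) (1 + d) x)"
    proof -
      have e: "-g-1 = -(1+g)" "-d-1 = -(1+d)" by simp_all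
      show ?thesis unfolding power_mult_distrib JJ e by (simp only: ac_simps)
    qed
    also have "jacobi_weight (-(1+g)) (-(1+d)) x * jacobi_weight (1 + g) (1 + d) x = 1"
      using jacobi_weight_minus[OF x, of "1 + g" "1 + d"] jacobi_weight_pos[OF x, of "1 + g" "1 + d"] by simp
    finally show ?thesis by simp
  qed
  have low: "c / 2 * ?h x - 8 / c * ?K x \<le> Re (nth_deriv 1 \<Psi> x)" if x: "x \<in> {-1<..<1} - N" for x
  proof -
    let ?k = "nth_deriv 1 F x" and ?J = "jacobi_weight (-g-2) (-d-2) x" and ?JB = "jacobi_weight (-g-1) (-d-1) x" and ?JA = "jacobi_weight (-g) (-d) x"
    have xI: "x \<in> {-1<..<1}" using x by simp
    note pos = jacobi_weight_pos[OF xI]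
    have Fd: "(F has_vector_derivative ?k) (at x)" by (rule N(2)[OF x])
    have "nth_deriv 1 \<Psi> x = complex_of_real (\<phi> x) * (F x * cnj ?k + ?k * cnj (F x)) + of_real (?J * Q x) * (F x * cnj (F x))"
      unfolding \<Psi>_def by (intro has_vector_derivative_nth_deriv_1 has_vector_derivative_mult has_vector_derivative_of_real d\<phi> xI Fd
          has_vector_derivative_cnj)
    then have "Re (nth_deriv 1 \<Psi> x) = \<phi> x * (2 * Re (?k * cnj (F x))) + ?J * Q x * (norm (F x))\<^sup>2"
      by (simp add: complex_norm_square[symmetric] cmod_power2 power2_eq_square algebra_simps)
    moreover have "?J * Q x * (norm (F x))\<^sup>2 \<ge> c * ?h x"
    proof -
      have "c * ?h x \<le> Q x * ?h x" using c(2)[OF xI] pos[of "-g-2" "-d-2"] by (intro mult_right_mono) auto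
      then show ?thesis by (simp add: algebra_simps)
    qed
    \<comment> \<open>J(-g-1,-d-1) is the geometric mean of J(-g,-d) and J(-g-2,-d-2), so the mixed
      term costs half of the main term plus a multiple of the given integrand.\<close>
    moreover have "\<bar>\<phi> x * (2 * Re (?k * cnj (F x)))\<bar> \<le> c / 2 * ?h x + 8 / c * ?K x"
    proof -
      have "\<bar>Re (?k * cnj (F x))\<bar> \<le> norm ?k * norm (F x)"
        using abs_Re_le_cmod[of "?k * cnj (F x)"] by (simp add: norm_mult)
      then have "\<bar>\<phi> x * (2 * Re (?k * cnj (F x)))\<bar> \<le> (2 * ?JB) * (2 * (norm ?k * norm (F x)))"
        unfolding abs_mult using pos[of "-g-1" "-d-1"] by (intro mult_mono \<phi>b xI) auto
      also have "\<dots> = 4 * ((sqrt ?JA * norm ?k) * (sqrt ?J * norm (F x)))"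
      proof -
        have "?JA * ?J = ?JB * ?JB"
          using jacobi_weight_add[OF xI, of "-g" "-g-2" "-d" "-d-2"] jacobi_weight_add[OF xI, of "-g-1" "-g-1" "-d-1" "-d-1"]
          by (simp add: algebra_simps)
        then have "sqrt ?JA * sqrt ?J = ?JB" using pos[of "-g-1" "-d-1"] by (simp add: real_sqrt_mult[symmetric])
        then show ?thesis by (simp add: algebra_simps) 
      qed
      also have "\<dots> \<le> c / 2 * (sqrt ?J * norm (F x))\<^sup>2 + 8 / c * (sqrt ?JA * norm ?k)\<^sup>2"
      proof -
        have am: "4 * (u * v) \<le> c / 2 * v\<^sup>2 + 8 / c * u\<^sup>2" for u v :: real
        proof -
          have "0 \<le> (4 * u - c * v)\<^sup>2 / (2 * c)" using c(1) by simp
          also have "\<dots> = c / 2 * v\<^sup>2 + 8 / c * u\<^sup>2 - 4 * (u * v)"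
            using c(1) by (simp add: field_simps power2_eq_square)
          finally show ?thesis by simp
        qed
        show ?thesis by (rule am)
      qed
      also have "\<dots> = c / 2 * ?h x + 8 / c * ?K x"
        using pos[of "-g-2" "-d-2"] pos[of "-g" "-d"] by (simp add: power_mult_distrib)
      finally show ?thesis .
    qed
    ultimately show ?thesis by linarith
  qed
  have hc: "continuous_on {-1<..<1} ?h"
    by (intro continuous_intros continuous_jacobi_weight AC_loc_continuous F) simp
  have KI: "?K integrable_on {-1<..<1}" using K set_lebesgue_integral_eq_integral(1) by blast
  show ?thesis
  proof (rule nonneg_integrable_exhaustion[OF hc])
    show "0 \<le> ?h x" if "x \<in> {-1<..<1}" for x using jacobi_weight_pos[OF that] by (simp add: less_imp_le)
    fix s t :: real assume st: "-1 < s" "s \<le> t" "t < 1"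
    have sub: "{s..t} \<subseteq> {-1<..<1}" using st by auto
    have hi: "?h integrable_on {s..t}" by (intro integrable_continuous_interval continuous_on_subset[OF hc sub])
    have Ki: "?K integrable_on {s..t}" by (rule integrable_on_subinterval[OF KI sub])
    have \<Psi>i: "((\<lambda>x. Re (nth_deriv 1 \<Psi> x)) has_integral Re (\<Psi> t - \<Psi> s)) {s..t}"
      using has_integral_linear[OF AC_loc_has_integral[OF \<Psi>AC st] bounded_linear_Re] by (simp add: o_def)
    have "integral {s..t} (\<lambda>x. c / 2 * ?h x - 8 / c * ?K x) \<le> Re (\<Psi> t - \<Psi> s)"
    proof (rule has_integral_le_AE)
      show "((\<lambda>x. c / 2 * ?h x - 8 / c * ?K x) has_integral integral {s..t} (\<lambda>x. c / 2 * ?h x - 8 / c * ?K x)) {s..t}"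
        using hi Ki by (intro integrable_integral integrable_diff integrable_on_mult_right)
      show "((\<lambda>x. Re (nth_deriv 1 \<Psi> x)) has_integral Re (\<Psi> t - \<Psi> s)) {s..t}" by (rule \<Psi>i)
      show "negligible N" by (rule N)
      show "c / 2 * ?h x - 8 / c * ?K x \<le> Re (nth_deriv 1 \<Psi> x)" if "x \<in> {s..t} - N" for x
        using that sub by (intro low) auto
    qed
    also have "\<dots> \<le> 2 * C\<^sup>2 + 2 * C\<^sup>2" using \<Psi>b[of s] \<Psi>b[of t] st by (simp add: abs_le_iff) 
    also have "integral {s..t} (\<lambda>x. c / 2 * ?h x - 8 / c * ?K x) = c / 2 * integral {s..t} ?h - 8 / c * integral {s..t} ?K"
    proof -
      have i: "(\<lambda>x. c / 2 * ?h x) integrable_on {s..t}" "(\<lambda>x. 8 / c * ?K x) integrable_on {s..t}"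
        by (intro integrable_on_mult_right hi Ki)+
      show ?thesis unfolding integral_diff[OF i] integral_mult_right ..
    qed
    finally have "c / 2 * integral {s..t} ?h - 8 / c * integral {s..t} ?K \<le> 4 * C\<^sup>2" by simp
    moreover have "integral {s..t} ?K \<le> integral {-1<..<1} ?K"
      using jacobi_weight_pos by (intro integral_subset_le sub Ki KI) (auto simp: less_imp_le)
    then have "8 / c * integral {s..t} ?K \<le> 8 / c * integral {-1<..<1} ?K" using c(1) by (intro mult_left_mono) auto
    ultimately have "c / 2 * integral {s..t} ?h \<le> 4 * C\<^sup>2 + 8 / c * integral {-1<..<1} ?K" by linarith
    then show "integral {s..t} ?h \<le> (4 * C\<^sup>2 + 8 / c * integral {-1<..<1} ?K) / (c / 2)"
      using c(1) by (simp add: le_divide_eq mult.commute)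
  qed
qed

lemma AC_loc_cweight: "cweight a b \<in> AC_loc"
proof (rule AC_loc_C1)
  show "(cweight a b has_vector_derivative of_real (jacobi_weight (a - 1) (b - 1) x * (b * (1 - x) - a * (1 + x)))) (at x)"
    if "x \<in> {-1<..<1}" for x by (rule has_vector_derivative_of_real[OF jacobi_weight_has_derivative[OF that]])
  show "continuous_on {-1<..<1} (\<lambda>x. complex_of_real (jacobi_weight (a - 1) (b - 1) x * (b * (1 - x) - a * (1 + x))))"
    by (intro continuous_intros continuous_jacobi_weight) simp
qed

lemma AC_loc_bigJ_0_if_integrable:
  assumes F: "F \<in> AC_loc" and k: "nth_deriv 1 F absolutely_integrable_on {-1<..<1}"
  shows "bigJ 0 0 F"
proof (rule bigJ_bounded)
  fix x :: real assume x: "x \<in> {-1<..<1}"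
  let ?k = "\<lambda>x. norm (nth_deriv 1 F x)"
  have ki: "?k integrable_on {-1<..<1}"
    by (rule set_lebesgue_integral_eq_integral(1)) (use absolutely_integrable_norm[OF k] in \<open>simp add: o_def\<close>)
  have bd: "norm (F t - F s) \<le> integral {-1<..<1} ?k" if st: "-1 < s" "s \<le> t" "t < 1" for s t
  proof -
    have sub: "{s..t} \<subseteq> {-1<..<1}" using st by auto
    have i: "?k integrable_on {s..t}" by (rule integrable_on_subinterval[OF ki sub])
    have "norm (F t - F s) \<le> integral {s..t} ?k"
      by (rule AC_loc_norm_diff_le[OF F st negligible_empty _ i]) simp
    also have "\<dots> \<le> integral {-1<..<1} ?k" by (intro integral_subset_le sub i ki) auto
    finally show ?thesis .
  qed
  have "norm (F x - F 0) \<le> integral {-1<..<1} ?k"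
    using bd[of 0 x] bd[of x 0] x by (cases "x \<ge> 0") (auto simp: norm_minus_commute)
  then show "norm (F x) \<le> norm (F 0) + integral {-1<..<1} ?k"
    using norm_triangle_ineq2[of "F x" "F 0"] by linarith
qed

lemma bigJ_cmult: "bigJ a b f \<Longrightarrow> bigJ a b (\<lambda>x. c * f x)"
  by (rule bigJ_mult_bounded[OF bigJ_bounded[of _ "norm c"]]) simp_all

lemma bigJ_drift: "bigJ 0 0 (\<lambda>x. complex_of_real (drift a b x))"
  unfolding drift_def by (intro bigJ_continuous continuous_intros)

lemma bigJ_rho: "bigJ 1 1 (\<lambda>x. complex_of_real (1 - x\<^sup>2))"
  by (rule bigJ_cong[OF bigJ_cweight]) (simp add: jacobi_weight_1_1)

lemma bigJ_inverse_rho: "bigJ (-1) (-1) (\<lambda>x. complex_of_real (1 / (1 - x\<^sup>2)))"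
  by (rule bigJ_cong[OF bigJ_cweight]) (use jacobi_weight_minus[of _ 1 1] in \<open>simp add: jacobi_weight_1_1\<close>)

lemma rho_power_cweight: "x \<in> {-1<..<1} \<Longrightarrow> (1 - x\<^sup>2) ^ i = jacobi_weight (real i) (real i) x"
proof (induction i)
  case (Suc i)
  then show ?case using jacobi_weight_Suc[of x "real i" "real i"] by (simp add: add.commute)
qed (simp add: jacobi_weight_def)

lemma weighted_square:
  fixes z :: complex
  assumes x: "x \<in> {-1<..<1}"
  shows "jacobi_weight a b x * (norm (of_real ((1 - x\<^sup>2) ^ i) * z))\<^sup>2 = jacobi_weight (a + 2 * i) (b + 2 * i) x * (norm z)\<^sup>2"
proof -
  have "jacobi_weight (a + 2 * i) (b + 2 * i) x = jacobi_weight a b x * (jacobi_weight i i x * jacobi_weight i i x)"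
    using jacobi_weight_add[OF x, of a "2 * i" b "2 * i"] jacobi_weight_add[OF x, of "real i" "real i" "real i" "real i"] by simp
  moreover have "norm (of_real ((1 - x\<^sup>2) ^ i) * z) = jacobi_weight i i x * norm z"
    unfolding norm_mult norm_of_real rho_power_cweight[OF x] using jacobi_weight_pos[OF x, of i i] by simp
  ultimately show ?thesis by (simp add: power2_eq_square)
qed

section \<open>Vanishing quasi-derivatives at the endpoints\<close>

locale jacobi_params =
  fixes al be :: real
  assumes al: "al > 0" and be: "be > 0"
begin

definition quasi :: "nat \<Rightarrow> (real \<Rightarrow> complex) \<Rightarrow> real \<Rightarrow> complex" where
  "quasi i f x = cweight (al + 1) (be + 1) x * nth_deriv 1 ((jacobi_ell al be ^^ i) f) x"

definition good :: "nat \<Rightarrow> (real \<Rightarrow> complex) set" where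
  "good n = {f \<in> D_max n al be. \<forall>i<n. (quasi i f \<longlongrightarrow> 0) (at_left 1) \<and> (quasi i f \<longlongrightarrow> 0) (at_right (-1))}"

lemma D_max_iff: "f \<in> D_max n al be \<longleftrightarrow> f \<in> L2 (jacobi_measure al be) \<and> AC_upto (2 * n) f \<and>
    (jacobi_ell al be ^^ n) f \<in> L2 (jacobi_measure al be)"
  by (auto simp: D_max_def AC_upto_def jacobi_ell_pow_def)

lemma quasi_ell: "quasi i (jacobi_ell al be f) = quasi (Suc i) f"
  by (simp add: quasi_def fun_eq_iff funpow_Suc_right del: funpow.simps)

lemma quasi_AC:
  assumes "AC_upto (2 * i + 2) f" shows "quasi i f \<in> AC_loc"
proof -
  have "AC_upto 2 ((jacobi_ell al be ^^ i) f)" using assms by (intro AC_upto_jacobi_ell_pow) (simp add: add.commute)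
  then have "nth_deriv 1 ((jacobi_ell al be ^^ i) f) \<in> AC_loc" by (simp add: AC_upto_def)
  then show ?thesis unfolding quasi_def[abs_def] by (intro AC_loc_mult AC_loc_cweight)
qed

lemma quasi_deriv:
  "x \<in> {-1<..<1} \<Longrightarrow> nth_deriv 1 (quasi i f) x = - cweight al be x * (jacobi_ell al be ^^ Suc i) f x"
  unfolding quasi_def[abs_def] using jacobi_ell_divergence[of x al be "(jacobi_ell al be ^^ i) f"] by simp

lemma deriv_quasi:
  assumes "x \<in> {-1<..<1}"
  shows "nth_deriv 1 ((jacobi_ell al be ^^ i) f) x = cweight (-al-1) (-be-1) x * quasi i f x"
proof -
  have "-al-1 = -(al+1)" "-be-1 = -(be+1)" by simp_all
  then have "jacobi_weight (-al-1) (-be-1) x * jacobi_weight (al+1) (be+1) x = 1"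
    using jacobi_weight_minus[OF assms, of "al+1" "be+1"] jacobi_weight_pos[OF assms, of "al+1" "be+1"] by simp
  then show ?thesis unfolding quasi_def mult.assoc[symmetric] by (metis of_real_mult of_real_1 mult_1)
qed

lemma ell_pow_has_derivative:
  assumes "AC_upto (2 * i + 2) f" "x \<in> {-1<..<1}"
  shows "((jacobi_ell al be ^^ i) f has_vector_derivative nth_deriv 1 ((jacobi_ell al be ^^ i) f) x) (at x)"
proof -
  have "AC_upto 2 ((jacobi_ell al be ^^ i) f)" using assms by (intro AC_upto_jacobi_ell_pow) (simp add: add.commute)
  then have "times_diff 1 ((jacobi_ell al be ^^ i) f)" by (intro AC_upto_times_diff) (simp add: numeral_2_eq_2 One_nat_def)
  then show ?thesis using assms by (intro times_diffD0) auto
qed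

lemma ell_pow_continuous:
  assumes "AC_upto (2 * i + 2) f" shows "continuous_on {-1<..<1} ((jacobi_ell al be ^^ i) f)"
  by (intro continuous_at_imp_continuous_on ballI has_vector_derivative_continuous[OF ell_pow_has_derivative[OF assms]])

lemma ell_pow_antiderivative:
  assumes "AC_upto (2 * i + 2) f" "bigJ (-a-1) (-b-1) (nth_deriv 1 ((jacobi_ell al be ^^ i) f))" "a > 0" "b > 0"
  shows "bigJ (-a) (-b) ((jacobi_ell al be ^^ i) f)"
  by (rule bigJ_antiderivative[of "(jacobi_ell al be ^^ i) f" "nth_deriv 1 ((jacobi_ell al be ^^ i) f)"])
    (use assms ell_pow_has_derivative in auto)

text \<open>The weight is bounded for positive parameters, so w + w |g|^2 is an integrable majorant
  of w |g|.\<close>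

lemma L2_weighted_integrable:
  assumes g: "g \<in> L2 (jacobi_measure al be)"
  shows "(\<lambda>x. cweight al be x * g x) absolutely_integrable_on {-1<..<1}"
proof (rule absolutely_integrable_dominated)
  have gm: "g \<in> borel_measurable (lebesgue_on {-1<..<1})" using g by (simp add: L2_jacobi_measure)
  have "cweight al be \<in> borel_measurable (lebesgue_on {-1<..<1})"
    by (intro continuous_measurable_lebesgue_on AC_loc_continuous AC_loc_cweight)
  with gm show "(\<lambda>x. cweight al be x * g x) \<in> borel_measurable (lebesgue_on {-1<..<1})" by measurable
  have "jacobi_weight al be absolutely_integrable_on {-1<..<1}"
    using jacobi_weight_le_2[of _ al be] jacobi_weight_pos[of _ al be] al be
    by (intro absolutely_integrable_bounded[where C = "2 powr al * 2 powr be"] measurable_jacobi_weight) (auto simp: less_imp_le)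
  then show "(\<lambda>x. jacobi_weight al be x + jacobi_weight al be x * (norm (g x))\<^sup>2) absolutely_integrable_on {-1<..<1}"
    using g by (intro set_integral_add) (simp_all add: L2_jacobi_measure)
  fix x :: real assume x: "x \<in> {-1<..<1}"
  have "norm (g x) \<le> 1 + (norm (g x))\<^sup>2"
    using sum_squares_bound[of 1 "norm (g x)"] by (simp add: power2_eq_square) (smt (verit) norm_ge_zero)
  then have "jacobi_weight al be x * norm (g x) \<le> jacobi_weight al be x * (1 + (norm (g x))\<^sup>2)"
    using jacobi_weight_pos[OF x, of al be] by (intro mult_left_mono) auto
  then show "norm (cweight al be x * g x) \<le> jacobi_weight al be x + jacobi_weight al be x * (norm (g x))\<^sup>2"
    using jacobi_weight_pos[OF x, of al be] by (simp add: norm_mult distrib_left)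
qed

text \<open>The derivative of \<open>quasi i f\<close> is -w \<ell>^(i+1) f. If that is integrable,
  \<open>quasi i f\<close> has limits and is bounded; dividing by p and integrating gives \<ell>^i f
  = O(1/w). Then w \<ell>^i f is bounded, hence integrable, and the next lower power can be
  treated.\<close>

lemma ladder_step:
  assumes f: "AC_upto (2 * i + 2) f"
    and int: "(\<lambda>x. cweight al be x * (jacobi_ell al be ^^ Suc i) f x) absolutely_integrable_on {-1<..<1}"
  shows "\<exists>R. (quasi i f \<longlongrightarrow> R) (at_left 1)" "\<exists>L. (quasi i f \<longlongrightarrow> L) (at_right (-1))"
    and "bigJ (-al) (-be) ((jacobi_ell al be ^^ i) f)"
    and "(\<lambda>x. cweight al be x * (jacobi_ell al be ^^ i) f x) absolutely_integrable_on {-1<..<1}"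
proof -
  have k: "nth_deriv 1 (quasi i f) absolutely_integrable_on {-1<..<1}"
  proof (rule absolutely_integrable_spike[OF _ negligible_empty])
    show "(\<lambda>x. (-1) * (cweight al be x * (jacobi_ell al be ^^ Suc i) f x)) absolutely_integrable_on {-1<..<1}"
      by (intro set_integrable_mult_right impI int)
  qed (simp add: quasi_deriv)
  show "\<exists>R. (quasi i f \<longlongrightarrow> R) (at_left 1)" "\<exists>L. (quasi i f \<longlongrightarrow> L) (at_right (-1))"
    using AC_loc_limits[OF quasi_AC[OF f] k] by blast+
  have "bigJ (-al-1) (-be-1) (nth_deriv 1 ((jacobi_ell al be ^^ i) f))"
    by (rule bigJ_cong[OF bigJ_mult[OF bigJ_cweight AC_loc_bigJ_0_if_integrable[OF quasi_AC[OF f] k], of "-al-1" "-be-1", simplified]])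
      (rule deriv_quasi)
  then show b: "bigJ (-al) (-be) ((jacobi_ell al be ^^ i) f)"
    by (rule ell_pow_antiderivative[OF f _ al be])
  have "bigJ (al + -al) (be + -be) (\<lambda>x. cweight al be x * (jacobi_ell al be ^^ i) f x)"
    by (rule bigJ_mult[OF bigJ_cweight b])
  then obtain C where C: "\<And>x. x \<in> {-1<..<1} \<Longrightarrow> norm (cweight al be x * (jacobi_ell al be ^^ i) f x) \<le> C"
    unfolding bigJ_def by (force simp: jacobi_weight_def)
  show "(\<lambda>x. cweight al be x * (jacobi_ell al be ^^ i) f x) absolutely_integrable_on {-1<..<1}"
    by (rule absolutely_integrable_bounded[OF continuous_measurable_lebesgue_on C])
      (auto intro!: continuous_intros continuous_jacobi_weight ell_pow_continuous f)
qed

lemma D_max_ladder: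
  assumes f: "f \<in> D_max n al be" and i: "i \<le> n"
  shows "(\<lambda>x. cweight al be x * (jacobi_ell al be ^^ i) f x) absolutely_integrable_on {-1<..<1}"
  using i
proof (induction rule: inc_induct)
  case base then show ?case using f by (intro L2_weighted_integrable) (simp add: D_max_iff)
next
  case (step i)
  have "AC_upto (2 * i + 2) f" using f step.hyps by (auto simp: D_max_iff elim!: AC_upto_mono)
  then show ?case using step.IH by (rule ladder_step(4))
qed

lemma D_max_limits:
  assumes f: "f \<in> D_max n al be" and i: "i < n"
  shows "\<exists>R. (quasi i f \<longlongrightarrow> R) (at_left 1)" "\<exists>L. (quasi i f \<longlongrightarrow> L) (at_right (-1))"
    and "bigJ (-al) (-be) ((jacobi_ell al be ^^ i) f)"
proof -
  have "AC_upto (2 * i + 2) f" using f i by (auto simp: D_max_iff elim!: AC_upto_mono)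
  from ladder_step(1-3)[OF this D_max_ladder[OF f, of "Suc i"]] i
  show "\<exists>R. (quasi i f \<longlongrightarrow> R) (at_left 1)" "\<exists>L. (quasi i f \<longlongrightarrow> L) (at_right (-1))"
    "bigJ (-al) (-be) ((jacobi_ell al be ^^ i) f)" by auto
qed

lemma L2_bigJ_half:
  assumes c: "continuous_on {-1<..<1} u" and b: "bigJ (-al/2) (-be/2) u"
  shows "u \<in> L2 (jacobi_measure al be)"
  unfolding L2_jacobi_measure
proof
  obtain C where C: "C \<ge> 0" "\<And>x. x \<in> {-1<..<1} \<Longrightarrow> norm (u x) \<le> C * jacobi_weight (-al/2) (-be/2) x"
    using b unfolding bigJ_def by blast
  show "u \<in> borel_measurable (lebesgue_on {-1<..<1})" using c by (rule continuous_measurable_lebesgue_on)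
  show "(\<lambda>x. jacobi_weight al be x * (norm (u x))\<^sup>2) absolutely_integrable_on {-1<..<1}"
  proof (rule absolutely_integrable_bounded)
    show "(\<lambda>x. jacobi_weight al be x * (norm (u x))\<^sup>2) \<in> borel_measurable (lebesgue_on {-1<..<1})"
      by (intro continuous_measurable_lebesgue_on continuous_intros continuous_jacobi_weight c) simp
    fix x :: real assume x: "x \<in> {-1<..<1}"
    have "jacobi_weight al be x * (norm (u x))\<^sup>2 \<le> jacobi_weight al be x * (C * jacobi_weight (-al/2) (-be/2) x)\<^sup>2"
      using C x jacobi_weight_pos[OF x, of al be] by (intro mult_left_mono power_mono) auto
    also have "\<dots> = C\<^sup>2 * (jacobi_weight al be x * (jacobi_weight (-al/2) (-be/2) x * jacobi_weight (-al/2) (-be/2) x))"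
      by (simp add: power2_eq_square)
    also have "jacobi_weight (-al/2) (-be/2) x * jacobi_weight (-al/2) (-be/2) x = jacobi_weight (-al) (-be) x"
      using jacobi_weight_add[OF x, of "-al/2" "-al/2" "-be/2" "-be/2"] by simp
    also have "jacobi_weight al be x * jacobi_weight (-al) (-be) x = 1"
      using jacobi_weight_minus[OF x, of al be] jacobi_weight_pos[OF x, of al be] by simp
    finally show "norm (jacobi_weight al be x * (norm (u x))\<^sup>2) \<le> C\<^sup>2"
      using jacobi_weight_pos[OF x, of al be] by simp
  qed
qed

text \<open>Vanishing boundary values improve the ladder: the derivative of \<open>quasi i f\<close>
  is square integrable against 1/w, so \<open>quasi i f\<close> is of the order of the square root
  of p, and \<ell>^i f becomes small enough to be square integrable.\<close>

lemma good_step: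
  assumes f: "AC_upto (2 * i + 2) f" and g: "(jacobi_ell al be ^^ Suc i) f \<in> L2 (jacobi_measure al be)"
    and lim: "(quasi i f \<longlongrightarrow> 0) (at_left 1)" "(quasi i f \<longlongrightarrow> 0) (at_right (-1))"
  shows "bigJ (-(1+al)/2) (-(1+be)/2) (nth_deriv 1 ((jacobi_ell al be ^^ i) f))"
    and "bigJ (-al/2) (-be/2) ((jacobi_ell al be ^^ i) f)"
    and "(jacobi_ell al be ^^ i) f \<in> L2 (jacobi_measure al be)"
    and "bigJ ((1+al)/2) ((1+be)/2) (quasi i f)"
proof -
  have K: "(\<lambda>x. jacobi_weight (-al) (-be) x * (norm (nth_deriv 1 (quasi i f) x))\<^sup>2) absolutely_integrable_on {-1<..<1}"
  proof (rule absolutely_integrable_spike[OF _ negligible_empty])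
    show "(\<lambda>x. jacobi_weight al be x * (norm ((jacobi_ell al be ^^ Suc i) f x))\<^sup>2) absolutely_integrable_on {-1<..<1}"
      using g by (simp add: L2_jacobi_measure)
    fix x :: real assume "x \<in> {-1<..<1} - {}"
    then have x: "x \<in> {-1<..<1}" by simp
    show "jacobi_weight (-al) (-be) x * (norm (nth_deriv 1 (quasi i f) x))\<^sup>2 = jacobi_weight al be x * (norm ((jacobi_ell al be ^^ Suc i) f x))\<^sup>2"
      using jacobi_weight_pos[OF x, of al be]
      by (simp add: quasi_deriv[OF x] jacobi_weight_minus[OF x] norm_mult power2_eq_square)
  qed
  show q: "bigJ ((1+al)/2) ((1+be)/2) (quasi i f)"
    using al be by (intro AC_loc_vanishing_bigJ[OF quasi_AC[OF f] _ _ K lim]) auto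
  have e: "-al-1 + (1+al)/2 = -(1+al)/2" "-be-1 + (1+be)/2 = -(1+be)/2" by (simp_all add: field_simps)
  show d: "bigJ (-(1+al)/2) (-(1+be)/2) (nth_deriv 1 ((jacobi_ell al be ^^ i) f))"
    using bigJ_mult[OF bigJ_cweight q, of "-al-1" "-be-1"] unfolding e by (rule bigJ_cong) (rule deriv_quasi)
  \<comment> \<open>The exponents are lowered by 1/2 so that integration ends at -al/2 and -be/2,
    which are negative as \<open>bigJ_antiderivative\<close> requires.\<close>
  have "bigJ (-(al/2)-1) (-(be/2)-1) (nth_deriv 1 ((jacobi_ell al be ^^ i) f))"
    by (rule bigJ_mono[OF d]) (auto simp: field_simps)
  from ell_pow_antiderivative[OF f this]
  show b: "bigJ (-al/2) (-be/2) ((jacobi_ell al be ^^ i) f)" using al be by simp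
  show "(jacobi_ell al be ^^ i) f \<in> L2 (jacobi_measure al be)"
    by (rule L2_bigJ_half[OF ell_pow_continuous[OF f] b])
qed

lemma good_L2:
  assumes f: "f \<in> good n" and i: "i \<le> n"
  shows "(jacobi_ell al be ^^ i) f \<in> L2 (jacobi_measure al be)"
  using i
proof (induction rule: inc_induct)
  case base then show ?case using f by (simp add: good_def D_max_iff)
next
  case (step i)
  have "AC_upto (2 * i + 2) f" using f step.hyps by (auto simp: good_def D_max_iff elim!: AC_upto_mono)
  from good_step(3)[OF this step.IH] f step.hyps show ?case by (simp add: good_def)
qed

lemma good_bounds:
  assumes f: "f \<in> good n" and i: "i < n"
  shows "bigJ (-(1+al)/2) (-(1+be)/2) (nth_deriv 1 ((jacobi_ell al be ^^ i) f))"
    and "bigJ (-al/2) (-be/2) ((jacobi_ell al be ^^ i) f)"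
    and "bigJ ((1+al)/2) ((1+be)/2) (quasi i f)"
proof -
  have "AC_upto (2 * i + 2) f" using f i by (auto simp: good_def D_max_iff elim!: AC_upto_mono)
  from good_step[OF this good_L2[OF f, of "Suc i"]] f i
  show "bigJ (-(1+al)/2) (-(1+be)/2) (nth_deriv 1 ((jacobi_ell al be ^^ i) f))"
    "bigJ (-al/2) (-be/2) ((jacobi_ell al be ^^ i) f)" "bigJ ((1+al)/2) ((1+be)/2) (quasi i f)"
    by (simp_all add: good_def)
qed

text \<open>Both claims rest on the square integrability of the intermediate powers. They carry the
  inductions on n below.\<close>

lemma good_Suc:
  assumes f: "f \<in> good (Suc n)"
  shows "f \<in> good n" "jacobi_ell al be f \<in> good n"
proof -
  have ac: "AC_upto (2 * n + 2) f" using f by (simp add: good_def D_max_iff)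
  show "f \<in> good n"
    using f good_L2[OF f, of n] AC_upto_mono[OF ac, of "2 * n"] by (simp add: good_def D_max_iff)
  have "jacobi_ell al be f \<in> L2 (jacobi_measure al be)" using good_L2[OF f, of 1] by (simp add: One_nat_def)
  moreover have "(jacobi_ell al be ^^ n) (jacobi_ell al be f) \<in> L2 (jacobi_measure al be)"
    using good_L2[OF f, of "Suc n"] by (simp add: funpow_Suc_right del: funpow.simps)
  moreover have "AC_upto (2 * n) (jacobi_ell al be f)" by (rule AC_upto_jacobi_ell[OF ac])
  ultimately show "jacobi_ell al be f \<in> good n"
    using f by (simp add: good_def D_max_iff quasi_ell)
qed

section \<open>Derivatives of higher order and the domain A\<close>

lemma higher_derivative_eq:
  assumes f: "AC_upto (j + 3) f" and x: "x \<in> {-1<..<1}"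
  shows "nth_deriv (j + 2) f x = of_real (1 / (1 - x\<^sup>2)) *
    (- nth_deriv j (jacobi_ell al be f) x - of_real (drift (al + j) (be + j) x) * nth_deriv (j + 1) f x
      + of_real (jacobi_ev al be j) * nth_deriv j f x)"
proof -
  have "times_diff (j + 2) f" using f by (intro AC_upto_times_diff) (simp add: numeral_3_eq_3 numeral_2_eq_2)
  then show ?thesis
    using x by (intro second_derivative_eq nth_deriv_jacobi_ell) (auto simp: times_diff_def)
qed

text \<open>Outer induction on n, inner one on the order: the derivative of order j + 2 is expressed
  through the j-th derivative of \<ell> f, which belongs to the smaller n, and through lower
  derivatives of f. Solving for it divides by 1 - x^2.\<close>

lemma good_derivative_bounds:
  "f \<in> good n \<Longrightarrow> m < 2 * n \<Longrightarrow> bigJ (-al/2 - m) (-be/2 - m) (nth_deriv m f)"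
proof (induction n arbitrary: f m)
  case (Suc n)
  note good_f = \<open>f \<in> good (Suc n)\<close>
  have ac: "AC_upto (2 * n + 2) f" using good_f by (simp add: good_def D_max_iff)
  from \<open>m < 2 * Suc n\<close> show ?case
  proof (induction m rule: less_induct)
    case (less m)
    consider "m = 0" | "m = 1" | j where "m = j + 2"
      by (metis One_nat_def add_2_eq_Suc' not0_implies_Suc)
    then show ?case
    proof cases
      case 1 then show ?thesis using good_bounds(2)[OF good_f, of 0] by simp
    next
      case 2
      have "bigJ (-(1+al)/2) (-(1+be)/2) (nth_deriv 1 f)" using good_bounds(1)[OF good_f, of 0] by simp
      then show ?thesis unfolding 2 by (rule bigJ_mono) (auto simp: field_simps)
    next
      case 3
      then have j: "j < 2 * n" using less.prems by simp
      have g: "bigJ (-al/2 - j) (-be/2 - j) (nth_deriv j (jacobi_ell al be f))"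
        by (rule Suc.IH[OF good_Suc(2)[OF good_f] j])
      have f1: "bigJ (-al/2 - (j + 1)) (-be/2 - (j + 1)) (nth_deriv (j + 1) f)"
        using less.IH[of "j + 1"] less.prems 3 by simp
      have f0: "bigJ (-al/2 - j) (-be/2 - j) (nth_deriv j f)" using less.IH[of j] less.prems 3 by simp
      have "bigJ (-1 + (-al/2 - (j + 1))) (-1 + (-be/2 - (j + 1))) (\<lambda>x. of_real (1 / (1 - x\<^sup>2)) *
        ((-1) * nth_deriv j (jacobi_ell al be f) x + (-1) * (of_real (drift (al + j) (be + j) x) * nth_deriv (j + 1) f x)
         + of_real (jacobi_ev al be j) * nth_deriv j f x))"
        by (intro bigJ_mult[OF bigJ_inverse_rho] bigJ_add bigJ_cmult bigJ_mult_bounded[OF bigJ_drift] f1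
            bigJ_mono[OF g] bigJ_mono[OF f0]) auto
      moreover have "-1 + (-al/2 - (j + 1)) = -al/2 - m" "-1 + (-be/2 - (j + 1)) = -be/2 - m" using 3 by simp_all
      ultimately have "bigJ (-al/2 - m) (-be/2 - m) (\<lambda>x. of_real (1 / (1 - x\<^sup>2)) *
        ((-1) * nth_deriv j (jacobi_ell al be f) x + (-1) * (of_real (drift (al + j) (be + j) x) * nth_deriv (j + 1) f x)
         + of_real (jacobi_ev al be j) * nth_deriv j f x))" by (simp only:)
      then show ?thesis
      proof (rule bigJ_cong)
        fix x :: real assume x: "x \<in> {-1<..<1}"
        have "AC_upto (j + 3) f" by (rule AC_upto_mono[OF ac]) (use j in simp)
        from higher_derivative_eq[OF this x] show "nth_deriv m f x = of_real (1 / (1 - x\<^sup>2)) *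
        ((-1) * nth_deriv j (jacobi_ell al be f) x + (-1) * (of_real (drift (al + j) (be + j) x) * nth_deriv (j + 1) f x)
         + of_real (jacobi_ev al be j) * nth_deriv j f x)" unfolding 3 by simp
      qed
    qed
  qed
qed simp

text \<open>All i up to n are claimed for the sake of the induction on n. For j = n + i with i at
  most n, W = J(al+j+1,be+j+1) f^(j+1) has derivative -J(al+j,be+j) h, where h combines the j-th
  derivatives of \<ell> f and f and is controlled by the induction hypothesis; Hardy's inequality
  passes this on to W. The new case i = n + 1 is read off from the differential expression.\<close>

lemma good_weighted_L2:
  "f \<in> good n \<Longrightarrow> i \<le> n \<Longrightarrow> (\<lambda>x. of_real ((1 - x\<^sup>2) ^ i) * nth_deriv (n + i) f x) \<in> L2 (jacobi_measure al be)"
proof (induction n arbitrary: f i)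
  case 0 then show ?case by (simp add: good_def D_max_iff)
next
  case (Suc n)
  let ?g = "jacobi_ell al be f"
  note good_f = \<open>f \<in> good (Suc n)\<close>
  have ac: "AC_upto (2 * n + 2) f" using good_f by (simp add: good_def D_max_iff)
  note IHf = Suc.IH[OF good_Suc(1)[OF good_f]] and IHg = Suc.IH[OF good_Suc(2)[OF good_f]]
  obtain N where N: "negligible N" "\<And>x. x\<in>{-1<..<1} - N \<Longrightarrow> nth_deriv (2 * n + 1) f differentiable (at x)"
    using AC_upto_top_ae[of "2 * n + 1" f] ac by (auto simp: numeral_2_eq_2 One_nat_def)
  have td: "times_diff (2 * n + 1) f" using ac by (intro AC_upto_times_diff) (simp add: numeral_2_eq_2 One_nat_def)
  have diff: "nth_deriv (j + 1) f differentiable (at x)" if "j \<le> 2 * n" "x \<in> {-1<..<1} - N" for j x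
    using td N(2)[OF that(2)] that by (cases "j = 2 * n") (auto simp: times_diff_def)
  have main: "(\<lambda>x. of_real ((1 - x\<^sup>2) ^ i) * nth_deriv (Suc n + i) f x) \<in> L2 (jacobi_measure al be)" if i: "i \<le> n" for i
  proof -
    define j where "j = n + i"
    have j: "j \<le> 2 * n" using i by (simp add: j_def)
    define h where "h x = nth_deriv j ?g x + (- of_real (jacobi_ev al be j)) * nth_deriv j f x" for x
    have hL2: "(\<lambda>x. of_real ((1 - x\<^sup>2) ^ i) * h x) \<in> L2 (jacobi_measure al be)"
    proof -
      have "(\<lambda>x. (- of_real (jacobi_ev al be j)) * (of_real ((1 - x\<^sup>2) ^ i) * nth_deriv j f x)) \<in> L2 (jacobi_measure al be)"
        unfolding j_def by (rule L2_cmult_bounded[OF IHf[OF i], of "\<lambda>_. _" "norm (of_real (jacobi_ev al be (n + i)) :: complex)"]) auto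
      from L2_add[OF IHg[OF i] this] show ?thesis unfolding j_def[symmetric]
        by (rule L2_AE_cong[OF _ negligible_empty]) (simp add: h_def algebra_simps)
    qed
    define W where "W x = cweight (al + j + 1) (be + j + 1) x * nth_deriv (j + 1) f x" for x
    have f1: "nth_deriv (j + 1) f \<in> AC_loc" using ac j by (simp add: AC_upto_def)
    have WAC: "W \<in> AC_loc" unfolding W_def by (intro AC_loc_mult AC_loc_cweight f1)
    have Wb: "bigJ (al/2) (be/2) W"
    proof -
      have "bigJ (-al/2 - (j + 1)) (-be/2 - (j + 1)) (nth_deriv (j + 1) f)"
        using good_derivative_bounds[OF good_f, of "j + 1"] j by simp
      from bigJ_mult[OF bigJ_cweight this, of "al + j + 1" "be + j + 1"]
      have "bigJ (al + j + 1 + (-al/2 - (j + 1))) (be + j + 1 + (-be/2 - (j + 1))) W" unfolding W_def .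
      moreover have "al + j + 1 + (-al/2 - (j + 1)) = al/2" "be + j + 1 + (-be/2 - (j + 1)) = be/2" by simp_all
      ultimately show ?thesis by (simp only:)
    qed
    \<comment> \<open>The exponents al/2 and be/2 are positive, which gives the boundary values that
      Hardy's inequality requires.\<close>
    have Wlim: "(W \<longlongrightarrow> 0) (at_left 1)" "(W \<longlongrightarrow> 0) (at_right (-1))"
      using bigJ_tendsto[OF Wb] al be by simp_all
    have Wd: "nth_deriv 1 W x = - cweight (al + j) (be + j) x * h x" if x: "x \<in> {-1<..<1} - N" for x
    proof -
      have xI: "x \<in> {-1<..<1}" using x by simp
      have e: "nth_deriv 1 (nth_deriv j f) = nth_deriv (j + 1) f" "nth_deriv 2 (nth_deriv j f) = nth_deriv (j + 2) f"
        by (simp_all flip: nth_deriv_add add: add.commute)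
      have "nth_deriv 1 W x = cweight (al + j) (be + j) x * (of_real (1 - x\<^sup>2) * nth_deriv (j + 2) f x
          + of_real (drift (al + j) (be + j) x) * nth_deriv (j + 1) f x)"
        using weighted_derivative_has_derivative[OF xI, of "nth_deriv j f" "al + j" "be + j"] diff[OF j x]
        unfolding e W_def[abs_def] by (intro has_vector_derivative_nth_deriv_1) simp
      also have "of_real (1 - x\<^sup>2) * nth_deriv (j + 2) f x + of_real (drift (al + j) (be + j) x) * nth_deriv (j + 1) f x = - h x"
        unfolding h_def using nth_deriv_jacobi_ell[of j f x al be] times_diff_mono[OF td, of "j + 1"] diff[OF j x] xI j
        by (simp add: algebra_simps)
      finally show ?thesis by simp
    qed
    \<comment> \<open>The exponents match: -(al+2n) + 2(al+j) = al + 2i here, and -(al+2n) - 2 +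
      2(al+j+1) is again al + 2i after Hardy's inequality, so no power is lost.\<close>
    have K: "(\<lambda>x. jacobi_weight (-(al + 2 * n)) (-(be + 2 * n)) x * (norm (nth_deriv 1 W x))\<^sup>2) absolutely_integrable_on {-1<..<1}"
    proof (rule absolutely_integrable_spike[OF _ N(1)])
      show "(\<lambda>x. jacobi_weight al be x * (norm (of_real ((1 - x\<^sup>2) ^ i) * h x))\<^sup>2) absolutely_integrable_on {-1<..<1}"
        using hL2 by (simp add: L2_jacobi_measure)
      fix x assume x: "x \<in> {-1<..<1} - N"
      then have xI: "x \<in> {-1<..<1}" by simp
      have "jacobi_weight (-(al + 2 * n)) (-(be + 2 * n)) x * (jacobi_weight (al + j) (be + j) x * jacobi_weight (al + j) (be + j) x)
         = jacobi_weight (al + 2 * i) (be + 2 * i) x"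
        unfolding jacobi_weight_add[OF xI, symmetric] by (simp add: j_def algebra_simps)
      then show "jacobi_weight (-(al + 2 * n)) (-(be + 2 * n)) x * (norm (nth_deriv 1 W x))\<^sup>2
         = jacobi_weight al be x * (norm (of_real ((1 - x\<^sup>2) ^ i) * h x))\<^sup>2"
        using jacobi_weight_pos[OF xI, of "al + j" "be + j"] unfolding weighted_square[OF xI]
        by (simp add: Wd[OF x] norm_mult power_mult_distrib power2_eq_square flip: mult.assoc)
    qed
    have H: "(\<lambda>x. jacobi_weight (-(al + 2 * n)-2) (-(be + 2 * n)-2) x * (norm (W x))\<^sup>2) absolutely_integrable_on {-1<..<1}"
      using al be by (intro hardy_integrable[OF WAC _ _ K Wlim]) auto
    show ?thesis
      unfolding L2_jacobi_measure
    proof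
      have "continuous_on {-1<..<1} (\<lambda>x. of_real ((1 - x\<^sup>2) ^ i) * nth_deriv (j + 1) f x)"
        by (intro continuous_intros AC_loc_continuous f1)
      then show "(\<lambda>x. of_real ((1 - x\<^sup>2) ^ i) * nth_deriv (Suc n + i) f x) \<in> borel_measurable (lebesgue_on {-1<..<1})"
        unfolding j_def by (intro continuous_measurable_lebesgue_on) (simp add: One_nat_def)
      show "(\<lambda>x. jacobi_weight al be x * (norm (of_real ((1 - x\<^sup>2) ^ i) * nth_deriv (Suc n + i) f x))\<^sup>2) absolutely_integrable_on {-1<..<1}"
      proof (rule absolutely_integrable_spike[OF H negligible_empty])
        fix x :: real assume "x \<in> {-1<..<1} - {}"
        then have x: "x \<in> {-1<..<1}" by simp
        have "jacobi_weight (-(al + 2 * n)-2) (-(be + 2 * n)-2) x * (jacobi_weight (al + j + 1) (be + j + 1) x * jacobi_weight (al + j + 1) (be + j + 1) x)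
           = jacobi_weight (al + 2 * i) (be + 2 * i) x"
          unfolding jacobi_weight_add[OF x, symmetric] by (simp add: j_def algebra_simps)
        then show "jacobi_weight al be x * (norm (of_real ((1 - x\<^sup>2) ^ i) * nth_deriv (Suc n + i) f x))\<^sup>2 =
           jacobi_weight (-(al + 2 * n)-2) (-(be + 2 * n)-2) x * (norm (W x))\<^sup>2"
          using jacobi_weight_pos[OF x, of "al + j + 1" "be + j + 1"] unfolding weighted_square[OF x]
          by (simp add: W_def norm_mult power_mult_distrib power2_eq_square One_nat_def flip: mult.assoc)
            (simp add: j_def)
      qed
    qed
  qed
  show ?case
  proof (cases "i \<le> n")
    case True then show ?thesis by (rule main)
  next
    case False
    then have i: "i = Suc n" using Suc.prems by simp
    \<comment> \<open>At order 2n + 2 the formula for the derivative is available almost everywhere;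
      it is multiplied by (1-x^2)^n, and each term is square integrable by the cases already
      settled.\<close>
    let ?r = "\<lambda>x. complex_of_real ((1 - x\<^sup>2) ^ n)"
    have a: "(\<lambda>x. ?r x * nth_deriv (2 * n) ?g x) \<in> L2 (jacobi_measure al be)" "(\<lambda>x. ?r x * nth_deriv (2 * n) f x) \<in> L2 (jacobi_measure al be)"
      "(\<lambda>x. ?r x * nth_deriv (2 * n + 1) f x) \<in> L2 (jacobi_measure al be)"
      using IHg[of n] IHf[of n] main[of n] by (simp_all add: mult_2 One_nat_def)
    have m1: "(\<lambda>x. complex_of_real (drift (al + 2 * n) (be + 2 * n) x)) \<in> borel_measurable (lebesgue_on {-1<..<1})"
      by (intro continuous_measurable_lebesgue_on AC_loc_continuous AC_loc_of_real_drift)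
    obtain C where C: "\<And>x. x \<in> {-1<..<1} \<Longrightarrow> norm (complex_of_real (drift (al + 2 * n) (be + 2 * n) x)) \<le> C"
      using bigJ_drift[of "al + 2 * n" "be + 2 * n"] unfolding bigJ_def by (force simp: jacobi_weight_def)
    have b1: "(\<lambda>x. (-1) * (?r x * nth_deriv (2 * n) ?g x)) \<in> L2 (jacobi_measure al be)"
      by (rule L2_cmult_bounded[OF a(1), of "\<lambda>_. _" 1]; simp)
    have b0: "(\<lambda>x. of_real (drift (al + 2 * n) (be + 2 * n) x) * (?r x * nth_deriv (2 * n + 1) f x)) \<in> L2 (jacobi_measure al be)"
      by (rule L2_cmult_bounded[OF a(3) m1 C])
    have b3: "(\<lambda>x. of_real (jacobi_ev al be (2 * n)) * (?r x * nth_deriv (2 * n) f x)) \<in> L2 (jacobi_measure al be)"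
      by (rule L2_cmult_bounded[OF a(2), of "\<lambda>_. _" "norm (complex_of_real (jacobi_ev al be (2 * n)))"]; simp)
    have b2: "(\<lambda>x. (-1) * (of_real (drift (al + 2 * n) (be + 2 * n) x) * (?r x * nth_deriv (2 * n + 1) f x))) \<in> L2 (jacobi_measure al be)"
      by (rule L2_cmult_bounded[OF b0, of "\<lambda>_. _" 1]; simp)
    from L2_add[OF L2_add[OF b1 b2] b3] show ?thesis
    proof (rule L2_AE_cong[OF _ N(1)])
      fix x assume x: "x \<in> {-1<..<1} - N"
      then have xI: "x \<in> {-1<..<1}" by simp
      have "of_real (1 - x\<^sup>2) * nth_deriv (2 * n + 2) f x = - nth_deriv (2 * n) ?g x - of_real (drift (al + 2 * n) (be + 2 * n) x) * nth_deriv (2 * n + 1) f x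
         + of_real (jacobi_ev al be (2 * n)) * nth_deriv (2 * n) f x"
        using nth_deriv_jacobi_ell[OF td xI diff[OF _ x], of al be] by (simp add: algebra_simps)
      then have "?r x * (of_real (1 - x\<^sup>2) * nth_deriv (2 * n + 2) f x) = 
         (- 1) * (?r x * nth_deriv (2 * n) ?g x) + (- 1) * (of_real (drift (al + 2 * n) (be + 2 * n) x) * (?r x * nth_deriv (2 * n + 1) f x))
         + of_real (jacobi_ev al be (2 * n)) * (?r x * nth_deriv (2 * n) f x)"
        by (simp only:) (simp add: algebra_simps)
      moreover have "Suc n + Suc n = 2 * n + 2" by simp
      ultimately show "of_real ((1 - x\<^sup>2) ^ i) * nth_deriv (Suc n + i) f x = 
         (- 1) * (?r x * nth_deriv (2 * n) ?g x) + (- 1) * (of_real (drift (al + 2 * n) (be + 2 * n) x) * (?r x * nth_deriv (2 * n + 1) f x))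
         + of_real (jacobi_ev al be (2 * n)) * (?r x * nth_deriv (2 * n) f x)"
        unfolding i by (simp only: power_Suc2 of_real_mult mult.assoc)
    qed
  qed
qed

lemma good_subset_dom_A: "good n \<subseteq> dom_A n al be"
proof
  fix f assume f: "f \<in> good n"
  then have "f \<in> D_max n al be" by (simp add: good_def)
  then show "f \<in> dom_A n al be"
    using good_weighted_L2[OF f, of n] by (simp add: dom_A_def D_max_def mult_2)
qed

text \<open>Derivatives up to order \<open>N\<close> are as singular as \<open>J(-(al+1)/2,-(be+1)/2)\<close>, and each further one loses
  a factor \<open>1 - x\<^sup>2\<close>; \<open>\<ell>\<close> lowers \<open>N\<close> by one and uses up two derivatives.\<close>

definition graded :: "nat \<Rightarrow> nat \<Rightarrow> (real \<Rightarrow> complex) \<Rightarrow> bool" where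
  "graded N K f \<longleftrightarrow> (\<forall>m\<le>K. bigJ (-(al+1)/2 - real (m - N)) (-(be+1)/2 - real (m - N)) (nth_deriv m f))"

text \<open>The factor 1 - x^2 makes up for one of the two derivatives it multiplies. Truncated
  subtraction in m - N covers the orders below N uniformly.\<close>

lemma graded_jacobi_ell:
  assumes g: "graded (Suc N) (K + 2) f" and ac: "AC_upto (K + 3) f"
  shows "graded N K (jacobi_ell al be f)"
  unfolding graded_def
proof (intro allI impI)
  fix m assume m: "m \<le> K"
  have B: "bigJ (-(al+1)/2 - real (k - Suc N)) (-(be+1)/2 - real (k - Suc N)) (nth_deriv k f)" if "k \<le> K + 2" for k
    using g that by (simp add: graded_def)
  have td: "times_diff (K + 2) f" using ac by (intro AC_upto_times_diff) (simp add: numeral_3_eq_3 numeral_2_eq_2)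
  have "bigJ (-(al+1)/2 - real (m - N)) (-(be+1)/2 - real (m - N)) (\<lambda>x. (-1) * (of_real (1 - x\<^sup>2) * nth_deriv (m + 2) f x)
      + (-1) * (of_real (drift (al + m) (be + m) x) * nth_deriv (m + 1) f x) + of_real (jacobi_ev al be m) * nth_deriv m f x)"
  proof (intro bigJ_add bigJ_cmult bigJ_mult_bounded[OF bigJ_drift])
    show "bigJ (-(al+1)/2 - real (m - N)) (-(be+1)/2 - real (m - N)) (\<lambda>x. of_real (1 - x\<^sup>2) * nth_deriv (m + 2) f x)"
      by (rule bigJ_mono[OF bigJ_mult[OF bigJ_rho B[of "m + 2"]]]) (use m in auto)
    show "bigJ (-(al+1)/2 - real (m - N)) (-(be+1)/2 - real (m - N)) (nth_deriv (m + 1) f)"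
      by (rule bigJ_mono[OF B[of "m + 1"]]) (use m in auto)
    show "bigJ (-(al+1)/2 - real (m - N)) (-(be+1)/2 - real (m - N)) (nth_deriv m f)"
      by (rule bigJ_mono[OF B[of m]]) (use m in auto)
  qed
  then show "bigJ (-(al+1)/2 - real (m - N)) (-(be+1)/2 - real (m - N)) (nth_deriv m (jacobi_ell al be f))"
  proof (rule bigJ_cong)
    fix x :: real assume x: "x \<in> {-1<..<1}"
    show "nth_deriv m (jacobi_ell al be f) x = (-1) * (of_real (1 - x\<^sup>2) * nth_deriv (m + 2) f x)
      + (-1) * (of_real (drift (al + m) (be + m) x) * nth_deriv (m + 1) f x) + of_real (jacobi_ev al be m) * nth_deriv m f x"
      using td m x by (subst nth_deriv_jacobi_ell) (auto simp: times_diff_def)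
  qed
qed

lemma graded_jacobi_ell_pow:
  "graded (N + k) (K + 2 * k) f \<Longrightarrow> AC_upto (K + 2 * k + 1) f \<Longrightarrow> graded N K ((jacobi_ell al be ^^ k) f)"
proof (induction k arbitrary: N K)
  case (Suc k)
  have "graded (Suc N) (K + 2) ((jacobi_ell al be ^^ k) f)"
    using Suc.prems by (intro Suc.IH) (simp_all add: algebra_simps)
  moreover have "AC_upto (K + 3) ((jacobi_ell al be ^^ k) f)"
    by (rule AC_upto_jacobi_ell_pow, rule AC_upto_mono[OF Suc.prems(2)]) simp
  ultimately show ?case by (simp add: graded_jacobi_ell)
qed simp

text \<open>Descent from order 2n - 1, where the condition on f^(2n) gives a growth bound. Each
  integration gains one power until the exponents -(al+1)/2 and -(be+1)/2 are reached at order n;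
  below that order the bound is merely kept.\<close>

lemma dom_A_graded:
  assumes f: "f \<in> dom_A n al be" and n: "n \<ge> 1"
  shows "graded n (2 * n - 1) f"
  unfolding graded_def
proof (intro allI impI)
  have ac: "AC_upto (2 * n) f" using f by (simp add: dom_A_def AC_upto_def)
  have td: "times_diff (2 * n - 1) f" using ac n by (intro AC_upto_times_diff) simp
  fix m assume "m \<le> 2 * n - 1"
  then show "bigJ (-(al+1)/2 - real (m - n)) (-(be+1)/2 - real (m - n)) (nth_deriv m f)"
  proof (induction rule: inc_induct)
    case base
    have e: "nth_deriv 1 (nth_deriv (2 * n - 1) f) = nth_deriv (2 * n) f"
      using n by (simp flip: nth_deriv_add)
    have "(\<lambda>x. jacobi_weight (al + 2 * n) (be + 2 * n) x * (norm (nth_deriv 1 (nth_deriv (2 * n - 1) f) x))\<^sup>2) absolutely_integrable_on {-1<..<1}"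
    proof (rule absolutely_integrable_spike[OF _ negligible_empty])
      show "(\<lambda>x. jacobi_weight al be x * (norm (of_real ((1 - x\<^sup>2) ^ n) * nth_deriv (2 * n) f x))\<^sup>2) absolutely_integrable_on {-1<..<1}"
        using f by (simp add: dom_A_def L2_jacobi_measure)
    qed (simp only: weighted_square e Diff_empty)
    moreover have "nth_deriv (2 * n - 1) f \<in> AC_loc" using ac n by (simp add: AC_upto_def)
    ultimately have "bigJ (-((al + 2 * n - 1) / 2)) (-((be + 2 * n - 1) / 2)) (nth_deriv (2 * n - 1) f)"
      using al be n by (intro AC_loc_growth_bigJ) auto
    moreover have "-((al + 2 * n - 1) / 2) = -(al+1)/2 - real (2 * n - 1 - n)" "-((be + 2 * n - 1) / 2) = -(be+1)/2 - real (2 * n - 1 - n)"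
      using n by (simp_all add: of_nat_diff field_simps)
    ultimately show ?case by (simp only:)
  next
    case (step m)
    have "bigJ (-((al+1)/2 + real (m - n)) - 1) (-((be+1)/2 + real (m - n)) - 1) (nth_deriv (Suc m) f)"
      by (rule bigJ_mono[OF step.IH]) (auto simp: field_simps)
    moreover have "(al+1)/2 + real (m - n) > 0" "(be+1)/2 + real (m - n) > 0"
      using al be by (simp_all add: add_pos_nonneg)
    ultimately have "bigJ (-((al+1)/2 + real (m - n))) (-((be+1)/2 + real (m - n))) (nth_deriv m f)"
      using times_diffD[OF td] step.hyps by (intro bigJ_antiderivative[of "nth_deriv m f" "nth_deriv (Suc m) f"]) auto
    then show ?case by (rule bigJ_mono) (auto simp: field_simps)
  qed
qed

lemma dom_A_eq_good:
  assumes n: "n \<ge> 1" shows "dom_A n al be = good n"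
proof
  show "dom_A n al be \<subseteq> good n"
  proof
    fix f assume f: "f \<in> dom_A n al be"
    have ac: "AC_upto (2 * n) f" using f by (simp add: dom_A_def AC_upto_def)
    have "(quasi k f \<longlongrightarrow> 0) (at_left 1) \<and> (quasi k f \<longlongrightarrow> 0) (at_right (-1))" if k: "k < n" for k
    proof -
      \<comment> \<open>For k < n the grade n - k is at least 1, so the first derivative of \<ell>^k
        f suffers no extra loss, and multiplied by p it tends to zero.\<close>
      have "graded (n - k) (2 * n - 1 - 2 * k) ((jacobi_ell al be ^^ k) f)"
      proof (rule graded_jacobi_ell_pow)
        have "n - k + k = n" "2 * n - 1 - 2 * k + 2 * k = 2 * n - 1" using k by simp_all
        then show "graded (n - k + k) (2 * n - 1 - 2 * k + 2 * k) f" using dom_A_graded[OF f n] by simp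
        show "AC_upto (2 * n - 1 - 2 * k + 2 * k + 1) f" using k by (intro AC_upto_mono[OF ac]) simp
      qed
      moreover have "1 \<le> 2 * n - 1 - 2 * k" using k by simp
      ultimately have "bigJ (-(al+1)/2 - real (1 - (n - k))) (-(be+1)/2 - real (1 - (n - k))) (nth_deriv 1 ((jacobi_ell al be ^^ k) f))"
        unfolding graded_def by blast
      moreover have "1 - (n - k) = 0" using k by simp
      ultimately have "bigJ (-(al+1)/2) (-(be+1)/2) (nth_deriv 1 ((jacobi_ell al be ^^ k) f))" by simp
      from bigJ_mult[OF bigJ_cweight this, of "al + 1" "be + 1"]
      have "bigJ (al + 1 + -(al+1)/2) (be + 1 + -(be+1)/2) (quasi k f)" unfolding quasi_def[abs_def] .
      from bigJ_tendsto[OF this] show ?thesis using al be by (simp add: field_simps)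
    qed
    then show "f \<in> good n" using f by (simp add: good_def dom_A_def)
  qed
qed (rule good_subset_dom_A)

end

section \<open>Boundary conditions of B, C and F in terms of quasi-derivatives\<close>

lemma lead_coeff_npoly: "coeff (npoly a b k) k = 1"
proof -
  have "lead_coeff (npoly a b k) = 1" unfolding npoly_def lead_coeff_prod by simp
  then show ?thesis by (simp add: degree_npoly)
qed

lemma eventually_in_interval:
  "\<forall>\<^sub>F x in at_left 1. x \<in> {-1<..<1::real}" "\<forall>\<^sub>F x in at_right (-1). x \<in> {-1<..<1::real}"
  using eventually_at_left_real[of "-1" "1::real"] eventually_at_right_real[of "-1" "1::real"] by simp_all

lemma tendsto_cong_interval:
  assumes "\<forall>\<^sub>F x in F. x \<in> {-1<..<1::real}" "\<And>x. x \<in> {-1<..<1} \<Longrightarrow> f x = g x"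
  shows "(f \<longlongrightarrow> c) F \<longleftrightarrow> (g \<longlongrightarrow> c) F"
  by (rule tendsto_cong) (use assms(1) in eventually_elim, rule assms(2))

lemma tendsto_0_iff_limit:
  fixes f :: "'a \<Rightarrow> complex"
  assumes "(f \<longlongrightarrow> L) F" "F \<noteq> bot" shows "(f \<longlongrightarrow> 0) F \<longleftrightarrow> L = 0"
  using assms tendsto_unique by blast

context jacobi_params
begin

lemma quasi_ell_poly:
  assumes "times_diff (2 * n - 1) f" "degree r < n" "x \<in> {-1<..<1}"
  shows "cweight (al + 1) (be + 1) x * nth_deriv 1 (ell_poly al be r f) x = (\<Sum>i<n. coeff r i * quasi i f x)"
proof -
  have "cweight (al + 1) (be + 1) x * nth_deriv 1 (ell_poly al be r f) x
      = cweight (al + 1) (be + 1) x * (\<Sum>i\<le>degree r. coeff r i * nth_deriv 1 ((jacobi_ell al be ^^ i) f) x)"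
    using assms by (subst nth_deriv_ell_poly_sum) (auto elim!: times_diff_mono)
  also have "\<dots> = (\<Sum>i\<le>degree r. coeff r i * quasi i f x)"
    unfolding quasi_def sum_distrib_left by (simp add: mult.left_commute)
  also have "\<dots> = (\<Sum>i<n. coeff r i * quasi i f x)"
    using assms(2) by (intro sum.mono_neutral_left) (auto simp: coeff_eq_0)
  finally show ?thesis .
qed

lemma D_max_times_diff: "f \<in> D_max n al be \<Longrightarrow> n \<ge> 1 \<Longrightarrow> times_diff (2 * n - 1) f"
  by (intro AC_upto_times_diff) (simp add: D_max_iff)

end

text \<open>The eigenvalue equation is assumed here and discharged at the end from the operator A,
  which has the Jacobi polynomials among its eigenfunctions.\<close>

locale jacobi_eigen = jacobi_params +
  assumes eig: "\<And>m x. x \<in> {-1<..<1} \<Longrightarrow>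
    jacobi_ell al be (jacobi_P al be m) x = of_real (jacobi_ev al be m) * jacobi_P al be m x"
begin

lemma P_times_diff: "times_diff k (jacobi_P al be m)"
  using jacobi_P_poly[OF al be, of m] times_diff_poly by metis

text \<open>The Newton coefficients show that the choice has a witness, and uniqueness on 1..n,
  tested on the Jacobi polynomials, identifies the chosen constants.\<close>

lemma jacobi_const_eq:
  assumes k: "1 \<le> k" "k \<le> n"
  shows "jacobi_const n al be k = jacobi_stirling al be n k"
proof -
  have ex: "lagrange_symmetric n al be (jacobi_stirling al be n)"
    using k by (intro lagrange_symmetric_jacobi_stirling) simp
  have c: "lagrange_symmetric n al be (jacobi_const n al be)"
    unfolding jacobi_const_def by (rule someI[of "lagrange_symmetric n al be", OF ex])
  show ?thesis
  proof (rule lagrange_symmetric_unique[OF al be _ c ex k])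
    fix m
    have "\<exists>x\<in>{-1<..<1}. jacobi_P al be m x \<noteq> 0"
    proof (rule ccontr)
      assume "\<not> ?thesis"
      then have z: "jacobi_P al be m x = 0" if "x \<in> {-1<..<1}" for x using that by blast
      obtain q where q: "jacobi_P al be m = (\<lambda>x. poly q (of_real x))" using jacobi_P_poly[OF al be] .
      have "complex_of_real ` {-1<..<1} \<subseteq> {y. poly q y = 0}" using z q by auto
      moreover have "infinite (complex_of_real ` {-1<..<1})"
        using negligible_complement_infinite[of "{}"] by (simp add: finite_image_iff inj_on_def)
      ultimately have "q = 0" using poly_roots_finite[of q] finite_subset by blast
      then show False using jacobi_P_endpoints(1)[OF al be, of m] q by simp
    qed
    then show "\<exists>g. times_diff (2 * n) g \<and> (\<forall>x\<in>{-1<..<1}. jacobi_ell al be g x = of_real (jacobi_ev al be m) * g x) \<and>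
        (\<exists>x\<in>{-1<..<1}. g x \<noteq> 0)"
      using P_times_diff eig by blast
  qed
qed

lemma jacobi_coeff_eq:
  "k < n \<Longrightarrow> jacobi_coeff n al be (Suc k) t = of_real (jacobi_stirling al be n (Suc k)) * cweight (al + k + 1) (be + k + 1) t"
  unfolding jacobi_coeff_def sym_coeff_cweight by (simp add: jacobi_const_eq)

lemma boundary_term_eq:
  assumes f: "f \<in> D_max n al be" and k: "k < n" and x: "x \<in> {-1<..<1}"
  shows "nth_deriv k (\<lambda>t. jacobi_coeff n al be (Suc k) t * nth_deriv (Suc k) f t) x =
    of_real (jacobi_stirling al be n (Suc k)) * (-1) ^ k * (\<Sum>i<Suc k. coeff (npoly al be k) i * quasi i f x)"
proof -
  have td: "times_diff (2 * k + 1) f" using D_max_times_diff[OF f] k by (auto elim!: times_diff_mono)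
  show ?thesis unfolding jacobi_coeff_eq[OF k] symmetric_term[OF td x]
    using quasi_ell_poly[of "Suc k" f "npoly al be k" x] td x by (simp add: degree_npoly flip: Suc_eq_plus1)
qed

text \<open>The filter stands for either endpoint. The system is triangular with nonzero diagonal,
  since \<open>npoly\<close> is monic and the constants are positive, so the quasi-derivatives are
  recovered one by one.\<close>

lemma boundary_terms_vanish_iff:
  assumes f: "f \<in> D_max n al be" and F: "\<forall>\<^sub>F x in F. x \<in> {-1<..<1}"
  shows "(\<forall>j\<in>{1..n}. (nth_deriv (j - 1) (\<lambda>t. jacobi_coeff n al be j t * nth_deriv j f t) \<longlongrightarrow> 0) F) \<longleftrightarrow>
    (\<forall>i<n. (quasi i f \<longlongrightarrow> 0) F)" (is "?L \<longleftrightarrow> ?R")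
proof -
  let ?S = "\<lambda>k. complex_of_real (jacobi_stirling al be n (Suc k)) * (-1) ^ k"
  let ?T = "\<lambda>k x. ?S k * (\<Sum>i<Suc k. coeff (npoly al be k) i * quasi i f x)"
  have nz: "?S k \<noteq> 0" if "k < n" for k
    using jacobi_stirling_pos[OF al be, of "Suc k" n] that by (simp add: One_nat_def)
  have "?L \<longleftrightarrow> (\<forall>k<n. (nth_deriv k (\<lambda>t. jacobi_coeff n al be (Suc k) t * nth_deriv (Suc k) f t) \<longlongrightarrow> 0) F)"
  proof
    assume L: ?L
    show "\<forall>k<n. (nth_deriv k (\<lambda>t. jacobi_coeff n al be (Suc k) t * nth_deriv (Suc k) f t) \<longlongrightarrow> 0) F"
    proof (intro allI impI)
      fix k assume "k < n"
      then have "Suc k \<in> {1..n}" by (simp add: One_nat_def)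
      from L[rule_format, OF this]
      show "(nth_deriv k (\<lambda>t. jacobi_coeff n al be (Suc k) t * nth_deriv (Suc k) f t) \<longlongrightarrow> 0) F" by (simp add: One_nat_def)
    qed
  next
    assume R: "\<forall>k<n. (nth_deriv k (\<lambda>t. jacobi_coeff n al be (Suc k) t * nth_deriv (Suc k) f t) \<longlongrightarrow> 0) F"
    show ?L
    proof
      fix j assume "j \<in> {1..n}"
      then obtain k where "j = Suc k" "k < n" by (cases j) (auto simp: One_nat_def)
      then show "(nth_deriv (j - 1) (\<lambda>t. jacobi_coeff n al be j t * nth_deriv j f t) \<longlongrightarrow> 0) F"
        using R by (simp add: One_nat_def)
    qed
  qed
  also have "\<dots> \<longleftrightarrow> (\<forall>k<n. (?T k \<longlongrightarrow> 0) F)"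
    by (intro iff_allI imp_cong refl tendsto_cong_interval[OF F] boundary_term_eq[OF f])
  also have "\<dots> \<longleftrightarrow> ?R"
  proof
    assume R: ?R
    show "\<forall>k<n. (?T k \<longlongrightarrow> 0) F"
    proof (intro allI impI)
      fix k assume "k < n"
      then have "(?T k \<longlongrightarrow> ?S k * (\<Sum>i<Suc k. coeff (npoly al be k) i * 0)) F"
        using R by (intro tendsto_intros) auto
      then show "(?T k \<longlongrightarrow> 0) F" by simp
    qed
  next
    assume T: "\<forall>k<n. (?T k \<longlongrightarrow> 0) F"
    show ?R
    proof (intro allI impI)
      fix i assume "i < n"
      then show "(quasi i f \<longlongrightarrow> 0) F"
      proof (induction i rule: less_induct)
        case (less i)
        have "((\<lambda>x. 1 / ?S i * ?T i x - (\<Sum>k<i. coeff (npoly al be i) k * quasi k f x))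
           \<longlongrightarrow> 1 / ?S i * 0 - (\<Sum>k<i. coeff (npoly al be i) k * 0)) F"
          using T less by (intro tendsto_intros) auto
        moreover have "(\<lambda>x. 1 / ?S i * ?T i x - (\<Sum>k<i. coeff (npoly al be i) k * quasi k f x)) = quasi i f"
          using nz[OF less.prems] by (simp add: fun_eq_iff lead_coeff_npoly)
        ultimately show ?case by simp
      qed
    qed
  qed
  finally show ?thesis .
qed

lemma dom_F_eq_good: "dom_F n al be = good n"
proof -
  have "f \<in> dom_F n al be \<longleftrightarrow> f \<in> good n" for f
    using boundary_terms_vanish_iff[of f n "at_left 1"] boundary_terms_vanish_iff[of f n "at_right (-1)"] eventually_in_interval
    by (auto simp: dom_F_def good_def)
  then show ?thesis by blast
qed

text \<open>By the Newton expansion of x^n the combination of divided differences is (x^n - l^n) /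
  (x - l), the geometric sum on the right. The factor x - l is carried along and cancelled at the
  end.\<close>

lemma sum_dpoly:
  assumes n: "n \<ge> 1"
  shows "(\<Sum>K<n. smult (of_real (jacobi_stirling al be n (Suc K))) (dpoly al be l K)) = (\<Sum>i<n. monom (l ^ (n - 1 - i)) i)"
proof -
  let ?S = "\<lambda>K. complex_of_real (jacobi_stirling al be n (Suc K))"
  have "[:-l, 1:] * (\<Sum>K<n. smult (?S K) (dpoly al be l K)) = (\<Sum>K<n. smult (?S K) ([:-l, 1:] * dpoly al be l K))"
    unfolding sum_distrib_left by (simp only: mult_smult_right)
  also have "\<dots> = (\<Sum>K<n. smult (?S K) (rpoly al be (Suc K))) - (\<Sum>K<n. smult (?S K) [:poly (rpoly al be (Suc K)) l:])"
    unfolding dpoly_mult smult_diff_right by (rule sum_subtractf)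
  also have "(\<Sum>K<n. smult (?S K) (rpoly al be (Suc K))) = monom 1 n"
    by (rule monom_eq_jacobi_stirling'[OF n, symmetric])
  also have "(\<Sum>K<n. smult (?S K) [:poly (rpoly al be (Suc K)) l:]) = monom (l ^ n) 0"
  proof -
    have "(\<Sum>K<n. ?S K * poly (rpoly al be (Suc K)) l) = poly (monom 1 n) l"
      unfolding monom_eq_jacobi_stirling'[OF n, of al be] poly_sum poly_smult ..
    moreover have "(\<Sum>K<n. smult (?S K) [:poly (rpoly al be (Suc K)) l:]) = (\<Sum>K<n. [:?S K * poly (rpoly al be (Suc K)) l:])" by simp
    moreover have "(\<Sum>K<n. [:g K:]) = [:\<Sum>K<n. g K:]" for g :: "nat \<Rightarrow> complex"
      by (induction n) auto
    ultimately show ?thesis by (simp add: poly_monom monom_0)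
  qed
  also have "monom 1 n - monom (l ^ n) 0 = (\<Sum>i<n. monom (l ^ (n - Suc i)) (Suc i) - monom (l ^ (n - i)) i)"
    using sum_lessThan_telescope[of "\<lambda>i. monom (l ^ (n - i)) i" n] by simp
  also have "\<dots> = (\<Sum>i<n. [:-l, 1:] * monom (l ^ (n - 1 - i)) i)"
  proof (rule sum.cong)
    fix i assume "i \<in> {..<n}"
    then have e: "n - i = Suc (n - 1 - i)" "n - Suc i = n - 1 - i" by auto
    show "monom (l ^ (n - Suc i)) (Suc i) - monom (l ^ (n - i)) i = [:-l, 1:] * monom (l ^ (n - 1 - i)) i"
      unfolding e(2) unfolding e(1) by (simp add: monom_Suc smult_monom minus_monom)
  qed simp
  also have "\<dots> = [:-l, 1:] * (\<Sum>i<n. monom (l ^ (n - 1 - i)) i)" by (simp only: sum_distrib_left)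
  finally show ?thesis by (subst (asm) mult_cancel_left) simp
qed

text \<open>Each k contributes a first-order form with a divided difference of \<ell> applied to f;
  summed with the constants these leave only powers of l. The Jacobi polynomials are real, so the
  conjugation disappears.\<close>

lemma jacobi_form_eq:
  fixes m :: nat
  assumes f: "f \<in> D_max n al be" and n: "n \<ge> 1" and x: "x \<in> {-1<..<1}"
  defines "l \<equiv> complex_of_real (jacobi_ev al be m)"
  shows "jacobi_form n al be f (jacobi_P al be m) x = (\<Sum>i<n. l ^ (n - 1 - i) *
    (cweight (al + 1) (be + 1) x * (jacobi_ell al be ^^ i) f x * nth_deriv 1 (jacobi_P al be m) x - quasi i f x * jacobi_P al be m x))"
proof -
  let ?P = "jacobi_P al be m" and ?p = "cweight (al + 1) (be + 1) x"
  let ?S = "\<lambda>K. complex_of_real (jacobi_stirling al be n (Suc K))"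
  have td: "times_diff (2 * n - 1) f" by (rule D_max_times_diff[OF f n])
  have cnjP: "(\<lambda>s. cnj (?P s)) = ?P" by (simp add: fun_eq_iff jacobi_P_def)
  have inner: "(\<Sum>j=1..Suc K. (-1) ^ (Suc K + j) *
        (nth_deriv (Suc K - j) (\<lambda>t. jacobi_coeff n al be (Suc K) t * nth_deriv (Suc K) ?P t) x * nth_deriv (j - 1) f x
         - nth_deriv (Suc K - j) (\<lambda>t. jacobi_coeff n al be (Suc K) t * nth_deriv (Suc K) f t) x * nth_deriv (j - 1) ?P x))
     = ?S K * ((\<Sum>i<n. coeff (dpoly al be l K) i * (?p * (jacobi_ell al be ^^ i) f x)) * nth_deriv 1 ?P x
         - (\<Sum>i<n. coeff (dpoly al be l K) i * quasi i f x) * ?P x)" (is "?lhs = _") if K: "K < n" for K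
  proof -
    have deg: "degree (dpoly al be l K) < n" using degree_dpoly[of al be l K] K by simp
    have "?lhs = (\<Sum>j<Suc K. (-1) ^ (Suc K + Suc j) *
        (nth_deriv (Suc K - Suc j) (\<lambda>t. jacobi_coeff n al be (Suc K) t * nth_deriv (Suc K) ?P t) x * nth_deriv (Suc j - 1) f x
         - nth_deriv (Suc K - Suc j) (\<lambda>t. jacobi_coeff n al be (Suc K) t * nth_deriv (Suc K) f t) x * nth_deriv (Suc j - 1) ?P x))"
      unfolding One_nat_def by (rule sum.atLeast1_atMost_eq)
    also have "\<dots> = (\<Sum>j\<le>K. (-1) ^ (K + j) *
      (nth_deriv (K - j) (\<lambda>t. ?S K * cweight (al + K + 1) (be + K + 1) t * nth_deriv (Suc K) ?P t) x * nth_deriv j f x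
     - nth_deriv (K - j) (\<lambda>t. ?S K * cweight (al + K + 1) (be + K + 1) t * nth_deriv (Suc K) f t) x * nth_deriv j ?P x))"
      unfolding jacobi_coeff_eq[OF K] lessThan_Suc_atMost by (intro sum.cong refl) (simp add: One_nat_def)
    also have "\<dots> = ?S K * ?p * (ell_poly al be (dpoly al be l K) f x * nth_deriv 1 ?P x
        - nth_deriv 1 (ell_poly al be (dpoly al be l K) f) x * ?P x)"
      using K x eig by (intro symmetric_form_eigen times_diff_mono[OF td] P_times_diff) (auto simp: l_def)
    also have "\<dots> = ?S K * (?p * ell_poly al be (dpoly al be l K) f x * nth_deriv 1 ?P x
        - ?p * nth_deriv 1 (ell_poly al be (dpoly al be l K) f) x * ?P x)"
      by (simp add: algebra_simps)
    also have "?p * nth_deriv 1 (ell_poly al be (dpoly al be l K) f) x = (\<Sum>i<n. coeff (dpoly al be l K) i * quasi i f x)"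
      by (rule quasi_ell_poly[OF td deg x])
    also have "?p * ell_poly al be (dpoly al be l K) f x = (\<Sum>i<n. coeff (dpoly al be l K) i * (?p * (jacobi_ell al be ^^ i) f x))"
    proof -
      have "ell_poly al be (dpoly al be l K) f x = (\<Sum>i\<le>n - 1. coeff (dpoly al be l K) i * (jacobi_ell al be ^^ i) f x)"
        using deg by (intro ell_poly_sum) simp
      moreover have "{..n - 1} = {..<n}" using n by auto
      ultimately show ?thesis by (simp add: sum_distrib_left mult.left_commute)
    qed
    finally show ?thesis .
  qed
  have co: "(\<Sum>K<n. ?S K * coeff (dpoly al be l K) i) = l ^ (n - 1 - i)" if "i < n" for i
  proof -
    have "(\<Sum>K<n. ?S K * coeff (dpoly al be l K) i) = coeff (\<Sum>K<n. smult (?S K) (dpoly al be l K)) i"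
      by (simp add: coeff_sum)
    also have "\<dots> = (\<Sum>k<n. if k = i then l ^ (n - 1 - i) else 0)"
      unfolding sum_dpoly[OF n] coeff_sum by (intro sum.cong) auto
    finally show ?thesis using that by simp
  qed
  have swap: "(\<Sum>K<n. ?S K * (\<Sum>i<n. coeff (dpoly al be l K) i * v i)) = (\<Sum>i<n. l ^ (n - 1 - i) * v i)" for v
  proof -
    have "(\<Sum>K<n. ?S K * (\<Sum>i<n. coeff (dpoly al be l K) i * v i)) = (\<Sum>K<n. \<Sum>i<n. ?S K * coeff (dpoly al be l K) i * v i)"
      by (simp add: sum_distrib_left mult.assoc)
    also have "\<dots> = (\<Sum>i<n. \<Sum>K<n. ?S K * coeff (dpoly al be l K) i * v i)" by (rule sum.swap)
    also have "\<dots> = (\<Sum>i<n. l ^ (n - 1 - i) * v i)" by (simp add: co flip: sum_distrib_right)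
    finally show ?thesis .
  qed
  have "jacobi_form n al be f ?P x = (\<Sum>K<n. \<Sum>j=1..Suc K. (-1) ^ (Suc K + j) *
        (nth_deriv (Suc K - j) (\<lambda>t. jacobi_coeff n al be (Suc K) t * nth_deriv (Suc K) ?P t) x * nth_deriv (j - 1) f x
         - nth_deriv (Suc K - j) (\<lambda>t. jacobi_coeff n al be (Suc K) t * nth_deriv (Suc K) f t) x * nth_deriv (j - 1) ?P x))"
    unfolding jacobi_form_def cnjP unfolding One_nat_def by (rule sum.atLeast1_atMost_eq)
  also have "\<dots> = (\<Sum>K<n. ?S K * ((\<Sum>i<n. coeff (dpoly al be l K) i * (?p * (jacobi_ell al be ^^ i) f x)) * nth_deriv 1 ?P x
         - (\<Sum>i<n. coeff (dpoly al be l K) i * quasi i f x) * ?P x))"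
    by (intro sum.cong refl inner) simp
  also have "\<dots> = (\<Sum>K<n. ?S K * (\<Sum>i<n. coeff (dpoly al be l K) i * (?p * (jacobi_ell al be ^^ i) f x))) * nth_deriv 1 ?P x
      - (\<Sum>K<n. ?S K * (\<Sum>i<n. coeff (dpoly al be l K) i * quasi i f x)) * ?P x"
    by (simp only: sum_distrib_right right_diff_distrib sum_subtractf mult.assoc)
  also have "\<dots> = (\<Sum>i<n. l ^ (n - 1 - i) * (?p * (jacobi_ell al be ^^ i) f x)) * nth_deriv 1 ?P x
      - (\<Sum>i<n. l ^ (n - 1 - i) * quasi i f x) * ?P x" by (simp only: swap)
  also have "\<dots> = (\<Sum>i<n. l ^ (n - 1 - i) * (?p * (jacobi_ell al be ^^ i) f x * nth_deriv 1 ?P x - quasi i f x * ?P x))"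
    by (simp only: sum_distrib_right right_diff_distrib sum_subtractf mult.assoc)
  finally show ?thesis .
qed

lemma jacobi_P_tendsto: "(jacobi_P al be m \<longlongrightarrow> jacobi_P al be m c) (at c within S)"
  "(nth_deriv 1 (jacobi_P al be m) \<longlongrightarrow> nth_deriv 1 (jacobi_P al be m) c) (at c within S)"
proof -
  obtain q where q: "jacobi_P al be m = (\<lambda>x. poly q (of_real x))" using jacobi_P_poly[OF al be] .
  show "(jacobi_P al be m \<longlongrightarrow> jacobi_P al be m c) (at c within S)"
    "(nth_deriv 1 (jacobi_P al be m) \<longlongrightarrow> nth_deriv 1 (jacobi_P al be m) c) (at c within S)"
    unfolding q nth_deriv_poly by (intro tendsto_intros)+
qed

text \<open>Once p \<ell>^i f tends to zero, only the products of quasi-derivatives with P survive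
  in the limit.\<close>

lemma form_limit:
  assumes f: "f \<in> D_max n al be" and n: "n \<ge> 1"
    and F: "\<forall>\<^sub>F x in at c within S. x \<in> {-1<..<1}"
    and z: "\<And>i. i < n \<Longrightarrow> ((\<lambda>x. cweight (al + 1) (be + 1) x * (jacobi_ell al be ^^ i) f x) \<longlongrightarrow> 0) (at c within S)"
    and b: "\<And>i. i < n \<Longrightarrow> (quasi i f \<longlongrightarrow> b i) (at c within S)"
  shows "(jacobi_form n al be f (jacobi_P al be m) \<longlongrightarrow>
     - (jacobi_P al be m c * (\<Sum>i<n. of_real (jacobi_ev al be m) ^ (n - 1 - i) * b i))) (at c within S)"
proof -
  let ?P = "jacobi_P al be m" and ?l = "complex_of_real (jacobi_ev al be m)"
  have "((\<lambda>x. \<Sum>i<n. ?l ^ (n - 1 - i) *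
    (cweight (al + 1) (be + 1) x * (jacobi_ell al be ^^ i) f x * nth_deriv 1 ?P x - quasi i f x * ?P x)) \<longlongrightarrow>
     (\<Sum>i<n. ?l ^ (n - 1 - i) * (0 * nth_deriv 1 ?P c - b i * ?P c))) (at c within S)"
    by (intro tendsto_sum tendsto_mult tendsto_diff tendsto_const z b jacobi_P_tendsto) auto
  moreover have "(\<Sum>i<n. ?l ^ (n - 1 - i) * (0 * nth_deriv 1 ?P c - b i * ?P c)) = - (?P c * (\<Sum>i<n. ?l ^ (n - 1 - i) * b i))"
    by (simp add: sum_distrib_left sum_negf[symmetric] algebra_simps)
  ultimately show ?thesis
    using tendsto_cong_interval[OF F jacobi_form_eq[OF f n]] by simp
qed

text \<open>The sums are values of one polynomial of degree below n, with coefficients b in reversed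
  order, at n distinct eigenvalues; so it is the zero polynomial.\<close>

lemma vandermonde_vanish:
  assumes I: "card I = n" "finite I" and n: "n \<ge> 1"
    and z: "\<And>m. m \<in> I \<Longrightarrow> (\<Sum>i<n. complex_of_real (jacobi_ev al be m) ^ (n - 1 - i) * b i) = 0"
    and i: "i < n"
  shows "b i = 0"
proof -
  define R where "R = (\<Sum>i<n. monom (b i) (n - 1 - i))"
  let ?A = "(\<lambda>m. complex_of_real (jacobi_ev al be m)) ` I"
  have inj: "inj_on (\<lambda>m. complex_of_real (jacobi_ev al be m)) I"
  proof (rule inj_onI)
    fix m k assume "complex_of_real (jacobi_ev al be m) = complex_of_real (jacobi_ev al be k)"
    then show "m = k" using jacobi_ev_strict_mono[OF al be, of m k] jacobi_ev_strict_mono[OF al be, of k m]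
      by (cases m k rule: linorder_cases) auto
  qed
  have cA: "card ?A = n" using I card_image[OF inj] by simp
  have "degree R \<le> n - 1" unfolding R_def
    by (intro degree_sum_le) (auto intro: order_trans[OF degree_monom_le])
  then have "degree R < card ?A" "degree 0 < card ?A" using cA n by simp_all
  moreover have "poly R y = poly 0 y" if "y \<in> ?A" for y
    using that z by (auto simp: R_def poly_sum poly_monom mult.commute)
  ultimately have "R = 0" by (intro poly_eqI_degree[of ?A R 0])
  then have "0 = coeff R (n - 1 - i)" by simp
  also have "\<dots> = (\<Sum>k<n. if k = i then b i else 0)"
    unfolding R_def coeff_sum using i by (intro sum.cong) auto
  finally show ?thesis using i by simp
qed

text \<open>On the maximal domain the limits of the quasi-derivatives exist and p \<ell>^i f =
  O(J(1,1)) vanishes. As P is nonzero at the endpoints, each condition is a linear equation in these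
  limits, separately at 1 and at -1. Arbitrary index sets of size n treat B and C together.\<close>

lemma forms_vanish_iff:
  assumes f: "f \<in> D_max n al be" and n: "n \<ge> 1" and I: "finite I" "card I = n"
  shows "(\<forall>m\<in>I. form_vanishes n al be f (jacobi_P al be m)) \<longleftrightarrow> f \<in> good n"
proof -
  have z: "((\<lambda>x. cweight (al + 1) (be + 1) x * (jacobi_ell al be ^^ i) f x) \<longlongrightarrow> 0) (at_left 1)"
    "((\<lambda>x. cweight (al + 1) (be + 1) x * (jacobi_ell al be ^^ i) f x) \<longlongrightarrow> 0) (at_right (-1))" if "i < n" for i
    using bigJ_tendsto[OF bigJ_mult[OF bigJ_cweight D_max_limits(3)[OF f that], of "al + 1" "be + 1"]] by simp_all
  obtain b where b: "\<And>i. i < n \<Longrightarrow> (quasi i f \<longlongrightarrow> b i) (at_left 1)" using D_max_limits(1)[OF f] by metis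
  obtain d where d: "\<And>i. i < n \<Longrightarrow> (quasi i f \<longlongrightarrow> d i) (at_right (-1))" using D_max_limits(2)[OF f] by metis
  let ?s = "\<lambda>m b. \<Sum>i<n. complex_of_real (jacobi_ev al be m) ^ (n - 1 - i) * b i"
  have fv: "form_vanishes n al be f (jacobi_P al be m) \<longleftrightarrow> ?s m b = 0 \<and> ?s m d = 0" for m
  proof -
    note L = form_limit[OF f n eventually_in_interval(1) z(1) b, of m] form_limit[OF f n eventually_in_interval(2) z(2) d, of m]
    have "(jacobi_form n al be f (jacobi_P al be m) \<longlongrightarrow> 0) (at_left 1) \<longleftrightarrow> - (jacobi_P al be m 1 * ?s m b) = 0"
      by (rule tendsto_0_iff_limit[OF L(1) trivial_limit_at_left_real])
    moreover have "(jacobi_form n al be f (jacobi_P al be m) \<longlongrightarrow> 0) (at_right (-1)) \<longleftrightarrow> - (jacobi_P al be m (-1) * ?s m d) = 0"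
      by (rule tendsto_0_iff_limit[OF L(2) trivial_limit_at_right_real])
    ultimately show ?thesis
      unfolding form_vanishes_def using jacobi_P_endpoints[OF al be, of m] by simp
  qed
  have gd: "f \<in> good n \<longleftrightarrow> (\<forall>i<n. b i = 0 \<and> d i = 0)"
  proof -
    have "(quasi i f \<longlongrightarrow> 0) (at_left 1) \<longleftrightarrow> b i = 0" "(quasi i f \<longlongrightarrow> 0) (at_right (-1)) \<longleftrightarrow> d i = 0" if "i < n" for i
      by (rule tendsto_0_iff_limit[OF b[OF that] trivial_limit_at_left_real], rule tendsto_0_iff_limit[OF d[OF that] trivial_limit_at_right_real])
    then show ?thesis using f by (auto simp: good_def)
  qed
  show ?thesis
  proof
    assume "\<forall>m\<in>I. form_vanishes n al be f (jacobi_P al be m)"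
    then have "?s m b = 0" "?s m d = 0" if "m \<in> I" for m using that fv by auto
    from vandermonde_vanish[OF I(2,1) n this(1)] vandermonde_vanish[OF I(2,1) n this(2)]
    show "f \<in> good n" unfolding gd by blast
  next
    assume "f \<in> good n"
    then show "\<forall>m\<in>I. form_vanishes n al be f (jacobi_P al be m)" unfolding fv gd by simp
  qed
qed

lemma dom_B_eq_good: "n \<ge> 1 \<Longrightarrow> dom_B n al be = good n"
  using forms_vanish_iff[of _ n "{..<n}"] by (auto simp: dom_B_def good_def)

lemma dom_C_eq_good:
  assumes n: "n \<ge> 1" shows "dom_C n al be = good n"
proof -
  have "dom_C_of n al be I = good n" if "finite I" "card I = n" for I
    using forms_vanish_iff[OF _ n that] by (auto simp: dom_C_of_def good_def)
  moreover have "finite {..<n} \<and> card {..<n} = n" by simp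
  ultimately show ?thesis unfolding dom_C_def by blast
qed

end

section \<open>Green's formula and symmetry\<close>

lemma AC_loc_cnj: "F \<in> AC_loc \<Longrightarrow> (\<lambda>x. cnj (F x)) \<in> AC_loc"
  by (rule AC_loc_dominated[of F F]) (auto intro!: exI[of _ 1] simp flip: complex_cnj_diff)

context jacobi_params
begin

text \<open>Lagrange's identity: the products of p with both first derivatives cancel. The
  quasi-derivatives are differentiable almost everywhere, hence the null set.\<close>

lemma green:
  assumes h: "AC_upto 2 h" and k: "AC_upto 2 k"
  defines "B \<equiv> \<lambda>x. h x * cnj (quasi 0 k x) + (-1) * (quasi 0 h x * cnj (k x))"
  shows "B \<in> AC_loc"
    and "\<exists>N. negligible N \<and> (\<forall>x\<in>{-1<..<1} - N. nth_deriv 1 B x =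
      cweight al be x * (jacobi_ell al be h x * cnj (k x)) - cweight al be x * (h x * cnj (jacobi_ell al be k x)))"
proof -
  have hk: "h \<in> AC_loc" "k \<in> AC_loc" using h k by (auto simp: AC_upto_def dest: spec[of _ 0])
  have q: "quasi 0 h \<in> AC_loc" "quasi 0 k \<in> AC_loc" using h k by (auto intro!: quasi_AC simp: numeral_2_eq_2)
  show "B \<in> AC_loc" unfolding B_def by (intro AC_loc_add AC_loc_mult AC_loc_const AC_loc_cnj hk q)
  obtain N1 where N1: "negligible N1" "\<And>x. x \<in> {-1<..<1} - N1 \<Longrightarrow> (quasi 0 h has_vector_derivative nth_deriv 1 (quasi 0 h) x) (at x)"
    using AC_loc_derivative_ae[OF q(1)] by blast
  obtain N2 where N2: "negligible N2" "\<And>x. x \<in> {-1<..<1} - N2 \<Longrightarrow> (quasi 0 k has_vector_derivative nth_deriv 1 (quasi 0 k) x) (at x)"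
    using AC_loc_derivative_ae[OF q(2)] by blast
  show "\<exists>N. negligible N \<and> (\<forall>x\<in>{-1<..<1} - N. nth_deriv 1 B x =
      cweight al be x * (jacobi_ell al be h x * cnj (k x)) - cweight al be x * (h x * cnj (jacobi_ell al be k x)))"
  proof (intro exI[of _ "N1 \<union> N2"] conjI ballI)
    show "negligible (N1 \<union> N2)" using N1 N2 by simp
    fix x assume x: "x \<in> {-1<..<1} - (N1 \<union> N2)"
    then have xI: "x \<in> {-1<..<1}" by simp
    have d: "(h has_vector_derivative nth_deriv 1 h x) (at x)" "(k has_vector_derivative nth_deriv 1 k x) (at x)"
      using ell_pow_has_derivative[of 0 h x] ell_pow_has_derivative[of 0 k x] h k xI by (simp_all add: numeral_2_eq_2)
    have q1: "nth_deriv 1 (quasi 0 h) x = - cweight al be x * jacobi_ell al be h x"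
      "nth_deriv 1 (quasi 0 k) x = - cweight al be x * jacobi_ell al be k x"
      using quasi_deriv[OF xI, of 0] by simp_all
    have "nth_deriv 1 B x = (h x * cnj (nth_deriv 1 (quasi 0 k) x) + nth_deriv 1 h x * cnj (quasi 0 k x))
       + (-1) * (quasi 0 h x * cnj (nth_deriv 1 k x) + nth_deriv 1 (quasi 0 h) x * cnj (k x))"
      unfolding B_def using x
      by (intro has_vector_derivative_nth_deriv_1 has_vector_derivative_add has_vector_derivative_mult_right
          has_vector_derivative_mult has_vector_derivative_cnj d N1 N2) auto
    then show "nth_deriv 1 B x = cweight al be x * (jacobi_ell al be h x * cnj (k x)) - cweight al be x * (h x * cnj (jacobi_ell al be k x))"
      unfolding q1 by (simp add: quasi_def algebra_simps)
  qed
qed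

lemma L2_product:
  assumes u: "u \<in> L2 (jacobi_measure al be)" and v: "v \<in> L2 (jacobi_measure al be)"
  shows "(\<lambda>x. cweight al be x * (u x * cnj (v x))) absolutely_integrable_on {-1<..<1}"
    and "L2_inner (jacobi_measure al be) u v = integral {-1<..<1} (\<lambda>x. cweight al be x * (u x * cnj (v x)))"
proof -
  have m: "u \<in> borel_measurable (lebesgue_on {-1<..<1})" "v \<in> borel_measurable (lebesgue_on {-1<..<1})"
    using u v by (auto simp: L2_jacobi_measure)
  have "(\<lambda>x. cnj (v x)) \<in> borel_measurable (lebesgue_on {-1<..<1})"
    by (rule measurable_compose[OF m(2)]) (intro borel_measurable_continuous_onI continuous_intros)
  then have m2: "(\<lambda>x. u x * cnj (v x)) \<in> borel_measurable (lebesgue_on {-1<..<1})" using m by measurable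
  have wm: "cweight al be \<in> borel_measurable (lebesgue_on {-1<..<1})"
    by (intro continuous_measurable_lebesgue_on AC_loc_continuous AC_loc_cweight)
  show i: "(\<lambda>x. cweight al be x * (u x * cnj (v x))) absolutely_integrable_on {-1<..<1}"
  proof (rule absolutely_integrable_dominated)
    show "(\<lambda>x. cweight al be x * (u x * cnj (v x))) \<in> borel_measurable (lebesgue_on {-1<..<1})"
      using m2 wm by measurable
    show "(\<lambda>x. jacobi_weight al be x * (norm (u x))\<^sup>2 + jacobi_weight al be x * (norm (v x))\<^sup>2) absolutely_integrable_on {-1<..<1}"
      using u v by (intro set_integral_add) (simp_all add: L2_jacobi_measure)
    fix x :: real assume x: "x \<in> {-1<..<1}"
    have "norm (u x) * norm (v x) \<le> (norm (u x))\<^sup>2 + (norm (v x))\<^sup>2"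
    proof -
      have "2 * norm (u x) * norm (v x) \<le> (norm (u x))\<^sup>2 + (norm (v x))\<^sup>2" by (rule sum_squares_bound)
      moreover have "0 \<le> norm (u x) * norm (v x)" by simp
      ultimately show ?thesis by linarith
    qed
    then have "jacobi_weight al be x * (norm (u x) * norm (v x)) \<le> jacobi_weight al be x * ((norm (u x))\<^sup>2 + (norm (v x))\<^sup>2)"
      using jacobi_weight_pos[OF x, of al be] by (intro mult_left_mono) auto
    then show "norm (cweight al be x * (u x * cnj (v x))) \<le> jacobi_weight al be x * (norm (u x))\<^sup>2 + jacobi_weight al be x * (norm (v x))\<^sup>2"
      using jacobi_weight_pos[OF x, of al be] by (simp add: norm_mult distrib_left)
  qed
  have s: "(\<lambda>x. jacobi_weight al be x *\<^sub>R (u x * cnj (v x))) = (\<lambda>x. cweight al be x * (u x * cnj (v x)))"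
    by (simp add: scaleR_conv_of_real)
  show "L2_inner (jacobi_measure al be) u v = integral {-1<..<1} (\<lambda>x. cweight al be x * (u x * cnj (v x)))"
    unfolding L2_inner_def using i integral_jacobi_measure[OF m2, of al be] integrable_jacobi_measure[OF m2, of al be]
    unfolding s by simp
qed

lemma L2_inner_AE_cong:
  assumes "u \<in> L2 (jacobi_measure al be)" "v \<in> L2 (jacobi_measure al be)" "u' \<in> L2 (jacobi_measure al be)" "v' \<in> L2 (jacobi_measure al be)"
    and "AE x in jacobi_measure al be. u x = u' x" "AE x in jacobi_measure al be. v x = v' x"
  shows "L2_inner (jacobi_measure al be) u v = L2_inner (jacobi_measure al be) u' v'"
proof -
  obtain N1 N2 where N: "negligible N1" "negligible N2" "\<And>x. x \<in> {-1<..<1} - N1 \<Longrightarrow> u x = u' x" "\<And>x. x \<in> {-1<..<1} - N2 \<Longrightarrow> v x = v' x"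
    using assms(5,6) unfolding AE_jacobi_measure by blast
  have "negligible (N1 \<union> N2)" using N by simp
  then show ?thesis unfolding L2_product(2)[OF assms(1,2)] L2_product(2)[OF assms(3,4)]
    by (rule integral_spike) (use N(3,4) in auto)
qed

lemma green_integral:
  assumes h: "h \<in> D_max 1 al be" and k: "k \<in> D_max 1 al be"
  obtains L R where
    "((\<lambda>x. h x * cnj (quasi 0 k x) + (-1) * (quasi 0 h x * cnj (k x))) \<longlongrightarrow> R) (at_left 1)"
    "((\<lambda>x. h x * cnj (quasi 0 k x) + (-1) * (quasi 0 h x * cnj (k x))) \<longlongrightarrow> L) (at_right (-1))"
    "R - L = L2_inner (jacobi_measure al be) (jacobi_ell al be h) k - L2_inner (jacobi_measure al be) h (jacobi_ell al be k)"
proof -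
  let ?B = "\<lambda>x. h x * cnj (quasi 0 k x) + (-1) * (quasi 0 h x * cnj (k x))"
  have L2s: "h \<in> L2 (jacobi_measure al be)" "k \<in> L2 (jacobi_measure al be)"
    "jacobi_ell al be h \<in> L2 (jacobi_measure al be)" "jacobi_ell al be k \<in> L2 (jacobi_measure al be)"
    and ac: "AC_upto 2 h" "AC_upto 2 k"
    using h k by (simp_all add: D_max_iff One_nat_def numeral_2_eq_2)
  let ?u = "\<lambda>x. cweight al be x * (jacobi_ell al be h x * cnj (k x))" and ?v = "\<lambda>x. cweight al be x * (h x * cnj (jacobi_ell al be k x))"
  obtain N where N: "negligible N" "\<And>x. x \<in> {-1<..<1} - N \<Longrightarrow> nth_deriv 1 ?B x = ?u x - ?v x"
    using green(2)[OF ac] by blast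
  have i: "?u absolutely_integrable_on {-1<..<1}" "?v absolutely_integrable_on {-1<..<1}"
    by (intro L2_product L2s)+
  have "nth_deriv 1 ?B absolutely_integrable_on {-1<..<1}"
    by (rule absolutely_integrable_spike[OF set_integral_diff(1)[OF i] N(1)]) (rule N(2))
  from AC_loc_limits[OF green(1)[OF ac] this] obtain L R where LR: "(?B \<longlongrightarrow> R) (at_left 1)" "(?B \<longlongrightarrow> L) (at_right (-1))"
    "R - L = integral {-1<..<1} (nth_deriv 1 ?B)" by blast
  have "integral {-1<..<1} (nth_deriv 1 ?B) = integral {-1<..<1} (\<lambda>x. ?u x - ?v x)"
    by (rule integral_spike[OF N(1)]) (use N(2) in auto)
  also have "\<dots> = integral {-1<..<1} ?u - integral {-1<..<1} ?v"
    using i set_lebesgue_integral_eq_integral(1) by (intro integral_diff) blast+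
  finally show ?thesis using that[OF LR(1,2)] LR(3) L2s by (simp add: L2_product(2))
qed

text \<open>A function in \<open>good 1\<close> is O(J(-al/2,-be/2)) and its quasi-derivative is
  O(J((1+al)/2,(1+be)/2)), so the boundary terms are O(J(1/2,1/2)) and vanish.\<close>

lemma good_symmetric:
  assumes h: "h \<in> good 1" and k: "k \<in> good 1"
  shows "L2_inner (jacobi_measure al be) (jacobi_ell al be h) k = L2_inner (jacobi_measure al be) h (jacobi_ell al be k)"
proof -
  let ?B = "\<lambda>x. h x * cnj (quasi 0 k x) + (-1) * (quasi 0 h x * cnj (k x))"
  have D: "h \<in> D_max 1 al be" "k \<in> D_max 1 al be" using h k by (auto simp: good_def)
  have cb: "bigJ a b (\<lambda>x. cnj (u x))" if "bigJ a b u" for a b u using that by (simp add: bigJ_def)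
  have b: "bigJ (-al/2) (-be/2) h" "bigJ (-al/2) (-be/2) (\<lambda>x. cnj (k x))"
    "bigJ ((1+al)/2) ((1+be)/2) (quasi 0 h)" "bigJ ((1+al)/2) ((1+be)/2) (\<lambda>x. cnj (quasi 0 k x))"
    using good_bounds(2,3)[OF h, of 0] good_bounds(2,3)[OF k, of 0] cb by simp_all
  have "bigJ (-al/2 + (1+al)/2) (-be/2 + (1+be)/2) (\<lambda>x. h x * cnj (quasi 0 k x))"
    "bigJ ((1+al)/2 + -al/2) ((1+be)/2 + -be/2) (\<lambda>x. quasi 0 h x * cnj (k x))"
    by (intro bigJ_mult b)+
  moreover have e: "-al/2 + (1+al)/2 = 1/2" "-be/2 + (1+be)/2 = 1/2" "(1+al)/2 + -al/2 = 1/2" "(1+be)/2 + -be/2 = 1/2"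
    by (simp_all add: field_simps)
  ultimately have "bigJ (1/2) (1/2) ?B" unfolding e by (intro bigJ_add bigJ_cmult)
  then have z: "(?B \<longlongrightarrow> 0) (at_left 1)" "(?B \<longlongrightarrow> 0) (at_right (-1))" by (auto intro: bigJ_tendsto)
  obtain L R where LR: "(?B \<longlongrightarrow> R) (at_left 1)" "(?B \<longlongrightarrow> L) (at_right (-1))"
    "R - L = L2_inner (jacobi_measure al be) (jacobi_ell al be h) k - L2_inner (jacobi_measure al be) h (jacobi_ell al be k)"
    by (rule green_integral[OF D])
  have "R = 0" "L = 0" using tendsto_0_iff_limit[OF LR(1) trivial_limit_at_left_real] tendsto_0_iff_limit[OF LR(2) trivial_limit_at_right_real] z by simp_all
  then show ?thesis using LR(3) by simp
qed

lemma good_mono: "f \<in> good n \<Longrightarrow> k \<le> n \<Longrightarrow> f \<in> good k"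
  by (induction n) (auto simp: le_Suc_eq dest: good_Suc(1))

end

context jacobi_eigen
begin

lemma P_in_D_max:
  assumes "jacobi_P al be m \<in> L2 (jacobi_measure al be)"
  shows "jacobi_P al be m \<in> D_max 1 al be"
proof -
  have "AC_upto 2 (jacobi_P al be m)"
    unfolding AC_upto_def
  proof (intro allI impI)
    fix k :: nat
    have "(nth_deriv k (jacobi_P al be m) has_vector_derivative nth_deriv (Suc k) (jacobi_P al be m) x) (at x)"
      if "x \<in> {-1<..<1}" for x using times_diffD[OF P_times_diff[of "Suc k"] _ that] by simp
    then show "nth_deriv k (jacobi_P al be m) \<in> AC_loc"
    proof (rule AC_loc_C1)
      show "continuous_on {-1<..<1} (nth_deriv (Suc k) (jacobi_P al be m))"
        using times_diffD[OF P_times_diff[of "Suc (Suc k)"], of "Suc k"]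
        by (intro continuous_at_imp_continuous_on ballI has_vector_derivative_continuous) auto
    qed
  qed
  moreover have "jacobi_ell al be (jacobi_P al be m) \<in> L2 (jacobi_measure al be)"
  proof (rule L2_AE_cong[OF _ negligible_empty])
    show "(\<lambda>x. of_real (jacobi_ev al be m) * jacobi_P al be m x) \<in> L2 (jacobi_measure al be)"
      by (rule L2_cmult_bounded[OF assms, of "\<lambda>_. _" "norm (complex_of_real (jacobi_ev al be m))"]; simp)
  qed (simp add: eig)
  ultimately show ?thesis using assms by (simp add: D_max_iff One_nat_def numeral_2_eq_2)
qed

text \<open>Testing against \<open>P\<^sub>0\<close> and \<open>P\<^sub>1\<close> alone already forces both boundary values of \<open>quasi 0 h\<close> to vanish.\<close>

lemma good_1_if_orthogonality:
  assumes h: "h \<in> D_max 1 al be" and P: "\<And>m. jacobi_P al be m \<in> L2 (jacobi_measure al be)"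
    and eq: "\<And>m. L2_inner (jacobi_measure al be) (jacobi_ell al be h) (jacobi_P al be m) =
       L2_inner (jacobi_measure al be) h (jacobi_ell al be (jacobi_P al be m))"
  shows "h \<in> good 1"
proof -
  obtain b where b: "(quasi 0 h \<longlongrightarrow> b) (at_left 1)" using D_max_limits(1)[OF h, of 0] by auto
  obtain d where d: "(quasi 0 h \<longlongrightarrow> d) (at_right (-1))" using D_max_limits(2)[OF h, of 0] by auto
  have z: "((\<lambda>x. cweight (al + 1) (be + 1) x * h x) \<longlongrightarrow> 0) (at_left 1)"
    "((\<lambda>x. cweight (al + 1) (be + 1) x * h x) \<longlongrightarrow> 0) (at_right (-1))"
    using bigJ_tendsto[OF bigJ_mult[OF bigJ_cweight D_max_limits(3)[OF h, of 0], of "al + 1" "be + 1"]] by simp_all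
  have rel: "b * jacobi_P al be m 1 = d * jacobi_P al be m (-1)" for m
  proof -
    let ?P = "jacobi_P al be m"
    let ?B = "\<lambda>x. h x * cnj (quasi 0 ?P x) + (-1) * (quasi 0 h x * cnj (?P x))"
    have cnjP: "cnj (?P x) = ?P x" for x by (simp add: jacobi_P_def)
    obtain q where q: "?P = (\<lambda>x. poly q (of_real x))" using jacobi_P_poly[OF al be] .
    obtain L R where LR: "(?B \<longlongrightarrow> R) (at_left 1)" "(?B \<longlongrightarrow> L) (at_right (-1))"
      "R - L = L2_inner (jacobi_measure al be) (jacobi_ell al be h) ?P - L2_inner (jacobi_measure al be) h (jacobi_ell al be ?P)"
      by (rule green_integral[OF h P_in_D_max[OF P, of m]])
    have e: "?B x = cweight (al + 1) (be + 1) x * h x * cnj (nth_deriv 1 ?P x) + (-1) * (quasi 0 h x * ?P x)" for x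
      by (simp add: cnjP quasi_def)
    have "(?B \<longlongrightarrow> 0 * cnj (nth_deriv 1 ?P 1) + (-1) * (b * ?P 1)) (at_left 1)"
      unfolding e by (intro tendsto_add tendsto_mult tendsto_const tendsto_cnj jacobi_P_tendsto z b)
    moreover have "(?B \<longlongrightarrow> 0 * cnj (nth_deriv 1 ?P (-1)) + (-1) * (d * ?P (-1))) (at_right (-1))"
      unfolding e by (intro tendsto_add tendsto_mult tendsto_const tendsto_cnj jacobi_P_tendsto z d)
    ultimately have "R = - (b * ?P 1)" "L = - (d * ?P (-1))"
      using tendsto_unique[OF trivial_limit_at_left_real LR(1)] tendsto_unique[OF trivial_limit_at_right_real LR(2)] by simp_all
    then show ?thesis using LR(3) eq by simp
  qed
  \<comment> \<open>The constant polynomial gives b = d; the one of degree 1 has endpoint values al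
    + 1 and -(be + 1) of opposite sign, which gives b = 0.\<close>
  have "b = d" using rel[of 0] by (simp add: jacobi_P_0)
  then have "b * of_real (al + 1) = b * of_real (- (be + 1))" using rel[of 1] by (simp only: jacobi_P_1)
  then have "b * of_real (al + be + 2) = 0" by (simp add: algebra_simps)
  moreover have "complex_of_real (al + be + 2) \<noteq> 0" using al be by (simp only: of_real_eq_0_iff)
  ultimately have "b = 0" by simp
  then show ?thesis using h b d \<open>b = d\<close> by (simp add: good_def)
qed

section \<open>The self-adjoint operator and its powers\<close>

text \<open>Saturated under almost everywhere changes in both components, like
  \<open>ell_operator\<close>, so that it can be equal to the self-adjoint graph A and not merely
  represent it.\<close>

definition "good_graph \<equiv> {(f, g). f \<in> L2 (jacobi_measure al be) \<and> g \<in> L2 (jacobi_measure al be) \<and>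
   (\<exists>h\<in>good 1. (AE x in jacobi_measure al be. f x = h x) \<and> (AE x in jacobi_measure al be. g x = jacobi_ell al be h x))}"

text \<open>Testing an element of A against the eigenfunctions, by self-adjointness, gives the
  relations that \<open>good_1_if_orthogonality\<close> asks for.\<close>

lemma jacobi_operator_subset:
  assumes sa: "adjoint (jacobi_measure al be) A = A"
    and A: "A \<subseteq> ell_operator 1 al be (D_max 1 al be)"
    and P: "\<And>m. (jacobi_P al be m, \<lambda>x. of_real (jacobi_ev al be m) * jacobi_P al be m x) \<in> A"
  shows "A \<subseteq> good_graph"
proof
  fix p assume p: "p \<in> A"
  obtain f g where fg: "p = (f, g)" by (cases p)
  let ?M = "jacobi_measure al be"
  from p A obtain h where fL: "f \<in> L2 ?M" "g \<in> L2 ?M" and h: "h \<in> D_max 1 al be"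
    and ae: "AE x in ?M. f x = h x" "AE x in ?M. g x = jacobi_ell al be h x"
    unfolding fg ell_operator_def jacobi_ell_pow_def by (auto simp: One_nat_def)
  have hL: "h \<in> L2 ?M" "jacobi_ell al be h \<in> L2 ?M" using h by (simp_all add: D_max_iff One_nat_def)
  have PL: "jacobi_P al be m \<in> L2 ?M" "(\<lambda>x. of_real (jacobi_ev al be m) * jacobi_P al be m x) \<in> L2 ?M" for m
    using P[of m] A by (auto simp: ell_operator_def)
  have cnj_inner: "L2_inner ?M u v = cnj (L2_inner ?M v u)" if "u \<in> L2 ?M" "v \<in> L2 ?M" for u v
  proof -
    have i: "(\<lambda>x. cweight al be x * (v x * cnj (u x))) integrable_on {-1<..<1}"
      using L2_product(1)[OF that(2,1)] set_lebesgue_integral_eq_integral(1) by blast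
    show ?thesis unfolding L2_product(2)[OF that] L2_product(2)[OF that(2,1)]
      using integral_linear[OF i bounded_linear_cnj] by (simp add: o_def mult.commute mult.left_commute)
  qed
  have "h \<in> good 1"
  proof (rule good_1_if_orthogonality[OF h PL(1)])
    fix m
    let ?P = "jacobi_P al be m" and ?lP = "\<lambda>x. of_real (jacobi_ev al be m) * jacobi_P al be m x"
    have ellP: "jacobi_ell al be ?P \<in> L2 ?M" "AE x in ?M. ?lP x = jacobi_ell al be ?P x"
      using P_in_D_max[OF PL(1), of m] eig by (auto simp: D_max_iff One_nat_def AE_jacobi_measure intro!: exI[of _ "{}"])
    have "(f, g) \<in> adjoint ?M A" using p fg sa by simp
    then have adj: "L2_inner ?M ?lP f = L2_inner ?M ?P g" using P[of m] unfolding adjoint_def by blast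
    have "L2_inner ?M (jacobi_ell al be h) ?P = L2_inner ?M g ?P"
      using ae(2) by (intro L2_inner_AE_cong fL hL PL) (auto elim: eventually_mono)
    also have "\<dots> = L2_inner ?M f ?lP"
      using cnj_inner[OF fL(2) PL(1)] cnj_inner[OF fL(1) PL(2)] adj by simp
    also have "\<dots> = L2_inner ?M h (jacobi_ell al be ?P)"
      using ae(1) ellP by (intro L2_inner_AE_cong fL hL PL)
    finally show "L2_inner ?M (jacobi_ell al be h) ?P = L2_inner ?M h (jacobi_ell al be ?P)" .
  qed
  then show "p \<in> good_graph" using fL ae unfolding good_graph_def fg by blast
qed

text \<open>The reverse inclusion is the maximality of self-adjoint operators among symmetric ones:
  symmetry on \<open>good 1\<close> puts every pair of \<open>good_graph\<close> into the adjoint of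
  A, which is A.\<close>

lemma jacobi_operator_eq:
  assumes sa: "adjoint (jacobi_measure al be) A = A"
    and A: "A \<subseteq> ell_operator 1 al be (D_max 1 al be)"
    and P: "\<And>m. (jacobi_P al be m, \<lambda>x. of_real (jacobi_ev al be m) * jacobi_P al be m x) \<in> A"
  shows "A = good_graph"
proof
  show sub: "A \<subseteq> good_graph" by (rule jacobi_operator_subset[OF assms])
  let ?M = "jacobi_measure al be"
  have goodL: "h \<in> L2 ?M" "jacobi_ell al be h \<in> L2 ?M" if "h \<in> good 1" for h
    using that by (simp_all add: good_def D_max_iff One_nat_def)
  show "good_graph \<subseteq> A"
  proof
    fix p assume "p \<in> good_graph"
    then obtain f g h where p: "p = (f, g)" and fg: "f \<in> L2 ?M" "g \<in> L2 ?M" and h: "h \<in> good 1"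
      and ae: "AE x in ?M. f x = h x" "AE x in ?M. g x = jacobi_ell al be h x"
      unfolding good_graph_def by blast
    have "L2_inner ?M v f = L2_inner ?M u g" if uv: "(u, v) \<in> A" for u v
    proof -
      obtain k where uL: "u \<in> L2 ?M" "v \<in> L2 ?M" and k: "k \<in> good 1"
        and aek: "AE x in ?M. u x = k x" "AE x in ?M. v x = jacobi_ell al be k x"
        using uv sub unfolding good_graph_def by blast
      have "L2_inner ?M v f = L2_inner ?M (jacobi_ell al be k) h"
        by (intro L2_inner_AE_cong uL fg goodL h k ae aek)
      also have "\<dots> = L2_inner ?M k (jacobi_ell al be h)" by (rule good_symmetric[OF k h])
      also have "\<dots> = L2_inner ?M u g"
        by (rule L2_inner_AE_cong[symmetric]) (intro uL fg goodL h k ae aek)+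
      finally show ?thesis .
    qed
    then have "(f, g) \<in> adjoint ?M A" unfolding adjoint_def using fg by blast
    then show "p \<in> A" using sa p by simp
  qed
qed

text \<open>Continuity of k turns the equation into a pointwise one, and h inherits the regularity
  of k with two more derivatives. The quasi-derivative of h of index i + 1 is that of k of index
  i.\<close>

lemma good_Suc_if_ell_AE:
  assumes h: "h \<in> good 1" and k: "k \<in> good n" and n: "n \<ge> 1"
    and ae: "AE x in jacobi_measure al be. jacobi_ell al be h x = k x"
  shows "h \<in> good (Suc n)"
proof -
  obtain N where N: "negligible N" "\<And>x. x \<in> {-1<..<1} - N \<Longrightarrow> jacobi_ell al be h x = k x"
    using ae unfolding AE_jacobi_measure by blast
  have ach: "AC_upto 2 h" using h by (simp add: good_def D_max_iff One_nat_def numeral_2_eq_2)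
  have ack: "AC_upto (2 * n) k" using k by (simp add: good_def D_max_iff)
  then have "k \<in> AC_loc" using n by (auto simp: AC_upto_def dest: spec[of _ 0])
  then have eq: "jacobi_ell al be h x = k x" if "x \<in> {-1<..<1}" for x
    by (rule jacobi_ell_eq_everywhere(2)[OF ach _ N that])
  have "AC_upto (2 * n + 2) h" by (rule AC_upto_lift[OF ach ack eq])
  moreover have "h \<in> L2 (jacobi_measure al be)" using h by (simp add: good_def D_max_iff)
  moreover have "(jacobi_ell al be ^^ Suc n) h \<in> L2 (jacobi_measure al be)"
  proof (rule L2_AE_cong[OF _ negligible_empty])
    show "(jacobi_ell al be ^^ n) k \<in> L2 (jacobi_measure al be)" using k by (simp add: good_def D_max_iff)
    fix x :: real assume "x \<in> {-1<..<1} - {}"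
    then show "(jacobi_ell al be ^^ Suc n) h x = (jacobi_ell al be ^^ n) k x"
      unfolding funpow_Suc_right o_apply using eq by (intro jacobi_ell_pow_cong) auto
  qed
  ultimately have D: "h \<in> D_max (Suc n) al be" by (simp add: D_max_iff)
  have q: "quasi (Suc i) h x = quasi i k x" if "x \<in> {-1<..<1}" for i x
    unfolding quasi_ell[symmetric] quasi_def using that eq
    by (intro arg_cong2[where f = "(*)"] refl nth_deriv_cong jacobi_ell_pow_cong) auto
  have "(quasi i h \<longlongrightarrow> 0) (at_left 1) \<and> (quasi i h \<longlongrightarrow> 0) (at_right (-1))" if i: "i < Suc n" for i
  proof (cases i)
    case 0 then show ?thesis using h by (simp add: good_def One_nat_def)
  next
    case (Suc j)
    then show ?thesis
      using tendsto_cong_interval[OF eventually_in_interval(1) q[of _ j]] tendsto_cong_interval[OF eventually_in_interval(2) q[of _ j]] k i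
      by (simp add: good_def)
  qed
  with D show ?thesis by (simp add: good_def)
qed

text \<open>Only positive powers occur, since the zeroth relation power has all functions in its
  domain. \<open>L2_classes\<close> accounts for the freedom of representatives.\<close>

lemma Domain_good_graph_pow:
  "Domain (good_graph ^^ Suc n) = L2_classes (jacobi_measure al be) (good (Suc n))"
proof (induction n)
  case 0
  have "jacobi_ell al be h \<in> L2 (jacobi_measure al be)" if "h \<in> good 1" for h
    using that by (simp add: good_def D_max_iff One_nat_def)
  then show ?case unfolding good_graph_def L2_classes_def One_nat_def[symmetric] 
    by (fastforce simp: Domain_iff)
next
  case (Suc n)
  let ?M = "jacobi_measure al be"
  \<comment> \<open>The first factor is split off, because the induction hypothesis describes the
    image of f under it.\<close>
  have step: "f \<in> Domain (good_graph ^^ Suc (Suc n)) \<longleftrightarrow> (\<exists>g. (f, g) \<in> good_graph \<and> g \<in> Domain (good_graph ^^ Suc n))" for f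
    unfolding Domain_iff using relpow_Suc_D2[of f _ "Suc n" good_graph] relpow_Suc_I2[of f _ good_graph _ "Suc n"] by blast
  show ?case
  proof (intro equalityI subsetI)
    fix f assume "f \<in> Domain (good_graph ^^ Suc (Suc n))"
    then obtain g where g: "(f, g) \<in> good_graph" "g \<in> L2_classes ?M (good (Suc n))" unfolding step Suc by blast
    then obtain h k where h: "h \<in> good 1" "f \<in> L2 ?M" "AE x in ?M. f x = h x" "AE x in ?M. g x = jacobi_ell al be h x"
      and k: "k \<in> good (Suc n)" "AE x in ?M. g x = k x" unfolding good_graph_def L2_classes_def by blast
    have "AE x in ?M. jacobi_ell al be h x = k x" using h(4) k(2) by eventually_elim simp
    then have "h \<in> good (Suc (Suc n))" by (intro good_Suc_if_ell_AE[OF h(1) k(1)]) (simp_all add: One_nat_def)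
    then show "f \<in> L2_classes ?M (good (Suc (Suc n)))" using h unfolding L2_classes_def by blast
  next
    fix f assume "f \<in> L2_classes ?M (good (Suc (Suc n)))"
    then obtain h where h: "h \<in> good (Suc (Suc n))" "f \<in> L2 ?M" "AE x in ?M. f x = h x" unfolding L2_classes_def by blast
    have e: "jacobi_ell al be h \<in> good (Suc n)" by (rule good_Suc(2)[OF h(1)])
    then have eL: "jacobi_ell al be h \<in> L2 ?M" by (simp add: good_def D_max_iff)
    have "h \<in> good 1" using good_mono[OF h(1), of 1] by (simp add: One_nat_def)
    then have "(f, jacobi_ell al be h) \<in> good_graph" using h eL unfolding good_graph_def by auto
    moreover have "jacobi_ell al be h \<in> L2_classes ?M (good (Suc n))" using e eL unfolding L2_classes_def by auto
    ultimately show "f \<in> Domain (good_graph ^^ Suc (Suc n))" unfolding step Suc by blast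
  qed
qed

end

text \<open>Membership in the operator speaks of a representative h. Both h and P are continuous,
  hence equal on (-1,1), so the equation holds for P off a null set and therefore at infinitely many
  points.\<close>

lemma jacobi_P_eigen_if_operator:
  assumes ab: "a > 0" "b > 0"
    and P: "(jacobi_P a b m, \<lambda>x. z * jacobi_P a b m x) \<in> ell_operator 1 a b (D_max 1 a b)"
  shows "z = of_real (jacobi_ev a b m)"
    and "x \<in> {-1<..<1} \<Longrightarrow> jacobi_ell a b (jacobi_P a b m) x = z * jacobi_P a b m x"
proof -
  obtain h where h: "h \<in> D_max 1 a b" and ae: "AE x in jacobi_measure a b. jacobi_P a b m x = h x"
    "AE x in jacobi_measure a b. z * jacobi_P a b m x = jacobi_ell a b h x"
    using P unfolding ell_operator_def jacobi_ell_pow_def by (auto simp: One_nat_def)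
  obtain q where q: "jacobi_P a b m = (\<lambda>x. poly q (of_real x))" using jacobi_P_poly[OF ab] .
  have "\<forall>k<2 * 1. nth_deriv k h \<in> AC_loc" using h unfolding D_max_def by blast
  from this[rule_format, of 0] have "h \<in> AC_loc" by simp
  moreover obtain N1 where N1: "negligible N1" "\<And>x. x \<in> {-1<..<1} - N1 \<Longrightarrow> jacobi_P a b m x = h x"
    using ae(1) unfolding AE_jacobi_measure by blast
  ultimately have Ph: "jacobi_P a b m x = h x" if "x \<in> {-1<..<1}" for x
    using that by (intro continuous_eq_if_AE[OF _ AC_loc_continuous N1]) (auto simp: q intro!: continuous_intros)
  obtain N where N: "negligible N" "\<And>x. x \<in> {-1<..<1} - N \<Longrightarrow> z * jacobi_P a b m x = jacobi_ell a b h x"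
    using ae(2) unfolding AE_jacobi_measure by blast
  have "jacobi_ell a b (jacobi_P a b m) x = z * jacobi_P a b m x" if "x \<in> {-1<..<1} - N" for x
    using N(2)[OF that] jacobi_ell_cong[of "jacobi_P a b m" h x a b] Ph that by auto
  then have "{-1<..<1} - N \<subseteq> {x \<in> {-1<..<1}. jacobi_ell a b (jacobi_P a b m) x = z * jacobi_P a b m x}" by auto
  then have inf: "infinite {x \<in> {-1<..<1}. jacobi_ell a b (jacobi_P a b m) x = z * jacobi_P a b m x}"
    using negligible_complement_infinite[OF N(1)] finite_subset by blast
  show "z = of_real (jacobi_ev a b m)" by (rule jacobi_P_eigen(1)[OF ab inf])
  show "x \<in> {-1<..<1} \<Longrightarrow> jacobi_ell a b (jacobi_P a b m) x = z * jacobi_P a b m x" by (rule jacobi_P_eigen(2)[OF ab inf])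
qed

theorem theorem5p2:
  fixes n :: nat and \<alpha> \<beta> :: real and A :: graph
  assumes "n \<ge> 1" and "\<alpha> > 0" and "\<beta> > 0"
    and "jacobi_operator \<alpha> \<beta> A"
    and "L_min n \<alpha> \<beta> \<subseteq> left_definite_operator n \<alpha> \<beta> A"
    and "has_deficiency_indices (jacobi_measure \<alpha> \<beta>) (L_min n \<alpha> \<beta>) (2 * n) (2 * n)"
  shows "left_definite_domain A n = L2_classes (jacobi_measure \<alpha> \<beta>) (dom_A n \<alpha> \<beta>) \<and>
         dom_A n \<alpha> \<beta> = dom_B n \<alpha> \<beta> \<and>
         dom_B n \<alpha> \<beta> = dom_C n \<alpha> \<beta> \<and>
         dom_C n \<alpha> \<beta> = dom_F n \<alpha> \<beta>"
proof -
  note ab = \<open>\<alpha> > 0\<close> \<open>\<beta> > 0\<close>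
  have sa: "adjoint (jacobi_measure \<alpha> \<beta>) A = A" and A: "A \<subseteq> ell_operator 1 \<alpha> \<beta> (D_max 1 \<alpha> \<beta>)"
    and ex: "\<And>m. \<exists>z. (jacobi_P \<alpha> \<beta> m, \<lambda>x. z * jacobi_P \<alpha> \<beta> m x) \<in> A"
    using assms(4) unfolding jacobi_operator_def self_adjoint_def by auto
  have P: "(jacobi_P \<alpha> \<beta> m, \<lambda>x. of_real (jacobi_ev \<alpha> \<beta> m) * jacobi_P \<alpha> \<beta> m x) \<in> A" for m
    using ex[of m] A jacobi_P_eigen_if_operator(1)[OF ab] by blast
  \<comment> \<open>The assumptions on A enter twice: here they supply the eigenvalue equation, and
    below they identify A with \<open>good_graph\<close>.\<close>
  interpret jacobi_eigen \<alpha> \<beta>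
    using ab jacobi_P_eigen_if_operator(2)[OF ab] P A by unfold_locales blast+
  obtain k where n: "n = Suc k" using \<open>n \<ge> 1\<close> by (cases n) auto
  have "left_definite_domain A n = L2_classes (jacobi_measure \<alpha> \<beta>) (good n)"
    unfolding left_definite_domain_def jacobi_operator_eq[OF sa A P] n by (rule Domain_good_graph_pow)
  then show ?thesis
    using dom_A_eq_good dom_B_eq_good dom_C_eq_good dom_F_eq_good \<open>n \<ge> 1\<close> by simp
qed

end
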